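(* Fix a Coxeter group $W$ with simple reflections indexed by $I$ and Coxeter matrix $(m_{ij})_{i,j\in I}$, and integers $d_i\geqslant 2$ for all $i\in I$; put $\mathbf d=(d_i)_{i\in I}$. Let $k$ be an integer or $\infty$, with $1\leqslant k\leqslant\infty$. Then the following are equivalent: (1) The corresponding nil-Hecke $\Bbbk$-algebra $n\mathcal H(W,\mathbf d,J_{<k})$ is a finitely generated $\Bbbk$-module. (2) The nil-Hecke algebra is found in the following list: (a) $k\in\{1,2\}$, the Coxeter (multi)graph of $W$ is a tree with exactly one multiple edge, this edge has label $4\leqslant m_{i_0j_0}<\infty$, and $d_i=2$ for all $i$; (b) $k\in\{1,2\}$, the Coxeter (multi)graph of $W$ is a simply laced tree, and at most one node $i_0\in I$ satisfies $d_{i_0}\geqslant 3$; (c) $k\geqslant 3$, $W$ is a finite Coxeter group and $\mathbf d=(2,\dots,2)$; (d) $k=3$, $W$ is of type $E_n$ $(n\geqslant 9)$, $F_n$ $(n\geqslant 5)$ or $H_n$ $(n\geqslant 5)$, and $\mathbf d=(2,\dots,2)$; (e) $k\geqslant 3$, $W$ is of type $A$, and $\mathbf d=(d,2,\dots,2)$ or $(2,\dots,2,d)$ for some $d>2$. (3) The two-sided augmentation ideal $\mathfrak m\subset n\mathcal H(W,\mathbf d,J_{<k})$, which is generated by $\{\mathbf s_i:i\in I\}$, is nilpotent. If $\Bbbk$ is moreover a field (and these conditions hold), then the finite-dimensional $\Bbbk$-algebra $n\mathcal H(W,\mathbf d,J_{<k})$ is local, with unique maximal ideal $\mathfrak m$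.
   Context: $\Bbbk$ is a fixed unital commutative ring. A Coxeter group $W$ has a finite index set $I$ of simple reflections and a Coxeter matrix $(m_{ij})_{i,j\in I}$ with $m_{ii}=1$ and $m_{ij}=m_{ji}\in\{2,3,\dots,\infty\}$ for $i\ne j$. Let $J$ be the set of unordered pairs $\{a,b\}\subset I$, $a\neq b$, with $m_{ab}<\infty$. For $j=\{a,b\}\in J$ let $\mathbf v_j=\mathbf s_a\mathbf s_b\mathbf s_a\cdots$ and $\mathbf w_j=\mathbf s_b\mathbf s_a\mathbf s_b\cdots$ be the two alternating words with $m_{ab}$ letters each; these are the two sides of the braid relation for $j$, whose length is $\ell(\mathbf v_j)=\ell(\mathbf w_j)=m_{ab}$. For $J_0\subset J$ and $\mathbf d=(d_i)_{i\in I}$ with integers $d_i\geqslant 2$, the nil-Hecke algebra $n\mathcal H(W,\mathbf d,J_0)$ is the associative unital $\Bbbk$-algebra generated by $\{\mathbf s_i:i\in I\}$ with relations $$\mathbf s_i^{d_i}=0\ (i\in I),\qquad \mathbf v_j=\mathbf w_j\ (j\in J_0),\qquad \mathbf v_j=0=\mathbf w_j\ (j\in J\setminus J_0).$$ For $k\geqslant 1$ put $J_{<k}=\{j\in J:\ell(\mathbf v_j)=\ell(\mathbf w_j)<k\}$, and $J_{<\infty}=J$. The Coxeter multigraph of $W$ has node set $I$ and $m_{ij}-2$ edges between $i\neq j$. An edge is multiple if $m_{ij}\geqslant 4$; "tree" refers to the underlying simple graph; "simply laced" means all $m_{ij}\leqslant 3$. Types are given by Coxeter graphs on nodes $1,\dots,n$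 (edges have $m_{ij}=3$ unless stated, non-edges have $m_{ij}=2$): $A_n$ is the path $1-2-\cdots-n$ (and $\mathbf d$ is listed in this order); $E_n$ is the path $1-2-4-5-\cdots-n$ together with node $3$ joined to node $4$; $F_n$ is the path $1-2-\cdots-n$ with $m_{23}=4$; $H_n$ is the path $1-2-\cdots-n$ with $m_{12}=5$.
   Formalization: The implication (1) ⇒ (2) is stated only for W with connected Coxeter graph (for reducible W it fails, e.g. k=1, W=A_1×A_1, d=(3,3)), and the ground ring is assumed nonzero (over the zero ring (1) and (3) always hold). *)

theory Defs
  imports
    "HOL-Algebra.Ideal_Product"
    "HOL-Algebra.QuotRing"
    "HOL-Algebra.Module"
    "HOL-Library.Extended_Nat"
begin

section \<open>Coxeter matrices and Coxeter groups\<close>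

definition coxeter_matrix :: "'i set \<Rightarrow> ('i \<Rightarrow> 'i \<Rightarrow> enat) \<Rightarrow> bool" where
  "coxeter_matrix I m \<longleftrightarrow> finite I \<and> (\<forall>i\<in>I. m i i = 1) \<and>
     (\<forall>i\<in>I. \<forall>j\<in>I. i \<noteq> j \<longrightarrow> m i j = m j i \<and> 2 \<le> m i j)"

text \<open>The Coxeter group is the quotient of the free monoid on \<open>I\<close> by the congruence generated by
  \<open>(ij) ^ (m i j) = 1\<close>; the case \<open>i = j\<close> reads \<open>ii = 1\<close>, so every generator is its own inverse and
  formal inverses are not needed.\<close>

inductive coxeter_eq :: "'i set \<Rightarrow> ('i \<Rightarrow> 'i \<Rightarrow> enat) \<Rightarrow> 'i list \<Rightarrow> 'i list \<Rightarrow> bool"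
  for I m where
  refl: "u \<in> lists I \<Longrightarrow> coxeter_eq I m u u"
| sym: "coxeter_eq I m u v \<Longrightarrow> coxeter_eq I m v u"
| trans: "coxeter_eq I m u v \<Longrightarrow> coxeter_eq I m v w \<Longrightarrow> coxeter_eq I m u w"
| relator: "u \<in> lists I \<Longrightarrow> v \<in> lists I \<Longrightarrow> i \<in> I \<Longrightarrow> j \<in> I \<Longrightarrow> m i j \<noteq> \<infinity> \<Longrightarrow>
    coxeter_eq I m (u @ concat (replicate (the_enat (m i j)) [i, j]) @ v) (u @ v)"

definition coxeter_group :: "'i set \<Rightarrow> ('i \<Rightarrow> 'i \<Rightarrow> enat) \<Rightarrow> 'i list set monoid" where
  "coxeter_group I m =
    \<lparr>carrier = lists I // {(u, v). coxeter_eq I m u v},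
     mult = (\<lambda>X Y. \<Union>x\<in>X. \<Union>y\<in>Y. {w. coxeter_eq I m (x @ y) w}),
     one = {w. coxeter_eq I m [] w}\<rparr>"


section \<open>The Coxeter graph\<close>

definition coxeter_adj :: "'i set \<Rightarrow> ('i \<Rightarrow> 'i \<Rightarrow> enat) \<Rightarrow> 'i \<Rightarrow> 'i \<Rightarrow> bool" where
  "coxeter_adj I m a b \<longleftrightarrow> a \<in> I \<and> b \<in> I \<and> a \<noteq> b \<and> 3 \<le> m a b"

text \<open>The empty graph counts as connected, and hence as a tree.\<close>

definition coxeter_connected :: "'i set \<Rightarrow> ('i \<Rightarrow> 'i \<Rightarrow> enat) \<Rightarrow> bool" where
  "coxeter_connected I m \<longleftrightarrow> (\<forall>a\<in>I. \<forall>b\<in>I. (coxeter_adj I m)\<^sup>*\<^sup>* a b)"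

definition coxeter_cycle :: "'i set \<Rightarrow> ('i \<Rightarrow> 'i \<Rightarrow> enat) \<Rightarrow> 'i list \<Rightarrow> bool" where
  "coxeter_cycle I m c \<longleftrightarrow> 3 \<le> length c \<and> distinct c \<and>
     (\<forall>l<length c. coxeter_adj I m (c ! l) (c ! (Suc l mod length c)))"

definition coxeter_tree :: "'i set \<Rightarrow> ('i \<Rightarrow> 'i \<Rightarrow> enat) \<Rightarrow> bool" where
  "coxeter_tree I m \<longleftrightarrow> coxeter_connected I m \<and> (\<nexists>c. coxeter_cycle I m c)"

definition simply_laced :: "'i set \<Rightarrow> ('i \<Rightarrow> 'i \<Rightarrow> enat) \<Rightarrow> bool" where
  "simply_laced I m \<longleftrightarrow> (\<forall>i\<in>I. \<forall>j\<in>I. m i j \<le> 3)"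

definition multiple_edges :: "'i set \<Rightarrow> ('i \<Rightarrow> 'i \<Rightarrow> enat) \<Rightarrow> 'i set set" where
  "multiple_edges I m = {{a, b} | a b. a \<in> I \<and> b \<in> I \<and> a \<noteq> b \<and> 4 \<le> m a b}"

definition A_matrix :: "nat \<Rightarrow> nat \<Rightarrow> enat" where
  "A_matrix i j = (if i = j then 1 else if j = Suc i \<or> i = Suc j then 3 else 2)"

definition F_matrix :: "nat \<Rightarrow> nat \<Rightarrow> enat" where
  "F_matrix i j = (if {i, j} = {2, 3} then 4 else A_matrix i j)"

definition H_matrix :: "nat \<Rightarrow> nat \<Rightarrow> enat" where
  "H_matrix i j = (if {i, j} = {1, 2} then 5 else A_matrix i j)"

definition E_matrix :: "nat \<Rightarrow> nat \<Rightarrow> enat" where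
  "E_matrix i j =
     (if i = j then 1
      else if {i, j} \<in> {{1, 2}, {2, 4}, {3, 4}} \<union> {{l, Suc l} | l. 4 \<le> l} then 3
      else 2)"

text \<open>\<open>f\<close> identifies the nodes \<open>1, \<dots>, n\<close> with \<open>I\<close> so that \<open>m\<close> becomes the restriction of \<open>M\<close>.\<close>

definition coxeter_labelling ::
    "(nat \<Rightarrow> nat \<Rightarrow> enat) \<Rightarrow> nat \<Rightarrow> 'i set \<Rightarrow> ('i \<Rightarrow> 'i \<Rightarrow> enat) \<Rightarrow> (nat \<Rightarrow> 'i) \<Rightarrow> bool" where
  "coxeter_labelling M n I m f \<longleftrightarrow> bij_betw f {1..n} I \<and>
     (\<forall>i\<in>{1..n}. \<forall>j\<in>{1..n}. m (f i) (f j) = M i j)"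

definition coxeter_type ::
    "(nat \<Rightarrow> nat \<Rightarrow> enat) \<Rightarrow> nat \<Rightarrow> 'i set \<Rightarrow> ('i \<Rightarrow> 'i \<Rightarrow> enat) \<Rightarrow> bool" where
  "coxeter_type M n I m \<longleftrightarrow> (\<exists>f. coxeter_labelling M n I m f)"


section \<open>Free algebras and quotient algebras\<close>

text \<open>The free algebra \<open>R\<langle>I\<rangle>\<close>: finitely supported functions on words over \<open>I\<close>, with the
  concatenation (convolution) product.\<close>

definition free_algebra :: "('a, 'c) ring_scheme \<Rightarrow> 'i set \<Rightarrow> ('a, 'i list \<Rightarrow> 'a) module" where
  "free_algebra R I =
    \<lparr>carrier = {f. (\<forall>w. f w \<in> carrier R) \<and> finite {w. f w \<noteq> \<zero>\<^bsub>R\<^esub>} \<and> {w. f w \<noteq> \<zero>\<^bsub>R\<^esub>} \<subseteq> lists I},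
     mult = (\<lambda>f g w. \<Oplus>\<^bsub>R\<^esub>k\<in>{..length w}. f (take k w) \<otimes>\<^bsub>R\<^esub> g (drop k w)),
     one = (\<lambda>w. if w = [] then \<one>\<^bsub>R\<^esub> else \<zero>\<^bsub>R\<^esub>),
     zero = (\<lambda>w. \<zero>\<^bsub>R\<^esub>),
     add = (\<lambda>f g w. f w \<oplus>\<^bsub>R\<^esub> g w),
     smult = (\<lambda>r f w. r \<otimes>\<^bsub>R\<^esub> f w)\<rparr>"

definition word_monom :: "('a, 'c) ring_scheme \<Rightarrow> 'i list \<Rightarrow> 'i list \<Rightarrow> 'a" where
  "word_monom R w = (\<lambda>u. if u = w then \<one>\<^bsub>R\<^esub> else \<zero>\<^bsub>R\<^esub>)"

text \<open>The ring \<open>F Quot K\<close> together with the induced scalar multiplication.\<close>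

definition quot_algebra :: "('a, 'b) module \<Rightarrow> 'b set \<Rightarrow> ('a, 'b set) module" where
  "quot_algebra F K =
    \<lparr>carrier = carrier (F Quot K), mult = mult (F Quot K), one = one (F Quot K),
     zero = zero (F Quot K), add = add (F Quot K),
     smult = (\<lambda>r X. \<Union>x\<in>X. K +>\<^bsub>F\<^esub> (r \<odot>\<^bsub>F\<^esub> x))\<rparr>"

definition fin_gen_module :: "('a, 'c) ring_scheme \<Rightarrow> ('a, 'b) module \<Rightarrow> bool" where
  "fin_gen_module R M \<longleftrightarrow> (\<exists>S. finite S \<and> S \<subseteq> carrier M \<and>
     (\<forall>x\<in>carrier M. \<exists>c\<in>S \<rightarrow> carrier R. x = (\<Oplus>\<^bsub>M\<^esub>s\<in>S. c s \<odot>\<^bsub>M\<^esub> s)))"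

definition nilpotent_ideal :: "('b, 'c) ring_scheme \<Rightarrow> 'b set \<Rightarrow> bool" where
  "nilpotent_ideal A K \<longleftrightarrow> (\<exists>n::nat. K [^]\<^bsub>ideals_set A\<^esub> n = {\<zero>\<^bsub>A\<^esub>})"

definition left_ideal :: "'b set \<Rightarrow> ('b, 'c) ring_scheme \<Rightarrow> bool" where
  "left_ideal L A \<longleftrightarrow> additive_subgroup L A \<and> (\<forall>a\<in>carrier A. \<forall>x\<in>L. a \<otimes>\<^bsub>A\<^esub> x \<in> L)"

definition maximal_left_ideal :: "'b set \<Rightarrow> ('b, 'c) ring_scheme \<Rightarrow> bool" where
  "maximal_left_ideal L A \<longleftrightarrow> left_ideal L A \<and> L \<noteq> carrier A \<and>
     (\<forall>K. left_ideal K A \<and> L \<subseteq> K \<longrightarrow> K = L \<or> K = carrier A)"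

definition local_ring :: "('b, 'c) ring_scheme \<Rightarrow> bool" where
  "local_ring A \<longleftrightarrow> ring A \<and> (\<exists>!L. maximal_left_ideal L A)"


section \<open>Nil-Hecke algebras\<close>

fun alt_word :: "'i \<Rightarrow> 'i \<Rightarrow> nat \<Rightarrow> 'i list" where
  "alt_word a b 0 = []"
| "alt_word a b (Suc n) = a # alt_word b a n"

definition braid_pairs :: "'i set \<Rightarrow> ('i \<Rightarrow> 'i \<Rightarrow> enat) \<Rightarrow> 'i set set" where
  "braid_pairs I m = {{a, b} | a b. a \<in> I \<and> b \<in> I \<and> a \<noteq> b \<and> m a b < \<infinity>}"

definition braid_pairs_less :: "'i set \<Rightarrow> ('i \<Rightarrow> 'i \<Rightarrow> enat) \<Rightarrow> enat \<Rightarrow> 'i set set" where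
  "braid_pairs_less I m k = {{a, b} | a b. {a, b} \<in> braid_pairs I m \<and> m a b < k}"

text \<open>In the last two sets an unordered pair is met in both orders, so both alternating words of a
  pair in \<open>braid_pairs I m\<close> outside \<open>J\<^sub>0\<close> are killed.\<close>

definition nil_hecke_relators ::
    "('a, 'c) ring_scheme \<Rightarrow> 'i set \<Rightarrow> ('i \<Rightarrow> 'i \<Rightarrow> enat) \<Rightarrow> ('i \<Rightarrow> nat) \<Rightarrow> 'i set set
      \<Rightarrow> ('i list \<Rightarrow> 'a) set" where
  "nil_hecke_relators R I m d J\<^sub>0 =
     {word_monom R (replicate (d i) i) | i. i \<in> I} \<union>
     {word_monom R (alt_word a b (the_enat (m a b))) \<ominus>\<^bsub>free_algebra R I\<^esub>
        word_monom R (alt_word b a (the_enat (m a b))) | a b. {a, b} \<in> J\<^sub>0} \<union>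
     {word_monom R (alt_word a b (the_enat (m a b))) | a b. {a, b} \<in> braid_pairs I m - J\<^sub>0}"

definition nil_hecke ::
    "('a, 'c) ring_scheme \<Rightarrow> 'i set \<Rightarrow> ('i \<Rightarrow> 'i \<Rightarrow> enat) \<Rightarrow> ('i \<Rightarrow> nat) \<Rightarrow> 'i set set
      \<Rightarrow> ('a, ('i list \<Rightarrow> 'a) set) module" where
  "nil_hecke R I m d J\<^sub>0 =
     quot_algebra (free_algebra R I) (Idl\<^bsub>free_algebra R I\<^esub> nil_hecke_relators R I m d J\<^sub>0)"

definition nil_hecke_gen ::
    "('a, 'c) ring_scheme \<Rightarrow> 'i set \<Rightarrow> ('i \<Rightarrow> 'i \<Rightarrow> enat) \<Rightarrow> ('i \<Rightarrow> nat) \<Rightarrow> 'i set set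
      \<Rightarrow> 'i \<Rightarrow> ('i list \<Rightarrow> 'a) set" where
  "nil_hecke_gen R I m d J\<^sub>0 i =
     (Idl\<^bsub>free_algebra R I\<^esub> nil_hecke_relators R I m d J\<^sub>0) +>\<^bsub>free_algebra R I\<^esub> word_monom R [i]"

definition augmentation_ideal ::
    "('a, 'c) ring_scheme \<Rightarrow> 'i set \<Rightarrow> ('i \<Rightarrow> 'i \<Rightarrow> enat) \<Rightarrow> ('i \<Rightarrow> nat) \<Rightarrow> 'i set set
      \<Rightarrow> ('i list \<Rightarrow> 'a) set set" where
  "augmentation_ideal R I m d J\<^sub>0 =
     Idl\<^bsub>nil_hecke R I m d J\<^sub>0\<^esub> (nil_hecke_gen R I m d J\<^sub>0 ` I)"

definition nil_hecke_finite_list ::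
    "'i set \<Rightarrow> ('i \<Rightarrow> 'i \<Rightarrow> enat) \<Rightarrow> ('i \<Rightarrow> nat) \<Rightarrow> enat \<Rightarrow> bool" where
  "nil_hecke_finite_list I m d k \<longleftrightarrow>
     (k \<in> {1, 2} \<and> coxeter_tree I m \<and>
        (\<exists>i\<^sub>0\<in>I. \<exists>j\<^sub>0\<in>I. i\<^sub>0 \<noteq> j\<^sub>0 \<and> multiple_edges I m = {{i\<^sub>0, j\<^sub>0}} \<and> 4 \<le> m i\<^sub>0 j\<^sub>0 \<and> m i\<^sub>0 j\<^sub>0 < \<infinity>) \<and>
        (\<forall>i\<in>I. d i = 2)) \<or>
     (k \<in> {1, 2} \<and> coxeter_tree I m \<and> simply_laced I m \<and> card {i \<in> I. 3 \<le> d i} \<le> 1) \<or>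
     (3 \<le> k \<and> finite (carrier (coxeter_group I m)) \<and> (\<forall>i\<in>I. d i = 2)) \<or>
     (k = 3 \<and>
        ((\<exists>n\<ge>9. coxeter_type E_matrix n I m) \<or> (\<exists>n\<ge>5. coxeter_type F_matrix n I m) \<or>
         (\<exists>n\<ge>5. coxeter_type H_matrix n I m)) \<and>
        (\<forall>i\<in>I. d i = 2)) \<or>
     (3 \<le> k \<and>
        (\<exists>n\<ge>1. \<exists>f. coxeter_labelling A_matrix n I m f \<and>
           (2 < d (f 1) \<and> (\<forall>i\<in>{2..n}. d (f i) = 2) \<or>
            2 < d (f n) \<and> (\<forall>i\<in>{1..<n}. d (f i) = 2))))"

end

theory Submission
  imports Defs Complex_Main
begin

text \<open>
  The defining relations either kill a word or identify two words of the same length, so the algebra can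
  be read off from words alone. Two words are equivalent if the moves \<open>v = w\<close> of the kept
  braid relations lead from one to the other, and a word is called alive if no equivalent word has a
  factor that is killed. Dead words vanish in the algebra. Conversely, for a finite set \<open>D\<close>
  of alive words that is closed under the moves, the sum of the coefficients at \<open>D\<close> is a
  linear form on the free algebra that vanishes on all relations, and these forms together cut out an
  ideal; hence alive words do not vanish, over any nonzero ground ring (\<open>wm_K_iff\<close>).
  Because the alphabet is finite, the algebra is a finitely generated module if and only if the alive
  words have bounded length, and because the \<open>n\<close>-th power of the augmentation ideal is
  spanned by the words of length at least \<open>n\<close>, the same condition says that this ideal is
  nilpotent (\<open>fin_gen_iff_bounded\<close>, \<open>nilpotent_iff_bounded\<close>). Over a field an
  element outside a nilpotent augmentation ideal is a unit, which gives locality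
  (\<open>Aug_local\<close>). What remains is a question on words: for which Coxeter matrices, exponents
  \<open>d\<close> and levels \<open>k\<close> is the length of alive words bounded?

  In the listed cases it is bounded (\<open>list_imp_bounded\<close>). Dropping braid relations only
  kills more words, so for a finite Coxeter group and \<open>d = 2\<close> one may keep them all; the
  geometric representation then separates the prefixes of an alive word, whence its length is less than
  the order of the group. In types E, F, H with only the commutations kept, alive words are the reduced
  words of the fully commutative elements, and the last letter of the long tail occurs at most three
  times. In type A with a large exponent at one end, the letter of that end can be collected into one
  block or one occurrence. Without any braid relation, alive words are walks in the tree that can turn
  back only at the exceptional node or edge.

  In all other connected cases there are arbitrarily long alive words (\<open>bounded_imp_list\<close>).
  To see that a word is alive it is enough to let the letters act by partial maps on a set of states so
  that the kept braid relations hold and killed words are nowhere defined: a word that is defined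
  somewhere cannot be dead (\<open>partial_action_alive\<close>). A walk can go on for ever around a
  cycle, across an edge with infinite label, or back and forth between two places at which it can turn:
  a node of exponent at least three, a multiple edge, or a pair of commuting neighbours of a branch
  node, which can be read in either order. The graphs that are left are paths and three-armed stars. On
  the affine diagrams of types E6 and E7 there are numbers games that return to their starting position,
  and small automata treat the paths with a further node next to a label of at least six, with the label
  five inside the path, and with the label four at distance at least two from both ends. If the braid
  relations of length three are kept, games on the affine diagrams of types E8 and F4 and an automaton
  for H5 exclude the infinite groups of types E, F and H. Finiteness of the remaining types B, D, E, F,
  H is proved by a superharmonic vector, which makes the Coxeter form positive definite and the set of
  roots finite; type A is a case of the words with one large exponent.
\<close>

section \<open>Words modulo braid moves\<close>

lemma length_alt_word [simp]: "length (alt_word a b n) = n"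
  by (induction n arbitrary: a b) auto

lemma set_alt_word: "set (alt_word a b n) \<subseteq> {a, b}"
  by (induction n arbitrary: a b) auto

lemma nth_alt_word: "i < n \<Longrightarrow> alt_word a b n ! i = (if even i then a else b)"
  by (induction n arbitrary: a b i) (auto simp: nth_Cons split: nat.split)

lemma alt_word_add:
  "alt_word a b (k + n) = alt_word a b k @ (if even k then alt_word a b n else alt_word b a n)"
  by (induction k arbitrary: a b) auto

lemma rev_alt_word:
  "rev (alt_word a b n) = (if even n then alt_word b a n else alt_word a b n)"
proof (induction n arbitrary: a b)
  case (Suc n)
  show ?case using Suc alt_word_add[of a b n 1] alt_word_add[of b a n 1] by auto
qed simp

text \<open>The data of a nil-Hecke algebra apart from its ground ring, which has no influence on the
  question which words vanish. The set \<open>J\<close> consists of the pairs whose braid relation is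
  kept.\<close>

locale braid_words =
  fixes I :: "'i set" and m :: "'i \<Rightarrow> 'i \<Rightarrow> enat" and d :: "'i \<Rightarrow> nat" and J :: "'i set set"
  assumes cox: "coxeter_matrix I m"
    and d2: "\<And>i. i \<in> I \<Longrightarrow> 2 \<le> d i"
    and J_sub: "J \<subseteq> braid_pairs I m"
begin

abbreviation braid_word :: "'i \<Rightarrow> 'i \<Rightarrow> 'i list" where
  "braid_word a b \<equiv> alt_word a b (the_enat (m a b))"

definition null_words :: "'i list set" where
  "null_words = {replicate (d i) i | i. i \<in> I} \<union> {braid_word a b | a b. {a, b} \<in> braid_pairs I m - J}"

definition braid_step :: "'i list \<Rightarrow> 'i list \<Rightarrow> bool" where
  "braid_step u v \<longleftrightarrow>
     (\<exists>p q a b. {a, b} \<in> J \<and> u = p @ braid_word a b @ q \<and> v = p @ braid_word b a @ q)"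

abbreviation braid_eq :: "'i list \<Rightarrow> 'i list \<Rightarrow> bool" (infix "\<approx>" 50) where
  "u \<approx> v \<equiv> braid_step\<^sup>*\<^sup>* u v"

text \<open>Null factors of equivalent words are the obvious reasons for a word to vanish in the
  algebra; the lemma \<open>wm_K_iff\<close> shows that there is no other reason.\<close>

definition alive :: "'i list \<Rightarrow> bool" where
  "alive w \<longleftrightarrow> w \<in> lists I \<and> (\<forall>v p x q. w \<approx> v \<longrightarrow> v = p @ x @ q \<longrightarrow> x \<notin> null_words)"

definition bounded_words :: bool where
  "bounded_words \<longleftrightarrow> (\<exists>N. \<forall>w. alive w \<longrightarrow> length w \<le> N)"

lemma finite_I: "finite I"
  using cox unfolding coxeter_matrix_def by blast

lemma m_sym: "a \<in> I \<Longrightarrow> b \<in> I \<Longrightarrow> m a b = m b a"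
  using cox unfolding coxeter_matrix_def by metis

lemma m_ge2: "a \<in> I \<Longrightarrow> b \<in> I \<Longrightarrow> a \<noteq> b \<Longrightarrow> 2 \<le> m a b"
  using cox unfolding coxeter_matrix_def by metis

lemma m_refl: "a \<in> I \<Longrightarrow> m a a = 1"
  using cox unfolding coxeter_matrix_def by metis

lemma braid_pairs_iff:
  "{a, b} \<in> braid_pairs I m \<longleftrightarrow> a \<in> I \<and> b \<in> I \<and> a \<noteq> b \<and> m a b < \<infinity>"
proof
  assume "{a, b} \<in> braid_pairs I m"
  then obtain x y where "{a,b} = {x,y}" "x \<in> I" "y \<in> I" "x \<noteq> y" "m x y < \<infinity>"
    unfolding braid_pairs_def by blast
  then show "a \<in> I \<and> b \<in> I \<and> a \<noteq> b \<and> m a b < \<infinity>"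
    using m_sym by (auto simp: doubleton_eq_iff)
qed (auto simp: braid_pairs_def)

lemma J_D: "{a, b} \<in> J \<Longrightarrow> a \<in> I \<and> b \<in> I \<and> a \<noteq> b \<and> m a b < \<infinity>"
  using J_sub braid_pairs_iff by blast

lemma braid_step_sym: "braid_step u v \<Longrightarrow> braid_step v u"
  unfolding braid_step_def by (metis J_D insert_commute m_sym)

lemma braid_eq_sym: "u \<approx> v \<Longrightarrow> v \<approx> u"
  by (induction rule: rtranclp_induct) (auto intro: braid_step_sym converse_rtranclp_into_rtranclp)

lemma braid_step_length: "braid_step u v \<Longrightarrow> length u = length v"
  unfolding braid_step_def by (metis J_D length_alt_word length_append m_sym)

lemma braid_eq_length: "u \<approx> v \<Longrightarrow> length u = length v"
  by (induction rule: rtranclp_induct) (auto dest: braid_step_length)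

lemma alt_word_lists: "a \<in> I \<Longrightarrow> b \<in> I \<Longrightarrow> alt_word a b n \<in> lists I"
  by (induction n arbitrary: a b) auto

lemma braid_step_lists:
  assumes "braid_step u v" "u \<in> lists I" shows "v \<in> lists I"
proof -
  obtain p q a b where "{a, b} \<in> J" "u = p @ braid_word a b @ q" "v = p @ braid_word b a @ q"
    using assms(1) unfolding braid_step_def by blast
  then show ?thesis using assms(2) alt_word_lists[of b a] by (auto dest!: J_D)
qed

lemma braid_eq_lists: "u \<approx> v \<Longrightarrow> u \<in> lists I \<Longrightarrow> v \<in> lists I"
proof (induction rule: rtranclp_induct)
  case (step y z)
  show ?case by (rule braid_step_lists[OF step(2) step(3)[OF step(4)]])
qed

lemma braid_step_context: "braid_step u v \<Longrightarrow> braid_step (p @ u @ q) (p @ v @ q)"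
proof -
  assume "braid_step u v"
  then obtain r s a b where "{a, b} \<in> J" "u = r @ braid_word a b @ s" "v = r @ braid_word b a @ s"
    unfolding braid_step_def by blast
  then have "{a,b} \<in> J \<and> p @ u @ q = (p @ r) @ braid_word a b @ (s @ q)
    \<and> p @ v @ q = (p @ r) @ braid_word b a @ (s @ q)" by simp
  then show ?thesis unfolding braid_step_def by blast
qed

lemma braid_eq_context: "u \<approx> v \<Longrightarrow> p @ u @ q \<approx> p @ v @ q"
  by (induction rule: rtranclp_induct) (auto intro: braid_step_context rtranclp.rtrancl_into_rtrancl)

lemma braid_eq_Cons: "u \<approx> v \<Longrightarrow> i # u \<approx> i # v"
  using braid_eq_context[of u v "[i]" "[]"] by simp

lemma braid_eq_prefix: "u \<approx> v \<Longrightarrow> p @ u \<approx> p @ v"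
  using braid_eq_context[of u v p "[]"] by simp

lemma braid_eq_suffix: "u \<approx> v \<Longrightarrow> u @ q \<approx> v @ q"
  using braid_eq_context[of u v "[]" q] by simp

lemma braid_eq_swap: "{a, b} \<in> J \<Longrightarrow> p @ braid_word a b @ q \<approx> p @ braid_word b a @ q"
  by (rule r_into_rtranclp) (auto simp: braid_step_def)

lemma alive_lists: "alive w \<Longrightarrow> w \<in> lists I"
  by (simp add: alive_def)

lemma alive_cong: "u \<approx> v \<Longrightarrow> alive u \<longleftrightarrow> alive v"
proof -
  have "alive v" if "u \<approx> v" "alive u" for u v
    unfolding alive_def
  proof (intro conjI allI impI)
    show "v \<in> lists I" by (rule braid_eq_lists[OF that(1) alive_lists[OF that(2)]])
    fix z p x q assume "v \<approx> z" "z = p @ x @ q"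
    then show "x \<notin> null_words" using that rtranclp_trans[OF that(1) \<open>v \<approx> z\<close>] unfolding alive_def by blast
  qed
  then show "u \<approx> v \<Longrightarrow> alive u \<longleftrightarrow> alive v" using braid_eq_sym by blast
qed

lemma alive_factor:
  assumes "alive (p @ u @ q)" shows "alive u"
  unfolding alive_def
proof (intro conjI allI impI)
  show "u \<in> lists I" using alive_lists[OF assms] by auto
  fix v r x s assume "u \<approx> v" "v = r @ x @ s"
  then have "p @ u @ q \<approx> (p @ r) @ x @ (s @ q)" using braid_eq_context[of u v p q] by simp
  then show "x \<notin> null_words" using assms unfolding alive_def by blast
qed

lemma alive_null: "alive (p @ x @ q) \<Longrightarrow> x \<notin> null_words"
  unfolding alive_def by blast

lemma alive_take: "alive w \<Longrightarrow> alive (take n w)"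
  using alive_factor[of "[]" "take n w" "drop n w"] by simp

lemma alive_drop: "alive w \<Longrightarrow> alive (drop n w)"
  using alive_factor[of "take n w" "drop n w" "[]"] by simp

end

lemma E_matrix_eq:
  "E_matrix i j = (if i = j then 1
    else if (i = 1 \<and> j = 2) \<or> (i = 2 \<and> j = 1) \<or> (i = 2 \<and> j = 4) \<or> (i = 4 \<and> j = 2) \<or> (i = 3 \<and> j = 4)
      \<or> (i = 4 \<and> j = 3) \<or> (4 \<le> i \<and> j = Suc i) \<or> (4 \<le> j \<and> i = Suc j) then 3 else 2)"
proof -
  have "{i, j} \<in> {{1, 2}, {2, 4}, {3, 4}} \<union> {{l, Suc l} | l. 4 \<le> l} \<longleftrightarrow>
    (i = 1 \<and> j = 2) \<or> (i = 2 \<and> j = 1) \<or> (i = 2 \<and> j = 4) \<or> (i = 4 \<and> j = 2) \<or> (i = 3 \<and> j = 4)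
      \<or> (i = 4 \<and> j = 3) \<or> (4 \<le> i \<and> j = Suc i) \<or> (4 \<le> j \<and> i = Suc j)"
    unfolding Un_iff mem_Collect_eq insert_iff doubleton_eq_iff empty_iff by blast
  then show ?thesis unfolding E_matrix_def by presburger
qed

lemma F_matrix_eq:
  "F_matrix i j = (if i = j then 1 else if (i = 2 \<and> j = 3) \<or> (i = 3 \<and> j = 2) then 4
    else if j = Suc i \<or> i = Suc j then 3 else 2)"
  by (auto simp: F_matrix_def A_matrix_def doubleton_eq_iff)

lemma H_matrix_eq:
  "H_matrix i j = (if i = j then 1 else if (i = 1 \<and> j = 2) \<or> (i = 2 \<and> j = 1) then 5
    else if j = Suc i \<or> i = Suc j then 3 else 2)"
  by (auto simp: H_matrix_def A_matrix_def doubleton_eq_iff)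

lemma no_square_alt_word:
  assumes "set y \<subseteq> {s, t}" "\<And>p i q. y \<noteq> p @ [i, i] @ q" "y \<noteq> []" "hd y = t" "s \<noteq> t"
  shows "y = alt_word t s (length y)"
  using assms
proof (induction y arbitrary: s t)
  case (Cons a y)
  show ?case
  proof (cases y)
    case (Cons b z)
    have "b \<noteq> a" using Cons.prems(2)[of "[]" a z] Cons by auto
    then have "y = alt_word s t (length y)"
      using Cons.prems Cons by (intro Cons.IH[of t s]) (auto, metis append_Cons)
    then show ?thesis using Cons.prems by simp
  qed (use Cons.prems in simp)
qed simp

context braid_words begin

text \<open>A proposition of the meta-logic, so that an assumption of this form is a rule.\<close>

abbreviation keeps :: "enat \<Rightarrow> prop" where
  "keeps r \<equiv> (\<And>a b. a \<in> I \<Longrightarrow> b \<in> I \<Longrightarrow> m a b = r \<Longrightarrow> {a, b} \<in> J)"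

lemma braid_word_set:
  assumes "a \<in> I" "b \<in> I" "a \<noteq> b" "m a b < \<infinity>" shows "set (braid_word a b) = {a, b}"
proof -
  obtain n where n: "m a b = enat n" using assms(4) by auto
  have "2 \<le> n" using m_ge2[OF assms(1-3)] n by (simp add: numeral_eq_enat)
  then obtain k where "n = Suc (Suc k)" by (metis add_2_eq_Suc le_Suc_ex)
  then show ?thesis using n set_alt_word[of a b k] by auto
qed

lemma braid_step_set: "braid_step u v \<Longrightarrow> set u = set v"
proof -
  assume "braid_step u v"
  then obtain p q a b where h: "{a, b} \<in> J" "u = p @ braid_word a b @ q" "v = p @ braid_word b a @ q"
    unfolding braid_step_def by blast
  then have "a \<in> I" "b \<in> I" "a \<noteq> b" "m a b < \<infinity>" using J_D by blast+
  then show ?thesis using h braid_word_set[of a b] braid_word_set[of b a] m_sym[of a b] by auto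
qed

lemma braid_eq_set: "u \<approx> v \<Longrightarrow> set u = set v"
  by (induction rule: rtranclp_induct) (auto dest: braid_step_set)

lemma commute:
  assumes "\<And>b. b \<in> set x \<Longrightarrow> {a, b} \<in> J \<and> m a b = 2"
  shows "a # x \<approx> x @ [a]"
  using assms
proof (induction x)
  case (Cons b x)
  have b: "{a, b} \<in> J" "m a b = 2" using Cons.prems[of b] by auto
  have "m b a = 2" using b J_D m_sym by metis
  then have "braid_word a b = [a, b]" "braid_word b a = [b, a]"
    using b by (simp_all add: numeral_eq_enat numeral_2_eq_2)
  then have "a # b # x \<approx> b # a # x" using braid_eq_swap[OF b(1), of "[]" x] by simp
  also have "b # a # x \<approx> b # x @ [a]" using Cons by (intro braid_eq_Cons) simp
  finally show ?case by simp
qed simp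

lemma commute_replicate:
  assumes "\<And>b. b \<in> set x \<Longrightarrow> {a, b} \<in> J \<and> m a b = 2"
  shows "replicate k a @ x \<approx> x @ replicate k a"
proof (induction k)
  case (Suc k)
  have "replicate (Suc k) a @ x \<approx> (a # x) @ replicate k a"
    using braid_eq_Cons[OF Suc, of a] by simp
  also have "(a # x) @ replicate k a \<approx> (x @ [a]) @ replicate k a"
    by (rule braid_eq_suffix[OF commute[OF assms]])
  finally show ?case by simp
qed simp

lemma braid_step_rev: "braid_step u v \<Longrightarrow> braid_step (rev u) (rev v)"
proof -
  assume "braid_step u v"
  then obtain p q a b where h: "{a, b} \<in> J" "u = p @ braid_word a b @ q" "v = p @ braid_word b a @ q"
    unfolding braid_step_def by blast
  have s: "m a b = m b a" using h(1) J_D m_sym by metis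
  show ?thesis
  proof (cases "even (the_enat (m a b))")
    case True
    then have "rev u = rev q @ braid_word b a @ rev p" "rev v = rev q @ braid_word a b @ rev p"
      using h s by (simp_all add: rev_alt_word)
    then show ?thesis unfolding braid_step_def using h(1) by (metis insert_commute)
  next
    case False
    then have "rev u = rev q @ braid_word a b @ rev p" "rev v = rev q @ braid_word b a @ rev p"
      using h s by (simp_all add: rev_alt_word)
    then show ?thesis unfolding braid_step_def using h(1) by metis
  qed
qed

lemma braid_eq_rev: "u \<approx> v \<Longrightarrow> rev u \<approx> rev v"
  by (induction rule: rtranclp_induct) (auto intro: rtranclp.rtrancl_into_rtrancl braid_step_rev)

lemma null_words_rev: "x \<in> null_words \<Longrightarrow> rev x \<in> null_words"
proof -
  assume "x \<in> null_words"
  then consider i where "i \<in> I" "x = replicate (d i) i"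
    | a b where "{a, b} \<in> braid_pairs I m - J" "x = braid_word a b"
    unfolding null_words_def by blast
  then show ?thesis
  proof cases
    case 1
    then show ?thesis unfolding null_words_def by auto
  next
    case 2
    then have "m a b = m b a" using braid_pairs_iff[of a b] m_sym by blast
    then have "rev x = braid_word a b \<or> rev x = braid_word b a" using 2 by (simp add: rev_alt_word)
    moreover have "{b, a} \<in> braid_pairs I m - J" using 2 by (simp add: insert_commute)
    ultimately show ?thesis unfolding null_words_def using 2(1) by blast
  qed
qed

lemma alive_rev:
  assumes "alive w" shows "alive (rev w)"
  unfolding alive_def
proof (intro conjI allI impI)
  show "rev w \<in> lists I" using alive_lists[OF assms] by (simp add: lists_eq_set)
  fix v p x q assume "rev w \<approx> v" "v = p @ x @ q"
  then have "w \<approx> rev q @ rev x @ rev p" using braid_eq_rev[of "rev w" v] by simp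
  then have "rev x \<notin> null_words" using assms unfolding alive_def by blast
  then show "x \<notin> null_words" using null_words_rev by blast
qed

lemma alive_no_power:
  assumes "alive (p @ x @ q)" "x = replicate (d i) i" "i \<in> I" shows False
  using alive_null[OF assms(1)] assms(2,3) unfolding null_words_def by blast

end

text \<open>The map \<open>f\<close> carries moves and null words of the small system to moves and null
  words of the large one, so a reason for \<open>w\<close> to be dead becomes one for \<open>map f
  w\<close>.\<close>

lemma alive_map:
  assumes B: "braid_words I m d J" and B': "braid_words I' m' d' J'"
    and f: "\<And>a. a \<in> I' \<Longrightarrow> f a \<in> I" "\<And>a b. a \<in> I' \<Longrightarrow> b \<in> I' \<Longrightarrow> m (f a) (f b) = m' a b"
      "\<And>a. a \<in> I' \<Longrightarrow> d (f a) = d' a"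
    and J: "\<And>a b. {a, b} \<in> J' \<Longrightarrow> {f a, f b} \<in> J"
      "\<And>a b. {a, b} \<in> braid_pairs I' m' - J' \<Longrightarrow> {f a, f b} \<in> braid_pairs I m - J"
    and w: "w \<in> lists I'" and al: "braid_words.alive I m d J (map f w)"
  shows "braid_words.alive I' m' d' J' w"
proof -
  interpret B: braid_words I m d J by (rule B)
  interpret B': braid_words I' m' d' J' by (rule B')
  have alt: "map f (alt_word a b n) = alt_word (f a) (f b) n" for a b n
    by (induction n arbitrary: a b) auto
  have step: "B.braid_step (map f u) (map f v)" if uv: "B'.braid_step u v" for u v
  proof -
    obtain p q a b where h: "{a, b} \<in> J'" "u = p @ B'.braid_word a b @ q" "v = p @ B'.braid_word b a @ q"
      using uv unfolding B'.braid_step_def by blast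
    then have "a \<in> I'" "b \<in> I'" using B'.J_D by blast+
    then have "map f u = map f p @ B.braid_word (f a) (f b) @ map f q"
      "map f v = map f p @ B.braid_word (f b) (f a) @ map f q" using h f(2) alt by simp_all
    then show ?thesis unfolding B.braid_step_def using J(1)[OF h(1)] by blast
  qed
  have eq: "B.braid_eq (map f w) (map f v)" if "B'.braid_eq w v" for v
    using that by (induction rule: rtranclp_induct) (auto intro: rtranclp.rtrancl_into_rtrancl step)
  have null: "map f x \<in> B.null_words" if x: "x \<in> B'.null_words" for x
  proof -
    consider i where "i \<in> I'" "x = replicate (d' i) i"
      | a b where "{a, b} \<in> braid_pairs I' m' - J'" "x = B'.braid_word a b"
      using x unfolding B'.null_words_def by blast
    then show ?thesis
    proof cases
      case 1
      then have "map f x = replicate (d (f i)) (f i)" using f(3) by simp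
      then show ?thesis unfolding B.null_words_def using f(1) 1(1) by blast
    next
      case 2
      then have "a \<in> I'" "b \<in> I'" using B'.braid_pairs_iff by blast+
      then have "map f x = B.braid_word (f a) (f b)" using 2 f(2) alt by simp
      then show ?thesis unfolding B.null_words_def using J(2)[OF 2(1)] by blast
    qed
  qed
  show ?thesis unfolding B'.alive_def
  proof (intro conjI allI impI w)
    fix v p x q assume "B'.braid_eq w v" "v = p @ x @ q"
    then have "B.braid_eq (map f w) (map f p @ map f x @ map f q)" using eq by fastforce
    then show "x \<notin> B'.null_words" using null al unfolding B.alive_def by blast
  qed
qed

text \<open>Enlarging the set of kept relations replaces some relations \<open>v = w = 0\<close> by
  \<open>v = w\<close>. A sequence of moves for the larger set can only use one of the new moves at a
  word that was dead before.\<close>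

lemma alive_mono:
  assumes B1: "braid_words I m d J1" and B2: "braid_words I m d J2" and sub: "J1 \<subseteq> J2"
    and al: "braid_words.alive I m d J1 w"
  shows "braid_words.alive I m d J2 w"
proof -
  interpret B1: braid_words I m d J1 by (rule B1)
  interpret B2: braid_words I m d J2 by (rule B2)
  have eq: "B1.braid_eq w v" if "B2.braid_eq w v" for v
    using that
  proof (induction rule: rtranclp_induct)
    case (step u v)
    obtain p q a b where h: "{a, b} \<in> J2" "u = p @ B1.braid_word a b @ q" "v = p @ B1.braid_word b a @ q"
      using step(2) unfolding B2.braid_step_def by blast
    have "B1.alive u" using B1.alive_cong[OF step.IH] al by blast
    then have "B1.braid_word a b \<notin> B1.null_words" using B1.alive_null h(2) by blast
    then have "{a, b} \<in> J1" using h(1) B2.J_sub unfolding B1.null_words_def by blast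
    then have "B1.braid_step u v" unfolding B1.braid_step_def using h by blast
    then show ?case using step.IH by (rule rtranclp.rtrancl_into_rtrancl[rotated])
  qed simp
  have null: "B2.null_words \<subseteq> B1.null_words" unfolding B1.null_words_def B2.null_words_def using sub by blast
  show ?thesis unfolding B2.alive_def
  proof (intro conjI allI impI)
    show "w \<in> lists I" using al B1.alive_lists by blast
    fix v p x q assume "B2.braid_eq w v" "v = p @ x @ q"
    then show "x \<notin> B2.null_words" using eq null al unfolding B1.alive_def by blast
  qed
qed

section \<open>The free algebra\<close>

context cring begin

text \<open>The product of the free algebra, for arbitrary functions on words. Its laws hold without any
  condition on the support and follow by recursion on the word.\<close>

definition conv :: "('i list \<Rightarrow> 'a) \<Rightarrow> ('i list \<Rightarrow> 'a) \<Rightarrow> 'i list \<Rightarrow> 'a" where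
  "conv f g w = (\<Oplus>k\<in>{..length w}. f (take k w) \<otimes> g (drop k w))"

lemma conv_closed [simp]:
  "(\<And>w. f w \<in> carrier R) \<Longrightarrow> (\<And>w. g w \<in> carrier R) \<Longrightarrow> conv f g w \<in> carrier R"
  unfolding conv_def by (intro finsum_closed) auto

lemma conv_Nil: "(\<And>w. f w \<in> carrier R) \<Longrightarrow> (\<And>w. g w \<in> carrier R) \<Longrightarrow> conv f g [] = f [] \<otimes> g []"
  unfolding conv_def by simp

lemma conv_Cons:
  assumes "\<And>w. f w \<in> carrier R" "\<And>w. g w \<in> carrier R"
  shows "conv f g (x # w) = f [] \<otimes> g (x # w) \<oplus> conv (\<lambda>u. f (x # u)) g w"
proof -
  have "conv f g (x # w) = (\<Oplus>k\<in>{..Suc (length w)}. f (take k (x # w)) \<otimes> g (drop k (x # w)))"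
    unfolding conv_def by simp
  also have "\<dots> = (\<Oplus>k\<in>{..length w}. f (take (Suc k) (x # w)) \<otimes> g (drop (Suc k) (x # w)))
      \<oplus> f (take 0 (x # w)) \<otimes> g (drop 0 (x # w))"
    by (rule finsum_Suc2) (use assms in auto)
  finally show ?thesis unfolding conv_def using assms
    by (simp add: a_comm)
qed

lemma conv_add_left:
  assumes "\<And>w. f w \<in> carrier R" "\<And>w. f' w \<in> carrier R" "\<And>w. g w \<in> carrier R"
  shows "conv (\<lambda>u. f u \<oplus> f' u) g w = conv f g w \<oplus> conv f' g w"
  using assms by (induction w arbitrary: f f') (simp_all add: conv_Nil conv_Cons l_distr a_ac)

lemma conv_add_right:
  assumes "\<And>w. f w \<in> carrier R" "\<And>w. g w \<in> carrier R" "\<And>w. g' w \<in> carrier R"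
  shows "conv f (\<lambda>u. g u \<oplus> g' u) w = conv f g w \<oplus> conv f g' w"
  using assms by (induction w arbitrary: f) (simp_all add: conv_Nil conv_Cons r_distr a_ac)

lemma conv_smult_left:
  assumes "\<And>w. f w \<in> carrier R" "\<And>w. g w \<in> carrier R" "r \<in> carrier R"
  shows "conv (\<lambda>u. r \<otimes> f u) g w = r \<otimes> conv f g w"
  using assms by (induction w arbitrary: f) (simp_all add: conv_Nil conv_Cons r_distr m_assoc)

lemma conv_smult_right:
  assumes "\<And>w. f w \<in> carrier R" "\<And>w. g w \<in> carrier R" "r \<in> carrier R"
  shows "conv f (\<lambda>u. r \<otimes> g u) w = r \<otimes> conv f g w"
  using assms by (induction w arbitrary: f) (simp_all add: conv_Nil conv_Cons r_distr m_lcomm)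

lemma conv_assoc:
  assumes "\<And>w. f w \<in> carrier R" "\<And>w. g w \<in> carrier R" "\<And>w. h w \<in> carrier R"
  shows "conv (conv f g) h w = conv f (conv g h) w"
  using assms(1)
proof (induction w arbitrary: f)
  case Nil
  then show ?case using assms(2,3) by (simp add: conv_Nil m_assoc)
next
  case (Cons x w)
  have eq: "(\<lambda>u. conv f g (x # u)) = (\<lambda>u. f [] \<otimes> g (x # u) \<oplus> conv (\<lambda>v. f (x # v)) g u)"
    using Cons.prems assms(2) by (simp add: conv_Cons)
  show ?case
    using Cons.prems assms(2,3)
    by (simp add: conv_Cons conv_Nil eq conv_add_left conv_smult_left Cons.IH r_distr m_assoc a_assoc)
qed

lemma conv_zero_left: "(\<And>w. g w \<in> carrier R) \<Longrightarrow> conv (\<lambda>u. \<zero>) g w = \<zero>"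
  by (induction w) (simp_all add: conv_Nil conv_Cons)

lemma conv_zero_right: "(\<And>w. f w \<in> carrier R) \<Longrightarrow> conv f (\<lambda>u. \<zero>) w = \<zero>"
  by (induction w arbitrary: f) (simp_all add: conv_Nil conv_Cons)

lemma conv_one_left:
  "(\<And>w. g w \<in> carrier R) \<Longrightarrow> conv (\<lambda>w. if w = [] then \<one> else \<zero>) g w = g w"
  by (cases w) (simp_all add: conv_Nil conv_Cons conv_zero_left)

lemma conv_one_right:
  "(\<And>w. f w \<in> carrier R) \<Longrightarrow> conv f (\<lambda>w. if w = [] then \<one> else \<zero>) w = f w"
  by (induction w arbitrary: f) (simp_all add: conv_Nil conv_Cons)

lemma conv_nonzero:
  assumes "conv f g w \<noteq> \<zero>" "\<And>w. f w \<in> carrier R" "\<And>w. g w \<in> carrier R"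
  shows "\<exists>u v. w = u @ v \<and> f u \<noteq> \<zero> \<and> g v \<noteq> \<zero>"
proof (rule ccontr)
  assume "\<not> ?thesis"
  then have "f (take k w) \<otimes> g (drop k w) = \<zero>" for k
    using assms(2,3) by (metis append_take_drop_id l_null r_null)
  then show False using assms(1) unfolding conv_def by simp
qed

lemma conv_monom_left:
  assumes "\<And>w. g w \<in> carrier R"
  shows "conv (word_monom R u) g w = (if take (length u) w = u then g (drop (length u) w) else \<zero>)"
proof (induction u arbitrary: w)
  case Nil
  then show ?case using conv_one_left[OF assms] by (simp add: word_monom_def)
next
  case (Cons x u)
  have [simp]: "word_monom R v w \<in> carrier R" for v w by (simp add: word_monom_def)
  show ?case
  proof (cases w)
    case Nil
    then show ?thesis using assms by (simp add: conv_Nil) (simp add: word_monom_def)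
  next
    case (Cons y v)
    have "(\<lambda>z. word_monom R (x # u) (y # z)) = (if x = y then word_monom R u else (\<lambda>_. \<zero>))"
      by (auto simp: word_monom_def)
    moreover have "word_monom R (x # u) [] = \<zero>" by (simp add: word_monom_def)
    ultimately show ?thesis using Cons assms Cons.IH by (simp add: conv_Cons conv_zero_left)
  qed
qed

lemma conv_monom_right:
  assumes "\<And>w. f w \<in> carrier R"
  shows "conv f (word_monom R u) w
    = (if length u \<le> length w \<and> drop (length w - length u) w = u
       then f (take (length w - length u) w) else \<zero>)"
  using assms
proof (induction w arbitrary: f)
  case Nil
  then show ?case by (simp add: conv_Nil word_monom_def)
next
  case (Cons x w)
  have [simp]: "word_monom R v w \<in> carrier R" for v w by (simp add: word_monom_def)
  show ?case
  proof (cases "length u = Suc (length w)")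
    case True
    then show ?thesis using Cons by (auto simp add: conv_Cons word_monom_def)
  next
    case False
    then have "word_monom R u (x # w) = \<zero>" by (auto simp: word_monom_def)
    moreover have "Suc (length w) - length u = Suc (length w - length u)" if "length u \<le> length w"
      using that by simp
    ultimately show ?thesis using Cons False by (auto simp add: conv_Cons)
  qed
qed

abbreviation "FA \<equiv> free_algebra R"

lemma FA_simps:
  "\<zero>\<^bsub>FA S\<^esub> = (\<lambda>w. \<zero>)" "\<one>\<^bsub>FA S\<^esub> = (\<lambda>w. if w = [] then \<one> else \<zero>)"
  "f \<oplus>\<^bsub>FA S\<^esub> g = (\<lambda>w. f w \<oplus> g w)" "f \<otimes>\<^bsub>FA S\<^esub> g = conv f g"
  "r \<odot>\<^bsub>FA S\<^esub> f = (\<lambda>w. r \<otimes> f w)"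
  by (simp_all add: free_algebra_def conv_def fun_eq_iff)

lemma FA_carrier:
  "f \<in> carrier (FA S) \<longleftrightarrow>
    (\<forall>w. f w \<in> carrier R) \<and> finite {w. f w \<noteq> \<zero>} \<and> {w. f w \<noteq> \<zero>} \<subseteq> lists S"
  by (simp add: free_algebra_def)

lemma FA_closedD: "f \<in> carrier (FA S) \<Longrightarrow> f w \<in> carrier R"
  by (simp add: FA_carrier)

lemma FA_smult_closed:
  assumes "r \<in> carrier R" "f \<in> carrier (FA S)" shows "(\<lambda>w. r \<otimes> f w) \<in> carrier (FA S)"
proof -
  have "{w. r \<otimes> f w \<noteq> \<zero>} \<subseteq> {w. f w \<noteq> \<zero>}" using assms(1) by auto
  then show ?thesis using assms unfolding FA_carrier
    by (meson finite_subset m_closed order_trans)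
qed

lemma FA_add_closed:
  assumes "f \<in> carrier (FA S)" "g \<in> carrier (FA S)" shows "(\<lambda>w. f w \<oplus> g w) \<in> carrier (FA S)"
proof -
  have "{w. f w \<oplus> g w \<noteq> \<zero>} \<subseteq> {w. f w \<noteq> \<zero>} \<union> {w. g w \<noteq> \<zero>}" using assms by auto
  moreover have "{w. f w \<noteq> \<zero>} \<union> {w. g w \<noteq> \<zero>} \<subseteq> lists S" "finite ({w. f w \<noteq> \<zero>} \<union> {w. g w \<noteq> \<zero>})"
    using assms unfolding FA_carrier by auto
  ultimately show ?thesis using assms unfolding FA_carrier
    by (meson a_closed finite_subset order_trans)
qed

lemma FA_mult_closed:
  assumes "f \<in> carrier (FA S)" "g \<in> carrier (FA S)" shows "conv f g \<in> carrier (FA S)"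
proof -
  have c: "f w \<in> carrier R" "g w \<in> carrier R" for w using assms by (auto simp: FA_carrier)
  let ?X = "(\<lambda>(u, v). u @ v) ` ({w. f w \<noteq> \<zero>} \<times> {w. g w \<noteq> \<zero>})"
  have "{w. conv f g w \<noteq> \<zero>} \<subseteq> ?X" using conv_nonzero[OF _ c] by fastforce
  moreover have "finite ?X" using assms unfolding FA_carrier by blast
  moreover have "?X \<subseteq> lists S"
  proof (rule image_subsetI)
    fix z assume z: "z \<in> {w. f w \<noteq> \<zero>} \<times> {w. g w \<noteq> \<zero>}"
    obtain u v where "z = (u, v)" by (cases z)
    moreover have "u \<in> lists S" "v \<in> lists S"
      using z calculation assms unfolding FA_carrier by (simp_all add: subset_iff)
    ultimately show "(\<lambda>(u, v). u @ v) z \<in> lists S" by simp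
  qed
  ultimately show ?thesis unfolding FA_carrier using c
    by (meson conv_closed finite_subset order_trans)
qed

lemma word_monom_closed: "w \<in> lists S \<Longrightarrow> word_monom R w \<in> carrier (FA S)"
  by (auto simp: FA_carrier word_monom_def if_split_mem2)

lemma FA_ring: "ring (FA S)"
proof (rule ringI)
  show "abelian_group (FA S)"
  proof (rule abelian_groupI)
    fix f assume f: "f \<in> carrier (FA S)"
    have "(\<lambda>w. \<ominus> \<one> \<otimes> f w) \<in> carrier (FA S)" by (rule FA_smult_closed) (use f in auto)
    moreover have "(\<lambda>w. \<ominus> \<one> \<otimes> f w \<oplus> f w) = (\<lambda>w. \<zero>)"
      using f by (auto simp: FA_carrier l_minus l_neg)
    ultimately show "\<exists>g\<in>carrier (FA S). g \<oplus>\<^bsub>FA S\<^esub> f = \<zero>\<^bsub>FA S\<^esub>"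
      by (intro bexI[of _ "\<lambda>w. \<ominus> \<one> \<otimes> f w"]) (simp_all only: FA_simps)
  qed (simp_all add: FA_simps FA_add_closed FA_closedD a_ac,
       simp_all add: FA_carrier)
  show "Group.monoid (FA S)"
  proof (rule monoidI)
    show "\<one>\<^bsub>FA S\<^esub> \<in> carrier (FA S)"
      using word_monom_closed[of "[]" S] by (simp add: FA_simps word_monom_def)
  qed (simp_all add: FA_simps FA_mult_closed FA_closedD conv_assoc
      conv_one_left conv_one_right fun_eq_iff)
qed (auto simp: FA_simps FA_closedD conv_add_left conv_add_right)

lemma FA_uminus:
  assumes "g \<in> carrier (FA S)" shows "\<ominus>\<^bsub>FA S\<^esub> g = (\<lambda>w. \<ominus> g w)"
proof -
  interpret F: ring "FA S" by (rule FA_ring)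
  have g': "(\<lambda>w. \<ominus> \<one> \<otimes> g w) \<in> carrier (FA S)"
    by (rule FA_smult_closed) (use assms in auto)
  have "(\<lambda>w. \<ominus> \<one> \<otimes> g w) \<oplus>\<^bsub>FA S\<^esub> g = \<zero>\<^bsub>FA S\<^esub>"
    unfolding FA_simps using assms by (auto simp: FA_closedD l_minus l_neg)
  then have "\<ominus>\<^bsub>FA S\<^esub> g = (\<lambda>w. \<ominus> \<one> \<otimes> g w)"
    using F.minus_equality g' assms by blast
  then show ?thesis using assms by (auto simp: FA_closedD l_minus)
qed

lemma FA_minus:
  assumes "f \<in> carrier (FA S)" "g \<in> carrier (FA S)"
  shows "f \<ominus>\<^bsub>FA S\<^esub> g = (\<lambda>w. f w \<ominus> g w)"
  using assms by (simp add: a_minus_def FA_uminus FA_simps)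

lemma FA_induct [consumes 1, case_names zero add]:
  assumes "f \<in> carrier (FA S)" and z: "P (\<lambda>w. \<zero>)"
    and step: "\<And>g r u. g \<in> carrier (FA S) \<Longrightarrow> P g \<Longrightarrow> r \<in> carrier R \<Longrightarrow> u \<in> lists S \<Longrightarrow>
       f u \<noteq> \<zero> \<Longrightarrow> P (\<lambda>w. r \<otimes> word_monom R u w \<oplus> g w)"
  shows "P f"
proof -
  have main: "finite A \<Longrightarrow> A \<subseteq> {w. f w \<noteq> \<zero>} \<Longrightarrow> g \<in> carrier (FA S) \<Longrightarrow> {w. g w \<noteq> \<zero>} \<subseteq> A \<Longrightarrow> P g" for A g
  proof (induction A arbitrary: g rule: finite_induct)
    case empty
    then have "g = (\<lambda>w. \<zero>)" by auto
    then show ?case using z by simp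
  next
    case (insert u A)
    define h where "h = (\<lambda>w. if w = u then \<zero> else g w)"
    have hc: "h \<in> carrier (FA S)"
    proof -
      have "{w. h w \<noteq> \<zero>} \<subseteq> {w. g w \<noteq> \<zero>}" by (auto simp: h_def)
      moreover have "h w \<in> carrier R" for w using insert.prems(2) by (simp add: h_def FA_closedD)
      ultimately show ?thesis using insert.prems(2) unfolding FA_carrier
        by (meson finite_subset order_trans)
    qed
    have "P h" using insert.prems by (intro insert.IH[OF _ hc]) (auto simp: h_def)
    moreover have "u \<in> lists S" "f u \<noteq> \<zero>" using insert.prems(1) assms(1) unfolding FA_carrier by auto
    ultimately have "P (\<lambda>w. g u \<otimes> word_monom R u w \<oplus> h w)"
      using step[OF hc] insert.prems(2) by (simp add: FA_closedD)
    moreover have "(\<lambda>w. g u \<otimes> word_monom R u w \<oplus> h w) = g"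
      using insert.prems(2) by (auto simp: h_def word_monom_def FA_closedD)
    ultimately show ?case by simp
  qed
  show ?thesis
    by (rule main[OF _ order_refl assms(1) order_refl]) (use assms(1) in \<open>simp add: FA_carrier\<close>)
qed

end

section \<open>The words that do not vanish\<close>

locale nil_hecke_ring = braid_words I m d J + cring R
  for R :: "('a, 'c) ring_scheme" (structure) and I :: "'i set" and m d J +
  assumes one_not_zero: "\<one> \<noteq> \<zero>"
begin

abbreviation "F \<equiv> free_algebra R I"
abbreviation "Rel \<equiv> nil_hecke_relators R I m d J"
abbreviation "K \<equiv> Idl\<^bsub>F\<^esub> Rel"
abbreviation "NH \<equiv> nil_hecke R I m d J"
abbreviation "wm \<equiv> word_monom R"

sublocale F: ring F by (rule FA_ring)

lemma wm_closed: "wm u w \<in> carrier R" by (simp add: word_monom_def)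

lemma wm_carrier: "w \<in> lists I \<Longrightarrow> wm w \<in> carrier F" by (rule word_monom_closed)

lemma null_words_lists: "x \<in> null_words \<Longrightarrow> x \<in> lists I"
  unfolding null_words_def using alt_word_lists
  by (auto simp: braid_pairs_iff simp del: in_lists_conv_set)

lemma braid_pair_word_lists: "{a, b} \<in> J \<Longrightarrow> alt_word a b n \<in> lists I"
  using J_D alt_word_lists by metis

lemma Rel_eq:
  "Rel = wm ` null_words \<union> {wm (braid_word a b) \<ominus>\<^bsub>F\<^esub> wm (braid_word b a) | a b. {a, b} \<in> J}"
proof -
  have sym: "the_enat (m a b) = the_enat (m b a)" if "{a, b} \<in> J" for a b
    using that J_D m_sym by metis
  have "{wm (braid_word a b) \<ominus>\<^bsub>F\<^esub> wm (alt_word b a (the_enat (m a b))) | a b. {a, b} \<in> J}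
      = {wm (braid_word a b) \<ominus>\<^bsub>F\<^esub> wm (braid_word b a) | a b. {a, b} \<in> J}"
    by (rule Collect_cong) (metis sym)
  then show ?thesis unfolding nil_hecke_relators_def null_words_def by auto
qed

lemma Rel_carrier: "Rel \<subseteq> carrier F"
proof -
  have "wm (alt_word a b n) \<in> carrier F" "wm (alt_word b a n) \<in> carrier F" if "{a, b} \<in> J" for a b n
    using braid_pair_word_lists[of a b] braid_pair_word_lists[of b a] that wm_carrier
    by (simp_all add: insert_commute del: in_lists_conv_set)
  moreover have "wm x \<in> carrier F" if "x \<in> null_words" for x
    using null_words_lists[OF that] wm_carrier by blast
  ultimately show ?thesis unfolding Rel_eq by (auto intro!: F.minus_closed)
qed

sublocale K: ideal K F by (rule F.genideal_ideal[OF Rel_carrier])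

lemma Rel_K: "Rel \<subseteq> K" by (rule F.genideal_self[OF Rel_carrier])

lemma K_smult: "r \<in> carrier R \<Longrightarrow> f \<in> K \<Longrightarrow> (\<lambda>w. r \<otimes> f w) \<in> K"
proof -
  assume r: "r \<in> carrier R" and f: "f \<in> K"
  have e: "(\<lambda>w. r \<otimes> wm [] w) \<in> carrier F"
    by (rule FA_smult_closed[OF r wm_carrier]) simp
  have fc: "\<And>w. f w \<in> carrier R" using K.Icarr[OF f] FA_closedD by blast
  have "conv (\<lambda>w. r \<otimes> wm [] w) f = (\<lambda>w. r \<otimes> f w)"
    by (rule ext) (simp add: conv_smult_left wm_closed fc r conv_monom_left)
  moreover have "(\<lambda>w. r \<otimes> wm [] w) \<otimes>\<^bsub>F\<^esub> f \<in> K" by (rule K.I_l_closed[OF f e])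
  ultimately show ?thesis by (simp add: FA_simps)
qed

lemma wm_append: "wm u \<otimes>\<^bsub>F\<^esub> wm v = wm (u @ v)"
proof
  fix w
  have "conv (wm u) (wm v) w = (if take (length u) w = u then wm v (drop (length u) w) else \<zero>)"
    by (rule conv_monom_left) (rule wm_closed)
  then show "(wm u \<otimes>\<^bsub>F\<^esub> wm v) w = wm (u @ v) w"
    unfolding FA_simps by (simp add: word_monom_def) (metis append_eq_conv_conj)
qed

lemma wm_step_K:
  assumes "braid_step u v" "u \<in> lists I" shows "wm u \<ominus>\<^bsub>F\<^esub> wm v \<in> K"
proof -
  obtain p q a b where ab: "{a, b} \<in> J" and u: "u = p @ braid_word a b @ q" and v: "v = p @ braid_word b a @ q"
    using assms(1) unfolding braid_step_def by blast
  let ?x = "wm (braid_word a b)" and ?y = "wm (braid_word b a)"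
  have pq: "p \<in> lists I" "q \<in> lists I" using assms(2) u by auto
  have l: "braid_word a b \<in> lists I" "braid_word b a \<in> lists I"
    using ab braid_pair_word_lists[of a b] braid_pair_word_lists[of b a] by (simp_all add: insert_commute)
  note c = pq[THEN wm_carrier] l[THEN wm_carrier]
  have "?x \<ominus>\<^bsub>F\<^esub> ?y \<in> K" using Rel_K ab unfolding Rel_eq by blast
  then have "wm p \<otimes>\<^bsub>F\<^esub> (?x \<ominus>\<^bsub>F\<^esub> ?y) \<otimes>\<^bsub>F\<^esub> wm q \<in> K"
    using c by (simp add: K.I_l_closed K.I_r_closed)
  moreover have "wm p \<otimes>\<^bsub>F\<^esub> (?x \<ominus>\<^bsub>F\<^esub> ?y) \<otimes>\<^bsub>F\<^esub> wm q
      = wm p \<otimes>\<^bsub>F\<^esub> (?x \<otimes>\<^bsub>F\<^esub> wm q) \<ominus>\<^bsub>F\<^esub> wm p \<otimes>\<^bsub>F\<^esub> (?y \<otimes>\<^bsub>F\<^esub> wm q)"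
    using c by (simp add: F.minus_eq F.r_distr F.l_distr F.r_minus F.l_minus F.m_assoc)
  ultimately show ?thesis using pq l by (simp add: wm_append u v del: in_lists_conv_set)
qed

lemma wm_eq_K:
  assumes "u \<approx> v" "u \<in> lists I" shows "wm u \<ominus>\<^bsub>F\<^esub> wm v \<in> K"
  using assms
proof (induction rule: rtranclp_induct)
  case base
  then show ?case using K.zero_closed by (simp add: F.minus_eq F.r_neg wm_carrier del: in_lists_conv_set)
next
  case (step v w)
  have v: "v \<in> lists I" by (rule braid_eq_lists[OF step(1) step.prems])
  have w: "w \<in> lists I" by (rule braid_step_lists[OF step(2) v])
  note c = wm_carrier[OF step.prems] wm_carrier[OF v] wm_carrier[OF w]
  have "(wm u \<ominus>\<^bsub>F\<^esub> wm v) \<oplus>\<^bsub>F\<^esub> (wm v \<ominus>\<^bsub>F\<^esub> wm w) \<in> K"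
    using step.IH[OF step.prems] wm_step_K[OF step(2) v] by (rule K.a_closed)
  moreover have "(wm u \<ominus>\<^bsub>F\<^esub> wm v) \<oplus>\<^bsub>F\<^esub> (wm v \<ominus>\<^bsub>F\<^esub> wm w) = wm u \<ominus>\<^bsub>F\<^esub> wm w"
    using c by (simp add: F.minus_eq F.a_assoc F.r_neg1)
  ultimately show ?case by simp
qed

lemma dead_K:
  assumes "w \<in> lists I" "\<not> alive w" shows "wm w \<in> K"
proof -
  obtain p x q where eq: "w \<approx> p @ x @ q" and x: "x \<in> null_words"
    using assms unfolding alive_def by blast
  have l: "p @ x @ q \<in> lists I" by (rule braid_eq_lists[OF eq assms(1)])
  then have c: "wm p \<in> carrier F" "wm q \<in> carrier F" "wm x \<in> carrier F" "wm (p @ x @ q) \<in> carrier F"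
    by (simp_all add: wm_carrier)
  have "wm x \<in> K" using Rel_K x unfolding Rel_eq by blast
  then have "wm p \<otimes>\<^bsub>F\<^esub> (wm x \<otimes>\<^bsub>F\<^esub> wm q) \<in> K" using c by (simp add: K.I_l_closed K.I_r_closed)
  then have "wm (p @ x @ q) \<in> K" using l by (simp add: wm_append)
  with wm_eq_K[OF eq assms(1)] have "(wm w \<ominus>\<^bsub>F\<^esub> wm (p @ x @ q)) \<oplus>\<^bsub>F\<^esub> wm (p @ x @ q) \<in> K"
    by (rule K.a_closed)
  then show ?thesis using c wm_carrier[OF assms(1)] by (simp add: F.minus_eq F.a_assoc F.l_neg)
qed

text \<open>The sum of coefficients over such a set is a linear form that does not change under braid
  moves.\<close>

definition alive_closed :: "'i list set \<Rightarrow> bool" where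
  "alive_closed D \<longleftrightarrow> finite D \<and> (\<forall>u\<in>D. alive u \<and> (\<forall>v. u \<approx> v \<longrightarrow> v \<in> D))"

text \<open>The common kernel of the linear forms given by the sets \<open>alive_closed\<close>. It will
  turn out to be an ideal that contains the relations.\<close>

definition K0 :: "('i list \<Rightarrow> 'a) set" where
  "K0 = {f \<in> carrier F. \<forall>D. alive_closed D \<longrightarrow> (\<Oplus>w\<in>D. f w) = \<zero>}"

lemma K0_add: "f \<in> K0 \<Longrightarrow> g \<in> K0 \<Longrightarrow> (\<lambda>w. f w \<oplus> g w) \<in> K0"
  unfolding K0_def by (auto simp: FA_add_closed FA_closedD finsum_addf)

lemma finsum_combine:
  assumes "finite D" "\<And>w. f w \<in> carrier R" "\<And>w. g w \<in> carrier R" "r \<in> carrier R"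
  shows "(\<Oplus>w\<in>D. f w \<oplus> r \<otimes> g w) = (\<Oplus>w\<in>D. f w) \<oplus> r \<otimes> (\<Oplus>w\<in>D. g w)"
  using assms by (induction D rule: finite_induct) (simp_all add: r_distr a_ac)

lemma K0_smult:
  assumes "r \<in> carrier R" "f \<in> K0" shows "(\<lambda>w. r \<otimes> f w) \<in> K0"
  unfolding K0_def
proof (intro CollectI conjI allI impI)
  have f: "f \<in> carrier F" "\<And>D. alive_closed D \<Longrightarrow> (\<Oplus>w\<in>D. f w) = \<zero>"
    using assms(2) unfolding K0_def by auto
  show "(\<lambda>w. r \<otimes> f w) \<in> carrier F" by (rule FA_smult_closed[OF assms(1) f(1)])
  fix D assume D: "alive_closed D"
  then show "(\<Oplus>w\<in>D. r \<otimes> f w) = \<zero>"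
    using finsum_combine[of D "\<lambda>_. \<zero>" f r] f assms(1) FA_closedD[OF f(1)]
    by (simp add: alive_closed_def)
qed

lemma K0_zero: "(\<lambda>w. \<zero>) \<in> K0"
  unfolding K0_def using F.zero_closed by (auto simp: FA_simps)

lemma finsum_shift:
  assumes "finite D" "inj_on h D'" "h ` D' \<subseteq> D" "\<And>w. f w \<in> carrier R"
    and "\<And>w. w \<in> D - h ` D' \<Longrightarrow> f w = \<zero>"
  shows "(\<Oplus>w\<in>D. f w) = (\<Oplus>v\<in>D'. f (h v))"
proof -
  have "(\<Oplus>w\<in>D. f w) = (\<Oplus>w\<in>h ` D'. f w)"
    using assms by (intro add.finprod_mono_neutral_cong_right) auto
  also have "\<dots> = (\<Oplus>v\<in>D'. f (h v))"
    using assms by (intro finsum_reindex) auto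
  finally show ?thesis .
qed

text \<open>These sets correspond to multiplication by the word \<open>u\<close> on the left and on the
  right: the words in \<open>D\<close> that start with \<open>u\<close>, stripped of \<open>u\<close>,
  are again alive and closed under braid moves.\<close>

lemma alive_closed_vimage:
  assumes D: "alive_closed D"
  shows "alive_closed {v. u @ v \<in> D}" "alive_closed {v. v @ u \<in> D}"
proof -
  have "finite ((\<lambda>v. u @ v) -` D)" "finite ((\<lambda>v. v @ u) -` D)"
    using D unfolding alive_closed_def by (auto intro!: finite_vimageI simp: inj_def)
  then have fin: "finite {v. u @ v \<in> D}" "finite {v. v @ u \<in> D}" by (simp_all add: vimage_def)
  have D': "alive w" "w \<approx> w' \<Longrightarrow> w' \<in> D" if "w \<in> D" for w w' using D that unfolding alive_closed_def by blast+
  show "alive_closed {v. u @ v \<in> D}" unfolding alive_closed_def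
  proof (intro conjI ballI allI impI fin(1))
    fix v assume v: "v \<in> {v. u @ v \<in> D}"
    then show "alive v" using D'(1)[of "u @ v"] alive_factor[of u v "[]"] by simp
    fix w assume "v \<approx> w"
    then show "w \<in> {v. u @ v \<in> D}" using v D'(2)[OF _ braid_eq_prefix, of u v w] by simp
  qed
  show "alive_closed {v. v @ u \<in> D}" unfolding alive_closed_def
  proof (intro conjI ballI allI impI fin(2))
    fix v assume v: "v \<in> {v. v @ u \<in> D}"
    then show "alive v" using D'(1)[of "v @ u"] alive_factor[of "[]" v u] by simp
    fix w assume "v \<approx> w"
    then show "w \<in> {v. v @ u \<in> D}" using v D'(2)[OF _ braid_eq_suffix, of v u w] by simp
  qed
qed

text \<open>The coefficients of a product with the word \<open>u\<close>, summed over \<open>D\<close>,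
  are the coefficients of \<open>g\<close>, summed over the stripped set of the preceding lemma.\<close>

lemma K0_wm:
  assumes "g \<in> K0" "u \<in> lists I"
  shows "conv (wm u) g \<in> K0" "conv g (wm u) \<in> K0"
proof -
  have g: "g \<in> carrier F" "\<And>D. alive_closed D \<Longrightarrow> (\<Oplus>w\<in>D. g w) = \<zero>"
    using assms(1) unfolding K0_def by auto
  have gc: "\<And>w. g w \<in> carrier R" using g(1) FA_closedD by blast
  show "conv (wm u) g \<in> K0" unfolding K0_def
  proof (intro CollectI conjI allI impI)
    show "conv (wm u) g \<in> carrier F" by (rule FA_mult_closed[OF wm_carrier[OF assms(2)] g(1)])
    fix D assume D: "alive_closed D"
    have "(\<Oplus>w\<in>D. conv (wm u) g w) = (\<Oplus>v\<in>{v. u @ v \<in> D}. conv (wm u) g (u @ v))"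
    proof (rule finsum_shift)
      fix w assume w: "w \<in> D - (@) u ` {v. u @ v \<in> D}"
      have "take (length u) w \<noteq> u"
      proof
        assume "take (length u) w = u"
        then have "u @ drop (length u) w = w" by (metis append_take_drop_id)
        then have "drop (length u) w \<in> {v. u @ v \<in> D}" "w = u @ drop (length u) w" using w by simp_all
        then have "w \<in> (@) u ` {v. u @ v \<in> D}" by (rule rev_image_eqI)
        then show False using w by simp
      qed
      then show "conv (wm u) g w = \<zero>" by (simp add: conv_monom_left gc)
    qed (use D in \<open>simp_all add: alive_closed_def gc wm_closed inj_on_def image_subset_iff\<close>)
    also have "\<dots> = (\<Oplus>v\<in>{v. u @ v \<in> D}. g v)" by (simp add: conv_monom_left gc)
    also have "\<dots> = \<zero>" using g(2) alive_closed_vimage(1)[OF D] by blast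
    finally show "(\<Oplus>w\<in>D. conv (wm u) g w) = \<zero>" .
  qed
  show "conv g (wm u) \<in> K0" unfolding K0_def
  proof (intro CollectI conjI allI impI)
    show "conv g (wm u) \<in> carrier F" by (rule FA_mult_closed[OF g(1) wm_carrier[OF assms(2)]])
    fix D assume D: "alive_closed D"
    have "(\<Oplus>w\<in>D. conv g (wm u) w) = (\<Oplus>v\<in>{v. v @ u \<in> D}. conv g (wm u) (v @ u))"
    proof (rule finsum_shift)
      fix w assume w: "w \<in> D - (\<lambda>v. v @ u) ` {v. v @ u \<in> D}"
      have "drop (length w - length u) w \<noteq> u"
      proof
        assume "drop (length w - length u) w = u"
        then have "take (length w - length u) w @ u = w" by (metis append_take_drop_id)
        then have "take (length w - length u) w \<in> {v. v @ u \<in> D}" "w = take (length w - length u) w @ u"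
          using w by simp_all
        then have "w \<in> (\<lambda>v. v @ u) ` {v. v @ u \<in> D}" by (rule rev_image_eqI)
        then show False using w by simp
      qed
      then show "conv g (wm u) w = \<zero>" by (simp add: conv_monom_right gc)
    qed (use D in \<open>simp_all add: alive_closed_def gc wm_closed inj_on_def image_subset_iff\<close>)
    also have "\<dots> = (\<Oplus>v\<in>{v. v @ u \<in> D}. g v)" by (simp add: conv_monom_right gc)
    also have "\<dots> = \<zero>" using g(2) alive_closed_vimage(2)[OF D] by blast
    finally show "(\<Oplus>w\<in>D. conv g (wm u) w) = \<zero>" .
  qed
qed

lemma K0_ideal: "ideal K0 F"
proof (rule idealI)
  show "ring F" by (rule F.ring_axioms)
  show "subgroup K0 (add_monoid F)"
  proof (rule F.add.subgroupI)
    show "K0 \<subseteq> carrier F" by (auto simp: K0_def)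
    show "K0 \<noteq> {}" using K0_zero by blast
  next
    fix f assume f: "f \<in> K0"
    then have fc: "f \<in> carrier F" by (simp add: K0_def)
    have "(\<lambda>w. \<ominus> \<one> \<otimes> f w) \<in> K0" by (rule K0_smult[OF _ f]) simp
    moreover have "(\<lambda>w. \<ominus> \<one> \<otimes> f w) = \<ominus>\<^bsub>F\<^esub> f"
      using fc by (auto simp: FA_uminus FA_closedD l_minus)
    ultimately show "\<ominus>\<^bsub>F\<^esub> f \<in> K0" by simp
  next
    fix f g assume "f \<in> K0" "g \<in> K0"
    then show "f \<oplus>\<^bsub>F\<^esub> g \<in> K0" using K0_add by (simp add: FA_simps)
  qed
next
  fix g f assume g: "g \<in> K0" and f: "f \<in> carrier F"
  have gc: "\<And>w. g w \<in> carrier R" using g FA_closedD unfolding K0_def by blast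
  show "f \<otimes>\<^bsub>F\<^esub> g \<in> K0" using f unfolding FA_simps
  proof (induction rule: FA_induct)
    case zero
    have "conv (\<lambda>w. \<zero>) g = (\<lambda>w. \<zero>)" by (rule ext) (simp add: conv_zero_left gc)
    then show ?case using K0_zero by simp
  next
    case (add h r u)
    have hc: "\<And>w. h w \<in> carrier R" and r: "r \<in> carrier R" using add FA_closedD by blast+
    have "conv (\<lambda>w. r \<otimes> wm u w \<oplus> h w) g = (\<lambda>w. r \<otimes> conv (wm u) g w \<oplus> conv h g w)"
      by (rule ext) (simp only: conv_add_left[OF m_closed[OF r wm_closed] hc gc] conv_smult_left[OF wm_closed gc r])
    then show ?case using add g by (simp add: K0_add K0_smult K0_wm del: in_lists_conv_set)
  qed
  show "g \<otimes>\<^bsub>F\<^esub> f \<in> K0" using f unfolding FA_simps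
  proof (induction rule: FA_induct)
    case zero
    have "conv g (\<lambda>w. \<zero>) = (\<lambda>w. \<zero>)" by (rule ext) (simp add: conv_zero_right gc)
    then show ?case using K0_zero by simp
  next
    case (add h r u)
    have hc: "\<And>w. h w \<in> carrier R" and r: "r \<in> carrier R" using add FA_closedD by blast+
    have "conv g (\<lambda>w. r \<otimes> wm u w \<oplus> h w) = (\<lambda>w. r \<otimes> conv g (wm u) w \<oplus> conv g h w)"
      by (rule ext) (simp only: conv_add_right[OF gc m_closed[OF r wm_closed] hc] conv_smult_right[OF gc wm_closed r])
    then show ?case using add g by (simp add: K0_add K0_smult K0_wm del: in_lists_conv_set)
  qed
qed

lemma finsum_wm: "finite D \<Longrightarrow> (\<Oplus>w\<in>D. wm u w) = (if u \<in> D then \<one> else \<zero>)"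
proof -
  assume fin: "finite D"
  show ?thesis
  proof (cases "u \<in> D")
    case True
    have "(\<Oplus>w\<in>D. wm u w) = (\<Oplus>w\<in>D. if u = w then \<one> else \<zero>)"
      by (intro finsum_cong') (auto simp: word_monom_def)
    also have "\<dots> = \<one>" using finsum_singleton[OF True fin, of "\<lambda>_. \<one>"] by simp
    finally show ?thesis using True by simp
  next
    case False
    then have "(\<Oplus>w\<in>D. wm u w) = (\<Oplus>w\<in>D. \<zero>)"
      by (intro finsum_cong') (auto simp: word_monom_def)
    then show ?thesis using False by simp
  qed
qed

text \<open>A null word is in no set \<open>D\<close>, and of the two sides of a kept braid relation
  \<open>D\<close> contains both or none.\<close>

lemma Rel_K0: "Rel \<subseteq> K0"
proof
  fix f assume f: "f \<in> Rel"
  then have fc: "f \<in> carrier F" using Rel_carrier by blast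
  show "f \<in> K0" unfolding K0_def
  proof (intro CollectI conjI allI impI fc)
    fix D assume D: "alive_closed D"
    then have fin: "finite D" by (simp add: alive_closed_def)
    consider (null) x where "x \<in> null_words" "f = wm x"
      | (braid) a b where "{a, b} \<in> J" "f = wm (braid_word a b) \<ominus>\<^bsub>F\<^esub> wm (braid_word b a)"
      using f unfolding Rel_eq by blast
    then show "(\<Oplus>w\<in>D. f w) = \<zero>"
    proof cases
      case null
      have "x \<notin> D" using D null(1) alive_null[of "[]" x "[]"] unfolding alive_closed_def by auto
      then show ?thesis using null fin by (simp add: finsum_wm)
    next
      case braid
      let ?x = "braid_word a b" and ?y = "braid_word b a"
      have "?x \<approx> ?y" using braid_eq_swap[OF braid(1), of "[]" "[]"] by simp
      then have iff: "?x \<in> D \<longleftrightarrow> ?y \<in> D" using D braid_eq_sym unfolding alive_closed_def by blast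
      have l: "?x \<in> lists I" "?y \<in> lists I"
        using braid(1) braid_pair_word_lists[of a b] braid_pair_word_lists[of b a] by (simp_all add: insert_commute)
      have "f = (\<lambda>w. wm ?x w \<oplus> \<ominus> \<one> \<otimes> wm ?y w)"
        unfolding braid(2) FA_minus[OF wm_carrier[OF l(1)] wm_carrier[OF l(2)]]
        by (simp add: a_minus_def l_minus wm_closed)
      then have "(\<Oplus>w\<in>D. f w) = (\<Oplus>w\<in>D. wm ?x w) \<oplus> \<ominus> \<one> \<otimes> (\<Oplus>w\<in>D. wm ?y w)"
        by (simp only: finsum_combine[OF fin wm_closed wm_closed a_inv_closed[OF one_closed]])
      also have "\<dots> = \<zero>" using fin iff by (simp add: finsum_wm r_neg)
      finally show ?thesis .
    qed
  qed
qed

lemma K_sub_K0: "K \<subseteq> K0"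
  by (rule F.genideal_minimal[OF K0_ideal Rel_K0])

lemma K_finsum: "f \<in> K \<Longrightarrow> alive_closed D \<Longrightarrow> (\<Oplus>w\<in>D. f w) = \<zero>"
  using K_sub_K0 unfolding K0_def by blast

lemma alive_class:
  assumes "alive w" shows "alive_closed {v. w \<approx> v}"
proof -
  have "{v. w \<approx> v} \<subseteq> {v. set v \<subseteq> I \<and> length v = length w}"
    using braid_eq_lists[OF _ alive_lists[OF assms]] braid_eq_length by (fastforce simp: lists_eq_set)
  then have "finite {v. w \<approx> v}" using finite_lists_length_eq[OF finite_I] finite_subset by blast
  then show ?thesis unfolding alive_closed_def using assms alive_cong by (auto intro: rtranclp_trans)
qed

text \<open>For an alive word, the sum of coefficients over its braid class is one at the word itself,
  and zero on all relations.\<close>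

lemma wm_K_iff: "w \<in> lists I \<Longrightarrow> wm w \<in> K \<longleftrightarrow> \<not> alive w"
proof
  assume "wm w \<in> K"
  show "\<not> alive w"
  proof
    assume "alive w"
    from K_finsum[OF \<open>wm w \<in> K\<close> alive_class[OF this]] alive_class[OF this] show False
      using one_not_zero by (simp add: finsum_wm alive_closed_def)
  qed
qed (rule dead_K)

end

section \<open>Word length in the quotient\<close>

context nil_hecke_ring begin

definition cl :: "('i list \<Rightarrow> 'a) \<Rightarrow> ('i list \<Rightarrow> 'a) set" where
  "cl f = K +>\<^bsub>F\<^esub> f"

abbreviation "Q \<equiv> F Quot K"

sublocale Q: ring Q by (rule K.quotient_is_ring)

lemma NH_eqs:
  "carrier NH = carrier Q" "\<zero>\<^bsub>NH\<^esub> = \<zero>\<^bsub>Q\<^esub>" "\<one>\<^bsub>NH\<^esub> = \<one>\<^bsub>Q\<^esub>"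
  "x \<oplus>\<^bsub>NH\<^esub> y = x \<oplus>\<^bsub>Q\<^esub> y" "x \<otimes>\<^bsub>NH\<^esub> y = x \<otimes>\<^bsub>Q\<^esub> y"
  by (simp_all add: nil_hecke_def quot_algebra_def)

lemma NH_ring: "ring NH"
proof (rule ringI)
  show "abelian_group NH"
  proof (rule abelian_groupI)
    fix x assume "x \<in> carrier NH"
    then show "\<exists>y\<in>carrier NH. y \<oplus>\<^bsub>NH\<^esub> x = \<zero>\<^bsub>NH\<^esub>"
      unfolding NH_eqs by (intro bexI[of _ "\<ominus>\<^bsub>Q\<^esub> x"]) (simp_all add: Q.l_neg)
  qed (unfold NH_eqs, simp_all add: Q.a_ac)
  show "Group.monoid NH"
    by (rule monoidI) (unfold NH_eqs, simp_all add: Q.m_assoc)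
qed (unfold NH_eqs, simp_all add: Q.l_distr Q.r_distr)

sublocale NH: ring NH by (rule NH_ring)

lemma cl_hom: "ring_hom_ring F Q cl"
proof -
  have "cl = (+>\<^bsub>F\<^esub>) K" by (rule ext) (simp add: cl_def)
  then show ?thesis using K.rcos_ring_hom_ring by simp
qed

lemma cl_closed: "f \<in> carrier F \<Longrightarrow> cl f \<in> carrier NH"
  unfolding NH_eqs by (rule ring_hom_closed[OF ring_hom_ring.homh[OF cl_hom]])

lemma cl_add: "f \<in> carrier F \<Longrightarrow> g \<in> carrier F \<Longrightarrow> cl (\<lambda>w. f w \<oplus> g w) = cl f \<oplus>\<^bsub>NH\<^esub> cl g"
  unfolding NH_eqs using ring_hom_ring.homh[OF cl_hom] ring_hom_add[of cl F Q f g]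
  by (simp add: FA_simps)

lemma cl_mult: "f \<in> carrier F \<Longrightarrow> g \<in> carrier F \<Longrightarrow> cl (conv f g) = cl f \<otimes>\<^bsub>NH\<^esub> cl g"
  unfolding NH_eqs using ring_hom_ring.homh[OF cl_hom] ring_hom_mult[of cl F Q f g]
  by (simp add: FA_simps)

lemma cl_one: "cl (wm []) = \<one>\<^bsub>NH\<^esub>"
proof -
  have "wm [] = \<one>\<^bsub>F\<^esub>" by (simp add: FA_simps word_monom_def)
  then show ?thesis unfolding NH_eqs using ring_hom_ring.homh[OF cl_hom] ring_hom_one[of cl F Q] by simp
qed

lemma NH_zero: "\<zero>\<^bsub>NH\<^esub> = K"
  unfolding NH_eqs by (simp add: FactRing_def)

lemma cl_eq_zero_iff: "f \<in> carrier F \<Longrightarrow> cl f = \<zero>\<^bsub>NH\<^esub> \<longleftrightarrow> f \<in> K"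
  unfolding NH_zero cl_def using K.a_rcos_const K.a_rcos_self by metis

lemma cl_eq_iff:
  assumes "f \<in> carrier F" "g \<in> carrier F" shows "cl f = cl g \<longleftrightarrow> f \<ominus>\<^bsub>F\<^esub> g \<in> K"
proof -
  interpret h: ring_hom_ring F Q cl by (rule cl_hom)
  have "cl (f \<ominus>\<^bsub>F\<^esub> g) = cl f \<ominus>\<^bsub>Q\<^esub> cl g" using assms by (simp add: F.minus_eq Q.minus_eq)
  then have "f \<ominus>\<^bsub>F\<^esub> g \<in> K \<longleftrightarrow> cl f \<ominus>\<^bsub>Q\<^esub> cl g = \<zero>\<^bsub>Q\<^esub>"
    using cl_eq_zero_iff[of "f \<ominus>\<^bsub>F\<^esub> g"] assms unfolding NH_eqs by simp
  moreover have "x \<ominus>\<^bsub>Q\<^esub> y = \<zero>\<^bsub>Q\<^esub> \<longleftrightarrow> x = y" if "x \<in> carrier Q" "y \<in> carrier Q" for x y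
  proof
    assume "x \<ominus>\<^bsub>Q\<^esub> y = \<zero>\<^bsub>Q\<^esub>"
    then have "(x \<ominus>\<^bsub>Q\<^esub> y) \<oplus>\<^bsub>Q\<^esub> y = y" using that by simp
    then show "x = y" using that by (simp add: Q.minus_eq Q.a_assoc Q.l_neg)
  qed (use that in \<open>simp add: Q.minus_eq Q.r_neg\<close>)
  ultimately show ?thesis using assms by simp
qed

lemma NH_carrier: "x \<in> carrier NH \<longleftrightarrow> (\<exists>f\<in>carrier F. x = cl f)"
  unfolding NH_eqs by (simp add: FactRing_def A_RCOSETS_defs cl_def a_r_coset_def[symmetric]) 

lemma cl_smult:
  assumes "r \<in> carrier R" "f \<in> carrier F" shows "r \<odot>\<^bsub>NH\<^esub> cl f = cl (\<lambda>w. r \<otimes> f w)"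
proof -
  have "cl (\<lambda>w. r \<otimes> g w) = cl (\<lambda>w. r \<otimes> f w)" if "g \<in> cl f" for g
  proof -
    have gc: "g \<in> carrier F" using that assms(2) unfolding cl_def
      by (meson F.a_r_coset_subset_G K.a_subset subsetD)
    then have "g \<ominus>\<^bsub>F\<^esub> f \<in> K" using K.a_rcos_module[OF assms(2) gc] that unfolding cl_def F.minus_eq by simp
    then have "(\<lambda>w. r \<otimes> (g \<ominus>\<^bsub>F\<^esub> f) w) \<in> K" by (rule K_smult[OF assms(1)])
    moreover have "(\<lambda>w. r \<otimes> (g \<ominus>\<^bsub>F\<^esub> f) w) = (\<lambda>w. r \<otimes> g w) \<ominus>\<^bsub>F\<^esub> (\<lambda>w. r \<otimes> f w)"
      unfolding FA_minus[OF gc assms(2)]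
        FA_minus[OF FA_smult_closed[OF assms(1) gc] FA_smult_closed[OF assms]]
      using assms(1) FA_closedD[OF gc] FA_closedD[OF assms(2)]
      by (simp add: a_minus_def r_distr r_minus)
    ultimately show ?thesis
      using cl_eq_iff[OF FA_smult_closed[OF assms(1) gc] FA_smult_closed[OF assms]] by simp
  qed
  moreover have "f \<in> cl f" unfolding cl_def by (rule K.a_rcos_self[OF assms(2)])
  ultimately have "(\<Union>g\<in>cl f. cl (\<lambda>w. r \<otimes> g w)) = cl (\<lambda>w. r \<otimes> f w)" by blast
  then show ?thesis unfolding nil_hecke_def quot_algebra_def
    by (simp add: cl_def FA_simps)
qed

lemma cl_zero: "cl (\<lambda>w. \<zero>) = \<zero>\<^bsub>NH\<^esub>"
proof -
  have "(\<lambda>w. \<zero>) = \<zero>\<^bsub>F\<^esub>" by (simp add: FA_simps)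
  then show ?thesis using cl_eq_zero_iff[OF F.zero_closed] K.zero_closed by simp
qed

lemma cl_dead: "w \<in> lists I \<Longrightarrow> \<not> alive w \<Longrightarrow> cl (wm w) = \<zero>\<^bsub>NH\<^esub>"
  using cl_eq_zero_iff[OF wm_carrier] wm_K_iff by blast

lemma smult_closed: "r \<in> carrier R \<Longrightarrow> x \<in> carrier NH \<Longrightarrow> r \<odot>\<^bsub>NH\<^esub> x \<in> carrier NH"
  unfolding NH_carrier using cl_smult FA_smult_closed by metis

lemma smult_distr:
  assumes "r \<in> carrier R" "s \<in> carrier R" "x \<in> carrier NH"
  shows "(r \<oplus> s) \<odot>\<^bsub>NH\<^esub> x = r \<odot>\<^bsub>NH\<^esub> x \<oplus>\<^bsub>NH\<^esub> s \<odot>\<^bsub>NH\<^esub> x"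
proof -
  obtain f where f: "f \<in> carrier F" "x = cl f" using assms(3) NH_carrier by blast
  have "(\<lambda>w. (r \<oplus> s) \<otimes> f w) = (\<lambda>w. r \<otimes> f w \<oplus> s \<otimes> f w)"
    using assms FA_closedD[OF f(1)] by (simp add: l_distr)
  then show ?thesis using assms f
    by (simp add: cl_smult cl_add[symmetric] FA_smult_closed)
qed

lemma smult_zero: "x \<in> carrier NH \<Longrightarrow> \<zero> \<odot>\<^bsub>NH\<^esub> x = \<zero>\<^bsub>NH\<^esub>"
proof -
  assume "x \<in> carrier NH"
  then obtain f where f: "f \<in> carrier F" "x = cl f" using NH_carrier by blast
  then show ?thesis using FA_closedD[OF f(1)] by (simp add: cl_smult cl_zero)
qed

text \<open>A class may have several representatives; membership only asks for one whose words have
  lengths satisfying \<open>P\<close>. As the relations are homogeneous, this nevertheless detects the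
  length of an alive word.\<close>

definition supp_in :: "(nat \<Rightarrow> bool) \<Rightarrow> ('i list \<Rightarrow> 'a) set set" where
  "supp_in P = {cl g | g. g \<in> carrier F \<and> (\<forall>w. g w \<noteq> \<zero> \<longrightarrow> P (length w))}"

lemma supp_inI: "g \<in> carrier F \<Longrightarrow> (\<And>w. g w \<noteq> \<zero> \<Longrightarrow> P (length w)) \<Longrightarrow> cl g \<in> supp_in P"
  unfolding supp_in_def by blast

lemma supp_in_wm: "w \<in> lists I \<Longrightarrow> P (length w) \<Longrightarrow> cl (wm w) \<in> supp_in P"
  by (rule supp_inI[OF wm_carrier]) (auto simp: word_monom_def split: if_splits)

lemma supp_in_carrier: "supp_in P \<subseteq> carrier NH"
  unfolding supp_in_def using cl_closed by blast

lemma supp_in_zero: "\<zero>\<^bsub>NH\<^esub> \<in> supp_in P"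
proof -
  have "(\<lambda>w. \<zero>) \<in> carrier F" using F.zero_closed by (simp add: FA_simps)
  then show ?thesis using supp_inI[of "\<lambda>w. \<zero>" P] cl_zero by simp
qed

lemma supp_in_add:
  assumes "x \<in> supp_in P" "y \<in> supp_in P" shows "x \<oplus>\<^bsub>NH\<^esub> y \<in> supp_in P"
proof -
  obtain f g where f: "f \<in> carrier F" "x = cl f" "\<And>w. f w \<noteq> \<zero> \<Longrightarrow> P (length w)"
    and g: "g \<in> carrier F" "y = cl g" "\<And>w. g w \<noteq> \<zero> \<Longrightarrow> P (length w)"
    using assms unfolding supp_in_def by blast
  have "cl (\<lambda>w. f w \<oplus> g w) \<in> supp_in P"
  proof (rule supp_inI[OF FA_add_closed[OF f(1) g(1)]])
    fix w assume "f w \<oplus> g w \<noteq> \<zero>"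
    then have "f w \<noteq> \<zero> \<or> g w \<noteq> \<zero>" by auto
    then show "P (length w)" using f(3) g(3) by blast
  qed
  then show ?thesis using f g by (simp add: cl_add)
qed

lemma supp_in_smult:
  assumes "x \<in> supp_in P" "r \<in> carrier R" shows "r \<odot>\<^bsub>NH\<^esub> x \<in> supp_in P"
proof -
  obtain f where f: "f \<in> carrier F" "x = cl f" "\<And>w. f w \<noteq> \<zero> \<Longrightarrow> P (length w)"
    using assms unfolding supp_in_def by blast
  have "cl (\<lambda>w. r \<otimes> f w) \<in> supp_in P"
  proof (rule supp_inI[OF FA_smult_closed[OF assms(2) f(1)]])
    fix w assume "r \<otimes> f w \<noteq> \<zero>"
    then have "f w \<noteq> \<zero>" using assms(2) by auto
    then show "P (length w)" using f(3) by blast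
  qed
  then show ?thesis using f assms by (simp add: cl_smult)
qed

lemma supp_in_mult:
  assumes "x \<in> supp_in P" "y \<in> supp_in P'" "\<And>a b. P a \<Longrightarrow> P' b \<Longrightarrow> P'' (a + b)"
  shows "x \<otimes>\<^bsub>NH\<^esub> y \<in> supp_in P''"
proof -
  obtain f g where f: "f \<in> carrier F" "x = cl f" "\<And>w. f w \<noteq> \<zero> \<Longrightarrow> P (length w)"
    and g: "g \<in> carrier F" "y = cl g" "\<And>w. g w \<noteq> \<zero> \<Longrightarrow> P' (length w)"
    using assms(1,2) unfolding supp_in_def by blast
  have "cl (conv f g) \<in> supp_in P''"
  proof (rule supp_inI[OF FA_mult_closed[OF f(1) g(1)]])
    fix w assume "conv f g w \<noteq> \<zero>"
    then have "\<exists>u v. w = u @ v \<and> f u \<noteq> \<zero> \<and> g v \<noteq> \<zero>"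
      by (rule conv_nonzero) (simp_all add: FA_closedD[OF f(1)] FA_closedD[OF g(1)])
    then obtain u v where "w = u @ v" "f u \<noteq> \<zero>" "g v \<noteq> \<zero>" by (elim exE conjE)
    then show "P'' (length w)" using assms(3)[OF f(3)[of u] g(3)[of v]] by simp
  qed
  then show ?thesis using f g by (simp add: cl_mult)
qed

lemma supp_in_finsum:
  assumes "finite S" "S \<subseteq> supp_in P" "c \<in> S \<rightarrow> carrier R"
  shows "(\<Oplus>\<^bsub>NH\<^esub>s\<in>S. c s \<odot>\<^bsub>NH\<^esub> s) \<in> supp_in P"
  using assms
proof (induction S rule: finite_induct)
  case (insert s S)
  have sup: "t \<in> supp_in P" if "t \<in> insert s S" for t using that insert.prems(1) by (rule rev_subsetD)
  have c: "t \<in> carrier NH" "c t \<in> carrier R" if "t \<in> insert s S" for t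
    using subsetD[OF supp_in_carrier sup[OF that]] funcset_mem[OF insert.prems(2) that] by simp_all
  have s: "c s \<odot>\<^bsub>NH\<^esub> s \<in> supp_in P" by (rule supp_in_smult) (simp_all add: c sup)
  have "(\<lambda>t. c t \<odot>\<^bsub>NH\<^esub> t) \<in> S \<rightarrow> carrier NH"
    by (intro funcsetI smult_closed) (simp_all add: c)
  then have "(\<Oplus>\<^bsub>NH\<^esub>t\<in>insert s S. c t \<odot>\<^bsub>NH\<^esub> t) = c s \<odot>\<^bsub>NH\<^esub> s \<oplus>\<^bsub>NH\<^esub> (\<Oplus>\<^bsub>NH\<^esub>t\<in>S. c t \<odot>\<^bsub>NH\<^esub> t)"
    by (intro NH.finsum_insert insert smult_closed) (simp_all add: c)
  moreover have "(\<Oplus>\<^bsub>NH\<^esub>t\<in>S. c t \<odot>\<^bsub>NH\<^esub> t) \<in> supp_in P"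
    using insert.IH insert.prems by simp
  ultimately show ?case using s by (simp add: supp_in_add)
qed (simp add: supp_in_zero)

text \<open>The braid class of \<open>w\<close> consists of words of the same length, and the sum of
  coefficients over it vanishes on every combination of words of other lengths.\<close>

lemma alive_not_supp_in:
  assumes "alive w" "cl (wm w) \<in> supp_in P" shows "P (length w)"
proof (rule ccontr)
  assume nP: "\<not> P (length w)"
  have wl: "w \<in> lists I" by (rule alive_lists[OF assms(1)])
  obtain g where g: "g \<in> carrier F" "cl (wm w) = cl g" "\<And>v. g v \<noteq> \<zero> \<Longrightarrow> P (length v)"
    using assms(2) unfolding supp_in_def by blast
  have gc: "\<And>v. g v \<in> carrier R" using g(1) FA_closedD by blast
  let ?D = "{v. w \<approx> v}"
  have D: "alive_closed ?D" by (rule alive_class[OF assms(1)])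
  then have fin: "finite ?D" by (simp add: alive_closed_def)
  have "wm w \<ominus>\<^bsub>F\<^esub> g \<in> K" using cl_eq_iff[OF wm_carrier[OF wl] g(1)] g(2) by blast
  then have "(\<lambda>v. wm w v \<oplus> \<ominus> \<one> \<otimes> g v) \<in> K"
    using FA_minus[OF wm_carrier[OF wl] g(1)] gc by (simp add: a_minus_def l_minus)
  then have "(\<Oplus>v\<in>?D. wm w v \<oplus> \<ominus> \<one> \<otimes> g v) = \<zero>" using K_finsum D by blast
  then have "(\<Oplus>v\<in>?D. wm w v) \<oplus> \<ominus> \<one> \<otimes> (\<Oplus>v\<in>?D. g v) = \<zero>"
    by (simp only: finsum_combine[OF fin wm_closed gc a_inv_closed[OF one_closed]])
  moreover have "(\<Oplus>v\<in>?D. g v) = (\<Oplus>v\<in>?D. \<zero>)"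
  proof (rule finsum_cong')
    fix v assume "v \<in> ?D"
    then have "length v = length w" using braid_eq_length[of w v] by simp
    then show "g v = \<zero>" using g(3)[of v] nP by auto
  qed auto
  ultimately show False using fin one_not_zero by (simp add: finsum_wm)
qed

end

section \<open>Finite generation, nilpotency and locality\<close>

context nil_hecke_ring begin

text \<open>Finitely many generators only involve words up to some length, and scalars do not make them
  longer.\<close>

lemma fin_gen_imp_bounded:
  assumes "fin_gen_module R NH" shows bounded_words
proof -
  obtain S where S: "finite S" "S \<subseteq> carrier NH"
    and gen: "\<forall>x\<in>carrier NH. \<exists>c\<in>S \<rightarrow> carrier R. x = (\<Oplus>\<^bsub>NH\<^esub>s\<in>S. c s \<odot>\<^bsub>NH\<^esub> s)"
    using assms unfolding fin_gen_module_def by blast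
  have "\<exists>N. s \<in> supp_in (\<lambda>n. n \<le> N)" if s: "s \<in> S" for s
  proof -
    obtain f where f: "f \<in> carrier F" "s = cl f" using NH_carrier S(2) s by blast
    have fin: "finite (length ` {w. f w \<noteq> \<zero>})" using f(1) by (simp add: FA_carrier)
    have "cl f \<in> supp_in (\<lambda>n. n \<le> Max (length ` {w. f w \<noteq> \<zero>}))"
      by (rule supp_inI[OF f(1)]) (simp add: fin)
    then show ?thesis using f(2) by blast
  qed
  then obtain N where N: "\<And>s. s \<in> S \<Longrightarrow> s \<in> supp_in (\<lambda>n. n \<le> N s)" by metis
  define M where "M = Max (N ` S)"
  have SM: "S \<subseteq> supp_in (\<lambda>n. n \<le> M)"
  proof
    fix s assume s: "s \<in> S"
    have "N s \<le> M" unfolding M_def using s S(1) by simp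
    then show "s \<in> supp_in (\<lambda>n. n \<le> M)" using N[OF s] unfolding supp_in_def by fastforce
  qed
  have "length w \<le> M" if w: "alive w" for w
  proof -
    have "cl (wm w) \<in> carrier NH" by (rule cl_closed[OF wm_carrier[OF alive_lists[OF w]]])
    then obtain c where "c \<in> S \<rightarrow> carrier R" "cl (wm w) = (\<Oplus>\<^bsub>NH\<^esub>s\<in>S. c s \<odot>\<^bsub>NH\<^esub> s)"
      using gen by blast
    then have "cl (wm w) \<in> supp_in (\<lambda>n. n \<le> M)" using supp_in_finsum[OF S(1) SM] by simp
    then show ?thesis by (rule alive_not_supp_in[OF w])
  qed
  then show ?thesis unfolding bounded_words_def by blast
qed

definition span :: "('i list \<Rightarrow> 'a) set set \<Rightarrow> ('i list \<Rightarrow> 'a) set set" where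
  "span S = {\<Oplus>\<^bsub>NH\<^esub>s\<in>S. c s \<odot>\<^bsub>NH\<^esub> s | c. c \<in> S \<rightarrow> carrier R}"

lemma span_add:
  assumes "S \<subseteq> carrier NH" "x \<in> span S" "y \<in> span S" shows "x \<oplus>\<^bsub>NH\<^esub> y \<in> span S"
proof -
  obtain a b where ab: "a \<in> S \<rightarrow> carrier R" "b \<in> S \<rightarrow> carrier R"
    "x = (\<Oplus>\<^bsub>NH\<^esub>s\<in>S. a s \<odot>\<^bsub>NH\<^esub> s)" "y = (\<Oplus>\<^bsub>NH\<^esub>s\<in>S. b s \<odot>\<^bsub>NH\<^esub> s)"
    using assms(2,3) unfolding span_def by auto
  have c: "a s \<in> carrier R" "b s \<in> carrier R" "s \<in> carrier NH" if "s \<in> S" for s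
    using ab(1,2) that assms(1) by (auto simp: Pi_def)
  have "x \<oplus>\<^bsub>NH\<^esub> y = (\<Oplus>\<^bsub>NH\<^esub>s\<in>S. a s \<odot>\<^bsub>NH\<^esub> s \<oplus>\<^bsub>NH\<^esub> b s \<odot>\<^bsub>NH\<^esub> s)"
    unfolding ab(3,4) by (rule NH.finsum_addf[symmetric]) (simp_all add: smult_closed c)
  also have "\<dots> = (\<Oplus>\<^bsub>NH\<^esub>s\<in>S. (a s \<oplus> b s) \<odot>\<^bsub>NH\<^esub> s)"
    by (rule NH.finsum_cong') (simp_all add: smult_distr c smult_closed)
  finally show ?thesis using c unfolding span_def by (intro CollectI exI[of _ "\<lambda>s. a s \<oplus> b s"]) auto
qed

lemma span_smult:
  assumes "finite S" "S \<subseteq> carrier NH" "t \<in> S" "r \<in> carrier R"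
  shows "r \<odot>\<^bsub>NH\<^esub> t \<in> span S"
proof -
  have c: "s \<in> carrier NH" if "s \<in> S" for s using assms(2) that by blast
  have "(\<Oplus>\<^bsub>NH\<^esub>s\<in>S. (if t = s then r else \<zero>) \<odot>\<^bsub>NH\<^esub> s)
      = (\<Oplus>\<^bsub>NH\<^esub>s\<in>S. if t = s then r \<odot>\<^bsub>NH\<^esub> s else \<zero>\<^bsub>NH\<^esub>)"
    by (rule NH.finsum_cong') (simp_all add: smult_zero c assms(4) smult_closed)
  also have "\<dots> = r \<odot>\<^bsub>NH\<^esub> t"
    by (rule NH.finsum_singleton[OF assms(3,1)]) (simp add: smult_closed c assms(4))
  finally show ?thesis unfolding span_def using assms(4)
    by (intro CollectI exI[of _ "\<lambda>s. if t = s then r else \<zero>"]) auto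
qed

lemma span_zero:
  assumes "S \<subseteq> carrier NH" shows "\<zero>\<^bsub>NH\<^esub> \<in> span S"
proof -
  have c: "s \<in> carrier NH" if "s \<in> S" for s using assms that by blast
  have "(\<Oplus>\<^bsub>NH\<^esub>s\<in>S. \<zero> \<odot>\<^bsub>NH\<^esub> s) = (\<Oplus>\<^bsub>NH\<^esub>s\<in>S. \<zero>\<^bsub>NH\<^esub>)"
    by (rule NH.finsum_cong') (auto simp: smult_zero c)
  then show ?thesis unfolding span_def by (intro CollectI exI[of _ "\<lambda>s. \<zero>"]) simp
qed

text \<open>Words longer than the bound vanish, so the finitely many shorter words span.\<close>

lemma bounded_imp_fin_gen:
  assumes bounded_words shows "fin_gen_module R NH"
proof -
  obtain N where N: "\<And>w. alive w \<Longrightarrow> length w \<le> N" using assms unfolding bounded_words_def by blast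
  define T where "T = {w. set w \<subseteq> I \<and> length w \<le> N}"
  define S where "S = (\<lambda>w. cl (wm w)) ` T"
  have "finite T" unfolding T_def by (rule finite_lists_length_le[OF finite_I])
  then have fin: "finite S" by (simp add: S_def)
  have T: "w \<in> lists I" if "w \<in> T" for w using that by (auto simp: T_def)
  have SN: "S \<subseteq> carrier NH"
    unfolding S_def by (intro image_subsetI cl_closed wm_carrier T)
  have cl_span: "cl f \<in> span S" if "f \<in> carrier F" for f
    using that
  proof (induction rule: FA_induct)
    case zero
    then show ?case using span_zero[OF SN] by (simp add: cl_zero)
  next
    case (add g r u)
    then have g: "g \<in> carrier F" "cl g \<in> span S" and r: "r \<in> carrier R" and u: "u \<in> lists I" by blast+
    have wc: "(\<lambda>w. r \<otimes> wm u w) \<in> carrier F" by (rule FA_smult_closed[OF r wm_carrier[OF u]])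
    have eq: "cl (\<lambda>w. r \<otimes> wm u w \<oplus> g w) = r \<odot>\<^bsub>NH\<^esub> cl (wm u) \<oplus>\<^bsub>NH\<^esub> cl g"
      by (simp only: cl_add[OF wc g(1)] cl_smult[OF r wm_carrier[OF u]])
    have "r \<odot>\<^bsub>NH\<^esub> cl (wm u) \<in> span S"
    proof (cases "alive u")
      case True
      then have "u \<in> T" using N u by (auto simp: T_def)
      then show ?thesis by (intro span_smult[OF fin SN _ r]) (simp add: S_def)
    next
      case False
      have "r \<odot>\<^bsub>NH\<^esub> \<zero>\<^bsub>NH\<^esub> = cl (\<lambda>w. r \<otimes> \<zero>)"
        using cl_smult[OF r F.zero_closed] cl_zero by (simp add: FA_simps)
      then have "r \<odot>\<^bsub>NH\<^esub> cl (wm u) = \<zero>\<^bsub>NH\<^esub>"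
        using cl_dead[OF u False] r cl_zero by simp
      then show ?thesis using span_zero[OF SN] by simp
    qed
    then show ?case unfolding eq using g(2) by (rule span_add[OF SN])
  qed
  show ?thesis unfolding fin_gen_module_def
  proof (intro exI[of _ S] conjI fin SN ballI)
    fix x assume "x \<in> carrier NH"
    then have "x \<in> span S" unfolding NH_carrier using cl_span by (elim bexE) simp
    then show "\<exists>c\<in>S \<rightarrow> carrier R. x = (\<Oplus>\<^bsub>NH\<^esub>s\<in>S. c s \<odot>\<^bsub>NH\<^esub> s)"
      unfolding span_def mem_Collect_eq by (elim exE conjE) (rule bexI)
  qed
qed

abbreviation "Aug \<equiv> augmentation_ideal R I m d J"

lemma gen_eq: "nil_hecke_gen R I m d J i = cl (wm [i])"
  by (simp add: nil_hecke_gen_def cl_def)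

lemma gen_carrier: "nil_hecke_gen R I m d J ` I \<subseteq> carrier NH"
  unfolding gen_eq by (intro image_subsetI cl_closed wm_carrier) simp

sublocale Aug: ideal Aug NH
  unfolding augmentation_ideal_def by (rule NH.genideal_ideal[OF gen_carrier])

lemma supp_in_ideal: "ideal (supp_in (\<lambda>k. n \<le> k)) NH"
proof (rule idealI[OF NH_ring])
  show "subgroup (supp_in (\<lambda>k. n \<le> k)) (add_monoid NH)"
  proof (rule NH.add.subgroupI)
    show "supp_in (\<lambda>k. n \<le> k) \<subseteq> carrier NH" by (rule supp_in_carrier)
    show "supp_in (\<lambda>k. n \<le> k) \<noteq> {}" using supp_in_zero by blast
    fix x assume x: "x \<in> supp_in (\<lambda>k. n \<le> k)"
    then have xc: "x \<in> carrier NH" using supp_in_carrier by blast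
    have "\<ominus> \<one> \<odot>\<^bsub>NH\<^esub> x \<oplus>\<^bsub>NH\<^esub> x = \<zero>\<^bsub>NH\<^esub>"
    proof -
      obtain f where f: "f \<in> carrier F" "x = cl f" using xc NH_carrier by blast
      have c: "(\<lambda>w. \<ominus> \<one> \<otimes> f w) \<in> carrier F" by (rule FA_smult_closed[OF _ f(1)]) simp
      have "(\<lambda>w. \<ominus> \<one> \<otimes> f w \<oplus> f w) = (\<lambda>w. \<zero>)"
        using FA_closedD[OF f(1)] by (simp add: l_minus l_neg)
      then show ?thesis unfolding f(2) cl_smult[OF a_inv_closed[OF one_closed] f(1)] cl_add[OF c f(1), symmetric]
        by (simp only: cl_zero)
    qed
    then have "\<ominus>\<^bsub>NH\<^esub> x = \<ominus> \<one> \<odot>\<^bsub>NH\<^esub> x"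
      using NH.minus_equality smult_closed[OF _ xc] xc by simp
    then show "\<ominus>\<^bsub>NH\<^esub> x \<in> supp_in (\<lambda>k. n \<le> k)" using supp_in_smult[OF x, of "\<ominus> \<one>"] by simp
  qed (rule supp_in_add)
next
  fix a x assume a: "a \<in> supp_in (\<lambda>k. n \<le> k)" and "x \<in> carrier NH"
  then obtain f where "f \<in> carrier F" "x = cl f" using NH_carrier by blast
  then have x: "x \<in> supp_in (\<lambda>k. True)" by (simp add: supp_inI)
  show "x \<otimes>\<^bsub>NH\<^esub> a \<in> supp_in (\<lambda>k. n \<le> k)" by (rule supp_in_mult[OF x a]) simp
  show "a \<otimes>\<^bsub>NH\<^esub> x \<in> supp_in (\<lambda>k. n \<le> k)" by (rule supp_in_mult[OF a x]) simp
qed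

lemma Aug_wm: "w \<in> lists I \<Longrightarrow> w \<noteq> [] \<Longrightarrow> cl (wm w) \<in> Aug"
proof (cases w)
  case (Cons i u)
  assume w: "w \<in> lists I"
  have i: "i \<in> I" "[i] \<in> lists I" "u \<in> lists I" using w Cons by simp_all
  have "cl (wm [i]) \<in> Aug" unfolding augmentation_ideal_def
    using NH.genideal_self[OF gen_carrier] i(1) gen_eq by blast
  then have "cl (wm [i]) \<otimes>\<^bsub>NH\<^esub> cl (wm u) \<in> Aug"
    by (rule Aug.I_r_closed) (rule cl_closed[OF wm_carrier[OF i(3)]])
  then show ?thesis using cl_mult[OF wm_carrier[OF i(2)] wm_carrier[OF i(3)]] wm_append[of "[i]" u] Cons
    by (simp add: FA_simps)
qed simp

text \<open>Being spanned by nonempty words is visibly closed under products from both sides, and every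
  nonempty word is a multiple of its first letter.\<close>

lemma Aug_eq: "Aug = supp_in (\<lambda>k. 1 \<le> k)"
proof
  show "Aug \<subseteq> supp_in (\<lambda>k. 1 \<le> k)" unfolding augmentation_ideal_def
  proof (rule NH.genideal_minimal[OF supp_in_ideal])
    show "nil_hecke_gen R I m d J ` I \<subseteq> supp_in (\<lambda>k. 1 \<le> k)"
      unfolding gen_eq by (intro image_subsetI supp_in_wm) simp_all
  qed
  show "supp_in (\<lambda>k. 1 \<le> k) \<subseteq> Aug"
  proof
    fix x assume "x \<in> supp_in (\<lambda>k. 1 \<le> k)"
    then obtain f where f: "f \<in> carrier F" "x = cl f" and len: "\<And>w. f w \<noteq> \<zero> \<Longrightarrow> 1 \<le> length w"
      unfolding supp_in_def by blast
    have "cl f \<in> Aug" using f(1)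
    proof (induction rule: FA_induct)
      case zero
      then show ?case using Aug.zero_closed by (simp add: cl_zero)
    next
      case (add g r u)
      then have g: "g \<in> carrier F" "cl g \<in> Aug" and r: "r \<in> carrier R" and u: "u \<in> lists I" "f u \<noteq> \<zero>" by blast+
      have e: "(\<lambda>w. r \<otimes> wm [] w) \<in> carrier F" by (rule FA_smult_closed[OF r wm_carrier]) simp
      have wc: "(\<lambda>w. r \<otimes> wm u w) \<in> carrier F" by (rule FA_smult_closed[OF r wm_carrier[OF u(1)]])
      have "u \<noteq> []" using len[OF u(2)] by auto
      then have "cl (wm u) \<in> Aug" by (rule Aug_wm[OF u(1)])
      then have "cl (\<lambda>w. r \<otimes> wm [] w) \<otimes>\<^bsub>NH\<^esub> cl (wm u) \<in> Aug" by (rule Aug.I_l_closed) (rule cl_closed[OF e])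
      moreover have "conv (\<lambda>w. r \<otimes> wm [] w) (wm u) = (\<lambda>w. r \<otimes> wm u w)"
        by (rule ext) (simp add: conv_smult_left[OF wm_closed wm_closed r] conv_monom_left wm_closed)
      ultimately have "cl (\<lambda>w. r \<otimes> wm u w) \<in> Aug" by (simp add: cl_mult[OF e wm_carrier[OF u(1)], symmetric])
      then show ?case unfolding cl_add[OF wc g(1)] using g(2) by (rule Aug.a_closed)
    qed
    then show "x \<in> Aug" using f(2) by simp
  qed
qed

abbreviation AugPow :: "nat \<Rightarrow> ('i list \<Rightarrow> 'a) set set" where
  "AugPow n \<equiv> Aug [^]\<^bsub>ideals_set NH\<^esub> n"

lemma AugPow_simps: "AugPow 0 = carrier NH" "AugPow (Suc n) = ideal_prod NH (AugPow n) Aug"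
  by (simp_all add: nat_pow_def ideals_set_def)

lemma AugPow_ideal: "ideal (AugPow n) NH"
proof (induction n)
  case 0
  show ?case unfolding AugPow_simps by (rule NH.oneideal)
next
  case (Suc n)
  show ?case unfolding AugPow_simps by (rule NH.ideal_prod_is_ideal[OF Suc Aug.is_ideal])
qed

lemma AugPow_subset: "AugPow n \<subseteq> supp_in (\<lambda>k. n \<le> k)"
proof (induction n)
  case 0
  show ?case unfolding AugPow_simps supp_in_def using NH_carrier by auto
next
  case (Suc n)
  show ?case unfolding AugPow_simps
  proof
    fix x assume "x \<in> ideal_prod NH (AugPow n) Aug"
    then show "x \<in> supp_in (\<lambda>k. Suc n \<le> k)"
    proof (induction rule: ideal_prod.induct)
      case (prod i j)
      have "i \<in> supp_in (\<lambda>k. n \<le> k)" "j \<in> supp_in (\<lambda>k. 1 \<le> k)" using prod Suc Aug_eq by blast+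
      then show ?case by (rule supp_in_mult) simp
    next
      case (sum s1 s2)
      show ?case by (rule supp_in_add[OF sum.IH])
    qed
  qed
qed

lemma AugPow_wm: "w \<in> lists I \<Longrightarrow> cl (wm w) \<in> AugPow (length w)"
proof (induction w rule: rev_induct)
  case Nil
  show ?case unfolding list.size AugPow_simps by (rule cl_closed[OF wm_carrier]) simp
next
  case (snoc i w)
  have l: "[i] \<in> lists I" "w \<in> lists I" using snoc.prems by simp_all
  have "cl (wm w) \<otimes>\<^bsub>NH\<^esub> cl (wm [i]) \<in> AugPow (Suc (length w))"
    unfolding AugPow_simps by (rule ideal_prod.prod[OF snoc.IH[OF l(2)] Aug_wm[OF l(1)]]) simp
  then show ?case using cl_mult[OF wm_carrier[OF l(2)] wm_carrier[OF l(1)]] wm_append[of w "[i]"]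
    by (simp add: FA_simps)
qed

lemma bounded_imp_AugPow_zero:
  assumes "\<And>w. alive w \<Longrightarrow> length w \<le> N" shows "AugPow (Suc N) = {\<zero>\<^bsub>NH\<^esub>}"
proof
  show "{\<zero>\<^bsub>NH\<^esub>} \<subseteq> AugPow (Suc N)"
    using additive_subgroup.zero_closed[OF ideal.axioms(1)[OF AugPow_ideal]] by blast
  show "AugPow (Suc N) \<subseteq> {\<zero>\<^bsub>NH\<^esub>}"
  proof
    fix x assume "x \<in> AugPow (Suc N)"
    then have "x \<in> supp_in (\<lambda>k. Suc N \<le> k)" using AugPow_subset by blast
    then obtain f where f: "f \<in> carrier F" "x = cl f" and len: "\<And>w. f w \<noteq> \<zero> \<Longrightarrow> Suc N \<le> length w"
      unfolding supp_in_def by blast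
    have "f \<in> K" using f(1)
    proof (induction rule: FA_induct)
      case zero
      then show ?case using K.zero_closed by (simp add: FA_simps)
    next
      case (add g r u)
      then have g: "g \<in> K" and r: "r \<in> carrier R" and u: "u \<in> lists I" "f u \<noteq> \<zero>" by blast+
      have "\<not> alive u" using len[OF u(2)] assms[of u] by auto
      then have "(\<lambda>w. r \<otimes> wm u w) \<in> K" by (intro K_smult[OF r] dead_K[OF u(1)])
      then have "(\<lambda>w. r \<otimes> wm u w) \<oplus>\<^bsub>F\<^esub> g \<in> K" using g by (rule K.a_closed)
      then show ?case by (simp add: FA_simps)
    qed
    then show "x \<in> {\<zero>\<^bsub>NH\<^esub>}" using cl_eq_zero_iff[OF f(1)] f(2) by simp
  qed
qed

lemma nilpotent_iff_bounded: "nilpotent_ideal NH Aug \<longleftrightarrow> bounded_words"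
proof
  assume "nilpotent_ideal NH Aug"
  then obtain n where n: "AugPow n = {\<zero>\<^bsub>NH\<^esub>}" unfolding nilpotent_ideal_def by blast
  have "length w \<le> n" if w: "alive w" for w
  proof (rule ccontr)
    assume "\<not> length w \<le> n"
    then have len: "length (take n w) = n" by simp
    have a: "alive (take n w)" by (rule alive_take[OF w])
    note l = alive_lists[OF a]
    have "cl (wm (take n w)) = \<zero>\<^bsub>NH\<^esub>" using AugPow_wm[OF l] n len by simp
    then have "wm (take n w) \<in> K" using cl_eq_zero_iff[OF wm_carrier[OF l]] by simp
    then show False using wm_K_iff[OF l] a by simp
  qed
  then show bounded_words unfolding bounded_words_def by blast
next
  assume bounded_words
  then show "nilpotent_ideal NH Aug"
    unfolding bounded_words_def nilpotent_ideal_def using bounded_imp_AugPow_zero by meson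
qed

lemma fin_gen_iff_bounded: "fin_gen_module R NH \<longleftrightarrow> bounded_words"
  using fin_gen_imp_bounded bounded_imp_fin_gen by blast

lemma Nil_not_null: "[] \<notin> null_words"
proof
  assume "[] \<in> null_words"
  then consider i where "i \<in> I" "[] = replicate (d i) i"
    | a b where "{a, b} \<in> braid_pairs I m" "[] = braid_word a b"
    unfolding null_words_def by blast
  then show False
  proof cases
    case 1
    then show ?thesis using d2[of i] by simp
  next
    case 2
    then have "a \<in> I" "b \<in> I" "a \<noteq> b" "m a b < \<infinity>" using braid_pairs_iff by blast+
    moreover have "the_enat (m a b) = 0" using arg_cong[OF 2(2), of length] by simp
    ultimately show ?thesis using m_ge2[of a b] by (cases "m a b") (auto simp: numeral_eq_enat)
  qed
qed

lemma alive_Nil: "alive []"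
  unfolding alive_def
proof (intro conjI allI impI)
  fix v p x q assume v: "[] \<approx> v" "v = p @ x @ q"
  then have "x = []" using braid_eq_length[of "[]" v] by simp
  then show "x \<notin> null_words" using Nil_not_null by simp
qed simp

lemma one_not_Aug: "\<one>\<^bsub>NH\<^esub> \<notin> Aug"
proof
  assume "\<one>\<^bsub>NH\<^esub> \<in> Aug"
  then have "cl (wm []) \<in> supp_in (\<lambda>k. 1 \<le> k)" unfolding Aug_eq by (simp add: cl_one)
  from alive_not_supp_in[OF alive_Nil this] show False by simp
qed

text \<open>\<open>1 - z\<^sup>n\<close> is a left multiple of \<open>1 - z\<close>.\<close>

lemma one_minus_power:
  assumes L: "left_ideal L NH" and z: "z \<in> carrier NH" "\<one>\<^bsub>NH\<^esub> \<ominus>\<^bsub>NH\<^esub> z \<in> L"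
  shows "\<one>\<^bsub>NH\<^esub> \<ominus>\<^bsub>NH\<^esub> z [^]\<^bsub>NH\<^esub> (n::nat) \<in> L"
proof (induction n)
  interpret L: additive_subgroup L NH using L by (simp add: left_ideal_def)
  case 0
  show ?case using L.zero_closed by (simp add: NH.minus_eq NH.r_neg)
next
  interpret L: additive_subgroup L NH using L by (simp add: left_ideal_def)
  case (Suc n)
  let ?p = "z [^]\<^bsub>NH\<^esub> n"
  have p: "?p \<in> carrier NH" using z(1) by simp
  have "?p \<otimes>\<^bsub>NH\<^esub> (\<one>\<^bsub>NH\<^esub> \<ominus>\<^bsub>NH\<^esub> z) \<in> L" using L p z unfolding left_ideal_def by blast
  then have "(\<one>\<^bsub>NH\<^esub> \<ominus>\<^bsub>NH\<^esub> ?p) \<oplus>\<^bsub>NH\<^esub> ?p \<otimes>\<^bsub>NH\<^esub> (\<one>\<^bsub>NH\<^esub> \<ominus>\<^bsub>NH\<^esub> z) \<in> L" using Suc by (intro L.a_closed)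
  moreover have "(\<one>\<^bsub>NH\<^esub> \<ominus>\<^bsub>NH\<^esub> ?p) \<oplus>\<^bsub>NH\<^esub> ?p \<otimes>\<^bsub>NH\<^esub> (\<one>\<^bsub>NH\<^esub> \<ominus>\<^bsub>NH\<^esub> z) = \<one>\<^bsub>NH\<^esub> \<ominus>\<^bsub>NH\<^esub> z [^]\<^bsub>NH\<^esub> Suc n"
    using z(1) p by (simp add: NH.minus_eq NH.r_distr NH.r_minus NH.a_assoc NH.r_neg1 NH.r_neg2)
  ultimately show ?case by simp
qed

lemma Aug_power: "z \<in> Aug \<Longrightarrow> z [^]\<^bsub>NH\<^esub> (n::nat) \<in> AugPow n"
proof (induction n)
  case 0
  show ?case unfolding AugPow_simps by simp
next
  case (Suc n)
  show ?case unfolding AugPow_simps NH.nat_pow_Suc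
    by (rule ideal_prod.prod[OF Suc.IH[OF Suc.prems] Suc.prems])
qed

text \<open>An element of \<open>L\<close> outside the augmentation ideal is, up to a unit of the field,
  of the form \<open>1 - z\<close> with \<open>z\<close> in the augmentation ideal. Since
  \<open>z\<close> is nilpotent, \<open>1 \<in> L\<close>.\<close>

lemma left_ideal_sub_Aug:
  assumes "field R" bounded_words and L: "left_ideal L NH" "L \<noteq> carrier NH"
  shows "L \<subseteq> Aug"
proof
  interpret field R by (rule assms(1))
  interpret L: additive_subgroup L NH using L by (simp add: left_ideal_def)
  fix x assume x: "x \<in> L"
  then obtain f where f: "f \<in> carrier F" "x = cl f" using L.a_subset NH_carrier by blast
  note fc = FA_closedD[OF f(1)]
  show "x \<in> Aug"
  proof (cases "f [] = \<zero>")
    case True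
    have "1 \<le> length w" if "f w \<noteq> \<zero>" for w using that True by (cases w) auto
    then show ?thesis unfolding Aug_eq f(2) by (rule supp_inI[OF f(1)])
  next
    case False
    then have u: "f [] \<in> Units R" using fc field_Units by simp
    define r where "r = \<ominus> (inv (f []))"
    have r: "r \<in> carrier R" using u unfolding r_def by simp
    \<comment> \<open>normalised so that the constant term of \<open>h\<close> vanishes\<close>
    define h where "h = (\<lambda>w. wm [] w \<oplus> r \<otimes> f w)"
    define z where "z = cl h"
    have rf: "(\<lambda>w. r \<otimes> f w) \<in> carrier F" by (rule FA_smult_closed[OF r f(1)])
    have hF: "h \<in> carrier F" unfolding h_def by (rule FA_add_closed[OF wm_carrier rf]) simp
    have "h [] = \<zero>" using u fc by (simp add: h_def r_def word_monom_def l_minus r_neg)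
    then have "1 \<le> length w" if "h w \<noteq> \<zero>" for w using that by (cases w) auto
    then have zA: "z \<in> Aug" unfolding Aug_eq z_def by (rule supp_inI[OF hF])
    have zc: "z \<in> carrier NH" unfolding z_def by (rule cl_closed[OF hF])
    have re: "(\<lambda>w. r \<otimes> wm [] w) \<in> carrier F" by (rule FA_smult_closed[OF r wm_carrier]) simp
    have rx: "cl (\<lambda>w. r \<otimes> f w) \<in> L"
    proof -
      have "conv (\<lambda>w. r \<otimes> wm [] w) f = (\<lambda>w. r \<otimes> f w)"
        by (rule ext) (simp add: conv_smult_left[OF wm_closed fc r] conv_monom_left fc)
      then have "cl (\<lambda>w. r \<otimes> f w) = cl (\<lambda>w. r \<otimes> wm [] w) \<otimes>\<^bsub>NH\<^esub> x"
        using cl_mult[OF re f(1)] f(2) by simp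
      then show ?thesis using L(1) x cl_closed[OF re] unfolding left_ideal_def by simp
    qed
    have "z = \<one>\<^bsub>NH\<^esub> \<oplus>\<^bsub>NH\<^esub> cl (\<lambda>w. r \<otimes> f w)"
      unfolding z_def h_def using cl_add[OF wm_carrier rf] cl_one by simp
    then have "\<one>\<^bsub>NH\<^esub> \<ominus>\<^bsub>NH\<^esub> z = \<ominus>\<^bsub>NH\<^esub> cl (\<lambda>w. r \<otimes> f w)"
      using cl_closed[OF rf] by (simp add: NH.minus_eq NH.minus_add NH.r_neg1 NH.r_neg2)
    then have "\<one>\<^bsub>NH\<^esub> \<ominus>\<^bsub>NH\<^esub> z \<in> L" using L.a_inv_closed[OF rx] by simp
    note pow = one_minus_power[OF L(1) zc this]
    obtain N where N: "\<And>w. alive w \<Longrightarrow> length w \<le> N" using assms(2) unfolding bounded_words_def by blast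
    have "AugPow (Suc N) = {\<zero>\<^bsub>NH\<^esub>}" by (rule bounded_imp_AugPow_zero) (rule N)
    then have "z [^]\<^bsub>NH\<^esub> Suc N = \<zero>\<^bsub>NH\<^esub>" using Aug_power[OF zA, of "Suc N"] by blast
    then have "\<one>\<^bsub>NH\<^esub> \<in> L" using pow[of "Suc N"] by (simp add: NH.minus_eq del: NH.nat_pow_Suc)
    then have "y \<in> L" if "y \<in> carrier NH" for y
      using L(1) that unfolding left_ideal_def by (metis NH.r_one)
    then have "L = carrier NH" using L.a_subset by blast
    then show ?thesis using L(2) by contradiction
  qed
qed

lemma ideal_left_ideal: "ideal L NH \<Longrightarrow> left_ideal L NH"
  unfolding left_ideal_def by (simp add: ideal.axioms(1) ideal.I_l_closed)

lemma Aug_proper: "Aug \<noteq> carrier NH"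
  using one_not_Aug NH.one_closed by blast

lemma Aug_local:
  assumes "field R" bounded_words
  shows "local_ring NH" "maximal_left_ideal L NH \<longleftrightarrow> L = Aug" "maximalideal L NH \<longleftrightarrow> L = Aug"
proof -
  note sub = left_ideal_sub_Aug[OF assms]
  have left: "left_ideal Aug NH" by (rule ideal_left_ideal[OF Aug.is_ideal])
  have max: "maximal_left_ideal L NH \<longleftrightarrow> L = Aug" for L
  proof
    assume L: "maximal_left_ideal L NH"
    then have "L \<subseteq> Aug" using sub unfolding maximal_left_ideal_def by blast
    then show "L = Aug" using L left Aug_proper unfolding maximal_left_ideal_def by metis
  next
    assume "L = Aug"
    then show "maximal_left_ideal L NH"
      unfolding maximal_left_ideal_def using left Aug_proper sub by blast
  qed
  then show "maximal_left_ideal L NH \<longleftrightarrow> L = Aug" .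
  show "local_ring NH" unfolding local_ring_def using NH_ring max by blast
  show "maximalideal L NH \<longleftrightarrow> L = Aug"
  proof
    assume L: "maximalideal L NH"
    then have "L \<subseteq> Aug"
      using sub[OF ideal_left_ideal[OF maximalideal.axioms(1)[OF L]]] maximalideal.I_notcarr[OF L] by metis
    then show "L = Aug"
      using maximalideal.I_maximal[OF L Aug.is_ideal _ Aug.a_subset] Aug_proper by blast
  next
    assume L: "L = Aug"
    show "maximalideal L NH" unfolding L
    proof (rule maximalidealI[OF Aug.is_ideal])
      show "carrier NH \<noteq> Aug" using Aug_proper by blast
      fix M assume "ideal M NH" "Aug \<subseteq> M"
      then show "M = Aug \<or> M = carrier NH" using sub[OF ideal_left_ideal] by blast
    qed
  qed
qed

end

section \<open>The geometric representation\<close>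

text \<open>The Chebyshev polynomials of the second kind, shifted so that \<open>cheb (2 cos \<theta>) k
  = sin (k \<theta>) / sin \<theta>\<close>. They are the coordinates of the roots of a dihedral
  group.\<close>

fun cheb :: "real \<Rightarrow> nat \<Rightarrow> real" where
  "cheb t 0 = 0"
| "cheb t (Suc 0) = 1"
| "cheb t (Suc (Suc k)) = t * cheb t (Suc k) - cheb t k"

lemma cheb_sin: "sin \<theta> * cheb (2 * cos \<theta>) k = sin (real k * \<theta>)"
proof (induction "2 * cos \<theta>" k rule: cheb.induct)
  case (3 k)
  have "sin (real (Suc (Suc k)) * \<theta>) = 2 * cos \<theta> * sin (real (Suc k) * \<theta>) - sin (real k * \<theta>)"
  proof -
    have "real (Suc (Suc k)) * \<theta> = real (Suc k) * \<theta> + \<theta>" "real k * \<theta> = real (Suc k) * \<theta> - \<theta>"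
      by (simp_all add: algebra_simps)
    then show ?thesis by (simp only: sin_add sin_diff) (simp add: algebra_simps)
  qed
  then show ?case using 3 by (simp add: algebra_simps)
qed simp_all

lemma cheb_2: "cheb 2 k = real k"
  by (induction "2::real" k rule: cheb.induct) simp_all

lemma cheb_cos:
  assumes "2 \<le> n" "k \<le> n"
  shows "cheb (2 * cos (pi / real n)) n = 0" "0 \<le> cheb (2 * cos (pi / real n)) k"
    "cheb (2 * cos (pi / real n)) (n - k) = cheb (2 * cos (pi / real n)) k"
proof -
  let ?\<theta> = "pi / real n"
  have s: "0 < sin ?\<theta>" using assms(1) by (intro sin_gt_zero) (simp_all add: field_simps)
  have "sin ?\<theta> * cheb (2 * cos ?\<theta>) n = 0" using assms by (simp add: cheb_sin)
  then show "cheb (2 * cos ?\<theta>) n = 0" using s by simp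
  have "real k * ?\<theta> \<le> pi" using assms by (simp add: field_simps)
  then have "0 \<le> sin ?\<theta> * cheb (2 * cos ?\<theta>) k" unfolding cheb_sin by (intro sin_ge_zero) simp_all
  then show "0 \<le> cheb (2 * cos ?\<theta>) k" using s by (simp add: zero_le_mult_iff)
  have "real (n - k) * ?\<theta> = pi - real k * ?\<theta>" using assms by (simp add: of_nat_diff field_simps)
  then have "sin ?\<theta> * cheb (2 * cos ?\<theta>) (n - k) = sin ?\<theta> * cheb (2 * cos ?\<theta>) k"
    unfolding cheb_sin by simp
  then show "cheb (2 * cos ?\<theta>) (n - k) = cheb (2 * cos ?\<theta>) k" using s by simp
qed

text \<open>The pairing of the \<open>i\<close>-th basis vector with \<open>x\<close> under the form
  with diagonal entries \<open>2\<close> and off-diagonal entries \<open>- T i j\<close>. The Coxeter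
  form is the case \<open>T = tw\<close>; other matrices \<open>T\<close> appear as conjugates of
  it.\<close>

definition wpr :: "'i set \<Rightarrow> ('i \<Rightarrow> 'i \<Rightarrow> real) \<Rightarrow> 'i \<Rightarrow> ('i \<Rightarrow> real) \<Rightarrow> real" where
  "wpr I T i x = 2 * x i - (\<Sum>j\<in>I - {i}. T i j * x j)"

lemma wpr_upd:
  assumes "finite I" "j \<in> I"
  shows "wpr I T i (x(j := x j - c)) = wpr I T i x - (if i = j then 2 * c else - T i j * c)"
proof -
  have "(\<Sum>k\<in>I - {i}. T i k * (x(j := x j - c)) k)
      = (\<Sum>k\<in>I - {i}. T i k * x k - (if k = j then T i j * c else 0))"
    by (rule sum.cong) (auto simp: algebra_simps)
  also have "\<dots> = (\<Sum>k\<in>I - {i}. T i k * x k) - (if i = j then 0 else T i j * c)"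
    using assms by (simp add: sum_subtractf sum.delta')
  finally show ?thesis by (simp add: wpr_def)
qed

definition quad :: "'i set \<Rightarrow> ('i \<Rightarrow> 'i \<Rightarrow> real) \<Rightarrow> ('i \<Rightarrow> real) \<Rightarrow> real" where
  "quad I T x = (\<Sum>i\<in>I. x i * wpr I T i x)"

lemma quad_upd:
  assumes I: "finite I" "i \<in> I" and sym: "\<And>i j. i \<in> I \<Longrightarrow> j \<in> I \<Longrightarrow> T i j = T j i"
  shows "quad I T (x(i := x i - c)) = quad I T x - 2 * c * wpr I T i x + 2 * c * c"
proof -
  let ?p = "wpr I T i x" and ?y = "x(i := x i - c)"
  have rest: "(\<Sum>j\<in>I - {i}. x j * T j i) = (\<Sum>j\<in>I - {i}. T i j * x j)"
    using I sym by (intro sum.cong) auto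
  have "quad I T ?y = ?y i * wpr I T i ?y + (\<Sum>j\<in>I - {i}. ?y j * wpr I T j ?y)"
    unfolding quad_def using I by (simp add: sum.remove)
  also have "\<dots> = (x i - c) * (?p - 2 * c) + (\<Sum>j\<in>I - {i}. x j * wpr I T j x + c * (x j * T j i))"
    using I by (intro arg_cong2[where f="(+)"] sum.cong) (auto simp: wpr_upd algebra_simps)
  also have "\<dots> = (x i - c) * (?p - 2 * c) + (\<Sum>j\<in>I - {i}. x j * wpr I T j x) + c * (\<Sum>j\<in>I - {i}. T i j * x j)"
    by (simp add: sum.distrib sum_distrib_left[symmetric] rest)
  also have "(\<Sum>j\<in>I - {i}. T i j * x j) = 2 * x i - ?p" by (simp add: wpr_def)
  also have "(\<Sum>j\<in>I - {i}. x j * wpr I T j x) = quad I T x - x i * ?p"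
    unfolding quad_def using I by (simp add: sum.remove)
  also have "(x i - c) * (?p - 2 * c) + (quad I T x - x i * ?p) + c * (2 * x i - ?p)
      = quad I T x - 2 * c * ?p + 2 * c * c"
    by (simp add: algebra_simps)
  finally show ?thesis .
qed

lemma quad_refl:
  assumes "finite I" "i \<in> I" "\<And>i j. i \<in> I \<Longrightarrow> j \<in> I \<Longrightarrow> T i j = T j i"
  shows "quad I T (x(i := x i - wpr I T i x)) = quad I T x"
  using quad_upd[where T = T and c = "wpr I T i x", OF assms] by simp

text \<open>All braid relations are kept and all exponents are two. The alive words will be seen to be
  the reduced words of the Coxeter group.\<close>

locale coxeter =
  fixes I :: "'i set" and m :: "'i \<Rightarrow> 'i \<Rightarrow> enat"
  assumes cox: "coxeter_matrix I m"
begin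

sublocale braid_words I m "\<lambda>_. 2" "braid_pairs I m"
  by unfold_locales (simp_all add: cox)

notation braid_eq (infix "\<approx>" 50)

lemma null_words_eq: "null_words = {[i, i] | i. i \<in> I}"
  unfolding null_words_def by (auto simp: numeral_2_eq_2)

definition tw :: "'i \<Rightarrow> 'i \<Rightarrow> real" where
  "tw i j = (if m i j = \<infinity> then 2 else 2 * cos (pi / real (the_enat (m i j))))"

abbreviation pr :: "'i \<Rightarrow> ('i \<Rightarrow> real) \<Rightarrow> real" where
  "pr \<equiv> wpr I tw"

definition refl :: "'i \<Rightarrow> ('i \<Rightarrow> real) \<Rightarrow> 'i \<Rightarrow> real" where
  "refl i x = x(i := x i - pr i x)"

definition act :: "'i list \<Rightarrow> ('i \<Rightarrow> real) \<Rightarrow> 'i \<Rightarrow> real" where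
  "act u x = foldr refl u x"

definition e :: "'i \<Rightarrow> 'i \<Rightarrow> real" where
  "e i = (\<lambda>j. if j = i then 1 else 0)"

definition vec :: "'i \<Rightarrow> 'i \<Rightarrow> real \<Rightarrow> real \<Rightarrow> 'i \<Rightarrow> real" where
  "vec i j a b = (\<lambda>x. if x = i then a else if x = j then b else 0)"

lemma act_simps [simp]: "act [] x = x" "act (i # u) x = refl i (act u x)" "act (u @ v) x = act u (act v x)"
  by (simp_all add: act_def)

lemma tw_sym: "i \<in> I \<Longrightarrow> j \<in> I \<Longrightarrow> tw i j = tw j i"
  using m_sym by (simp add: tw_def)

lemma m_enat: "i \<in> I \<Longrightarrow> j \<in> I \<Longrightarrow> i \<noteq> j \<Longrightarrow> m i j = enat n \<Longrightarrow> 2 \<le> n"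
  using m_ge2[of i j] by (simp add: numeral_eq_enat)

lemma cheb_tw:
  assumes "i \<in> I" "j \<in> I" "i \<noteq> j" "m i j = enat n" "k \<le> n"
  shows "cheb (tw i j) n = 0" "0 \<le> cheb (tw i j) k" "cheb (tw i j) (n - k) = cheb (tw i j) k"
  using cheb_cos[OF m_enat[OF assms(1-4)] assms(5)] assms(4) by (simp_all add: tw_def)

lemma cheb_tw_inf: "m i j = \<infinity> \<Longrightarrow> 0 \<le> cheb (tw i j) k"
  by (simp add: tw_def cheb_2)

lemma pr_linear: "pr i (\<lambda>k. a * x k + b * y k) = a * pr i x + b * pr i y"
  by (simp add: wpr_def sum.distrib sum_distrib_left algebra_simps)

lemma refl_linear: "refl i (\<lambda>k. a * x k + b * y k) = (\<lambda>k. a * refl i x k + b * refl i y k)"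
  by (auto simp: refl_def pr_linear fun_eq_iff algebra_simps)

lemma act_linear: "act u (\<lambda>k. a * x k + b * y k) = (\<lambda>k. a * act u x k + b * act u y k)"
  by (induction u) (simp_all add: refl_linear)

lemma act_uminus: "act u (\<lambda>k. - x k) = (\<lambda>k. - act u x k)"
  using act_linear[of u "-1" x 0 x] by simp

lemmas pr_upd = wpr_upd[OF finite_I, where T = tw]

lemma refl_refl: "i \<in> I \<Longrightarrow> refl i (refl i x) = x"
  by (simp add: refl_def pr_upd)

lemma act_rev: "u \<in> lists I \<Longrightarrow> act (rev u) (act u x) = x"
  by (induction u arbitrary: x) (auto simp: refl_refl)

lemma pr_vec: "i \<in> I \<Longrightarrow> j \<in> I \<Longrightarrow> i \<noteq> j \<Longrightarrow> pr i (vec i j a b) = 2 * a - tw i j * b"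
proof -
  assume a: "i \<in> I" "j \<in> I" "i \<noteq> j"
  have "(\<Sum>k\<in>I - {i}. tw i k * vec i j a b k) = (\<Sum>k\<in>I - {i}. if k = j then tw i j * b else 0)"
    by (rule sum.cong) (auto simp: vec_def)
  also have "\<dots> = tw i j * b" using a finite_I by (simp add: sum.delta')
  finally show ?thesis by (simp add: wpr_def) (simp add: vec_def)
qed

lemma vec_swap: "i \<noteq> j \<Longrightarrow> vec i j a b = vec j i b a"
  by (auto simp: vec_def)

lemma refl_vec:
  "i \<in> I \<Longrightarrow> j \<in> I \<Longrightarrow> i \<noteq> j \<Longrightarrow> refl i (vec j i a b) = vec i j (tw i j * a - b) a"
proof -
  assume a: "i \<in> I" "j \<in> I" "i \<noteq> j"
  then have "pr i (vec j i a b) = 2 * b - tw i j * a" using pr_vec[OF a, of b a] vec_swap[of j i] by simp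
  then show ?thesis using a by (auto simp: refl_def vec_def fun_eq_iff)
qed

lemma e_vec: "e i = vec i j 1 0"
  by (auto simp: e_def vec_def)

lemma refl_e: "i \<in> I \<Longrightarrow> refl i (e i) = (\<lambda>k. - e i k)"
proof -
  have "(\<Sum>j\<in>I - {i}. tw i j * e i j) = 0" by (rule sum.neutral) (auto simp: e_def)
  then show ?thesis by (auto simp: refl_def wpr_def e_def)
qed

text \<open>The orbit of the two simple roots under the dihedral group: a reflection turns the
  coordinates \<open>cheb (Suc k)\<close>, \<open>cheb k\<close> into \<open>cheb (Suc (Suc k))\<close>,
  \<open>cheb (Suc k)\<close>.\<close>

lemma alt_root:
  assumes "i \<in> I" "j \<in> I" "i \<noteq> j"
  shows "act (alt_word i j k) (e (if even k then i else j))
    = vec i j (cheb (tw i j) (Suc k)) (cheb (tw i j) k)"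
  using assms
proof (induction k arbitrary: i j)
  case 0
  then show ?case using e_vec[of i j] by simp
next
  case (Suc k)
  have "act (alt_word i j (Suc k)) (e (if even (Suc k) then i else j))
      = refl i (act (alt_word j i k) (e (if even k then j else i)))" by simp
  also have "\<dots> = refl i (vec j i (cheb (tw j i) (Suc k)) (cheb (tw j i) k))"
    using Suc by simp
  also have "\<dots> = vec i j (tw i j * cheb (tw i j) (Suc k) - cheb (tw i j) k) (cheb (tw i j) (Suc k))"
    using Suc.prems by (simp add: refl_vec tw_sym[of j i])
  finally show ?case by simp
qed

lemma quad_tw:
  assumes "i \<in> I"
  shows "quad I tw (x(i := x i - c)) = quad I tw x - 2 * c * pr i x + 2 * c * c"
    "quad I tw (x(i := x i - pr i x)) = quad I tw x"
  using assms tw_sym by (simp_all add: quad_upd finite_I quad_refl)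

lemma quad_act: "u \<in> lists I \<Longrightarrow> quad I tw (act u x) = quad I tw x"
proof (induction u)
  case (Cons i u)
  then have "i \<in> I" "quad I tw (act u x) = quad I tw x" by simp_all
  then show ?case unfolding act_simps refl_def quad_tw(2)[OF \<open>i \<in> I\<close>] by simp
qed simp

lemma sub_e: "(\<lambda>k. x k - c * e i k) = x(i := x i - c)"
  by (auto simp: e_def)

lemma act_sub: "act u (\<lambda>k. x k - c * y k) = (\<lambda>k. act u x k - c * act u y k)"
  using act_linear[of u 1 x "- c" y] by simp

text \<open>Words act by isometries. Comparing the values of the form at \<open>x - e i\<close> and at
  its image \<open>act u x - e j\<close> gives the claim.\<close>

lemma pr_act:
  assumes u: "u \<in> lists I" "i \<in> I" "j \<in> I" "act u (e i) = e j"
  shows "pr i x = pr j (act u x)"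
proof -
  have "act u (x(i := x i - 1)) = (act u x)(j := act u x j - 1)"
    using act_sub[of u x 1 "e i"] u(4) sub_e[of x 1 i] sub_e[of "act u x" 1 j] by simp
  then have "quad I tw (x(i := x i - 1)) = quad I tw ((act u x)(j := act u x j - 1))"
    using quad_act[OF u(1), of "x(i := x i - 1)"] by simp
  then show ?thesis
    by (simp add: quad_tw(1)[OF u(2)] quad_tw(1)[OF u(3)] quad_act[OF u(1)])
qed

text \<open>The first \<open>n - 1\<close> letters \<open>u\<close> of the left side send the simple
  root of its last letter \<open>c\<close> to \<open>e j\<close>, as the Chebyshev coordinates of the
  image are \<open>0\<close> and \<open>1\<close>. Hence \<open>u\<close> conjugates the reflection of
  \<open>c\<close> to that of \<open>j\<close>, that is \<open>u c = j u\<close>, and this is the braid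
  relation.\<close>

lemma act_braid:
  assumes ij: "i \<in> I" "j \<in> I" "i \<noteq> j" and fin: "m i j < \<infinity>"
  shows "act (braid_word i j) x = act (braid_word j i) x"
proof -
  obtain n where n: "m i j = enat n" using fin by auto
  obtain k where k: "n = Suc k" using m_enat[OF ij n] by (cases n) auto
  define c u where "c = (if even k then i else j)" and "u = alt_word i j k"
  have u: "u \<in> lists I" and c: "c \<in> I" using ij unfolding u_def c_def by (simp_all add: alt_word_lists)
  have "act u (e c) = vec i j (cheb (tw i j) (Suc k)) (cheb (tw i j) k)"
    unfolding u_def c_def by (rule alt_root[OF ij])
  also have "\<dots> = e j"
    using cheb_tw(1)[OF ij n, of 0] cheb_tw(3)[OF ij n, of 1] k ij(3) by (auto simp: vec_def e_def)
  finally have ec: "act u (e c) = e j" .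
  have "act (alt_word i j n) x = act u (refl c x)"
    unfolding k u_def c_def using alt_word_add[of i j k 1] by simp
  also have "refl c x = (\<lambda>l. x l - pr c x * e c l)" by (simp add: refl_def sub_e)
  also have "act u \<dots> = (\<lambda>l. act u x l - pr j (act u x) * e j l)"
    by (simp only: act_sub ec pr_act[OF u c ij(2) ec])
  also have "\<dots> = act (alt_word j i n) x" by (simp only: sub_e) (simp add: k u_def refl_def)
  finally show ?thesis using n m_sym[OF ij(1,2)] by simp
qed

lemma braid_eq_act: "u \<approx> v \<Longrightarrow> act u = act v"
proof (induction rule: rtranclp_induct)
  case (step v w)
  obtain p q a b where ab: "{a, b} \<in> braid_pairs I m" "v = p @ braid_word a b @ q" "w = p @ braid_word b a @ q"
    using step(2) unfolding braid_step_def by blast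
  then have "a \<in> I" "b \<in> I" "a \<noteq> b" "m a b < \<infinity>" using braid_pairs_iff by blast+
  then have "act v = act w" using act_braid[of a b] ab by (intro ext) simp
  then show ?case using step by simp
qed simp

definition pos :: "('i \<Rightarrow> real) \<Rightarrow> bool" where
  "pos x \<longleftrightarrow> (\<forall>k. 0 \<le> x k)"

lemma pos_e: "pos (e i)"
  by (simp add: pos_def e_def)

lemma e_nz: "e i \<noteq> (\<lambda>k. 0)"
  by (auto simp: e_def fun_eq_iff)

lemma pos_neg: "pos x \<Longrightarrow> pos (\<lambda>k. - x k) \<Longrightarrow> x = (\<lambda>k. 0)"
  by (auto simp: pos_def fun_eq_iff intro: antisym)

text \<open>Let \<open>t\<close> be the last letter of \<open>u\<close>, and split off from
  \<open>u\<close>, up to braid moves, an end \<open>x\<close> in the letters \<open>s\<close> and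
  \<open>t\<close> that is as long as possible. The rest \<open>v\<close> cannot be made to end in
  \<open>s\<close> or in \<open>t\<close>, so by induction it maps both simple roots to positive
  vectors. As \<open>x\<close> is alternating, ends in \<open>t\<close>, and is shorter than the braid
  word because \<open>u\<close> cannot be made to end in \<open>s\<close>, it maps the simple root of
  \<open>s\<close> to a nonnegative combination of the two.\<close>

lemma alive_extend:
  assumes "alive u" "s \<in> I" "\<nexists>u'. u \<approx> u' @ [s]"
  shows "pos (act u (e s))"
  using assms
proof (induction "length u" arbitrary: u s rule: less_induct)
  case less
  show ?case
  proof (cases u rule: rev_cases)
    case Nil
    then show ?thesis by (simp add: pos_e)
  next
    case (snoc u0 t)
    have st: "s \<noteq> t" using less.prems(3) snoc by blast
    have tI: "t \<in> I" using alive_lists[OF less.prems(1)] snoc by simp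
    \<comment> \<open>the possible first parts when an end in the letters \<open>s\<close>,
      \<open>t\<close> is split off\<close>
    define P where "P = (\<lambda>v. \<exists>x. set x \<subseteq> {s, t} \<and> u \<approx> v @ x)"
    have "P u0" unfolding P_def using snoc by (intro exI[of _ "[t]"]) simp
    then obtain v where v: "P v" "\<And>v'. P v' \<Longrightarrow> length v \<le> length v'"
      using ex_has_least_nat[of P u0 length] by blast
    have lv: "length v < length u" using v(2)[OF \<open>P u0\<close>] snoc by simp
    obtain x where x: "set x \<subseteq> {s, t}" "u \<approx> v @ x" using v(1) unfolding P_def by blast
    have al: "alive (v @ x)" using alive_cong[OF x(2)] less.prems(1) by blast
    then have av: "alive v" using alive_factor[of "[]" v x] by simp
    have ax: "alive x" using alive_factor[of v x "[]"] al by simp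
    have nov: "\<nexists>v'. v \<approx> v' @ [r]" if "r \<in> {s, t}" for r
    proof
      assume "\<exists>v'. v \<approx> v' @ [r]"
      then obtain v' where v': "v \<approx> v' @ [r]" by blast
      have "u \<approx> v' @ (r # x)"
        using rtranclp_trans[OF x(2) braid_eq_suffix[OF v', of x]] by simp
      then have "P v'" unfolding P_def using x(1) that by (intro exI[of _ "r # x"]) auto
      then show False using v(2) braid_eq_length[OF v'] by fastforce
    qed
    have pv: "pos (act v (e s))" "pos (act v (e t))"
      using less.hyps[OF lv av] nov less.prems(2) tI by auto
    have nil: "x \<noteq> []" using lv braid_eq_length[OF x(2)] by auto
    have last: "last x = t"
    proof (rule ccontr)
      assume "last x \<noteq> t"
      then have "last x = s" using nil x(1) last_in_set by fastforce
      then have "v @ x = (v @ butlast x) @ [s]" using nil by (metis append.assoc append_butlast_last_id)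
      then show False using less.prems(3) x(2) by metis
    qed
    define k where "k = length x"
    have "rev x = alt_word t s (length (rev x))"
    proof (rule no_square_alt_word)
      show "set (rev x) \<subseteq> {s, t}" using x(1) by simp
      show "rev x \<noteq> []" "hd (rev x) = t" using nil last by (simp_all add: hd_rev)
      show "s \<noteq> t" by (rule st)
      fix p i q
      show "rev x \<noteq> p @ [i, i] @ q"
      proof
        assume "rev x = p @ [i, i] @ q"
        then have "x = rev (p @ [i, i] @ q)" by (metis rev_rev_ident)
        then have xx: "x = rev q @ [i, i] @ rev p" by simp
        then have "i \<in> I" using alive_lists[OF ax] by simp
        then show False using alive_null[of "rev q" "[i,i]" "rev p"] ax xx unfolding null_words_eq by auto
      qed
    qed
    then have xr: "x = rev (alt_word t s k)" unfolding k_def by (metis length_rev rev_rev_ident)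
    \<comment> \<open>a braid word at the end of \<open>x\<close> could be turned into one that ends in
      \<open>s\<close>\<close>
    have klt: "k < n" if n: "m t s = enat n" for n
    proof (rule ccontr)
      assume "\<not> k < n"
      then obtain l where l: "k = n + l" using le_Suc_ex not_less by blast
      have n': "m s t = enat n" using n m_sym tI less.prems(2) by simp
      define y where "y = rev (if even n then alt_word t s l else alt_word s t l)"
      have xy: "x = y @ rev (alt_word t s n)" unfolding xr l y_def by (simp add: alt_word_add)
      have bp: "{t, s} \<in> braid_pairs I m" "{s, t} \<in> braid_pairs I m"
        using braid_pairs_iff tI less.prems(2) st n n' by auto
      have "rev (alt_word t s n) \<approx> rev (alt_word s t n)"
        using braid_eq_swap[OF bp(1), of "[]" "[]"] braid_eq_swap[OF bp(2), of "[]" "[]"] n n'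
        by (simp add: rev_alt_word)
      then have "v @ x \<approx> (v @ y) @ rev (alt_word s t n)"
        unfolding xy using braid_eq_prefix[of _ _ "v @ y"] by simp
      moreover obtain n0 where "n = Suc n0" using m_enat[OF tI less.prems(2) st[symmetric] n] by (cases n) auto
      ultimately have "u \<approx> (v @ y @ rev (alt_word t s n0)) @ [s]"
        using rtranclp_trans[OF x(2)] by simp
      then show False using less.prems(3) by blast
    qed
    have nn: "0 \<le> cheb (tw s t) k" "0 \<le> cheb (tw s t) (Suc k)"
    proof -
      have "0 \<le> cheb (tw t s) k \<and> 0 \<le> cheb (tw t s) (Suc k)"
      proof (cases "m t s")
        case (enat n)
        then show ?thesis using cheb_tw(2)[OF tI less.prems(2) st[symmetric] enat] klt[OF enat] by simp
      qed (simp add: cheb_tw_inf)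
      then show "0 \<le> cheb (tw s t) k" "0 \<le> cheb (tw s t) (Suc k)" using tw_sym[OF tI less.prems(2)] by simp_all
    qed
    obtain i j where ij: "x = alt_word i j k" "(if even k then i else j) = s" "{i, j} = {s, t}"
    proof (cases "even k")
      case True
      then show ?thesis using that[of s t] xr by (simp add: rev_alt_word)
    next
      case False
      then show ?thesis using that[of t s] xr by (auto simp add: rev_alt_word)
    qed
    have ijI: "i \<in> I" "j \<in> I" "i \<noteq> j" "tw i j = tw s t"
      using ij(3) tI less.prems(2) st tw_sym[OF tI less.prems(2)] by (auto simp: doubleton_eq_iff)
    have "act x (e s) = vec i j (cheb (tw s t) (Suc k)) (cheb (tw s t) k)"
      using alt_root[OF ijI(1-3), of k] ij(1,2) ijI(4) by simp
    also have "\<dots> = (\<lambda>l. cheb (tw s t) (Suc k) * e i l + cheb (tw s t) k * e j l)"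
      using ijI(3) by (auto simp: vec_def e_def)
    finally have "act u (e s) = (\<lambda>l. cheb (tw s t) (Suc k) * act v (e i) l + cheb (tw s t) k * act v (e j) l)"
      using braid_eq_act[OF x(2)] by (simp add: act_linear)
    moreover have "pos (act v (e i))" "pos (act v (e j))" using pv ij(3) by (auto simp: doubleton_eq_iff)
    ultimately show ?thesis using nn by (simp add: pos_def)
  qed
qed

lemma alive_snoc_pos:
  assumes "alive (u @ [s])" shows "pos (act u (e s))"
proof (rule alive_extend)
  show "alive u" using alive_factor[of "[]" u "[s]"] assms by simp
  show s: "s \<in> I" using alive_lists[OF assms] by simp
  show "\<nexists>u'. u \<approx> u' @ [s]"
  proof
    assume "\<exists>u'. u \<approx> u' @ [s]"
    then obtain u' where "u \<approx> u' @ [s]" by blast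
    then have "u @ [s] \<approx> u' @ [s, s] @ []" using braid_eq_suffix[of u "u' @ [s]" "[s]"] by simp
    then have "alive (u' @ [s, s] @ [])" using assms alive_cong by blast
    then have "[s, s] \<notin> null_words" by (rule alive_null)
    then show False unfolding null_words_eq using s by blast
  qed
qed

text \<open>The word \<open>u\<close> sends the simple root of its last letter to a negative
  vector.\<close>

lemma alive_act_neq:
  assumes "alive u" "u \<noteq> []" shows "act u \<noteq> act []"
proof
  assume id: "act u = act []"
  obtain v s where u: "u = v @ [s]" using assms(2) by (cases u rule: rev_cases) auto
  have s: "s \<in> I" using alive_lists[OF assms(1)] u by simp
  have "act u (e s) = (\<lambda>k. - act v (e s) k)" using u s by (simp add: refl_e act_uminus)
  then have "act v (e s) = (\<lambda>k. - e s k)" using id by (simp add: fun_eq_iff)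
  then have "pos (\<lambda>k. - e s k)" using alive_snoc_pos assms(1) u by metis
  then show False using pos_neg[OF pos_e] e_nz by blast
qed

lemma act_inj: "u \<in> lists I \<Longrightarrow> act u x = act u y \<Longrightarrow> x = y"
  using act_rev by metis

text \<open>If two prefixes acted in the same way, then the piece between them would act
  trivially.\<close>

lemma alive_take_act_inj:
  assumes "alive u" "k < l" "l \<le> length u" shows "act (take k u) \<noteq> act (take l u)"
proof
  assume eq: "act (take k u) = act (take l u)"
  define w where "w = take (l - k) (drop k u)"
  have split: "take l u = take k u @ w" unfolding w_def using assms(2)
    by (metis add_diff_inverse_nat less_imp_le_nat not_le take_add)
  have "alive w" unfolding w_def by (intro alive_take alive_drop assms(1))
  moreover have "w \<noteq> []" unfolding w_def using assms by simp
  moreover have "act w = act []"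
  proof
    fix x
    have "act (take k u) (act w x) = act (take k u) x" using eq split by (metis act_simps(3))
    moreover have "take k u \<in> lists I" by (rule alive_lists[OF alive_take[OF assms(1)]])
    ultimately show "act w x = act [] x" using act_inj by auto
  qed
  ultimately show False using alive_act_neq by blast
qed

end

section \<open>Finite Coxeter groups\<close>

text \<open>Each mixed term is estimated by \<open>2 \<bar>x i\<bar> \<bar>x j\<bar> \<le> h j / h i *
  (x i)\<^sup>2 + h i / h j * (x j)\<^sup>2\<close>.\<close>

lemma quad_lower:
  assumes I: "finite I" and sym: "\<And>i j. i \<in> I \<Longrightarrow> j \<in> I \<Longrightarrow> T i j = T j i"
    and h: "\<And>i. i \<in> I \<Longrightarrow> 0 < h i"
  shows "(\<Sum>i\<in>I. (2 * h i - (\<Sum>j\<in>I - {i}. \<bar>T i j\<bar> * h j)) / h i * (x i)\<^sup>2) \<le> quad I T x"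
proof -
  let ?A = "\<lambda>i j. \<bar>T i j\<bar> * (h j / h i) * (x i)\<^sup>2"
  have swap: "(\<Sum>i\<in>I. \<Sum>j\<in>I - {i}. ?A j i) = (\<Sum>i\<in>I. \<Sum>j\<in>I - {i}. ?A i j)"
  proof -
    have off: "(\<Sum>i\<in>I. \<Sum>j\<in>I - {i}. f i j) = (\<Sum>i\<in>I. \<Sum>j\<in>I. if i \<noteq> j then f i j else 0)"
      for f :: "_ \<Rightarrow> _ \<Rightarrow> real"
      using I by (intro sum.cong HOL.refl sum.mono_neutral_cong_left) auto
    show ?thesis unfolding off by (subst sum.swap) (intro sum.cong HOL.refl, auto)
  qed
  have prod_le: "T i j * x i * x j \<le> (?A i j + ?A j i) / 2" if "i \<in> I" "j \<in> I" for i j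
  proof -
    have hp: "0 < h i" "0 < h j" using h that by auto
    have "0 \<le> (h j * \<bar>x i\<bar> - h i * \<bar>x j\<bar>)\<^sup>2" by simp
    then have "2 * (h i * h j * (\<bar>x i\<bar> * \<bar>x j\<bar>)) \<le> (h j * x i)\<^sup>2 + (h i * x j)\<^sup>2"
      by (simp add: power2_diff power_mult_distrib algebra_simps)
    then have "2 * (\<bar>x i\<bar> * \<bar>x j\<bar>) \<le> h j / h i * (x i)\<^sup>2 + h i / h j * (x j)\<^sup>2"
      using hp by (simp add: field_simps power2_eq_square)
    then have "\<bar>T i j\<bar> * (2 * (\<bar>x i\<bar> * \<bar>x j\<bar>)) \<le> \<bar>T i j\<bar> * (h j / h i * (x i)\<^sup>2 + h i / h j * (x j)\<^sup>2)"
      by (rule mult_left_mono) simp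
    moreover have "T i j * x i * x j \<le> \<bar>T i j\<bar> * (\<bar>x i\<bar> * \<bar>x j\<bar>)"
      using abs_ge_self[of "T i j * x i * x j"] by (simp add: abs_mult mult.assoc)
    ultimately show ?thesis using sym[OF that] by (simp add: algebra_simps)
  qed
  have "quad I T x = (\<Sum>i\<in>I. 2 * (x i)\<^sup>2 - (\<Sum>j\<in>I - {i}. T i j * x i * x j))"
    unfolding quad_def wpr_def
  proof (intro sum.cong HOL.refl)
    fix i
    have "(\<Sum>j\<in>I - {i}. T i j * x i * x j) = x i * (\<Sum>j\<in>I - {i}. T i j * x j)"
      by (subst sum_distrib_left) (intro sum.cong HOL.refl, simp add: algebra_simps)
    then show "x i * (2 * x i - (\<Sum>j\<in>I - {i}. T i j * x j)) = 2 * (x i)\<^sup>2 - (\<Sum>j\<in>I - {i}. T i j * x i * x j)"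
      by (simp add: right_diff_distrib power2_eq_square)
  qed
  also have "\<dots> \<ge> (\<Sum>i\<in>I. 2 * (x i)\<^sup>2 - (\<Sum>j\<in>I - {i}. (?A i j + ?A j i) / 2))"
    using prod_le by (intro sum_mono diff_mono sum_mono) auto
  also have "(\<Sum>i\<in>I. 2 * (x i)\<^sup>2 - (\<Sum>j\<in>I - {i}. (?A i j + ?A j i) / 2))
      = (\<Sum>i\<in>I. 2 * (x i)\<^sup>2) - (\<Sum>i\<in>I. \<Sum>j\<in>I - {i}. ?A i j)"
    using swap by (simp add: sum_subtractf sum.distrib sum_divide_distrib[symmetric])
  also have "\<dots> = (\<Sum>i\<in>I. (2 * h i - (\<Sum>j\<in>I - {i}. \<bar>T i j\<bar> * h j)) / h i * (x i)\<^sup>2)"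
    unfolding sum_subtractf[symmetric]
  proof (rule sum.cong[OF HOL.refl])
    fix i assume "i \<in> I"
    then have "h i \<noteq> 0" using h[of i] by simp
    then show "2 * (x i)\<^sup>2 - (\<Sum>j\<in>I - {i}. ?A i j)
        = (2 * h i - (\<Sum>j\<in>I - {i}. \<bar>T i j\<bar> * h j)) / h i * (x i)\<^sup>2"
      by (simp add: diff_divide_distrib left_diff_distrib sum_divide_distrib sum_distrib_right)
  qed
  finally show ?thesis .
qed

text \<open>The form is positive definite as soon as there is a positive vector \<open>h\<close> on
  which all pairings are positive, even if the off-diagonal entries are replaced by their absolute
  values.\<close>

lemma quad_bound:
  assumes I: "finite I" and sym: "\<And>i j. i \<in> I \<Longrightarrow> j \<in> I \<Longrightarrow> T i j = T j i"
    and h: "\<And>i. i \<in> I \<Longrightarrow> 0 < h i"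
    and super: "\<And>i. i \<in> I \<Longrightarrow> (\<Sum>j\<in>I - {i}. \<bar>T i j\<bar> * h j) < 2 * h i"
  shows "\<exists>C. \<forall>x. quad I T x = 2 \<longrightarrow> (\<forall>i\<in>I. \<bar>x i\<bar> \<le> C)"
proof -
  define g where "g = (\<lambda>i. (2 * h i - (\<Sum>j\<in>I - {i}. \<bar>T i j\<bar> * h j)) / h i)"
  have g: "0 < g i" if "i \<in> I" for i unfolding g_def using h super that by simp
  define C where "C = (\<Sum>i\<in>I. 1 + 2 / g i)"
  have "\<bar>x i\<bar> \<le> C" if x: "quad I T x = 2" and i: "i \<in> I" for x i
  proof -
    have "0 \<le> g j * (x j)\<^sup>2" if "j \<in> I" for j using g[OF that] by simp
    then have "g i * (x i)\<^sup>2 \<le> (\<Sum>i\<in>I. g i * (x i)\<^sup>2)"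
      using I i by (intro member_le_sum) auto
    also have "\<dots> \<le> 2" using quad_lower[of I T h x] I sym h x unfolding g_def by auto
    finally have "(x i)\<^sup>2 \<le> 2 / g i" using g[OF i] by (simp add: field_simps)
    moreover have "\<bar>x i\<bar> \<le> 1 + (x i)\<^sup>2"
    proof (cases "\<bar>x i\<bar> \<le> 1")
      case False
      then have "\<bar>x i\<bar> * 1 \<le> \<bar>x i\<bar> * \<bar>x i\<bar>" by (intro mult_left_mono) auto
      then show ?thesis by (simp add: power2_eq_square)
    qed (use zero_le_power2[of "x i"] in linarith)
    ultimately have "\<bar>x i\<bar> \<le> 1 + 2 / g i" by linarith
    also have "\<dots> \<le> C"
    proof -
      have "0 \<le> 1 + 2 / g j" if "j \<in> I" for j using g[OF that] by (simp add: add_nonneg_nonneg)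
      then show ?thesis unfolding C_def using I i by (intro member_le_sum) auto
    qed
    finally show ?thesis .
  qed
  then show ?thesis by blast
qed

context coxeter begin

text \<open>For an alive word the vectors \<open>act (take k u) (e (u ! k))\<close>, one for each
  letter, are distinct: they are the roots made negative by the inverse, and if two of them agreed, the
  piece of \<open>u\<close> between the two letters would send a simple root to a negative
  vector.\<close>

lemma alive_length_le_card:
  assumes fin: "finite \<Phi>" and \<Phi>: "\<And>i. i \<in> I \<Longrightarrow> e i \<in> \<Phi>" "\<And>i x. i \<in> I \<Longrightarrow> x \<in> \<Phi> \<Longrightarrow> refl i x \<in> \<Phi>"
  shows bounded_words
proof -
  have closed: "act u x \<in> \<Phi>" if "u \<in> lists I" "x \<in> \<Phi>" for u x
    using that by (induction u) (auto simp: \<Phi>(2))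
  have "length u \<le> card \<Phi>" if u: "alive u" for u
  proof -
    let ?r = "\<lambda>k. act (take k u) (e (u ! k))"
    have uI: "u ! k \<in> I" if "k < length u" for k using alive_lists[OF u] that by (simp add: lists_eq_set subset_iff)
    have "?r k \<noteq> ?r l" if kl: "k < l" "l < length u" for k l
    proof
      assume eq: "?r k = ?r l"
      define w where "w = take (l - Suc k) (drop (Suc k) u)"
      have "take l u = take k u @ (u ! k) # w"
      proof -
        have "take l u = take (Suc k) u @ w" unfolding w_def using kl(1)
          by (metis Suc_leI add_diff_inverse_nat not_le take_add)
        then show ?thesis using kl by (simp add: take_Suc_conv_app_nth)
      qed
      then have "act (take k u) (e (u ! k)) = act (take k u) (refl (u ! k) (act w (e (u ! l))))"
        using eq by simp
      then have "e (u ! k) = refl (u ! k) (act w (e (u ! l)))"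
        using act_inj[OF alive_lists[OF alive_take[OF u]]] by blast
      then have "act w (e (u ! l)) = refl (u ! k) (e (u ! k))"
        using refl_refl[OF uI] kl by simp
      then have "act w (e (u ! l)) = (\<lambda>j. - e (u ! k) j)" using refl_e[OF uI] kl by simp
      moreover have "alive (w @ [u ! l])"
      proof -
        have "w @ [u ! l] = take (Suc (l - Suc k)) (drop (Suc k) u)"
          unfolding w_def using kl by (simp add: take_Suc_conv_app_nth)
        then show ?thesis using u by (simp only: alive_take alive_drop)
      qed
      ultimately have "pos (\<lambda>j. - e (u ! k) j)" using alive_snoc_pos by metis
      then show False using pos_neg[OF pos_e] e_nz by blast
    qed
    then have "inj_on ?r {..<length u}"
      by (intro inj_onI) (metis lessThan_iff nat_neq_iff)
    moreover have "?r ` {..<length u} \<subseteq> \<Phi>"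
      using closed[OF alive_lists[OF alive_take[OF u]]] \<Phi>(1) uI by blast
    ultimately show ?thesis using card_inj_on_le[OF _ _ fin] by fastforce
  qed
  then show ?thesis unfolding bounded_words_def by blast
qed

lemma coxeter_eq_act:
  assumes "coxeter_eq I m u v" shows "act u = act v"
  using assms
proof (induction rule: coxeter_eq.induct)
  case (relator u v i j)
  have "act (concat (replicate (the_enat (m i j)) [i, j])) x = x" for x
  proof (cases "i = j")
    case True
    then show ?thesis using relator by (simp add: m_refl refl_refl one_enat_def)
  next
    case False
    obtain n where n: "m i j = enat n" using relator by auto
    have n': "m j i = enat n" using n m_sym relator by simp
    have eq: "act (alt_word i j n) = act (alt_word j i n)"
      using act_braid[of i j] relator False n n' by (intro ext) simp
    have alt: "concat (replicate k [i, j]) = alt_word i j (k + k)" for k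
      by (induction k) simp_all
    have l: "alt_word i j n \<in> lists I" "alt_word j i n \<in> lists I"
      using alt_word_lists relator by blast+
    have "alt_word i j (n + n) = alt_word i j n @ rev (alt_word j i n)"
      by (auto simp: alt_word_add rev_alt_word)
    then have "act (alt_word i j (n + n)) x = act (rev (alt_word i j n)) (act (alt_word i j n) x)"
    proof -
      have "act (alt_word i j (n + n)) x = act (alt_word i j n) (act (rev (alt_word j i n)) x)"
        using \<open>alt_word i j (n + n) = _\<close> by simp
      also have "\<dots> = act (alt_word j i n) (act (rev (alt_word j i n)) x)" by (simp only: eq)
      also have "\<dots> = x"
        using act_rev[of "rev (alt_word j i n)" x] l(2) by (simp add: lists_eq_set)
      finally show ?thesis using act_rev[OF l(1)] by simp
    qed
    then show ?thesis using act_rev[OF l(1)] alt n by simp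
  qed
  then show ?case by (intro ext) simp
qed simp_all

text \<open>The action factors through the Coxeter group, so the prefixes of an alive word represent
  distinct elements.\<close>

lemma finite_coxeter_group_imp_bounded:
  assumes "finite (carrier (coxeter_group I m))" shows bounded_words
proof -
  let ?W = "carrier (coxeter_group I m)"
  let ?c = "\<lambda>u. {w. coxeter_eq I m u w}"
  have W: "?c u \<in> ?W" if "u \<in> lists I" for u
  proof -
    have "?c u = {(u, v). coxeter_eq I m u v} `` {u}" by auto
    then show ?thesis using that unfolding coxeter_group_def by (auto simp: quotient_def)
  qed
  have "length u \<le> card ?W" if u: "alive u" for u
  proof -
    have ne: "?c (take k u) \<noteq> ?c (take l u)" if "k < l" "l \<le> length u" for k l
    proof
      assume eq: "?c (take k u) = ?c (take l u)"
      have "take l u \<in> ?c (take l u)"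
        using coxeter_eq.refl[OF alive_lists[OF alive_take[OF u]]] by simp
      then have "take l u \<in> ?c (take k u)" by (simp only: eq)
      then have "act (take k u) = act (take l u)" by (intro coxeter_eq_act) simp
      with alive_take_act_inj[OF u that] show False by contradiction
    qed
    have "inj_on (\<lambda>k. ?c (take k u)) {..length u}"
      by (rule linorder_inj_onI', rule ne) simp_all
    moreover have "(\<lambda>k. ?c (take k u)) ` {..length u} \<subseteq> ?W"
      by (intro image_subsetI W alive_lists[OF alive_take[OF u]])
    ultimately have "card {..length u} \<le> card ?W" using assms by (rule card_inj_on_le)
    then show ?thesis by simp
  qed
  then show ?thesis unfolding bounded_words_def by blast
qed

lemma coxeter_eq_lists: "coxeter_eq I m u v \<Longrightarrow> u \<in> lists I \<and> v \<in> lists I"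
proof (induction rule: coxeter_eq.induct)
  case (relator u v i j)
  have "set (concat (replicate k [i, j])) \<subseteq> {i, j}" for k by (induction k) auto
  then show ?case using relator by (force simp: lists_eq_set)
qed auto

lemma coxeter_eq_context:
  "coxeter_eq I m u v \<Longrightarrow> p \<in> lists I \<Longrightarrow> q \<in> lists I \<Longrightarrow> coxeter_eq I m (p @ u @ q) (p @ v @ q)"
proof (induction rule: coxeter_eq.induct)
  case (refl u)
  then show ?case by (intro coxeter_eq.refl) simp
next
  case (relator u v i j)
  then show ?case using coxeter_eq.relator[of "p @ u" I "v @ q" i j m] by simp
qed (auto intro: coxeter_eq.sym coxeter_eq.trans)

lemma coxeter_eq_square: "p \<in> lists I \<Longrightarrow> q \<in> lists I \<Longrightarrow> i \<in> I \<Longrightarrow> coxeter_eq I m (p @ [i, i] @ q) (p @ q)"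
  using coxeter_eq.relator[of p I q i i m] m_refl[of i] by (simp add: one_enat_def)

lemma coxeter_eq_rev: "u \<in> lists I \<Longrightarrow> coxeter_eq I m (rev u @ u) []"
proof (induction u)
  case (Cons i u)
  then have "coxeter_eq I m (rev u @ [i, i] @ u) (rev u @ u)" by (intro coxeter_eq_square) auto
  then show ?case using Cons by (auto intro: coxeter_eq.trans)
qed (simp add: coxeter_eq.refl)

lemma coxeter_eq_braid:
  assumes "i \<in> I" "j \<in> I" "m i j < \<infinity>"
  shows "coxeter_eq I m (braid_word i j) (braid_word j i)"
proof -
  obtain n where n: "m i j = enat n" using assms(3) by auto
  have n': "m j i = enat n" using n m_sym assms by simp
  let ?u = "alt_word i j n" and ?v = "alt_word j i n"
  have l: "?u \<in> lists I" "?v \<in> lists I" using alt_word_lists assms by blast+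
  have alt: "concat (replicate k [i, j]) = alt_word i j (k + k)" for k
    by (induction k) simp_all
  have "alt_word i j (n + n) = ?u @ rev ?v"
    by (auto simp: alt_word_add rev_alt_word)
  then have "coxeter_eq I m (?u @ rev ?v) []"
    using coxeter_eq.relator[of "[]" I "[]" i j m] assms n alt by simp
  from coxeter_eq_context[OF this, of "[]" ?v] have "coxeter_eq I m (?u @ rev ?v @ ?v) ?v" using l by simp
  moreover have "coxeter_eq I m (?u @ rev ?v @ ?v) ?u"
    using coxeter_eq_context[OF coxeter_eq_rev[OF l(2)], of ?u "[]"] l by simp
  ultimately show ?thesis using n n' by (auto intro: coxeter_eq.sym coxeter_eq.trans)
qed

lemma braid_eq_coxeter_eq: "u \<approx> v \<Longrightarrow> u \<in> lists I \<Longrightarrow> coxeter_eq I m u v"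
proof (induction rule: rtranclp_induct)
  case base
  then show ?case by (rule coxeter_eq.refl)
next
  case (step v w)
  obtain p q a b where ab: "{a, b} \<in> braid_pairs I m" "v = p @ braid_word a b @ q" "w = p @ braid_word b a @ q"
    using step(2) unfolding braid_step_def by blast
  have "v \<in> lists I" by (rule braid_eq_lists[OF step(1) step.prems])
  then have "p \<in> lists I" "q \<in> lists I" using ab by auto
  moreover have "coxeter_eq I m (braid_word a b) (braid_word b a)"
    using coxeter_eq_braid braid_pairs_iff ab(1) by blast
  ultimately have "coxeter_eq I m v w" using coxeter_eq_context ab by blast
  then show ?case using step by (blast intro: coxeter_eq.trans)
qed

text \<open>A shortest word for an element is alive: a braid move keeps its element and its length, and
  a factor \<open>i i\<close> could be deleted. So every element has a word within the bound.\<close>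

lemma bounded_imp_finite_coxeter_group:
  assumes bounded_words shows "finite (carrier (coxeter_group I m))"
proof -
  obtain N where N: "\<And>w. alive w \<Longrightarrow> length w \<le> N" using assms unfolding bounded_words_def by blast
  let ?c = "\<lambda>u. {w. coxeter_eq I m u w}"
  have "\<exists>v. set v \<subseteq> I \<and> length v \<le> N \<and> ?c u = ?c v" if u: "u \<in> lists I" for u
  proof -
    obtain v where v: "coxeter_eq I m u v" "\<And>w. coxeter_eq I m u w \<Longrightarrow> length v \<le> length w"
      using ex_has_least_nat[of "coxeter_eq I m u" u length] coxeter_eq.refl[OF u] by blast
    have vI: "v \<in> lists I" using coxeter_eq_lists[OF v(1)] by blast
    have "alive v" unfolding alive_def
    proof (intro conjI allI impI vI)
      fix w p x q assume w: "v \<approx> w" "w = p @ x @ q"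
      show "x \<notin> null_words"
      proof
        assume "x \<in> null_words"
        then obtain i where i: "i \<in> I" "x = [i, i]" unfolding null_words_eq by blast
        have "w \<in> lists I" by (rule braid_eq_lists[OF w(1) vI])
        then have "coxeter_eq I m w (p @ q)" using coxeter_eq_square[of p q i] w(2) i by simp
        then have "coxeter_eq I m u (p @ q)"
          using v(1) braid_eq_coxeter_eq[OF w(1) vI] by (blast intro: coxeter_eq.trans)
        then show False using v(2) w(2) i braid_eq_length[OF w(1)] by fastforce
      qed
    qed
    then have "length v \<le> N" by (rule N)
    moreover have "?c u = ?c v" using v(1) by (blast intro: coxeter_eq.trans coxeter_eq.sym)
    ultimately show ?thesis using vI by (auto simp: lists_eq_set)
  qed
  then have rep: "?c u \<in> ?c ` {v. set v \<subseteq> I \<and> length v \<le> N}" if "u \<in> lists I" for u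
    using that by blast
  have "carrier (coxeter_group I m) = ?c ` lists I"
  proof -
    have "{(u, v). coxeter_eq I m u v} `` {u} = ?c u" for u by auto
    then show ?thesis unfolding coxeter_group_def quotient_def by (simp add: UNION_singleton_eq_range)
  qed
  then have "carrier (coxeter_group I m) \<subseteq> ?c ` {v. set v \<subseteq> I \<and> length v \<le> N}"
    using image_subsetI[of "lists I" ?c, OF rep] by simp
  then show ?thesis using finite_lists_length_le[OF finite_I] finite_surj by blast
qed

end

section \<open>Finite types\<close>

context coxeter begin

lemma tw_nonneg: "i \<in> I \<Longrightarrow> j \<in> I \<Longrightarrow> i \<noteq> j \<Longrightarrow> 0 \<le> tw i j"
proof (cases "m i j")
  case (enat n)
  assume "i \<in> I" "j \<in> I" "i \<noteq> j"
  then have "2 \<le> n" using m_enat enat by blast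
  then have "0 \<le> cos (pi / real n)" using order_trans[of "- (pi / 2)" 0 "pi / real n"] by (intro cos_ge_zero) (simp_all add: field_simps)
  then show ?thesis using enat by (simp add: tw_def)
qed (simp add: tw_def)

lemma quad_e: "i \<in> I \<Longrightarrow> quad I T (e i) = 2"
proof -
  assume i: "i \<in> I"
  have "quad I T (e i) = (\<Sum>j\<in>I. if j = i then wpr I T i (e i) else 0)"
    unfolding quad_def by (rule sum.cong) (auto simp: e_def)
  also have "\<dots> = wpr I T i (e i)" using i finite_I by simp
  also have "(\<Sum>j\<in>I - {i}. T i j * e i j) = 0" by (rule sum.neutral) (auto simp: e_def)
  then have "wpr I T i (e i) = 2" by (simp add: wpr_def) (simp add: e_def)
  finally show ?thesis .
qed

lemma finite_vectors:
  assumes "finite V" shows "finite {x. (\<forall>i\<in>I. x i \<in> (V :: real set)) \<and> (\<forall>i. i \<notin> I \<longrightarrow> x i = 0)}"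
proof -
  have "{x. (\<forall>i\<in>I. x i \<in> V) \<and> (\<forall>i. i \<notin> I \<longrightarrow> x i = 0)}
      = {x. \<forall>i. (i \<in> I \<longrightarrow> x i \<in> V) \<and> (i \<notin> I \<longrightarrow> x i = 0)}" by auto
  then show ?thesis using finite_set_of_finite_funs[OF finite_I assms, of 0] by simp
qed

text \<open>The roots have coordinates \<open>p + q t\<close> with integers \<open>p\<close>,
  \<open>q\<close>, where \<open>t\<close> is a root of \<open>x\<^sup>2 = \<alpha> x + \<beta>\<close>.
  The conjugation \<open>t \<mapsto> \<alpha> - t\<close> turns the Coxeter form into a form whose
  entries are not larger in absolute value, so the vector \<open>h\<close> shows that both forms are
  positive definite. Hence a root coordinate and its conjugate are bounded, and this leaves finitely
  many integers \<open>p\<close> and \<open>q\<close>. For the label \<open>4\<close> take \<open>t =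
  sqrt 2\<close>, for the label \<open>5\<close> the golden ratio.\<close>

lemma quadratic_bounded:
  fixes h :: "'i \<Rightarrow> real" and t :: real and \<alpha> \<beta> :: int and a b :: "'i \<Rightarrow> 'i \<Rightarrow> int"
  assumes t: "t * t = \<alpha> * t + \<beta>" "0 \<le> t" "1 \<le> 2 * t - \<alpha>"
    and h: "\<And>i. i \<in> I \<Longrightarrow> 0 < h i"
    and super: "\<And>i. i \<in> I \<Longrightarrow> (\<Sum>j\<in>I - {i}. tw i j * h j) < 2 * h i"
    and ab: "\<And>i j. i \<in> I \<Longrightarrow> j \<in> I \<Longrightarrow> i \<noteq> j \<Longrightarrow> tw i j = a i j + b i j * t"
      "\<And>i j. i \<in> I \<Longrightarrow> j \<in> I \<Longrightarrow> i \<noteq> j \<Longrightarrow> \<bar>a i j + b i j * (\<alpha> - t)\<bar> \<le> tw i j"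
      "\<And>i j. i \<in> I \<Longrightarrow> j \<in> I \<Longrightarrow> a i j = a j i \<and> b i j = b j i"
  shows bounded_words
proof -
  define T where "T = (\<lambda>i j. real_of_int (a i j) + b i j * (\<alpha> - t))"
  \<comment> \<open>vectors with coordinates in \<open>\<int>[t]\<close> on which both conjugate forms
    take the value \<open>2\<close>\<close>
  define \<Phi> where "\<Phi> = {x. (\<forall>i. i \<notin> I \<longrightarrow> x i = 0) \<and> quad I tw x = 2 \<and>
    (\<exists>(p :: 'i \<Rightarrow> int) (q :: 'i \<Rightarrow> int). (\<forall>i\<in>I. x i = p i + q i * t) \<and> quad I T (\<lambda>i. p i + q i * (\<alpha> - t)) = 2)}"
  have Tsym: "T i j = T j i" if "i \<in> I" "j \<in> I" for i j using ab(3)[OF that] by (simp add: T_def)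
  have "(\<Sum>j\<in>I - {i}. \<bar>tw i j\<bar> * h j) = (\<Sum>j\<in>I - {i}. tw i j * h j)" if "i \<in> I" for i
    using that tw_nonneg by (intro sum.cong) auto
  then have "\<exists>C. \<forall>x. quad I tw x = 2 \<longrightarrow> (\<forall>i\<in>I. \<bar>x i\<bar> \<le> C)"
    using quad_bound[of I tw h, OF finite_I tw_sym h] super by simp
  then obtain C where C: "\<And>x i. quad I tw x = 2 \<Longrightarrow> i \<in> I \<Longrightarrow> \<bar>x i\<bar> \<le> C" by blast
  have "(\<Sum>j\<in>I - {i}. \<bar>T i j\<bar> * h j) < 2 * h i" if "i \<in> I" for i
  proof -
    have "(\<Sum>j\<in>I - {i}. \<bar>T i j\<bar> * h j) \<le> (\<Sum>j\<in>I - {i}. tw i j * h j)"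
      using ab(2) that h unfolding T_def by (intro sum_mono mult_right_mono) (auto intro: less_imp_le)
    then show ?thesis using super[OF that] by simp
  qed
  then have "\<exists>D. \<forall>x. quad I T x = 2 \<longrightarrow> (\<forall>i\<in>I. \<bar>x i\<bar> \<le> D)"
    using quad_bound[of I T h, OF finite_I Tsym h] by simp
  then obtain D where D: "\<And>x i. quad I T x = 2 \<Longrightarrow> i \<in> I \<Longrightarrow> \<bar>x i\<bar> \<le> D" by blast
  define N where "N = \<lceil>C + (C + D) * t\<rceil> + \<lceil>C + D\<rceil> + 1"
  define V where "V = (\<lambda>(p, q). real_of_int p + real_of_int q * t) ` ({- N..N} \<times> {- N..N})"
  have "finite V" unfolding V_def by simp
  moreover have "\<Phi> \<subseteq> {x. (\<forall>i\<in>I. x i \<in> V) \<and> (\<forall>i. i \<notin> I \<longrightarrow> x i = 0)}"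
  proof
    fix x assume x: "x \<in> \<Phi>"
    then obtain p q :: "'i \<Rightarrow> int" where pq: "\<And>i. i \<in> I \<Longrightarrow> x i = p i + q i * t"
      "quad I T (\<lambda>i. p i + q i * (\<alpha> - t)) = 2" unfolding \<Phi>_def by auto
    have "x i \<in> V" if i: "i \<in> I" for i
    proof -
      have 1: "\<bar>real_of_int (p i) + q i * t\<bar> \<le> C" using C[of x i] i x pq(1)[OF i] unfolding \<Phi>_def by auto
      have 2: "\<bar>real_of_int (p i) + q i * (\<alpha> - t)\<bar> \<le> D" using D[OF pq(2) i] by simp
      have nonneg: "0 \<le> C" "0 \<le> D" using 1 2 by linarith+
      have "real_of_int (q i) * (2 * t - \<alpha>) = (p i + q i * t) - (p i + q i * (\<alpha> - t))" by (simp add: algebra_simps)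
      then have "\<bar>real_of_int (q i) * (2 * t - \<alpha>)\<bar> \<le> C + D" using 1 2 by linarith
      then have "\<bar>real_of_int (q i)\<bar> * (2 * t - \<alpha>) \<le> C + D" using t(3) by (simp add: abs_mult)
      moreover have "\<bar>real_of_int (q i)\<bar> * 1 \<le> \<bar>real_of_int (q i)\<bar> * (2 * t - \<alpha>)"
        using t(3) by (intro mult_left_mono) auto
      ultimately have q: "\<bar>real_of_int (q i)\<bar> \<le> C + D" by linarith
      then have "\<bar>real_of_int (q i) * t\<bar> \<le> (C + D) * t" using t(2) by (simp add: abs_mult mult_right_mono)
      then have p: "\<bar>real_of_int (p i)\<bar> \<le> C + (C + D) * t" using 1 by linarith
      have "0 \<le> \<lceil>C + D\<rceil>" "0 \<le> \<lceil>C + (C + D) * t\<rceil>" using p q by linarith+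
      then have "\<bar>p i\<bar> \<le> N" "\<bar>q i\<bar> \<le> N" unfolding N_def using p q by linarith+
      then have "(p i, q i) \<in> {- N..N} \<times> {- N..N}" by auto
      then show ?thesis unfolding V_def pq(1)[OF i] by (rule rev_image_eqI) simp
    qed
    then show "x \<in> {x. (\<forall>i\<in>I. x i \<in> V) \<and> (\<forall>i. i \<notin> I \<longrightarrow> x i = 0)}" using x unfolding \<Phi>_def by blast
  qed
  ultimately have fin: "finite \<Phi>" using finite_subset[OF _ finite_vectors] by blast
  show ?thesis
  proof (rule alive_length_le_card[OF fin])
    fix i assume i: "i \<in> I"
    have "(\<lambda>j. real_of_int (if j = i then 1 else 0) + real_of_int 0 * (\<alpha> - t)) = e i"
      by (auto simp: e_def)
    then have "quad I T (\<lambda>j. real_of_int (if j = i then 1 else 0) + real_of_int 0 * (\<alpha> - t)) = 2"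
      using quad_e[OF i, of T] by simp
    then show "e i \<in> \<Phi>" unfolding \<Phi>_def using i quad_e
      by (intro CollectI conjI exI[of _ "\<lambda>j. if j = i then 1 else 0"] exI[of _ "\<lambda>j. 0"]) (auto simp: e_def)
    fix x assume x: "x \<in> \<Phi>"
    then obtain p q :: "'i \<Rightarrow> int" where pq: "\<And>i. i \<in> I \<Longrightarrow> x i = p i + q i * t"
      "quad I T (\<lambda>i. p i + q i * (\<alpha> - t)) = 2" unfolding \<Phi>_def by auto
    define y where "y = (\<lambda>i. real_of_int (p i) + q i * (\<alpha> - t))"
    \<comment> \<open>the two integral parts of the pairing, which are the same for \<open>t\<close> and
      for its conjugate\<close>
    define P where "P = 2 * p i - (\<Sum>j\<in>I - {i}. a i j * p j + \<beta> * (b i j * q j))"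
    define Q where "Q = 2 * q i - (\<Sum>j\<in>I - {i}. a i j * q j + b i j * p j + \<alpha> * (b i j * q j))"
    have PQ: "wpr I U i z = P + Q * s"
      if "s * s = \<alpha> * s + \<beta>" "\<And>j. j \<in> I \<Longrightarrow> z j = p j + q j * s" "\<And>j. j \<in> I \<Longrightarrow> j \<noteq> i \<Longrightarrow> U i j = a i j + b i j * s"
      for s :: real and z U
    proof -
      have "(\<Sum>j\<in>I - {i}. U i j * z j)
          = (\<Sum>j\<in>I - {i}. real_of_int (a i j * p j + \<beta> * (b i j * q j)) + real_of_int (a i j * q j + b i j * p j + \<alpha> * (b i j * q j)) * s)"
      proof (rule sum.cong[OF HOL.refl])
        fix j assume j: "j \<in> I - {i}"
        have "(real_of_int (a i j) + b i j * s) * (p j + q j * s)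
            = a i j * p j + (a i j * q j + b i j * p j) * s + b i j * q j * (s * s)" by (simp add: algebra_simps)
        then show "U i j * z j = real_of_int (a i j * p j + \<beta> * (b i j * q j))
            + real_of_int (a i j * q j + b i j * p j + \<alpha> * (b i j * q j)) * s"
          using that(2)[of j] that(3)[of j] j by (simp add: that(1) algebra_simps)
      qed
      then show ?thesis using that(2)[OF i] unfolding wpr_def P_def Q_def
        by (simp add: sum.distrib sum_distrib_left algebra_simps)
    qed
    have prx: "pr i x = P + Q * t" using pq(1) ab(1) i t(1) by (intro PQ) auto
    have "(\<alpha> - t) * (\<alpha> - t) = \<alpha> * (\<alpha> - t) + \<beta>" using t(1) by (simp add: algebra_simps)
    then have pry: "wpr I T i y = P + Q * (\<alpha> - t)" by (intro PQ) (simp_all add: y_def T_def)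
    define p' where "p' = p(i := p i - P)"
    define q' where "q' = q(i := q i - Q)"
    have "(\<lambda>j. p' j + q' j * (\<alpha> - t)) = y(i := y i - wpr I T i y)"
      unfolding pry by (auto simp: p'_def q'_def y_def algebra_simps)
    then have "quad I T (\<lambda>j. p' j + q' j * (\<alpha> - t)) = 2"
      using quad_refl[of I i T y] finite_I i Tsym pq(2) unfolding y_def by simp
    moreover have "\<forall>j\<in>I. refl i x j = p' j + q' j * t"
      using pq(1) prx by (auto simp: refl_def p'_def q'_def algebra_simps)
    moreover have "quad I tw (refl i x) = 2"
      using quad_refl[of I i tw x] finite_I i tw_sym x unfolding \<Phi>_def refl_def by auto
    moreover have "\<forall>j. j \<notin> I \<longrightarrow> refl i x j = 0" using x i by (auto simp: \<Phi>_def refl_def)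
    ultimately show "refl i x \<in> \<Phi>" unfolding \<Phi>_def by blast
  qed
qed

end

definition twm :: "enat \<Rightarrow> real" where
  "twm x = (if x = \<infinity> then 2 else 2 * cos (pi / real (the_enat x)))"

lemma twm_2: "twm 2 = 0"
  by (simp add: twm_def numeral_eq_enat)

lemma twm_3: "twm 3 = 1"
  by (simp add: twm_def numeral_eq_enat cos_60)

lemma twm_4: "twm 4 = sqrt 2"
  by (simp add: twm_def numeral_eq_enat cos_45)

lemma twm_5: "(twm 5)\<^sup>2 = twm 5 + 1" "1 < twm 5"
proof -
  have t: "twm 5 = 2 * cos (pi / real 5)" by (simp add: twm_def numeral_eq_enat)
  have "cos (pi / 3) < cos (pi / 5)" by (rule cos_monotone_0_pi) simp_all
  then show gt: "1 < twm 5" using t by (simp add: cos_60)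
  have "cheb (twm 5) 5 = 0" unfolding t by (rule cheb_cos(1)[of 5 0]) simp_all
  then have "(twm 5 * twm 5 - twm 5 - 1) * (twm 5 * twm 5 + twm 5 - 1) = 0"
    by (simp add: numeral_eq_Suc algebra_simps)
  moreover have "twm 5 * twm 5 + twm 5 - 1 > 0" using gt less_1_mult[OF gt gt] by linarith
  ultimately show "(twm 5)\<^sup>2 = twm 5 + 1" by (simp add: power2_eq_square)
qed

definition B_matrix :: "nat \<Rightarrow> nat \<Rightarrow> enat" where
  "B_matrix i j = (if {i, j} = {1, 2} then 4 else A_matrix i j)"

definition D_matrix :: "nat \<Rightarrow> nat \<Rightarrow> enat" where
  "D_matrix i j = (if i = j then 1
    else if {i, j} \<in> {{1, 3}, {2, 3}} \<union> {{l, Suc l} | l. 3 \<le> l} then 3 else 2)"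

lemma D_matrix_eq:
  "D_matrix i j = (if i = j then 1
    else if (i = 1 \<and> j = 3) \<or> (i = 3 \<and> j = 1) \<or> (i = 2 \<and> j = 3) \<or> (i = 3 \<and> j = 2)
      \<or> (3 \<le> i \<and> j = Suc i) \<or> (3 \<le> j \<and> i = Suc j) then 3 else 2)"
proof -
  have "{i, j} \<in> {{1, 3}, {2, 3}} \<union> {{l, Suc l} | l. 3 \<le> l} \<longleftrightarrow>
    (i = 1 \<and> j = 3) \<or> (i = 3 \<and> j = 1) \<or> (i = 2 \<and> j = 3) \<or> (i = 3 \<and> j = 2)
      \<or> (3 \<le> i \<and> j = Suc i) \<or> (3 \<le> j \<and> i = Suc j)"
    unfolding Un_iff mem_Collect_eq insert_iff doubleton_eq_iff empty_iff by blast
  then show ?thesis unfolding D_matrix_def by presburger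
qed

context coxeter begin

lemma tw_twm: "tw i j = twm (m i j)"
  by (simp add: tw_def twm_def)

lemma labelled_sum:
  assumes lab: "coxeter_labelling M n I m f" and k: "k \<in> {1..n}"
    and h: "\<And>l. l \<in> {1..n} \<Longrightarrow> h (f l) = H l"
    and N: "finite N" "k \<notin> N" "\<And>l. l \<in> {1..n} \<Longrightarrow> l \<noteq> k \<Longrightarrow> l \<notin> N \<Longrightarrow> M k l = 2"
      "\<And>l. l \<in> N \<Longrightarrow> 0 \<le> twm (M k l) * H l"
  shows "(\<Sum>j\<in>I - {f k}. tw (f k) j * h j) \<le> (\<Sum>l\<in>N. twm (M k l) * H l)"
proof -
  have bij: "bij_betw f {1..n} I" and M: "\<And>k l. k \<in> {1..n} \<Longrightarrow> l \<in> {1..n} \<Longrightarrow> m (f k) (f l) = M k l"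
    using lab unfolding coxeter_labelling_def by blast+
  have inj: "inj_on f {1..n}" and im: "f ` {1..n} = I" using bij by (auto simp: bij_betw_def)
  have bij': "bij_betw f ({1..n} - {k}) (I - {f k})"
    unfolding bij_betw_def
  proof
    show "inj_on f ({1..n} - {k})" using inj by (rule inj_on_subset) blast
    show "f ` ({1..n} - {k}) = I - {f k}"
      using inj_on_image_set_diff[OF inj, of "{1..n}" "{k}"] k im by simp
  qed
  have "(\<Sum>j\<in>I - {f k}. tw (f k) j * h j) = (\<Sum>l\<in>{1..n} - {k}. tw (f k) (f l) * h (f l))"
    by (rule sum.reindex_bij_betw[OF bij', symmetric])
  also have "\<dots> = (\<Sum>l\<in>{1..n} - {k}. twm (M k l) * H l)"
    using M k h by (intro sum.cong) (auto simp: tw_twm)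
  also have "\<dots> = (\<Sum>l\<in>({1..n} - {k}) \<inter> N. twm (M k l) * H l)"
  proof (rule sum.mono_neutral_right)
    show "\<forall>l\<in>{1..n} - {k} - ({1..n} - {k}) \<inter> N. twm (M k l) * H l = 0"
    proof
      fix l assume "l \<in> {1..n} - {k} - ({1..n} - {k}) \<inter> N"
      then have "M k l = 2" by (intro N(3)) auto
      then show "twm (M k l) * H l = 0" by (simp add: twm_2)
    qed
  qed auto
  also have "\<dots> \<le> (\<Sum>l\<in>N. twm (M k l) * H l)"
    using N by (intro sum_mono2) auto
  finally show ?thesis .
qed

lemma labelling_inv:
  assumes "coxeter_labelling M n I m f"
  obtains g where "\<And>k. k \<in> {1..n} \<Longrightarrow> g (f k) = k" "\<And>i. i \<in> I \<Longrightarrow> g i \<in> {1..n} \<and> f (g i) = i"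
proof
  have bij: "bij_betw f {1..n} I" using assms unfolding coxeter_labelling_def by blast
  show "the_inv_into {1..n} f (f k) = k" if "k \<in> {1..n}" for k
    using bij that by (simp add: bij_betw_def the_inv_into_f_f)
  show "the_inv_into {1..n} f i \<in> {1..n} \<and> f (the_inv_into {1..n} f i) = i" if "i \<in> I" for i
    using bij that by (metis bij_betw_def f_the_inv_into_f order_refl the_inv_into_into)
qed

lemma labelling_M: "coxeter_labelling M n I m f \<Longrightarrow> k \<in> {1..n} \<Longrightarrow> l \<in> {1..n} \<Longrightarrow> m (f k) (f l) = M k l"
  unfolding coxeter_labelling_def by blast

text \<open>The set \<open>N k\<close> contains the neighbours of \<open>k\<close>, but may also contain
  numbers beyond \<open>n\<close>. They only enlarge the sum, so one vector \<open>H\<close> and one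
  list of neighbours serve all subgraphs \<open>{1..n}\<close> of a type.\<close>

lemma labelled_type_bounded:
  assumes lab: "coxeter_labelling M n I m f" and r: "r = 4 \<or> r = 5"
    and H: "\<And>k. k \<in> {1..n} \<Longrightarrow> 0 < H k"
    and N: "\<And>k. k \<in> {1..n} \<Longrightarrow> finite (N k) \<and> k \<notin> N k"
      "\<And>k l. k \<in> {1..n} \<Longrightarrow> l \<in> {1..n} \<Longrightarrow> l \<noteq> k \<Longrightarrow> l \<notin> N k \<Longrightarrow> M k l = 2"
      "\<And>k l. k \<in> {1..n} \<Longrightarrow> l \<in> N k \<Longrightarrow> (M k l = 3 \<or> M k l = r) \<and> 0 \<le> H l"
    and super: "\<And>k. k \<in> {1..n} \<Longrightarrow> (\<Sum>l\<in>N k. twm (M k l) * H l) < 2 * H k"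
  shows bounded_words
proof -
  obtain g where g: "\<And>k. k \<in> {1..n} \<Longrightarrow> g (f k) = k" "\<And>i. i \<in> I \<Longrightarrow> g i \<in> {1..n} \<and> f (g i) = i"
    using labelling_inv[OF lab] by blast
  define \<alpha> \<beta> :: int where "\<alpha> = (if r = 4 then 0 else 1)" and "\<beta> = (if r = 4 then 2 else 1)"
  have sqrt2: "1 \<le> 2 * sqrt 2" using real_sqrt_ge_one[of 2] by linarith
  have t: "twm r * twm r = \<alpha> * twm r + \<beta>" "0 \<le> twm r" "1 \<le> 2 * twm r - \<alpha>"
    "\<bar>\<alpha> - twm r\<bar> \<le> twm r"
    using r twm_5 sqrt2 by (auto simp: \<alpha>_def \<beta>_def twm_4 power2_eq_square numeral_eq_iff[where 'a=enat])
  have nn: "0 \<le> twm (M k l) * H l" if "k \<in> {1..n}" "l \<in> N k" for k l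
    using N(3)[OF that] t(2) by (auto simp: twm_3)
  have r3: "r \<noteq> 3" "r \<noteq> 2" using r by (auto simp: numeral_eq_enat)
  show ?thesis
  proof (rule quadratic_bounded[OF t(1-3), of "\<lambda>i. H (g i)" "\<lambda>i j. if m i j = 3 then 1 else 0" "\<lambda>i j. if m i j = r then 1 else 0"])
    fix i assume i: "i \<in> I"
    let ?k = "g i"
    have k: "?k \<in> {1..n}" "f ?k = i" using g(2)[OF i] by auto
    show "0 < H (g i)" using H k by blast
    have "(\<Sum>j\<in>I - {f ?k}. tw (f ?k) j * H (g j)) \<le> (\<Sum>l\<in>N ?k. twm (M ?k l) * H l)"
      using g(1) N k(1) nn by (intro labelled_sum[OF lab k(1)]) auto
    then show "(\<Sum>j\<in>I - {i}. tw i j * H (g j)) < 2 * H (g i)" using super[OF k(1)] k(2) by simp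
    fix j assume j: "j \<in> I"
    show "(if m i j = 3 then 1 else 0) = (if m j i = 3 then (1::int) else 0) \<and>
      (if m i j = r then 1 else 0) = (if m j i = r then (1::int) else 0)" using m_sym[OF i j] by simp
    assume "i \<noteq> j"
    moreover have l: "g j \<in> {1..n}" "f (g j) = j" using g(2)[OF j] by auto
    ultimately have "g j \<noteq> ?k" "m i j = M ?k (g j)" using k labelling_M[OF lab k(1) l(1)] by auto
    then have "m i j = 2 \<or> m i j = 3 \<or> m i j = r"
      using N(2)[OF k(1) l(1)] N(3)[OF k(1), of "g j"] by auto
    then show "tw i j = real_of_int (if m i j = 3 then 1 else 0) + real_of_int (if m i j = r then 1 else 0) * twm r"
      "\<bar>real_of_int (if m i j = 3 then 1 else 0) + real_of_int (if m i j = r then 1 else 0) * (\<alpha> - twm r)\<bar> \<le> tw i j"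
      using t(4) r3 by (auto simp: tw_twm twm_2 twm_3)
  qed
qed

text \<open>The number \<open>Suc n\<close> is no node; the value \<open>H (Suc n)\<close> gives the
  inequality at the last node the same form as in the interior of the path.\<close>

lemma path_type_bounded:
  assumes lab: "coxeter_labelling M n I m f" and r: "r = 4 \<or> r = 5"
    and M: "\<And>k l. M k l = A_matrix k l \<or> A_matrix k l = 3 \<and> M k l = r"
    and H: "\<And>k. k \<in> {1..n} \<Longrightarrow> 0 < H k" "0 \<le> H (Suc n)"
    and first: "twm (M 1 2) * H 2 < 2 * H 1"
    and later: "\<And>k. 2 \<le> k \<Longrightarrow> k \<le> n \<Longrightarrow>
      twm (M k (k - 1)) * H (k - 1) + twm (M k (Suc k)) * H (Suc k) < 2 * H k"
  shows bounded_words
proof (rule labelled_type_bounded[OF lab r, where H = H and N = "\<lambda>k. if k = 1 then {2} else {k - 1, Suc k}"])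
  fix k assume k: "k \<in> {1..n}"
  let ?N = "if k = 1 then {2} else {k - 1, Suc k}"
  show "finite ?N \<and> k \<notin> ?N" using k by auto
  show "(\<Sum>l\<in>?N. twm (M k l) * H l) < 2 * H k" using first later[of k] k by auto
  fix l
  show "l \<in> {1..n} \<Longrightarrow> l \<noteq> k \<Longrightarrow> l \<notin> ?N \<Longrightarrow> M k l = 2"
    using M[of k l] k by (auto simp: A_matrix_def split: if_splits)
  assume "l \<in> ?N"
  then have "A_matrix k l = 3" "l = Suc n \<or> l \<in> {1..n}"
    using k by (auto simp: A_matrix_def split: if_splits)
  then show "(M k l = 3 \<or> M k l = r) \<and> 0 \<le> H l" using M[of k l] H(1)[of l] H(2) by auto
qed (rule H(1))

text \<open>The second difference of \<open>k\<^sup>2\<close> is \<open>2\<close>, so \<open>C -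
  k\<^sup>2\<close> has positive pairings in the interior of a path. The value at the first node
  compensates the factor \<open>sqrt 2\<close> of the multiple edge, and \<open>C\<close> is large
  enough for positivity up to \<open>n + 1\<close>.\<close>

lemma B_type_bounded:
  assumes lab: "coxeter_labelling B_matrix n I m f" shows bounded_words
proof (rule path_type_bounded[OF lab disjI1[OF HOL.refl],
    of "\<lambda>k. if k = 1 then ((real n + 2)\<^sup>2 - 1) / sqrt 2 else (real n + 2)\<^sup>2 - (real k)\<^sup>2"])
  let ?C = "(real n + 2)\<^sup>2"
  have sq: "(real l)\<^sup>2 < ?C" if "l \<le> Suc n" for l
    using that by (intro power_strict_mono) auto
  have C1: "1 < ?C" using power_strict_mono[of 1 "real n + 2" 2] by simp
  have M: "B_matrix 1 2 = 4" "B_matrix (Suc 1) 1 = 4" "\<And>l. 2 \<le> l \<Longrightarrow> B_matrix l (Suc l) = 3 \<and> B_matrix (Suc l) l = 3"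
    by (auto simp: B_matrix_def A_matrix_def doubleton_eq_iff)
  show "0 < (if k = 1 then (?C - 1) / sqrt 2 else ?C - (real k)\<^sup>2)" if "k \<in> {1..n}" for k
    using sq[of k] C1 that by auto
  show "0 \<le> (if Suc n = 1 then (?C - 1) / sqrt 2 else ?C - (real (Suc n))\<^sup>2)"
    using sq[of "Suc n"] C1 by auto
  show "B_matrix k l = A_matrix k l \<or> A_matrix k l = 3 \<and> B_matrix k l = 4" for k l
    by (auto simp: B_matrix_def A_matrix_def doubleton_eq_iff)
  have s2: "sqrt 2 * (sqrt 2 * x) = 2 * x" for x :: real by (simp add: mult.assoc[symmetric])
  show "twm (B_matrix 1 2) * (if (2 :: nat) = 1 then (?C - 1) / sqrt 2 else ?C - (real 2)\<^sup>2)
      < 2 * (if (1 :: nat) = 1 then (?C - 1) / sqrt 2 else ?C - (real 1)\<^sup>2)"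
    using M(1) by (simp add: twm_4 field_simps s2)
  fix k :: nat assume k: "2 \<le> k"
  then consider "k = 2" | j where "k = Suc j" "2 \<le> j" by (cases k) force+
  then show "twm (B_matrix k (k - 1)) * (if k - 1 = 1 then (?C - 1) / sqrt 2 else ?C - (real (k - 1))\<^sup>2)
      + twm (B_matrix k (Suc k)) * (if Suc k = 1 then (?C - 1) / sqrt 2 else ?C - (real (Suc k))\<^sup>2)
      < 2 * (if k = 1 then (?C - 1) / sqrt 2 else ?C - (real k)\<^sup>2)"
  proof cases
    case 1
    then show ?thesis using M(2) M(3)[of 2] by (simp add: twm_4 twm_3 numeral_2_eq_2[symmetric] numeral_3_eq_3[symmetric])
  next
    case 2
    then show ?thesis using M(3)[of j] M(3)[of "Suc j"] by (simp add: twm_3 power2_eq_square algebra_simps)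
  qed
qed

text \<open>As for type B, with the constants at the two short arms chosen to fit at the branch
  node.\<close>

lemma D_type_bounded:
  assumes lab: "coxeter_labelling D_matrix n I m f" shows bounded_words
proof (rule labelled_type_bounded[OF lab disjI1[OF HOL.refl],
    of "\<lambda>k. if k \<le> 2 then ((real n + 4)\<^sup>2 - 5) / 2 else (real n + 4)\<^sup>2 - (real k)\<^sup>2"
       "\<lambda>k. if k \<le> 2 then {3} else if k = 3 then {1, 2, 4} else {k - 1, Suc k}"])
  fix k assume k: "k \<in> {1..n}"
  let ?C = "(real n + 4)\<^sup>2" and ?N = "if k \<le> 2 then {3} else if k = 3 then {1, 2, 4} else {k - 1, Suc k}"
  have sq: "(real l)\<^sup>2 < ?C" if "l \<le> n + 3" for l
    using that by (intro power_strict_mono) auto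
  have C5: "5 < ?C" using power_mono[of 4 "real n + 4" 2] by simp
  show "0 < (if k \<le> 2 then (?C - 5) / 2 else ?C - (real k)\<^sup>2)"
    using sq[of k] C5 k by auto
  show "finite ?N \<and> k \<notin> ?N" using k by auto
  fix l
  show "l \<in> {1..n} \<Longrightarrow> l \<noteq> k \<Longrightarrow> l \<notin> ?N \<Longrightarrow> D_matrix k l = 2"
    using k by (auto simp: D_matrix_eq split: if_splits)
  assume l: "l \<in> ?N"
  have l': "l \<le> n + 3" using l k by (auto split: if_splits)
  have M: "D_matrix k l = 3" using k l by (auto simp: D_matrix_eq split: if_splits)
  show "(D_matrix k l = 3 \<or> D_matrix k l = 4) \<and> 0 \<le> (if l \<le> 2 then (?C - 5) / 2 else ?C - (real l)\<^sup>2)"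
    unfolding M using sq[OF l'] C5 by (auto simp: less_imp_le)
next
  fix k assume k: "k \<in> {1..n}"
  let ?C = "(real n + 4)\<^sup>2"
  have M: "D_matrix (Suc 0) 3 = 3" "D_matrix 2 3 = 3" "D_matrix 3 (Suc 0) = 3" "D_matrix 3 2 = 3" "D_matrix 3 4 = 3"
    "\<And>l. 3 \<le> l \<Longrightarrow> D_matrix l (Suc l) = 3" "\<And>l. 3 \<le> l \<Longrightarrow> D_matrix (Suc l) l = 3"
    by (auto simp: D_matrix_eq)
  consider "k = Suc 0" | "k = 2" | "k = 3" | j where "k = Suc j" "3 \<le> j" using k by (cases k) force+
  then show "(\<Sum>l\<in>(if k \<le> 2 then {3} else if k = 3 then {1, 2, 4} else {k - 1, Suc k}).
      twm (D_matrix k l) * (if l \<le> 2 then (?C - 5) / 2 else ?C - (real l)\<^sup>2))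
      < 2 * (if k \<le> 2 then (?C - 5) / 2 else ?C - (real k)\<^sup>2)"
  proof cases
    case 4
    then show ?thesis using M(6)[of "Suc j"] M(7)[of j] by (simp add: twm_3 power2_eq_square algebra_simps)
  qed (simp_all add: M twm_3)
qed

text \<open>The coefficients of the sum of the positive roots of \<open>E\<^sub>8\<close>; its pairing
  with every simple root is \<open>2\<close>. The entry \<open>0\<close> at \<open>9\<close> stands for
  the missing neighbour of node \<open>8\<close>.\<close>

definition E_height :: "nat \<Rightarrow> real" where
  "E_height k = [0, 92, 182, 136, 270, 220, 168, 114, 58, 0] ! k"

lemma E_type_bounded:
  assumes lab: "coxeter_labelling E_matrix n I m f" and n: "n \<le> 8" shows bounded_words
proof -
  define N :: "nat \<Rightarrow> nat set" where "N = (\<lambda>k. [{}, {2}, {1, 4}, {4}, {2, 3, 5}, {4, 6}, {5, 7}, {6, 8}, {7, 9}] ! k)"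
  have cases8: "k = 1 \<or> k = 2 \<or> k = 3 \<or> k = 4 \<or> k = 5 \<or> k = 6 \<or> k = 7 \<or> k = 8" if "k \<in> {1..n}" for k
    using that n by auto
  have E: "E_matrix k l = 3" if "k \<in> {1..n}" "l \<in> N k" for k l
    using cases8[OF that(1)] that(2)
    by (elim disjE) (auto simp: N_def E_matrix_eq)
  show ?thesis
  proof (rule labelled_type_bounded[OF lab disjI1[OF HOL.refl], of E_height N])
    fix k assume k: "k \<in> {1..n}"
    show "0 < E_height k" using cases8[OF k] by (auto simp: E_height_def)
    show "finite (N k) \<and> k \<notin> N k" using cases8[OF k] by (auto simp: N_def)
    show "(\<Sum>l\<in>N k. twm (E_matrix k l) * E_height l) < 2 * E_height k"
    proof -
      have "(\<Sum>l\<in>N k. twm (E_matrix k l) * E_height l) = (\<Sum>l\<in>N k. E_height l)"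
        by (rule sum.cong) (simp_all add: E[OF k] twm_3)
      also have "\<dots> < 2 * E_height k" using cases8[OF k] by (auto simp: N_def E_height_def)
      finally show ?thesis .
    qed
    fix l
    show "l \<in> {1..n} \<Longrightarrow> l \<noteq> k \<Longrightarrow> l \<notin> N k \<Longrightarrow> E_matrix k l = 2"
      using cases8[OF k] cases8[of l] by (elim disjE; simp add: N_def E_matrix_eq)
    assume l: "l \<in> N k"
    have "0 \<le> E_height l" using cases8[OF k] l by (auto simp: N_def E_height_def)
    then show "(E_matrix k l = 3 \<or> E_matrix k l = 4) \<and> 0 \<le> E_height l" using E[OF k l] by simp
  qed
qed

text \<open>The vector is the sum of the positive roots of \<open>F\<^sub>4\<close>, rescaled by
  \<open>sqrt 2\<close> at two nodes because here all simple roots have the same length.\<close>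

lemma F_type_bounded:
  assumes lab: "coxeter_labelling F_matrix n I m f" and n: "n \<le> 4" shows bounded_words
proof (rule path_type_bounded[OF lab disjI1[OF HOL.refl], of "\<lambda>k. [0, 16, 30, 21 * sqrt 2, 11 * sqrt 2, 0] ! k"])
  let ?H = "\<lambda>k. [0, 16, 30, 21 * sqrt 2, 11 * sqrt 2, 0] ! k"
  have M: "F_matrix 1 2 = 3" "F_matrix 2 1 = 3" "F_matrix 2 3 = 4" "F_matrix 3 2 = 4" "F_matrix 3 4 = 3" "F_matrix 4 3 = 3"
    by (simp_all add: F_matrix_eq)
  have s2: "sqrt 2 * (x * sqrt 2) = 2 * x" for x :: real
    using real_sqrt_mult_self[of 2] by (simp add: algebra_simps)
  have cases4: "k = 1 \<or> k = 2 \<or> k = 3 \<or> k = 4" if "k \<in> {1..n}" for k using that n by auto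
  show "0 < ?H k" if "k \<in> {1..n}" for k using cases4[OF that] by auto
  have "n = 0 \<or> n = 1 \<or> n = 2 \<or> n = 3 \<or> n = 4" using n by linarith
  then show "0 \<le> ?H (Suc n)" by auto
  show "F_matrix k l = A_matrix k l \<or> A_matrix k l = 3 \<and> F_matrix k l = 4" for k l
    by (auto simp: F_matrix_def A_matrix_def doubleton_eq_iff)
  show "twm (F_matrix 1 2) * ?H 2 < 2 * ?H 1" using M by (simp add: twm_3)
  show "twm (F_matrix k (k - 1)) * ?H (k - 1) + twm (F_matrix k (Suc k)) * ?H (Suc k) < 2 * ?H k" if "2 \<le> k" "k \<le> n" for k
    using cases4[of k] that M by (auto simp: twm_3 twm_4 s2)
qed

text \<open>The vector solves the inequalities with the golden ratio replaced by its upper bound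
  \<open>81 / 50\<close>.\<close>

lemma H_type_bounded:
  assumes lab: "coxeter_labelling H_matrix n I m f" and n: "n \<le> 4" shows bounded_words
proof (rule path_type_bounded[OF lab disjI2[OF HOL.refl], of "\<lambda>k. [0, 341 / 5, 84, 57, 29, 0] ! k"])
  let ?H = "\<lambda>k. [0, 341 / 5, 84, 57, 29, 0] ! k :: real"
  have t: "twm 5 < 81 / 50"
  proof (rule ccontr)
    assume "\<not> twm 5 < 81 / 50"
    then have "81 / 50 * twm 5 \<le> twm 5 * twm 5" using twm_5(2) by (intro mult_right_mono) auto
    moreover have "twm 5 * twm 5 = twm 5 + 1" using twm_5(1) by (simp add: power2_eq_square)
    ultimately show False using \<open>\<not> twm 5 < 81 / 50\<close> by linarith
  qed
  have M: "H_matrix 1 2 = 5" "H_matrix 2 1 = 5" "H_matrix 2 3 = 3" "H_matrix 3 2 = 3" "H_matrix 3 4 = 3" "H_matrix 4 3 = 3"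
    by (simp_all add: H_matrix_eq)
  have cases4: "k = 1 \<or> k = 2 \<or> k = 3 \<or> k = 4" if "k \<in> {1..n}" for k using that n by auto
  show "0 < ?H k" if "k \<in> {1..n}" for k using cases4[OF that] by auto
  have "n = 0 \<or> n = 1 \<or> n = 2 \<or> n = 3 \<or> n = 4" using n by linarith
  then show "0 \<le> ?H (Suc n)" by auto
  show "H_matrix k l = A_matrix k l \<or> A_matrix k l = 3 \<and> H_matrix k l = 5" for k l
    by (auto simp: H_matrix_def A_matrix_def doubleton_eq_iff)
  show "twm (H_matrix 1 2) * ?H 2 < 2 * ?H 1" using M t by simp
  show "twm (H_matrix k (k - 1)) * ?H (k - 1) + twm (H_matrix k (Suc k)) * ?H (Suc k) < 2 * ?H k" if "2 \<le> k" "k \<le> n" for k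
    using cases4[of k] that M t by (auto simp: twm_3)
qed

text \<open>An alive word alternates, and at length \<open>m a b + 1\<close> a braid move at its
  beginning creates a repetition.\<close>

lemma rank_two_bounded:
  assumes I: "I = {a, b}" "a \<noteq> b" and fin: "m a b < \<infinity>" shows bounded_words
proof -
  obtain n where n: "m a b = enat n" using fin by auto
  have "length w \<le> n" if w: "alive w" for w
  proof (rule ccontr)
    assume "\<not> length w \<le> n"
    then have len: "length (take (Suc n) w) = Suc n" by simp
    define u where "u = take (Suc n) w"
    have u: "alive u" "length u = Suc n" "u \<noteq> []" using alive_take[OF w] len by (auto simp: u_def)
    have su: "set u \<subseteq> {a, b}" using alive_lists[OF u(1)] I by auto
    define t s where "t = hd u" and "s = (if hd u = a then b else a)"
    have ts: "t \<in> I" "s \<in> I" "s \<noteq> t" "set u \<subseteq> {s, t}" "m t s = enat n" "m s t = enat n"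
      using su hd_in_set[OF u(3)] I n m_sym[of a b] by (auto simp: t_def s_def)
    have "u = alt_word t s (length u)"
    proof (rule no_square_alt_word[OF ts(4) _ u(3) _ ts(3)])
      show "hd u = t" by (simp add: t_def)
      fix p i q
      show "u \<noteq> p @ [i, i] @ q"
      proof
        assume eq: "u = p @ [i, i] @ q"
        then have "i \<in> I" using alive_lists[OF u(1)] by simp
        then show False using alive_null[of p "[i, i]" q] u(1) eq unfolding null_words_eq by auto
      qed
    qed
    then have u': "u = alt_word t s n @ [if even n then t else s]"
      using alt_word_add[of t s n 1] u(2) by simp
    obtain k where k: "n = Suc k" using m_enat[OF ts(1,2) ts(3)[symmetric] ts(5)] by (cases n) auto
    have bp: "{t, s} \<in> braid_pairs I m" using braid_pairs_iff ts by auto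
    have "u \<approx> alt_word s t n @ [if even n then t else s]"
      using braid_eq_swap[OF bp, of "[]" "[if even n then t else s]"] ts(5,6) u' by simp
    moreover have "alt_word s t n = alt_word s t k @ [if even n then t else s]"
      using alt_word_add[of s t k 1] k by auto
    ultimately have "alive (alt_word s t k @ [if even n then t else s, if even n then t else s] @ [])"
      using alive_cong u(1) by auto
    from alive_null[OF this] show False unfolding null_words_eq using ts by (cases "even n") auto
  qed
  then show ?thesis unfolding bounded_words_def by blast
qed

end

section \<open>Fully commutative elements\<close>

text \<open>Only commutations are kept, so the alive words are the reduced words of the fully
  commutative elements: no sequence of commutations leads to a repetition or to a braid word of length
  at least three.\<close>

locale fully_commutative =
  fixes I :: "'i set" and m :: "'i \<Rightarrow> 'i \<Rightarrow> enat"
  assumes coxm: "coxeter_matrix I m"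
begin

sublocale braid_words I m "\<lambda>_. 2" "braid_pairs_less I m 3"
  by unfold_locales (auto simp: coxm braid_pairs_less_def)

notation braid_eq (infix "\<approx>" 50)

definition comm :: "'i \<Rightarrow> 'i list \<Rightarrow> bool" where
  "comm a x \<longleftrightarrow> (\<forall>b\<in>set x. m a b = 2)"

lemma comm_simps [simp]: "comm a []" "comm a (b # x) \<longleftrightarrow> m a b = 2 \<and> comm a x"
  "comm a (x @ y) \<longleftrightarrow> comm a x \<and> comm a y"
  by (auto simp: comm_def)

lemma commuting_pair: "a \<in> I \<Longrightarrow> b \<in> I \<Longrightarrow> m a b = 2 \<Longrightarrow> {a, b} \<in> braid_pairs_less I m 3"
proof -
  assume h: "a \<in> I" "b \<in> I" "m a b = 2"
  then have "a \<noteq> b" using m_refl[of a] by (auto simp: one_enat_def numeral_eq_enat)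
  then have "{a, b} \<in> braid_pairs I m" using h by (simp add: braid_pairs_iff numeral_eq_enat)
  moreover have "m a b < 3" using h by (simp add: numeral_eq_enat)
  ultimately show ?thesis unfolding braid_pairs_less_def by blast
qed

lemma comm_right: "a \<in> I \<Longrightarrow> x \<in> lists I \<Longrightarrow> comm a x \<Longrightarrow> a # x \<approx> x @ [a]"
  by (rule commute) (auto simp: comm_def lists_eq_set intro!: commuting_pair)

lemma comm_left: "a \<in> I \<Longrightarrow> x \<in> lists I \<Longrightarrow> comm a x \<Longrightarrow> x @ [a] \<approx> a # x"
  using comm_right braid_eq_sym by blast

lemma no_square: "alive (p @ [i, i] @ q) \<Longrightarrow> False"
proof -
  assume a: "alive (p @ [i, i] @ q)"
  then have "i \<in> I" using alive_lists by force
  then show False using alive_no_power[OF a, of i] by (simp add: numeral_2_eq_2)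
qed

lemma no_braid:
  assumes a: "alive (p @ alt_word i j n @ q)" and "i \<in> I" "j \<in> I" "3 \<le> n" shows "m i j \<noteq> enat n"
proof
  assume n: "m i j = enat n"
  then have "i \<noteq> j" using assms m_refl[of i] by (auto simp: one_enat_def)
  have "{i, j} \<notin> braid_pairs_less I m 3"
  proof
    assume "{i, j} \<in> braid_pairs_less I m 3"
    then obtain a b where "{i, j} = {a, b}" "m a b < 3" unfolding braid_pairs_less_def by blast
    then have "m i j < 3" using m_sym[OF assms(2,3)] by (auto simp: doubleton_eq_iff)
    then show False using n assms(4) by (simp add: numeral_eq_enat)
  qed
  then have "{i, j} \<in> braid_pairs I m - braid_pairs_less I m 3"
    using assms(2,3) \<open>i \<noteq> j\<close> n by (simp add: braid_pairs_iff)
  then have "alt_word i j n \<in> null_words" unfolding null_words_def using n by force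
  then show False using alive_null[OF a] by blast
qed

lemma gap_not_comm:
  assumes "alive (p @ i # u @ i # q)" shows "\<not> comm i u"
proof
  assume c: "comm i u"
  have l: "i \<in> I" "u \<in> lists I" using alive_lists[OF assms] by auto
  have "p @ (i # u) @ (i # q) \<approx> p @ (u @ [i]) @ (i # q)"
    by (rule braid_eq_context[OF comm_right[OF l c]])
  then have "alive ((p @ u) @ [i, i] @ q)" using assms alive_cong by simp
  then show False by (rule no_square)
qed

lemma gap_one:
  assumes "alive (p @ i # y @ j # z @ i # q)" "comm i y" "comm i z" shows "m i j \<noteq> 3"
proof
  assume m3: "m i j = 3"
  have l: "i \<in> I" "j \<in> I" "y \<in> lists I" "z \<in> lists I" using alive_lists[OF assms(1)] by auto
  have "p @ (i # y) @ (j # z @ i # q) \<approx> p @ (y @ [i]) @ (j # z @ i # q)"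
    by (rule braid_eq_context[OF comm_right[OF l(1,3) assms(2)]])
  also have "p @ (y @ [i]) @ (j # z @ i # q) = (p @ y @ [i, j]) @ (z @ [i]) @ q" by simp
  also have "(p @ y @ [i, j]) @ (z @ [i]) @ q \<approx> (p @ y @ [i, j]) @ (i # z) @ q"
    by (rule braid_eq_context[OF comm_left[OF l(1,4) assms(3)]])
  finally have "alive ((p @ y) @ alt_word i j 3 @ (z @ q))"
    using assms(1) alive_cong by (simp add: numeral_3_eq_3)
  from no_braid[OF this l(1,2)] show False using m3 by (simp add: numeral_eq_enat)
qed

lemma chain_four:
  assumes "alive (p @ i # x @ j # y @ i # z @ j # q)" "comm i x" "comm i y" "comm j y" "comm j z"
  shows "m i j \<noteq> 4"
proof
  assume m4: "m i j = 4"
  have l: "i \<in> I" "j \<in> I" "x \<in> lists I" "y \<in> lists I" "z \<in> lists I" using alive_lists[OF assms(1)] by auto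
  have "p @ (i # x) @ (j # y @ i # z @ j # q) \<approx> p @ (x @ [i]) @ (j # y @ i # z @ j # q)"
    by (rule braid_eq_context[OF comm_right[OF l(1,3) assms(2)]])
  also have "p @ (x @ [i]) @ (j # y @ i # z @ j # q) = (p @ x @ [i, j]) @ (y @ [i]) @ (z @ j # q)" by simp
  also have "(p @ x @ [i, j]) @ (y @ [i]) @ (z @ j # q) \<approx> (p @ x @ [i, j]) @ (i # y) @ (z @ j # q)"
    by (rule braid_eq_context[OF comm_left[OF l(1,4) assms(3)]])
  also have "(p @ x @ [i, j]) @ (i # y) @ (z @ j # q) = (p @ x @ [i, j, i]) @ ((y @ z) @ [j]) @ q" by simp
  also have "(p @ x @ [i, j, i]) @ ((y @ z) @ [j]) @ q \<approx> (p @ x @ [i, j, i]) @ (j # y @ z) @ q"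
    by (rule braid_eq_context[OF comm_left]) (use l assms in auto)
  finally have "alive ((p @ x) @ alt_word i j 4 @ (y @ z @ q))"
    using assms(1) alive_cong by (simp add: eval_nat_numeral)
  from no_braid[OF this l(1,2)] show False using m4 by (simp add: numeral_eq_enat)
qed

lemma chain_five:
  assumes "alive (p @ i # x @ j # y @ i # z @ j # t @ i # q)"
    "comm i x" "comm i y" "comm j y" "comm j z" "comm i z" "comm i t"
  shows "m i j \<noteq> 5"
proof
  assume m5: "m i j = 5"
  have l: "i \<in> I" "j \<in> I" "x \<in> lists I" "y \<in> lists I" "z \<in> lists I" "t \<in> lists I"
    using alive_lists[OF assms(1)] by auto
  have "p @ (i # x) @ (j # y @ i # z @ j # t @ i # q) \<approx> p @ (x @ [i]) @ (j # y @ i # z @ j # t @ i # q)"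
    by (rule braid_eq_context[OF comm_right[OF l(1,3) assms(2)]])
  also have "p @ (x @ [i]) @ (j # y @ i # z @ j # t @ i # q)
      = (p @ x @ [i, j]) @ (y @ [i]) @ (z @ j # t @ i # q)" by simp
  also have "(p @ x @ [i, j]) @ (y @ [i]) @ (z @ j # t @ i # q) \<approx> (p @ x @ [i, j]) @ (i # y) @ (z @ j # t @ i # q)"
    by (rule braid_eq_context[OF comm_left[OF l(1,4) assms(3)]])
  also have "(p @ x @ [i, j]) @ (i # y) @ (z @ j # t @ i # q)
      = (p @ x @ [i, j, i]) @ ((y @ z) @ [j]) @ (t @ i # q)" by simp
  also have "(p @ x @ [i, j, i]) @ ((y @ z) @ [j]) @ (t @ i # q)
      \<approx> (p @ x @ [i, j, i]) @ (j # y @ z) @ (t @ i # q)"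
    by (rule braid_eq_context[OF comm_left]) (use l assms in auto)
  also have "(p @ x @ [i, j, i]) @ (j # y @ z) @ (t @ i # q)
      = (p @ x @ [i, j, i, j]) @ ((y @ z @ t) @ [i]) @ q" by simp
  also have "(p @ x @ [i, j, i, j]) @ ((y @ z @ t) @ [i]) @ q \<approx> (p @ x @ [i, j, i, j]) @ (i # y @ z @ t) @ q"
    by (rule braid_eq_context[OF comm_left]) (use l assms in auto)
  finally have "alive ((p @ x) @ alt_word i j 5 @ (y @ z @ t @ q))"
    using assms(1) alive_cong by (simp add: eval_nat_numeral)
  from no_braid[OF this l(1,2)] show False using m5 by (simp add: numeral_eq_enat)
qed

lemma length_by_count:
  assumes S: "\<And>w. alive w \<Longrightarrow> set w \<subseteq> S \<Longrightarrow> length w \<le> L"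
    and w: "alive w" "set w \<subseteq> insert c S"
  shows "length w \<le> count_list w c + (count_list w c + 1) * L"
  using w
proof (induction "count_list w c" arbitrary: w)
  case 0
  then have "c \<notin> set w" by (metis count_list_0_iff)
  then show ?case using 0 S[of w] by auto
next
  case (Suc k)
  then have "c \<in> set w" by (metis count_list_0_iff nat.distinct(1))
  then obtain p q where w: "w = p @ c # q" "c \<notin> set p" by (meson split_list_first)
  have "alive p" using alive_factor[of "[]" p "c # q"] Suc.prems w by simp
  then have "length p \<le> L" using S[of p] Suc.prems(2) w by auto
  moreover have "alive q" using alive_factor[of "p @ [c]" q "[]"] Suc.prems w by simp
  moreover have "count_list q c = k" using Suc.hyps(2) w by (simp add: count_list_append)
  ultimately have "length q \<le> k + (k + 1) * L" using Suc.hyps(1)[of q] Suc.prems(2) w by auto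
  then show ?case using \<open>length p \<le> L\<close> Suc.hyps(2)[symmetric] w by (simp add: algebra_simps)
qed

end

lemma count_list_split_two:
  assumes "2 \<le> count_list w a"
  obtains p u q where "w = p @ a # u @ a # q" "a \<notin> set u" "a \<notin> set p"
proof -
  have "a \<in> set w" using assms by (metis count_list_0_iff not_numeral_le_zero)
  then obtain p v where w: "w = p @ a # v" "a \<notin> set p" by (meson split_list_first)
  then have "a \<in> set v" using assms by (cases "a \<in> set v") (auto simp: count_list_append count_list_0_iff)
  then obtain u q where "v = u @ a # q" "a \<notin> set u" by (meson split_list_first)
  then show ?thesis using that w by simp
qed

text \<open>The common shape of the types E, F and H: beyond the core \<open>1, \<dots>, s\<close> there
  is a simply laced path of arbitrary length, attached to \<open>s\<close>.\<close>

locale fc_tail = fully_commutative "{1..n}" M for n :: nat and M +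
  fixes s :: nat
  assumes s: "1 \<le> s"
    and tail: "\<And>l l'. s < l \<Longrightarrow> l \<le> n \<Longrightarrow> l' \<in> {1..n} \<Longrightarrow> l' \<noteq> l \<Longrightarrow>
      M l l' = (if l' = Suc l \<or> l = Suc l' then 3 else 2)"
begin

text \<open>Between two consecutive letters \<open>l\<close> all letters commute with \<open>l\<close>
  except \<open>l - 1\<close> and \<open>l + 1\<close>. With none of these the two letters
  \<open>l\<close> would meet, with only one of them they would form a braid word.\<close>

lemma tail_gap:
  assumes al: "alive (p @ l # u @ l # q)" and l: "s < l" and u: "l \<notin> set u"
  shows "2 \<le> count_list u (l - 1) + count_list u (Suc l)"
proof (rule ccontr)
  assume few: "\<not> 2 \<le> count_list u (l - 1) + count_list u (Suc l)"
  have in_range: "l \<le> n" "set u \<subseteq> {1..n}" using alive_lists[OF al] by auto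
  have cm: "comm l v" if "set v \<subseteq> set u" "l - 1 \<notin> set v" "Suc l \<notin> set v" for v
    unfolding comm_def
  proof
    fix b assume "b \<in> set v"
    then have "b \<in> {1..n}" "b \<noteq> l" "b \<noteq> Suc l" "l \<noteq> Suc b" using that in_range u by auto
    then show "M l b = 2" using tail[OF l in_range(1)] by simp
  qed
  show False
  proof (cases "l - 1 \<in> set u \<or> Suc l \<in> set u")
    case False
    then show ?thesis using gap_not_comm[OF al] cm[of u] by simp
  next
    case True
    then obtain j where j: "j = l - 1 \<or> j = Suc l" "j \<in> set u" by blast
    then obtain y z where yz: "u = y @ j # z" by (meson split_list)
    have "l - 1 \<noteq> Suc l" by simp
    then have "l - 1 \<notin> set y \<union> set z \<and> Suc l \<notin> set y \<union> set z"
      using few j yz by (auto simp: count_list_append count_list_0_iff Suc_le_eq)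
    then have "comm l y" "comm l z" using cm[of y] cm[of z] yz by auto
    then have "M l j \<noteq> 3" using gap_one[of p l y j z q] al yz by simp
    moreover have "j \<in> {1..n}" "j \<noteq> l" using j in_range l by auto
    ultimately show False using tail[OF l in_range(1), of j] j l by (auto split: if_splits)
  qed
qed

text \<open>Two letters \<open>i + 1\<close> in a gap of \<open>i\<close> enclose a gap of \<open>i +
  1\<close> that does not contain \<open>i\<close>, hence contains \<open>i + 2\<close> twice, and so on
  until the tail ends.\<close>

lemma tail_next_once:
  assumes "s \<le> i" "i < n" "alive (i # u @ [i])" "i \<notin> set u"
  shows "count_list u (Suc i) \<le> 1"
  using assms
proof (induction "n - i" arbitrary: i u rule: less_induct)
  case less
  show ?case
  proof (rule ccontr)
    assume "\<not> count_list u (Suc i) \<le> 1"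
    then have "2 \<le> count_list u (Suc i)" by simp
    then obtain p v q where u: "u = p @ Suc i # v @ Suc i # q" "Suc i \<notin> set v"
      by (rule count_list_split_two)
    have al: "alive ((i # p) @ Suc i # v @ Suc i # (q @ [i]))" using less.prems(3) u by simp
    have "i \<notin> set v" using less.prems(4) u by simp
    then have two: "2 \<le> count_list v (Suc (Suc i))"
      using tail_gap[OF al _ u(2)] less.prems(1) by (simp add: count_list_0_iff)
    have "Suc i < n"
    proof (rule ccontr)
      assume "\<not> Suc i < n"
      then have "Suc (Suc i) \<notin> set v" using alive_lists[OF al] by auto
      then show False using two by (simp add: count_list_0_iff)
    qed
    moreover have "alive (Suc i # v @ [Suc i])"
      using alive_factor[of "i # p" "Suc i # v @ [Suc i]" "q @ [i]"] al by simp
    ultimately have "count_list v (Suc (Suc i)) \<le> 1"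
      using less.hyps[of "Suc i" v] less.prems(1,2) u(2) by auto
    then show False using two by simp
  qed
qed

text \<open>The same argument towards the core: a gap of \<open>l\<close> without \<open>l + 1\<close>
  contains a gap of \<open>l - 1\<close> without \<open>l\<close>.\<close>

lemma tail_core_gap:
  assumes "s \<le> l" "alive (l # u @ [l])" "l \<notin> set u" "Suc l \<notin> set u"
  shows "\<exists>p v q. l # u @ [l] = p @ s # v @ s # q \<and> s \<notin> set v \<and> Suc s \<notin> set v"
  using assms
proof (induction l arbitrary: u rule: dec_induct)
  case base
  then show ?case by (intro exI[of _ "[]"] exI[of _ u]) auto
next
  case (step l)
  have "alive ([] @ Suc l # u @ Suc l # [])" using step.prems by simp
  then have "2 \<le> count_list u l"
    using tail_gap[of "[]" "Suc l" u "[]"] step by (simp add: count_list_0_iff)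
  then obtain p v q where u: "u = p @ l # v @ l # q" "l \<notin> set v"
    using count_list_split_two by metis
  have "alive (l # v @ [l])" using alive_factor[of "Suc l # p" "l # v @ [l]" "q @ [Suc l]"] step.prems u by simp
  moreover have "Suc l \<notin> set v" using step.prems u by auto
  ultimately obtain p' v' q' where "l # v @ [l] = p' @ s # v' @ s # q'" "s \<notin> set v'" "Suc s \<notin> set v'"
    using step.IH u(2) by blast
  then show ?case using u
    by (intro exI[of _ "Suc l # p @ p'"] exI[of _ v'] exI[of _ "q' @ q @ [Suc l]"]) simp
qed

text \<open>Four letters \<open>l\<close> bound three gaps, each of which contains a gap of
  \<open>s\<close> without \<open>s + 1\<close>. The middle one has further letters \<open>s\<close> on
  both sides, which the hypothesis on the core forbids.\<close>

lemma tail_count: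
  assumes core: "\<And>p v q. alive (p @ s # v @ s # q) \<Longrightarrow> s \<notin> set v \<Longrightarrow> Suc s \<notin> set v \<Longrightarrow>
      s \<in> set p \<Longrightarrow> s \<in> set q \<Longrightarrow> False"
    and l: "s \<le> l" and w: "alive w" "set w \<subseteq> {1..l}"
  shows "count_list w l \<le> 3"
proof (rule ccontr)
  assume "\<not> count_list w l \<le> 3"
  then have c4: "4 \<le> count_list w l" by simp
  then obtain p0 u1 r1 where w1: "w = p0 @ l # u1 @ l # r1" "l \<notin> set u1" "l \<notin> set p0"
    using count_list_split_two[of w l] by auto
  then have "2 \<le> count_list r1 l" using c4 by (simp add: count_list_append count_list_0_iff)
  then obtain u2 u3' r2 where r1: "r1 = u2 @ l # u3' @ l # r2" "l \<notin> set u3'" "l \<notin> set u2"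
    using count_list_split_two by metis
  have big: "Suc l \<notin> set w" using w(2) by auto
  have a: "alive (l # u1 @ [l])" "alive (l # u2 @ [l])" "alive (l # u3' @ [l])"
    using alive_factor[of p0 "l # u1 @ [l]" r1] alive_factor[of "p0 @ l # u1" "l # u2 @ [l]" "u3' @ l # r2"]
      alive_factor[of "p0 @ l # u1 @ l # u2" "l # u3' @ [l]" r2] w(1) w1 r1 by simp_all
  obtain p v q where m: "l # u2 @ [l] = p @ s # v @ s # q" "s \<notin> set v" "Suc s \<notin> set v"
    using tail_core_gap[OF l a(2) r1(3)] big w1 r1 by auto
  have s1: "s \<in> set (l # u1)" "s \<in> set (u3' @ [l])"
  proof -
    have "s \<in> set (l # u1 @ [l])"
      using tail_core_gap[OF l a(1) w1(2)] big w1 by (metis in_set_conv_decomp Un_iff set_append list.set_intros(2))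
    then show "s \<in> set (l # u1)" by auto
    have "s \<in> set (l # u3' @ [l])"
      using tail_core_gap[OF l a(3) r1(2)] big w1 r1 by (metis in_set_conv_decomp Un_iff set_append list.set_intros(2))
    then show "s \<in> set (u3' @ [l])" by auto
  qed
  have "w = p0 @ (l # u1) @ (l # u2 @ [l]) @ (u3' @ [l]) @ r2" using w1 r1 by simp
  then have "w = (p0 @ (l # u1) @ p) @ s # v @ s # (q @ (u3' @ [l]) @ r2)" using m by simp
  then show False using core[of "p0 @ (l # u1) @ p" v "q @ (u3' @ [l]) @ r2"] w(1) m s1 by auto
qed

lemma tail_bounded:
  assumes core: "\<And>p v q. alive (p @ s # v @ s # q) \<Longrightarrow> s \<notin> set v \<Longrightarrow> Suc s \<notin> set v \<Longrightarrow>
      s \<in> set p \<Longrightarrow> s \<in> set q \<Longrightarrow> False"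
    and base: "\<And>w. alive w \<Longrightarrow> set w \<subseteq> {1..<s} \<Longrightarrow> length w \<le> L"
  shows bounded_words
proof -
  have "\<exists>L. \<forall>w. alive w \<longrightarrow> set w \<subseteq> {1..s - 1 + k} \<longrightarrow> length w \<le> L" for k
  proof (induction k)
    case 0
    have "{1..<s} = {1..s - 1 + 0}" using s by auto
    then show ?case using base by (intro exI[of _ L]) auto
  next
    case (Suc k)
    let ?l = "s - 1 + Suc k" and ?S = "{1..s - 1 + k}"
    obtain L where L: "\<And>w. alive w \<Longrightarrow> set w \<subseteq> ?S \<Longrightarrow> length w \<le> L" using Suc by blast
    have ins: "{1..?l} = insert ?l ?S" by auto
    have "length w \<le> 3 + (3 + 1) * L" if w: "alive w" "set w \<subseteq> {1..?l}" for w
    proof -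
      have c: "count_list w ?l \<le> 3"
      proof (rule tail_count[OF _ _ w])
        fix p v q assume "alive (p @ s # v @ s # q)" "s \<notin> set v" "Suc s \<notin> set v" "s \<in> set p" "s \<in> set q"
        then show False by (rule core)
      qed simp
      have "length w \<le> count_list w ?l + (count_list w ?l + 1) * L"
        using length_by_count[of ?S L w ?l] L w ins by simp
      also have "\<dots> \<le> 3 + (3 + 1) * L" using c by (intro add_mono mult_mono) auto
      finally show ?thesis .
    qed
    then show ?case by blast
  qed
  from this[of n] obtain L where L: "\<And>w. alive w \<Longrightarrow> set w \<subseteq> {1..s - 1 + n} \<Longrightarrow> length w \<le> L" by blast
  have "length w \<le> L" if w: "alive w" for w
  proof (rule L[OF w])
    show "set w \<subseteq> {1..s - 1 + n}" using alive_lists[OF w] s by force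
  qed
  then show ?thesis unfolding bounded_words_def by blast
qed

end

context fully_commutative begin

lemma comm_notin:
  assumes "i \<in> I" "set x \<subseteq> I" "\<And>b. b \<in> I \<Longrightarrow> b \<noteq> i \<Longrightarrow> b \<notin> N \<Longrightarrow> m i b = 2" "i \<notin> set x" "set x \<inter> N = {}"
  shows "comm i x"
  using assms unfolding comm_def by blast

lemma gap_contains:
  assumes al: "alive (p @ i # u @ i # q)" and u: "i \<notin> set u"
    and N: "\<And>b. b \<in> I \<Longrightarrow> b \<noteq> i \<Longrightarrow> b \<notin> N \<Longrightarrow> m i b = 2"
  shows "set u \<inter> N \<noteq> {}"
proof
  assume "set u \<inter> N = {}"
  moreover have "i \<in> I" "set u \<subseteq> I" using alive_lists[OF al] by auto
  ultimately have "comm i u" using comm_notin[of i u N] N u by blast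
  then show False using gap_not_comm[OF al] by blast
qed

lemma leaf_once:
  assumes al: "alive u" and j: "j \<notin> set u" and N: "\<And>b. b \<in> I \<Longrightarrow> b \<noteq> i \<Longrightarrow> b \<notin> {j} \<Longrightarrow> m i b = 2"
  shows "count_list u i \<le> 1"
proof (rule ccontr)
  assume "\<not> count_list u i \<le> 1"
  then have "2 \<le> count_list u i" by simp
  then obtain p v q where v: "u = p @ i # v @ i # q" "i \<notin> set v" by (rule count_list_split_two)
  then have "set v \<inter> {j} \<noteq> {}" using gap_contains[of p i v q "{j}"] al N by auto
  then show False using j v by auto
qed

lemma once_split:
  assumes "count_list u a \<le> 1" "a \<in> set u"
  obtains y z where "u = y @ a # z" "a \<notin> set y" "a \<notin> set z"
proof -
  obtain y z where "u = y @ a # z" "a \<notin> set y" using assms(2) by (meson split_list_first)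
  moreover have "a \<notin> set z" using assms(1) calculation by (auto simp: count_list_append count_list_0_iff)
  ultimately show ?thesis using that by blast
qed

text \<open>The leaf \<open>i\<close> commutes with everything but \<open>j\<close>, so the displayed
  letters can be moved together to the braid word \<open>i j i\<close>.\<close>

lemma leaf_not_twice:
  assumes al: "alive (p @ i # x @ j # y @ i # q)" and ni: "i \<notin> set x" "i \<notin> set y" "j \<notin> set x" "j \<notin> set y"
    and N: "\<And>b. b \<in> I \<Longrightarrow> b \<noteq> i \<Longrightarrow> b \<notin> {j} \<Longrightarrow> m i b = 2"
  shows "m i j \<noteq> 3"
proof (rule gap_one[OF al])
  have "i \<in> I" "set x \<subseteq> I" "set y \<subseteq> I" using alive_lists[OF al] by auto
  then show "comm i x" "comm i y" using comm_notin[of i x "{j}"] comm_notin[of i y "{j}"] N ni by auto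
qed

text \<open>The arm is \<open>a - b - c\<close> with the leaf \<open>a\<close>. In a word without
  \<open>c\<close> only letters \<open>a\<close> can separate two letters \<open>b\<close>, and a single
  \<open>a\<close> between them gives the braid word \<open>b a b\<close>.\<close>

lemma arm_middle_once:
  assumes u: "alive u" "c \<notin> set u"
    and Na: "\<And>x. x \<in> I \<Longrightarrow> x \<noteq> a \<Longrightarrow> x \<notin> {b} \<Longrightarrow> m a x = 2"
    and Nb: "\<And>x. x \<in> I \<Longrightarrow> x \<noteq> b \<Longrightarrow> x \<notin> {a, c} \<Longrightarrow> m b x = 2"
    and m: "m b a = 3"
  shows "count_list u b \<le> 1"
proof (rule ccontr)
  assume "\<not> count_list u b \<le> 1"
  then have "2 \<le> count_list u b" by simp
  then obtain p v q where v: "u = p @ b # v @ b # q" "b \<notin> set v" by (rule count_list_split_two)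
  then have "set v \<inter> {a, c} \<noteq> {}" using gap_contains[of p b v q "{a, c}"] u Nb by auto
  then have "a \<in> set v" using u v by auto
  moreover have "alive v" using alive_factor[of "p @ [b]" v "b # q"] u v by simp
  then have "count_list v a \<le> 1" using leaf_once[of v b a] v(2) Na by blast
  ultimately obtain y z where yz: "v = y @ a # z" "a \<notin> set y" "a \<notin> set z" using once_split by metis
  have "comm b y" "comm b z"
    using comm_notin[of b y "{a, c}"] comm_notin[of b z "{a, c}"] alive_lists[OF u(1)] u v yz Nb by auto
  then show False using gap_one[of p b y a z q] u(1) v(1) yz(1) m by simp
qed

lemma arm_end_once:
  assumes u: "alive u" "c \<notin> set u"
    and Na: "\<And>x. x \<in> I \<Longrightarrow> x \<noteq> a \<Longrightarrow> x \<notin> {b} \<Longrightarrow> m a x = 2"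
    and Nb: "\<And>x. x \<in> I \<Longrightarrow> x \<noteq> b \<Longrightarrow> x \<notin> {a, c} \<Longrightarrow> m b x = 2"
    and m: "m b a = 3" "m a b = 3"
  shows "count_list u a \<le> 1"
proof (rule ccontr)
  assume "\<not> count_list u a \<le> 1"
  then have "2 \<le> count_list u a" by simp
  then obtain p v q where v: "u = p @ a # v @ a # q" "a \<notin> set v" by (rule count_list_split_two)
  then have "b \<in> set v" using gap_contains[of p a v q "{b}"] u(1) Na by auto
  moreover have "alive v" using alive_factor[of "p @ [a]" v "a # q"] u v by simp
  then have "count_list v b \<le> 1" using u(2) v(1) by (intro arm_middle_once[OF _ _ Na Nb m(1)]) auto
  ultimately obtain y z where yz: "v = y @ b # z" "b \<notin> set y" "b \<notin> set z" using once_split by metis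
  then show False using leaf_not_twice[of p a y b z q] u(1) v Na m by auto
qed

end

context fc_tail begin

lemma core_split:
  assumes al: "alive (p @ s # v @ s # q)" and sp: "s \<in> set p" "s \<in> set q"
  obtains p' x y q' where "p = p' @ s # x" "q = y @ s # q'" "s \<notin> set x" "s \<notin> set y"
    "count_list x (Suc s) \<le> 1" "count_list y (Suc s) \<le> 1"
proof -
  obtain p' x where p: "p = p' @ s # x" "s \<notin> set x" using sp(1) by (meson split_list_last)
  obtain y q' where q: "q = y @ s # q'" "s \<notin> set y" using sp(2) by (meson split_list_first)
  have a: "alive (s # x @ [s])" "alive (s # y @ [s])"
    using alive_factor[of p' "s # x @ [s]" "v @ s # q"] alive_factor[of "p @ s # v" "s # y @ [s]" q'] al p q by simp_all
  have "count_list z (Suc s) \<le> 1" if z: "alive (s # z @ [s])" "s \<notin> set z" for z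
  proof (cases "s < n")
    case True
    then show ?thesis using tail_next_once[of s z] z by simp
  next
    case False
    then have "Suc s \<notin> set z" using alive_lists[OF z(1)] by auto
    then show ?thesis by (simp add: count_list_0_iff)
  qed
  then show ?thesis using that p q a by blast
qed

text \<open>Between two consecutive letters \<open>s\<close> the tail contributes at most one letter
  \<open>s + 1\<close>, which does not suffice to separate them; so another neighbour of
  \<open>s\<close> has to help.\<close>

lemma core_gap_neighbour:
  assumes al: "alive (P @ s # x @ s # Q)" and x: "s \<notin> set x" "count_list x (Suc s) \<le> 1"
    and N: "\<And>b. b \<in> {1..n} \<Longrightarrow> b \<noteq> s \<Longrightarrow> b \<notin> insert (Suc s) N \<Longrightarrow> M s b = 2"
  shows "set x \<inter> N \<noteq> {}"
proof
  assume emp: "set x \<inter> N = {}"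
  have I: "s \<in> {1..n}" "set x \<subseteq> {1..n}" using alive_lists[OF al] by auto
  have cm: "comm s z" if "set z \<subseteq> set x" "Suc s \<notin> set z" for z
    by (rule comm_notin[of s z "insert (Suc s) N"]) (use that I N x emp in auto)
  show False
  proof (cases "Suc s \<in> set x")
    case True
    then obtain y z where yz: "x = y @ Suc s # z" "Suc s \<notin> set y" "Suc s \<notin> set z"
      using once_split[OF x(2)] by blast
    then have "M s (Suc s) \<noteq> 3" using gap_one[of P s y "Suc s" z Q] al cm[of y] cm[of z] by auto
    moreover have "Suc s \<in> {1..n}" using True I by auto
    ultimately show False using tail[of "Suc s" s] m_sym[of s "Suc s"] I by auto
  next
    case False
    then show False using gap_not_comm[OF al] cm[of x] by auto
  qed
qed

end

text \<open>Consider a gap of the branch node \<open>4\<close> that contains no \<open>5\<close> and has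
  further letters \<open>4\<close> on both sides. It contains each of \<open>2\<close> and
  \<open>3\<close> exactly once. The neighbouring gaps cannot contain the leaf \<open>3\<close>, because
  \<open>3 4 3\<close> is null, and so they contain \<open>2\<close>. Around the letter \<open>2\<close>
  of the gap this gives \<open>2 4 2 4 2\<close>, where a \<open>1\<close> is needed between consecutive
  letters \<open>2\<close>, and then \<open>1 2 1\<close> appears.\<close>

lemma E_fully_commutative_bounded:
  assumes cox: "coxeter_matrix {1..n} E_matrix"
  shows "braid_words.bounded_words {1..n} E_matrix (\<lambda>_. 2) (braid_pairs_less {1..n} E_matrix 3)"
proof -
  interpret fc_tail n E_matrix 4
    by unfold_locales (use cox in \<open>auto simp: E_matrix_eq\<close>)
  have N4: "\<And>b. b \<in> {1..n} \<Longrightarrow> b \<noteq> 4 \<Longrightarrow> b \<notin> insert (Suc 4) {2, 3} \<Longrightarrow> E_matrix 4 b = 2"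
    and N3: "\<And>b. b \<in> {1..n} \<Longrightarrow> b \<noteq> 3 \<Longrightarrow> b \<notin> {4} \<Longrightarrow> E_matrix 3 b = 2"
    and N2: "\<And>b. b \<in> {1..n} \<Longrightarrow> b \<noteq> 2 \<Longrightarrow> b \<notin> {1, 4} \<Longrightarrow> E_matrix 2 b = 2"
    and N1: "\<And>b. b \<in> {1..n} \<Longrightarrow> b \<noteq> 1 \<Longrightarrow> b \<notin> {2} \<Longrightarrow> E_matrix 1 b = 2"
    by (auto simp: E_matrix_eq)
  have E: "E_matrix 1 2 = 3" "E_matrix 2 1 = 3" "E_matrix 2 4 = 3" "E_matrix 3 4 = 3" by (simp_all add: E_matrix_eq)
  note two_once = arm_middle_once[OF _ _ N1 N2 E(2)]
  show ?thesis
  proof (rule tail_bounded[of 3])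
    fix w assume w: "alive w" "set w \<subseteq> {1..<4}"
    have four: "4 \<notin> set w" using w(2) by auto
    then have "count_list w 3 \<le> 1" "count_list w 2 \<le> 1"
      using leaf_once[OF w(1) four N3] two_once[OF w(1)] by auto
    moreover have "count_list w 1 \<le> 1" by (rule arm_end_once[OF w(1) four N1 N2 E(2,1)])
    moreover have "length w = count_list w 1 + count_list w 2 + count_list w 3"
      using w(2) by (induction w) auto
    ultimately show "length w \<le> 3" by simp
  next
    fix p v q assume al: "alive (p @ 4 # v @ 4 # q)" and v: "4 \<notin> set v" "Suc 4 \<notin> set v"
      and sp: "4 \<in> set p" "4 \<in> set q"
    obtain p' x y q' where xy: "p = p' @ 4 # x" "q = y @ 4 # q'" "4 \<notin> set x" "4 \<notin> set y"
      "count_list x (Suc 4) \<le> 1" "count_list y (Suc 4) \<le> 1" by (rule core_split[OF al sp])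
    have av: "alive v" using alive_factor[of "p @ [4]" v "4 # q"] al by simp
    have v1: "count_list v 2 \<le> 1" "count_list v 3 \<le> 1" using two_once[OF av v(1)] leaf_once[OF av v(1) N3] by auto
    have gapv: "z \<in> set v" if z: "z \<in> {2, 3}" for z
    proof (rule ccontr)
      assume nz: "z \<notin> set v"
      have N: "\<And>b. b \<in> {1..n} \<Longrightarrow> b \<noteq> 4 \<Longrightarrow> b \<notin> {2, 3, 5} \<Longrightarrow> E_matrix 4 b = 2" using N4 by simp
      have Iv: "set v \<subseteq> {1..n}" "4 \<in> {1..n}" using alive_lists[OF al] by auto
      \<comment> \<open>the other element of \<open>{2, 3}\<close>\<close>
      define z' :: nat where "z' = 5 - z"
      have z': "z' \<in> {2, 3}" "z' \<noteq> z" "{2, 3} = {z, z'}" using z by (auto simp: z'_def)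
      have "set v \<inter> {2, 3, 5} \<noteq> {}" using gap_contains[OF al v(1) N] by blast
      then have "z' \<in> set v" using nz v(2) z z' by auto
      moreover have "count_list v z' \<le> 1" using v1 z'(1) by auto
      ultimately obtain a b where ab: "v = a @ z' # b" "z' \<notin> set a" "z' \<notin> set b" using once_split by metis
      have "2 \<in> {z, z'}" "3 \<in> {z, z'}" using z'(3) by blast+
      then have "2 \<notin> set a" "3 \<notin> set a" "2 \<notin> set b" "3 \<notin> set b" using ab nz by auto
      then have "comm 4 a" "comm 4 b"
        using comm_notin[of 4 a "{2, 3, 5}"] comm_notin[of 4 b "{2, 3, 5}"] Iv N ab(1) v by auto
      then have "E_matrix 4 z' \<noteq> 3" using gap_one[of p 4 a z' b q] al ab(1) by simp
      then show False using z'(1) by (auto simp: E_matrix_eq)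
    qed
    have side: "2 \<in> set x" "2 \<in> set y"
    proof -
      obtain a b where ab: "v = a @ 3 # b" "3 \<notin> set a" "3 \<notin> set b" using once_split[OF v1(2) gapv] by auto
      have "3 \<notin> set x"
      proof
        assume "3 \<in> set x"
        then obtain x1 x2 where x12: "x = x1 @ 3 # x2" "3 \<notin> set x2" by (meson split_list_last)
        then show False using leaf_not_twice[of "p' @ 4 # x1" 3 x2 4 a "b @ 4 # q"] al xy ab v(1) N3 E by auto
      qed
      then show "2 \<in> set x"
        using core_gap_neighbour[of p' x "v @ 4 # q" "{2, 3}"] al xy N4 by auto
      have "3 \<notin> set y"
      proof
        assume "3 \<in> set y"
        then obtain y1 y2 where y12: "y = y1 @ 3 # y2" "3 \<notin> set y1" by (meson split_list_first)
        then show False using leaf_not_twice[of "p @ 4 # a" 3 b 4 y1 "y2 @ 4 # q'"] al xy ab v(1) N3 E by auto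
      qed
      then show "2 \<in> set y"
        using core_gap_neighbour[of "p @ 4 # v" y q' "{2, 3}"] al xy N4 by auto
    qed
    obtain x1 x2 where x: "x = x1 @ 2 # x2" "2 \<notin> set x2" using side(1) by (meson split_list_last)
    obtain y1 y2 where y: "y = y1 @ 2 # y2" "2 \<notin> set y1" using side(2) by (meson split_list_first)
    obtain u1 u2 where u: "v = u1 @ 2 # u2" "2 \<notin> set u1" "2 \<notin> set u2" using once_split[OF v1(1) gapv] by auto
    have al': "alive (p' @ 4 # x1 @ 2 # x2 @ 4 # u1 @ 2 # u2 @ 4 # y1 @ 2 # y2 @ 4 # q')"
      using al xy x y u by simp
    note I = alive_lists[OF al']
    have gap_one_in: "1 \<in> set a \<or> 1 \<in> set b"
      if ab: "alive (P @ 2 # a @ 4 # b @ 2 # Q)" "2 \<notin> set a" "2 \<notin> set b" "4 \<notin> set a" "4 \<notin> set b" for P a b Q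
    proof (rule ccontr)
      assume "\<not> (1 \<in> set a \<or> 1 \<in> set b)"
      then have "comm 2 a" "comm 2 b"
        using comm_notin[of 2 a "{1, 4}"] comm_notin[of 2 b "{1, 4}"] alive_lists[OF ab(1)] ab N2 by auto
      then show False using gap_one[OF ab(1)] E by simp
    qed
    have "1 \<in> set (x2 @ 4 # u1)" "1 \<in> set (u2 @ 4 # y1)"
      using gap_one_in[of "p' @ 4 # x1" x2 u1 "u2 @ 4 # y1 @ 2 # y2 @ 4 # q'"]
        gap_one_in[of "p' @ 4 # x1 @ 2 # x2 @ 4 # u1" u2 y1 "y2 @ 4 # q'"] al' xy v x y u by auto
    then obtain a1 a2 b1 b2 where "x2 @ 4 # u1 = a1 @ 1 # a2" "1 \<notin> set a2" "u2 @ 4 # y1 = b1 @ 1 # b2" "1 \<notin> set b1"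
      by (meson split_list_last split_list_first)
    moreover have "2 \<notin> set (x2 @ 4 # u1)" "2 \<notin> set (u2 @ 4 # y1)" using x y u by auto
    moreover have "alive ((p' @ 4 # x1 @ [2]) @ (x2 @ 4 # u1) @ 2 # (u2 @ 4 # y1) @ (2 # y2 @ 4 # q'))"
      using al' by simp
    ultimately have "alive ((p' @ 4 # x1 @ 2 # a1) @ 1 # a2 @ 2 # b1 @ 1 # (b2 @ 2 # y2 @ 4 # q'))"
      "2 \<notin> set a2" "2 \<notin> set b1" "1 \<notin> set a2" "1 \<notin> set b1" by auto
    then show False using leaf_not_twice[of "p' @ 4 # x1 @ 2 # a1" 1 a2 2 b1 "b2 @ 2 # y2 @ 4 # q'"] N1 E by auto
  qed
qed

context fc_tail begin

text \<open>If \<open>r\<close> is the only neighbour of \<open>s\<close> outside the tail, then the two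
  letters \<open>s\<close> around the gap alternate with letters \<open>r\<close>.\<close>

lemma alternating_core:
  assumes al: "alive (p @ s # v @ s # q)" and v: "s \<notin> set v" "Suc s \<notin> set v"
    and sp: "s \<in> set p" "s \<in> set q"
    and N: "\<And>b. b \<in> {1..n} \<Longrightarrow> b \<noteq> s \<Longrightarrow> b \<notin> insert (Suc s) {r} \<Longrightarrow> M s b = 2"
    and once: "\<And>u. alive u \<Longrightarrow> s \<notin> set u \<Longrightarrow> count_list u r \<le> 1"
  obtains P x u1 u2 y Q where "p @ s # v @ s # q = P @ r # x @ s # u1 @ r # u2 @ s # y @ r # Q"
    "s \<notin> set x" "r \<notin> set x" "s \<notin> set u1" "Suc s \<notin> set u1" "r \<notin> set u1"
    "s \<notin> set u2" "Suc s \<notin> set u2" "r \<notin> set u2" "s \<notin> set y" "r \<notin> set y"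
proof -
  obtain p' x y q' where xy: "p = p' @ s # x" "q = y @ s # q'" "s \<notin> set x" "s \<notin> set y"
    "count_list x (Suc s) \<le> 1" "count_list y (Suc s) \<le> 1" by (rule core_split[OF al sp])
  have "r \<in> set x"
    using core_gap_neighbour[of p' x "v @ s # q" "{r}"] al xy N by auto
  then obtain x1 x2 where x: "x = x1 @ r # x2" "r \<notin> set x2" by (meson split_list_last)
  have "r \<in> set y"
    using core_gap_neighbour[of "p @ s # v" y q' "{r}"] al xy N by auto
  then obtain y1 y2 where y: "y = y1 @ r # y2" "r \<notin> set y1" by (meson split_list_first)
  have "r \<in> set v"
    using core_gap_neighbour[of p v q "{r}"] al v N by (auto simp: count_list_0_iff)
  moreover have "count_list v r \<le> 1" using once[of v] v alive_factor[of "p @ [s]" v "s # q"] al by simp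
  ultimately obtain u1 u2 where u: "v = u1 @ r # u2" "r \<notin> set u1" "r \<notin> set u2" using once_split by metis
  show ?thesis
    by (rule that[of "p' @ s # x1" x2 u1 u2 y1 "y2 @ s # q'"]) (use xy x y u v in auto)
qed

end

text \<open>Here the pattern is \<open>2 3 2 3 2\<close> with \<open>m\<^sub>2\<^sub>3 = 4\<close>. A
  letter \<open>1\<close> must interrupt both \<open>2 3 2 3\<close> and \<open>3 2 3 2\<close>, and the
  two letters \<open>1\<close> around the middle \<open>2\<close> give \<open>1 2 1\<close>.\<close>

lemma F_fully_commutative_bounded:
  assumes cox: "coxeter_matrix {1..n} F_matrix"
  shows "braid_words.bounded_words {1..n} F_matrix (\<lambda>_. 2) (braid_pairs_less {1..n} F_matrix 3)"
proof -
  interpret fc_tail n F_matrix 3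
    by unfold_locales (use cox in \<open>auto simp: F_matrix_eq\<close>)
  have N3: "\<And>b. b \<in> {1..n} \<Longrightarrow> b \<noteq> 3 \<Longrightarrow> b \<notin> insert (Suc 3) {2} \<Longrightarrow> F_matrix 3 b = 2"
    and N2: "\<And>b. b \<in> {1..n} \<Longrightarrow> b \<noteq> 2 \<Longrightarrow> b \<notin> {1, 3} \<Longrightarrow> F_matrix 2 b = 2"
    and N1: "\<And>b. b \<in> {1..n} \<Longrightarrow> b \<noteq> 1 \<Longrightarrow> b \<notin> {2} \<Longrightarrow> F_matrix 1 b = 2"
    by (auto simp: F_matrix_eq)
  have E: "F_matrix 1 2 = 3" "F_matrix 2 1 = 3" "F_matrix 2 3 = 4" "F_matrix 3 2 = 4" by (simp_all add: F_matrix_eq)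
  note two_once = arm_middle_once[OF _ _ N1 N2 E(2)]
  show ?thesis
  proof (rule tail_bounded[of 2])
    fix w assume w: "alive w" "set w \<subseteq> {1..<3}"
    have three: "3 \<notin> set w" using w(2) by auto
    have "count_list w 2 \<le> 1" using two_once[OF w(1) three] .
    moreover have "count_list w 1 \<le> 1" by (rule arm_end_once[OF w(1) three N1 N2 E(2,1)])
    moreover have "length w = count_list w 1 + count_list w 2"
      using w(2) by (induction w) auto
    ultimately show "length w \<le> 2" by simp
  next
    fix p v q assume al: "alive (p @ 3 # v @ 3 # q)" and v: "3 \<notin> set v" "Suc 3 \<notin> set v"
      and sp: "3 \<in> set p" "3 \<in> set q"
    obtain P x u1 u2 y Q where eq: "p @ 3 # v @ 3 # q = P @ 2 # x @ 3 # u1 @ 2 # u2 @ 3 # y @ 2 # Q"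
      and ni: "3 \<notin> set x" "2 \<notin> set x" "3 \<notin> set u1" "Suc 3 \<notin> set u1" "2 \<notin> set u1"
        "3 \<notin> set u2" "Suc 3 \<notin> set u2" "2 \<notin> set u2" "3 \<notin> set y" "2 \<notin> set y"
      by (rule alternating_core[OF al v sp N3 two_once])
    have al': "alive (P @ 2 # x @ 3 # u1 @ 2 # u2 @ 3 # y @ 2 # Q)" using al eq by simp
    note I = alive_lists[OF al']
    have sub: "set u1 \<subseteq> {1..n}" "set u2 \<subseteq> {1..n}" "3 \<in> {1..n}" "set x \<subseteq> {1..n}" "set y \<subseteq> {1..n}"
      using I by auto
    have c3: "comm 3 u1" "comm 3 u2"
      using comm_notin[OF sub(3,1), of "{2, 4}"] comm_notin[OF sub(3,2), of "{2, 4}"] N3 ni by auto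
    have c2: "comm 2 z" if "set z \<subseteq> {1..n}" "2 \<notin> set z" "3 \<notin> set z" "1 \<notin> set z" for z
      using comm_notin[of 2 z "{1, 3}"] I N2 that by auto
    have "1 \<in> set (x @ 3 # u1)"
    proof (rule ccontr)
      assume "1 \<notin> set (x @ 3 # u1)"
      then have "comm 2 x" "comm 2 u1" using c2[OF sub(4)] c2[OF sub(1)] ni by simp_all
      then show False using chain_four[of P 2 x 3 u1 u2 "y @ 2 # Q"] al' c3 E by simp
    qed
    then obtain a1 a2 where a: "x @ 3 # u1 = a1 @ 1 # a2" "1 \<notin> set a2" by (meson split_list_last)
    have "1 \<in> set (u2 @ 3 # y)"
    proof (rule ccontr)
      assume "1 \<notin> set (u2 @ 3 # y)"
      then have "comm 2 u2" "comm 2 y" using c2[OF sub(2)] c2[OF sub(5)] ni by simp_all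
      then show False using chain_four[of "P @ 2 # x" 3 u1 2 u2 y Q] al' c3 E by simp
    qed
    then obtain b1 b2 where b: "u2 @ 3 # y = b1 @ 1 # b2" "1 \<notin> set b1" by (meson split_list_first)
    have "alive ((P @ [2]) @ (x @ 3 # u1) @ 2 # (u2 @ 3 # y) @ (2 # Q))" using al' by simp
    from this[unfolded a(1) b(1)] have "alive ((P @ 2 # a1) @ 1 # a2 @ 2 # b1 @ 1 # (b2 @ 2 # Q))" by simp
    moreover have "2 \<notin> set (x @ 3 # u1)" "2 \<notin> set (u2 @ 3 # y)" using ni by auto
    then have "2 \<notin> set a2" "2 \<notin> set b1" unfolding a(1) b(1) by auto
    ultimately show False using leaf_not_twice[of "P @ 2 # a1" 1 a2 2 b1 "b2 @ 2 # Q"] N1 E a b by auto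
  qed
qed

text \<open>Here the pattern \<open>1 2 1 2 1\<close> is itself a braid word.\<close>

lemma H_fully_commutative_bounded:
  assumes cox: "coxeter_matrix {1..n} H_matrix"
  shows "braid_words.bounded_words {1..n} H_matrix (\<lambda>_. 2) (braid_pairs_less {1..n} H_matrix 3)"
proof -
  interpret fc_tail n H_matrix 2
    by unfold_locales (use cox in \<open>auto simp: H_matrix_eq\<close>)
  have N2: "\<And>b. b \<in> {1..n} \<Longrightarrow> b \<noteq> 2 \<Longrightarrow> b \<notin> insert (Suc 2) {1} \<Longrightarrow> H_matrix 2 b = 2"
    and N1: "\<And>b. b \<in> {1..n} \<Longrightarrow> b \<noteq> 1 \<Longrightarrow> b \<notin> {2} \<Longrightarrow> H_matrix 1 b = 2"
    by (auto simp: H_matrix_eq)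
  have E: "H_matrix 1 2 = 5" "H_matrix 2 1 = 5" by (simp_all add: H_matrix_eq)
  have one_once: "count_list u 1 \<le> 1" if "alive u" "2 \<notin> set u" for u
    using leaf_once[OF that N1] .
  show ?thesis
  proof (rule tail_bounded[of 1])
    fix w assume w: "alive w" "set w \<subseteq> {1..<2}"
    then have "2 \<notin> set w" by auto
    then have "count_list w 1 \<le> 1" by (rule one_once[OF w(1)])
    moreover have "length w = count_list w 1" using w(2) by (induction w) auto
    ultimately show "length w \<le> 1" by simp
  next
    fix p v q assume al: "alive (p @ 2 # v @ 2 # q)" and v: "2 \<notin> set v" "Suc 2 \<notin> set v"
      and sp: "2 \<in> set p" "2 \<in> set q"
    obtain P x u1 u2 y Q where eq: "p @ 2 # v @ 2 # q = P @ 1 # x @ 2 # u1 @ 1 # u2 @ 2 # y @ 1 # Q"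
      and ni: "2 \<notin> set x" "1 \<notin> set x" "2 \<notin> set u1" "Suc 2 \<notin> set u1" "1 \<notin> set u1"
        "2 \<notin> set u2" "Suc 2 \<notin> set u2" "1 \<notin> set u2" "2 \<notin> set y" "1 \<notin> set y"
      by (rule alternating_core[OF al v sp N2 one_once])
    have al': "alive (P @ 1 # x @ 2 # u1 @ 1 # u2 @ 2 # y @ 1 # Q)" using al eq by simp
    note I = alive_lists[OF al']
    have sub: "set u1 \<subseteq> {1..n}" "set u2 \<subseteq> {1..n}" "2 \<in> {1..n}" "set x \<subseteq> {1..n}" "set y \<subseteq> {1..n}"
      using I by auto
    have c2: "comm 2 u1" "comm 2 u2"
      using comm_notin[OF sub(3,1), of "{1, 3}"] comm_notin[OF sub(3,2), of "{1, 3}"] N2 ni by auto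
    have c1: "comm 1 z" if "set z \<subseteq> {1..n}" "1 \<notin> set z" "2 \<notin> set z" for z
      using comm_notin[of 1 z "{2}"] I N1 that by auto
    have "comm 1 x" "comm 1 u1" "comm 1 u2" "comm 1 y"
      using c1[OF sub(4)] c1[OF sub(1)] c1[OF sub(2)] c1[OF sub(5)] ni by simp_all
    then show False using chain_five[of P 1 x 2 u1 u2 y Q] al' c2 E by simp
  qed
qed

section \<open>Type A with a larger exponent at one end\<close>

locale type_A_end =
  fixes n :: nat and d :: "nat \<Rightarrow> nat"
  assumes coxA: "coxeter_matrix {1..n} A_matrix"
    and d_ge: "\<And>i. i \<in> {1..n} \<Longrightarrow> 2 \<le> d i"
    and d_eq: "\<And>i. 2 \<le> i \<Longrightarrow> i \<le> n \<Longrightarrow> d i = 2"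
begin

sublocale braid_words "{1..n}" A_matrix d "braid_pairs {1..n} A_matrix"
  by unfold_locales (use coxA d_ge in auto)

notation braid_eq (infix "\<approx>" 50)

lemma far_commute:
  assumes "j \<in> {1..n}" "set u \<subseteq> {1..n}" "\<And>b. b \<in> set u \<Longrightarrow> Suc j < b"
  shows "replicate k j @ u \<approx> u @ replicate k j"
proof (rule commute_replicate)
  fix b assume b: "b \<in> set u"
  then have "b \<in> {1..n}" "Suc j < b" using assms by auto
  then show "{j, b} \<in> braid_pairs {1..n} A_matrix \<and> A_matrix j b = 2"
    using assms(1) unfolding braid_pairs_iff by (simp add: A_matrix_def numeral_eq_enat)
qed

lemma braid_next:
  assumes "j \<in> {1..n}" "Suc j \<in> {1..n}"
  shows "p @ [j, Suc j, j] @ q \<approx> p @ [Suc j, j, Suc j] @ q"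
proof -
  have "{j, Suc j} \<in> braid_pairs {1..n} A_matrix" using assms
    unfolding braid_pairs_iff by (simp add: A_matrix_def numeral_eq_enat)
  from braid_eq_swap[OF this, of p q] show ?thesis by (simp add: A_matrix_def numeral_3_eq_3 numeral_eq_enat)
qed

lemma no_square: "alive (p @ [i, i] @ q) \<Longrightarrow> 2 \<le> i \<Longrightarrow> False"
proof -
  assume a: "alive (p @ [i, i] @ q)" "2 \<le> i"
  then have "i \<in> {1..n}" using alive_lists[OF a(1)] by auto
  then show False using alive_no_power[OF a(1), of i] d_eq[of i] a(2) by (simp add: numeral_2_eq_2)
qed

text \<open>Take an equivalent word with as few letters \<open>j\<close> as possible. By induction the
  piece between two consecutive letters \<open>j\<close> can be written with at most one \<open>j +
  1\<close>; then the two letters \<open>j\<close> either meet or form \<open>j (j + 1) j\<close>, which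
  a braid move replaces by a word with one \<open>j\<close> less.\<close>

lemma first_letter_once:
  assumes "1 \<le> j" "alive w" "set w \<subseteq> {j..n}" "\<And>v p q. w \<approx> v \<Longrightarrow> v \<noteq> p @ [j, j] @ q"
  shows "\<exists>v. w \<approx> v \<and> count_list v j \<le> 1"
  using assms
proof (induction "n - j" arbitrary: j w rule: less_induct)
  case less
  obtain v where v: "w \<approx> v" "\<And>v'. w \<approx> v' \<Longrightarrow> count_list v j \<le> count_list v' j"
    using ex_has_least_nat[of "\<lambda>v. w \<approx> v" w "\<lambda>v. count_list v j"] by blast
  have av: "alive v" using alive_cong[OF v(1)] less.prems(2) by blast
  have sv: "set v \<subseteq> {j..n}" using braid_eq_set[OF v(1)] less.prems(3) by simp
  show ?case
  proof (rule ccontr)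
    assume "\<not> ?thesis"
    then have "2 \<le> count_list v j" using v(1) by force
    then obtain p u q where pq: "v = p @ j # u @ j # q" "j \<notin> set u"
    proof -
      assume c: "2 \<le> count_list v j" and t: "\<And>p u q. v = p @ j # u @ j # q \<Longrightarrow> j \<notin> set u \<Longrightarrow> thesis"
      have "j \<in> set v" using c by (metis count_list_0_iff not_numeral_le_zero)
      then obtain p v' where w: "v = p @ j # v'" "j \<notin> set p" by (meson split_list_first)
      then have "j \<in> set v'" using c by (cases "j \<in> set v'") (auto simp: count_list_append count_list_0_iff)
      then obtain u q where "v' = u @ j # q" "j \<notin> set u" by (meson split_list_first)
      then show thesis using t w by simp
    qed
    have jn: "j \<in> {1..n}" using sv pq less.prems(1) by auto
    have au: "alive u" using alive_factor[of "p @ [j]" u "j # q"] av pq by simp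
    have su: "set u \<subseteq> {Suc j..n}"
    proof
      fix b assume b: "b \<in> set u"
      then have "b \<in> {j..n}" "b \<noteq> j" using sv pq by auto
      then show "b \<in> {Suc j..n}" by auto
    qed
    have "\<exists>u'. u \<approx> u' \<and> count_list u' (Suc j) \<le> 1"
    proof (cases "j < n")
      case True
      show ?thesis
      proof (rule less.hyps[OF _ _ au su])
        show "n - Suc j < n - j" "1 \<le> Suc j" using True by auto
        fix v p q assume "u \<approx> v"
        then have "alive v" using alive_cong au by blast
        then show "v \<noteq> p @ [Suc j, Suc j] @ q" using no_square[of p "Suc j" q] less.prems(1) by auto
      qed
    next
      case False
      then show ?thesis using su by (intro exI[of _ u]) (auto simp: count_list_0_iff)
    qed
    then obtain u' where u': "u \<approx> u'" "count_list u' (Suc j) \<le> 1" by blast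
    have su': "set u' \<subseteq> {Suc j..n}" using braid_eq_set[OF u'(1)] su by simp
    have wv: "w \<approx> (p @ [j]) @ u' @ (j # q)"
      using rtranclp_trans[OF v(1)] braid_eq_context[OF u'(1), of "p @ [j]" "j # q"] pq by simp
    have far: "replicate 1 j @ x \<approx> x @ replicate 1 j" if "set x \<subseteq> set u'" "Suc j \<notin> set x" for x
    proof (rule far_commute[OF jn])
      show "set x \<subseteq> {1..n}" using that su' jn by fastforce
      fix b assume "b \<in> set x"
      then have "b \<in> {Suc j..n}" "b \<noteq> Suc j" using that su' by auto
      then show "Suc j < b" by simp
    qed
    show False
    proof (cases "Suc j \<in> set u'")
      case False
      have "p @ (replicate 1 j @ u') @ (j # q) \<approx> p @ (u' @ replicate 1 j) @ (j # q)"
        by (rule braid_eq_context[OF far]) (use False in auto)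
      then have "w \<approx> (p @ u') @ [j, j] @ q" using rtranclp_trans[OF wv] by simp
      then show False using less.prems(4) by blast
    next
      case True
      then obtain y z where yz: "u' = y @ Suc j # z" "Suc j \<notin> set y" by (meson split_list_first)
      have z: "Suc j \<notin> set z" using u'(2) yz by (auto simp: count_list_append count_list_0_iff)
      have sjn: "Suc j \<in> {1..n}" using True su' by auto
      have "p @ (replicate 1 j @ y) @ (Suc j # z @ j # q) \<approx> p @ (y @ replicate 1 j) @ (Suc j # z @ j # q)"
        by (rule braid_eq_context[OF far]) (use yz in auto)
      also have "p @ (y @ replicate 1 j) @ (Suc j # z @ j # q) = (p @ y @ [j, Suc j]) @ (z @ replicate 1 j) @ q" by simp
      also have "\<dots> \<approx> (p @ y @ [j, Suc j]) @ (replicate 1 j @ z) @ q"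
        by (rule braid_eq_context[OF braid_eq_sym[OF far]]) (use yz z in auto)
      also have "(p @ y @ [j, Suc j]) @ (replicate 1 j @ z) @ q = (p @ y) @ [j, Suc j, j] @ (z @ q)" by simp
      also have "\<dots> \<approx> (p @ y) @ [Suc j, j, Suc j] @ (z @ q)" by (rule braid_next[OF jn sjn])
      finally have "w \<approx> (p @ y) @ [Suc j, j, Suc j] @ (z @ q)" using rtranclp_trans[OF wv] yz by simp
      from v(2)[OF this] have "count_list v j \<le> count_list p j + count_list y j + 1 + count_list z j + count_list q j"
        by (simp add: count_list_append)
      moreover have "j \<notin> set y" "j \<notin> set z" using su' yz by auto
      ultimately show False using pq by (simp add: count_list_append count_list_0_iff)
    qed
  qed
qed

text \<open>Counting \<open>Suc (length w)\<close> makes the recursion a doubling: a single letter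
  \<open>j\<close> separates two words in the letters beyond \<open>j\<close>.\<close>

lemma length_from_two:
  assumes "2 \<le> j" "j \<le> Suc n" "alive w" "set w \<subseteq> {j..n}"
  shows "Suc (length w) \<le> 2 ^ (Suc n - j)"
  using assms
proof (induction "Suc n - j" arbitrary: j w)
  case 0
  then show ?case by auto
next
  case (Suc k)
  have nosq: "v \<noteq> p @ [j, j] @ q" if "w \<approx> v" for v p q
    using no_square[of p j q] alive_cong[OF that] Suc.prems by auto
  obtain v where v: "w \<approx> v" "count_list v j \<le> 1"
    using first_letter_once[of j w] Suc.prems nosq by auto
  have av: "alive v" "set v \<subseteq> {j..n}" using alive_cong[OF v(1)] braid_eq_set[OF v(1)] Suc.prems by auto
  have j: "Suc n - j = Suc (Suc n - Suc j)" "k = Suc n - Suc j" using Suc.hyps(2) by auto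
  have IH: "Suc (length y) \<le> 2 ^ (Suc n - Suc j)" if y: "alive y" "set y \<subseteq> set v" "j \<notin> set y" for y
  proof (rule Suc.hyps(1)[OF j(2) _ _ y(1)])
    show "2 \<le> Suc j" "Suc j \<le> Suc n" using Suc.prems j(1) by auto
    show "set y \<subseteq> {Suc j..n}"
    proof
      fix b assume "b \<in> set y"
      then have "b \<in> {j..n}" "b \<noteq> j" using y av by auto
      then show "b \<in> {Suc j..n}" by auto
    qed
  qed
  have "Suc (length v) \<le> 2 ^ (Suc n - j)"
  proof (cases "j \<in> set v")
    case False
    then show ?thesis using IH[OF av(1)] j(1) by simp
  next
    case True
    then obtain y z where yz: "v = y @ j # z" "j \<notin> set y" by (meson split_list_first)
    then have "j \<notin> set z" using v(2) by (auto simp: count_list_append count_list_0_iff)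
    moreover have "alive y" "alive z"
      using alive_factor[of "[]" y "j # z"] alive_factor[of "y @ [j]" z "[]"] av yz by simp_all
    ultimately have "Suc (length y) \<le> 2 ^ (Suc n - Suc j)" "Suc (length z) \<le> 2 ^ (Suc n - Suc j)"
      using IH[of y] IH[of z] yz by auto
    then have "Suc (length v) \<le> 2 * 2 ^ (Suc n - Suc j)" using yz(1) by simp
    then show ?thesis unfolding j(1) by simp
  qed
  then show ?case using braid_eq_length[OF v(1)] by simp
qed

text \<open>A later letter \<open>1\<close> could be moved up to the block, which would make it longer,
  or to a single \<open>2\<close> that follows the block. In the second case \<open>1 1 2 1 = 1 2 1 2 =
  2 1 2 2\<close>, and \<open>2 2\<close> is null.\<close>

lemma block_isolated:
  assumes w: "alive w" "w \<approx> u @ replicate a 1 @ v" "2 \<le> a"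
    and max: "\<And>u' a' v'. w \<approx> u' @ replicate a' 1 @ v' \<Longrightarrow> a' \<le> a"
  shows "1 \<notin> set v"
proof
  assume "1 \<in> set v"
  then obtain v1 v2 where v: "v = v1 @ 1 # v2" "1 \<notin> set v1" by (meson split_list_first)
  obtain b where b: "a = Suc (Suc b)" using w(3) by (metis add_2_eq_Suc le_Suc_ex)
  have al: "alive (u @ replicate a 1 @ v)" using alive_cong[OF w(2)] w(1) by blast
  have one: "1 \<in> {1..n}" "set v1 \<subseteq> {1..n}" using alive_lists[OF al] v by auto
  have s1: "set v1 \<subseteq> {2..n}"
  proof
    fix b assume "b \<in> set v1"
    then have "b \<in> {1..n}" "b \<noteq> 1" using one v(2) by auto
    then show "b \<in> {2..n}" by auto
  qed
  have a1: "alive v1" using alive_factor[of "u @ replicate a 1" v1 "1 # v2"] al v by simp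
  obtain v' where v': "v1 \<approx> v'" "count_list v' 2 \<le> 1"
  proof -
    have "v \<noteq> p @ [2, 2] @ q" if "v1 \<approx> v" for v p q
      using no_square[of p 2 q] alive_cong[OF that] a1 by auto
    then show ?thesis using first_letter_once[OF _ a1 s1] that by auto
  qed
  have s': "set v' \<subseteq> {2..n}" using braid_eq_set[OF v'(1)] s1 by simp
  have far: "replicate k 1 @ x \<approx> x @ replicate k 1" if "set x \<subseteq> set v'" "2 \<notin> set x" for x k
  proof (rule far_commute[OF one(1)])
    show "set x \<subseteq> {1..n}" using that s' by fastforce
    fix b assume "b \<in> set x"
    then have "b \<in> {2..n}" "b \<noteq> 2" using that s' by auto
    then show "Suc 1 < b" by auto
  qed
  have wv: "w \<approx> (u @ replicate a 1) @ v' @ (1 # v2)"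
    using rtranclp_trans[OF w(2)] braid_eq_context[OF v'(1), of "u @ replicate a 1" "1 # v2"] v by simp
  show False
  proof (cases "2 \<in> set v'")
    case False
    have "u @ (replicate a 1 @ v') @ (1 # v2) \<approx> u @ (v' @ replicate a 1) @ (1 # v2)"
      by (rule braid_eq_context[OF far]) (use False in auto)
    then have "w \<approx> (u @ v') @ replicate (Suc a) 1 @ v2"
      using rtranclp_trans[OF wv] by (simp add: replicate_app_Cons_same)
    then have "Suc a \<le> a" by (rule max)
    then show False by simp
  next
    case True
    then obtain y z where yz: "v' = y @ 2 # z" "2 \<notin> set y" by (meson split_list_first)
    have z: "2 \<notin> set z" using v'(2) yz by (auto simp: count_list_append count_list_0_iff)
    have two: "Suc 1 \<in> {1..n}" using True s' by auto
    have "u @ (replicate a 1 @ y) @ (2 # z @ 1 # v2) \<approx> u @ (y @ replicate a 1) @ (2 # z @ 1 # v2)"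
      by (rule braid_eq_context[OF far]) (use yz in auto)
    also have "u @ (y @ replicate a 1) @ (2 # z @ 1 # v2) = (u @ y @ replicate a 1 @ [2]) @ (z @ replicate 1 1) @ v2" by simp
    also have "\<dots> \<approx> (u @ y @ replicate a 1 @ [2]) @ (replicate 1 1 @ z) @ v2"
      by (rule braid_eq_context[OF braid_eq_sym[OF far]]) (use yz z in auto)
    also have "(u @ y @ replicate a 1 @ [2]) @ (replicate 1 1 @ z) @ v2
        = (u @ y @ replicate (Suc b) 1) @ [1, Suc 1, 1] @ (z @ v2)"
      using b by (simp add: numeral_2_eq_2 replicate_app_Cons_same)
    also have "\<dots> \<approx> (u @ y @ replicate (Suc b) 1) @ [Suc 1, 1, Suc 1] @ (z @ v2)"
      by (rule braid_next[OF one(1) two])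
    also have "(u @ y @ replicate (Suc b) 1) @ [Suc 1, 1, Suc 1] @ (z @ v2)
        = (u @ y @ replicate b 1) @ [1, Suc 1, 1] @ (Suc 1 # z @ v2)"
      by (simp add: replicate_app_Cons_same)
    also have "\<dots> \<approx> (u @ y @ replicate b 1) @ [Suc 1, 1, Suc 1] @ (Suc 1 # z @ v2)"
      by (rule braid_next[OF one(1) two])
    finally have "w \<approx> (u @ y @ replicate b 1 @ [Suc 1, 1]) @ [Suc 1, Suc 1] @ (z @ v2)"
      using rtranclp_trans[OF wv] yz by simp
    then have "alive ((u @ y @ replicate b 1 @ [Suc 1, 1]) @ [Suc 1, Suc 1] @ (z @ v2))"
      using alive_cong w(1) by blast
    then show False by (rule no_square) simp
  qed
qed

text \<open>If letters \<open>1\<close> never meet, one of them is enough; otherwise all of them are in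
  a single block, of length less than \<open>d 1\<close>. The rest consists of two words in the other
  letters.\<close>

lemma type_A_bounded: "bounded_words"
proof -
  let ?L = "2 ^ n"
  have L: "length y \<le> ?L" if y: "alive y" "1 \<notin> set y" for y
  proof -
    have "set y \<subseteq> {2..n}"
    proof
      fix b assume "b \<in> set y"
      then have "b \<in> {1..n}" "b \<noteq> 1" using alive_lists[OF y(1)] y(2) by auto
      then show "b \<in> {2..n}" by auto
    qed
    then have "n \<ge> 1 \<Longrightarrow> Suc (length y) \<le> 2 ^ (Suc n - 2)" "n = 0 \<Longrightarrow> y = []"
      using length_from_two[of 2 y] y by auto
    moreover have "(2::nat) ^ (Suc n - 2) \<le> 2 ^ n" by (intro power_increasing) auto
    ultimately show ?thesis by (cases "1 \<le> n") (use Suc_leD le_trans in blast, simp)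
  qed
  have "length w \<le> ?L + (d 1 + 1) + ?L" if w: "alive w" for w
  proof (cases "\<exists>v p q. w \<approx> v \<and> v = p @ [1, 1] @ q")
    case False
    then have nosq: "\<And>v p q. w \<approx> v \<Longrightarrow> v \<noteq> p @ [1, 1] @ q" by blast
    have "set w \<subseteq> {1..n}" using alive_lists[OF w] by auto
    then obtain v where v: "w \<approx> v" "count_list v 1 \<le> 1"
      using first_letter_once[OF order_refl w _ nosq] by blast
    have av: "alive v" using alive_cong[OF v(1)] w by blast
    have "length v \<le> ?L + 1 + ?L"
    proof (cases "1 \<in> set v")
      case False
      then show ?thesis using L[OF av] by simp
    next
      case True
      then obtain y z where yz: "v = y @ 1 # z" "1 \<notin> set y" by (meson split_list_first)
      then have "1 \<notin> set z" using v(2) by (auto simp: count_list_append count_list_0_iff)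
      moreover have "alive y" "alive z"
        using alive_factor[of "[]" y "1 # z"] alive_factor[of "y @ [1]" z "[]"] av yz by simp_all
      ultimately show ?thesis using L[of y] L[of z] yz by simp
    qed
    then show ?thesis using braid_eq_length[OF v(1)] by simp
  next
    case True
    define P where "P = (\<lambda>a. \<exists>u v. w \<approx> u @ replicate a 1 @ v)"
    have "P 2"
    proof -
      obtain p q where "w \<approx> p @ [1, 1] @ q" using True by blast
      then show ?thesis unfolding P_def by (intro exI[of _ p] exI[of _ q]) (simp add: numeral_2_eq_2)
    qed
    moreover have "a \<le> length w" if "P a" for a
      using that braid_eq_length unfolding P_def by fastforce
    ultimately obtain a where a: "P a" "\<And>a'. P a' \<Longrightarrow> a' \<le> a" "2 \<le> a"
      using Greatest_le_nat[of P _ "length w"] GreatestI_nat[of P 2 "length w"] by blast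
    then obtain u v where uv: "w \<approx> u @ replicate a 1 @ v" unfolding P_def by blast
    have al: "alive (u @ replicate a 1 @ v)" using alive_cong[OF uv] w by blast
    have "1 \<notin> set v" by (rule block_isolated[OF w uv a(3)]) (use a(2) P_def in blast)
    moreover have "1 \<notin> set (rev u)"
    proof (rule block_isolated[OF alive_rev[OF w] _ a(3)])
      show "rev w \<approx> rev v @ replicate a 1 @ rev u" using braid_eq_rev[OF uv] by simp
      fix u' a' v' assume "rev w \<approx> u' @ replicate a' 1 @ v'"
      then have "w \<approx> rev v' @ replicate a' 1 @ rev u'" using braid_eq_rev[of "rev w"] by fastforce
      then show "a' \<le> a" using a(2) unfolding P_def by blast
    qed
    ultimately have "length u \<le> ?L" "length v \<le> ?L"
      using L[of u] L[of v] alive_factor[of "[]" u "replicate a 1 @ v"] alive_factor[of "u @ replicate a 1" v "[]"] al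
      by simp_all
    moreover have "a < d 1"
    proof (rule ccontr)
      assume "\<not> a < d 1"
      then obtain k where k: "a = d 1 + k" by (metis le_Suc_ex not_less)
      have "1 \<in> {1..n}" using alive_lists[OF al] a(3) by (cases a) auto
      moreover have "u @ replicate a 1 @ v = u @ replicate (d 1) 1 @ (replicate k 1 @ v)"
        using k by (simp add: replicate_add)
      ultimately show False using alive_no_power[of u "replicate (d 1) 1" "replicate k 1 @ v" 1] al by simp
    qed
    ultimately show ?thesis using braid_eq_length[OF uv] by simp
  qed
  then show ?thesis unfolding bounded_words_def by blast
qed

end

section \<open>Walks without backtracking\<close>

context braid_words begin

abbreviation adj :: "'i \<Rightarrow> 'i \<Rightarrow> bool" where
  "adj \<equiv> coxeter_adj I m"

lemma adj_sym: "adj a b \<Longrightarrow> adj b a"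
  unfolding coxeter_adj_def using m_sym by metis

text \<open>A shortest closed piece of the walk would have length at least three and be a cycle.\<close>

lemma nonbacktracking_distinct:
  assumes acyclic: "\<nexists>c. coxeter_cycle I m c"
    and adj: "\<And>t. Suc t < length w \<Longrightarrow> adj (w ! t) (w ! Suc t)"
    and nb: "\<And>t. Suc (Suc t) < length w \<Longrightarrow> w ! t \<noteq> w ! Suc (Suc t)"
  shows "distinct w"
proof (rule ccontr)
  assume "\<not> distinct w"
  then obtain i j where "i < length w" "j < length w" "i \<noteq> j" "w ! i = w ! j"
    by (auto simp: distinct_conv_nth)
  then have "\<exists>l i. 0 < l \<and> i + l < length w \<and> w ! i = w ! (i + l)"
    by (metis add_diff_inverse_nat less_imp_le_nat nat_neq_iff not_le zero_less_diff)
  then obtain l where l: "\<exists>i. 0 < l \<and> i + l < length w \<and> w ! i = w ! (i + l)"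
    "\<And>l'. \<exists>i. 0 < l' \<and> i + l' < length w \<and> w ! i = w ! (i + l') \<Longrightarrow> l \<le> l'"
    using ex_has_least_nat[of "\<lambda>l. \<exists>i. 0 < l \<and> i + l < length w \<and> w ! i = w ! (i + l)" _ "\<lambda>l. l"] by blast
  then obtain i where i: "0 < l" "i + l < length w" "w ! i = w ! (i + l)" by blast
  have "l \<noteq> 1"
  proof
    assume "l = 1"
    then show False using adj[of i] i by (auto simp: coxeter_adj_def)
  qed
  moreover have "l \<noteq> 2" using nb[of i] i by auto
  ultimately have l3: "3 \<le> l" using i(1) by linarith
  define c where "c = take l (drop i w)"
  have len: "length c = l" and nth: "\<And>k. k < l \<Longrightarrow> c ! k = w ! (i + k)"
    using i unfolding c_def by auto
  have "distinct c" unfolding distinct_conv_nth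
  proof (intro allI impI)
    fix p q assume pq: "p < length c" "q < length c" "p \<noteq> q"
    have "c ! a \<noteq> c ! b" if ab: "a < b" "b < l" for a b
    proof
      assume "c ! a = c ! b"
      then have "w ! (i + a) = w ! ((i + a) + (b - a))" using nth ab by simp
      then have "\<exists>i'. 0 < b - a \<and> i' + (b - a) < length w \<and> w ! i' = w ! (i' + (b - a))"
        by (intro exI[of _ "i + a"]) (use ab i in simp)
      then have "l \<le> b - a" by (rule l(2))
      then show False using ab by simp
    qed
    then show "c ! p \<noteq> c ! q" using pq len by (metis nat_neq_iff)
  qed
  moreover have "adj (c ! k) (c ! (Suc k mod length c))" if k: "k < length c" for k
  proof (cases "Suc k = l")
    case True
    then have "adj (w ! (i + k)) (w ! (i + l))" using adj[of "i + k"] i by auto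
    then show ?thesis using True len nth[of k] nth[of 0] i k by simp
  next
    case False
    then have "Suc k < l" using k len by simp
    then show ?thesis using adj[of "i + k"] nth[of k] nth[of "Suc k"] len i by simp
  qed
  ultimately have "coxeter_cycle I m c" unfolding coxeter_cycle_def using l3 len by blast
  then show False using acyclic by blast
qed

end

section \<open>Partial actions\<close>

text \<open>Letters act on states from left to right, and a letter may be undefined at a state.\<close>

primrec run :: "('l \<Rightarrow> 's \<Rightarrow> 's option) \<Rightarrow> 'l list \<Rightarrow> 's \<Rightarrow> 's option" where
  "run act [] s = Some s"
| "run act (x # w) s = (case act x s of None \<Rightarrow> None | Some t \<Rightarrow> run act w t)"

lemma run_append: "run act (u @ v) s = (case run act u s of None \<Rightarrow> None | Some t \<Rightarrow> run act v t)"
  by (induction u arbitrary: s) (auto split: option.split)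

lemma run_append_cong: "(\<And>s. run act u s = run act v s) \<Longrightarrow> run act (p @ u @ q) s = run act (p @ v @ q) s"
  by (simp add: run_append split: option.split)

lemma run_factor_None: "(\<And>s. run act x s = None) \<Longrightarrow> run act (p @ x @ q) s = None"
  by (simp add: run_append split: option.split)

lemma run_alt_word_mono:
  assumes "\<And>s. run act (alt_word a b r) s = None" "r \<le> n" shows "run act (alt_word a b n) s = None"
proof -
  obtain q where "alt_word a b n = alt_word a b r @ q"
    using alt_word_add[of a b r "n - r"] assms(2) by auto
  then show ?thesis using run_factor_None[of act "alt_word a b r" "[]" q s] assms(1) by simp
qed

lemma run_cycle: "run act u s = Some s \<Longrightarrow> run act (concat (replicate n u)) s = Some s"
  by (induction n) (simp_all add: run_append)

lemma enat_cases_2_3_4: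
  fixes x :: enat assumes "2 \<le> x" obtains "x = 2" | "x = 3" | "4 \<le> x"
proof (cases x)
  case (enat n)
  then have "n = 2 \<or> n = 3 \<or> 4 \<le> n" using assms by (simp add: numeral_eq_enat) linarith
  then show ?thesis using that enat by (auto simp: numeral_eq_enat)
qed (use that in simp)

context braid_words begin

context
  fixes f :: "'l \<Rightarrow> 'i" and L :: "'l set" and act :: "'l \<Rightarrow> 's \<Rightarrow> 's option"
  assumes f: "inj_on f L" "f ` L \<subseteq> I"
    and sq: "\<And>i s. i \<in> L \<Longrightarrow> run act (replicate (d (f i)) i) s = None"
    and rel: "\<And>i j. i \<in> L \<Longrightarrow> j \<in> L \<Longrightarrow> i \<noteq> j \<Longrightarrow>
       ({f i, f j} \<in> J \<and> (\<forall>s. run act (alt_word i j (the_enat (m (f i) (f j)))) s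
          = run act (alt_word j i (the_enat (m (f i) (f j)))) s))
       \<or> (\<exists>r. enat r \<le> m (f i) (f j) \<and>
            (\<forall>s. run act (alt_word i j r) s = None \<and> run act (alt_word j i r) s = None))
       \<or> m (f i) (f j) = \<infinity>"
begin

text \<open>Extended by undefined letters outside \<open>L\<close>, the action is invariant under braid
  moves and null words are nowhere defined; so a word that is defined at some state is alive. If already
  an alternating word of length \<open>r \<le> m (f i) (f j)\<close> is undefined, then both sides of
  the braid relation are, whether it is kept or not.\<close>

lemma partial_action_alive:
  assumes w: "w \<in> lists L" "run act w s \<noteq> None"
  shows "alive (map f w)"
proof -
  define g where "g = the_inv_into L f"
  define del where "del x s = (if x \<in> f ` L then act (g x) s else None)" for x s
  have g: "g (f i) = i" if "i \<in> L" for i using that f(1) by (simp add: g_def the_inv_into_f_f)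
  have run: "run del (map f u) s = run act u s" if "u \<in> lists L" for u s
    using that by (induction u arbitrary: s) (auto simp: del_def g split: option.split)
  have altL: "alt_word i j n \<in> lists L" if "i \<in> L" "j \<in> L" for i j n
    using that set_alt_word[of i j n] by auto
  have altf: "alt_word (f i) (f j) n = map f (alt_word i j n)" for i j n
    by (induction n arbitrary: i j) auto
  have out: "run del x s = None" if "\<not> set x \<subseteq> f ` L" for x s
    using that by (induction x arbitrary: s) (auto simp: del_def split: option.split)
  have step: "run del u s = run del v s" if uv: "braid_step u v" for u v s
  proof -
    obtain p q a b where h: "{a, b} \<in> J" "u = p @ braid_word a b @ q" "v = p @ braid_word b a @ q"
      using uv unfolding braid_step_def by blast
    have ab: "a \<in> I" "b \<in> I" "a \<noteq> b" "m a b < \<infinity>" using J_D[OF h(1)] by auto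
    have s: "set (braid_word a b) = {a, b}" "set (braid_word b a) = {a, b}"
      using braid_word_set[of a b] braid_word_set[of b a] ab m_sym[of a b] by auto
    have "run del (braid_word a b) s = run del (braid_word b a) s" for s
    proof (cases "{a, b} \<subseteq> f ` L")
      case True
      then obtain i j where ij: "i \<in> L" "j \<in> L" "a = f i" "b = f j" by auto
      then have ne: "i \<noteq> j" using ab(3) by auto
      have ms: "m (f j) (f i) = m (f i) (f j)" using m_sym ab ij by metis
      obtain n where n: "m (f i) (f j) = enat n" using ab(4) ij by auto
      have "run act (alt_word i j n) s = run act (alt_word j i n) s"
        using rel[OF ij(1,2) ne]
      proof (elim disjE conjE exE)
        fix r assume "enat r \<le> m (f i) (f j)"
          "\<forall>s. run act (alt_word i j r) s = None \<and> run act (alt_word j i r) s = None"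
        then show ?thesis using n run_alt_word_mono[of act i j r n] run_alt_word_mono[of act j i r n] by simp
      qed (use n in simp_all)
      then show ?thesis using ij n ms by (simp add: altf run altL)
    next
      case False
      then show ?thesis using out s by metis
    qed
    then show ?thesis unfolding h(2,3) by (rule run_append_cong)
  qed
  have null: "run del x s = None" if x: "x \<in> null_words" for x s
  proof -
    consider i where "i \<in> I" "x = replicate (d i) i"
      | a b where "{a, b} \<in> braid_pairs I m - J" "x = braid_word a b"
      using x unfolding null_words_def by blast
    then show ?thesis
    proof cases
      case 1
      show ?thesis
      proof (cases "i \<in> f ` L")
        case True
        then obtain j where j: "j \<in> L" "i = f j" by auto
        then have "x = map f (replicate (d (f j)) j)" "replicate (d (f j)) j \<in> lists L"
          using 1 by (auto simp: in_lists_conv_set)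
        then show ?thesis using sq[OF j(1)] run by (simp del: map_replicate)
      next
        case False
        then show ?thesis using out[of x] 1 d2[of i] by auto
      qed
    next
      case 2
      then have ab: "a \<in> I" "b \<in> I" "a \<noteq> b" "m a b < \<infinity>" "{a, b} \<notin> J" using braid_pairs_iff by auto
      show ?thesis
      proof (cases "{a, b} \<subseteq> f ` L")
        case True
        then obtain i j where ij: "i \<in> L" "j \<in> L" "a = f i" "b = f j" by auto
        then have ne: "i \<noteq> j" using ab(3) by auto
        obtain n where n: "m (f i) (f j) = enat n" using ab(4) ij by auto
        have "run act (alt_word i j n) s = None"
          using rel[OF ij(1,2) ne]
        proof (elim disjE conjE exE)
          fix r assume "enat r \<le> m (f i) (f j)"
            "\<forall>s. run act (alt_word i j r) s = None \<and> run act (alt_word j i r) s = None"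
          then show ?thesis using n run_alt_word_mono[of act i j r n] by simp
        qed (use n ab(5) ij in simp_all)
        then show ?thesis using 2 ij n by (simp add: altf run altL)
      next
        case False
        then show ?thesis using out[of x] 2 braid_word_set[OF ab(1-4)] by auto
      qed
    qed
  qed
  show ?thesis unfolding alive_def
  proof (intro conjI allI impI)
    show "map f w \<in> lists I" using w(1) f(2) by (auto simp: image_subset_iff)
    fix v p x q assume v: "map f w \<approx> v" "v = p @ x @ q"
    have "run del (map f w) s = run del v s"
      using v(1) by (induction rule: rtranclp_induct) (use step in auto)
    moreover have "run del (map f w) s \<noteq> None" using run[OF w(1)] w(2) by simp
    ultimately show "x \<notin> null_words" using run_factor_None[of del x p q s] null v(2) by metis
  qed
qed

lemma partial_action_unbounded:
  assumes w: "\<And>N. \<exists>w\<in>lists L. N < length w \<and> (\<exists>s. run act w s \<noteq> None)"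
  shows "\<not> bounded_words"
proof
  assume "bounded_words"
  then obtain N where N: "\<And>w. alive w \<Longrightarrow> length w \<le> N" unfolding bounded_words_def by blast
  obtain w s where w': "w \<in> lists L" "N < length w" "run act w s \<noteq> None" using w by blast
  then have "alive (map f w)" using partial_action_alive by blast
  then show False using N w'(2) by fastforce
qed

end

subsection \<open>Sequences of blocks\<close>

text \<open>The state \<open>(n, P)\<close> says that the blocks before \<open>B n\<close> have been
  read completely, and from \<open>B n\<close> the letters in \<open>P\<close>.\<close>

definition block_act :: "(nat \<Rightarrow> 'i set) \<Rightarrow> 'i \<Rightarrow> nat \<times> 'i set \<Rightarrow> (nat \<times> 'i set) option" where
  "block_act B x s = (case s of (n, P) \<Rightarrow>
     if P \<subset> B n \<and> x \<in> B n - P then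
       Some (if insert x P = B n then (Suc n, {}) else (n, insert x P)) else None)"

text \<open>The infinite word \<open>B 0 B 1 B 2 \<dots>\<close>, in which the two letters of a block
  may come in either order. No other order of letters is readable, so the conditions have to exclude
  only that a factor \<open>x x\<close> (except where the exponent admits it) or a short alternating
  factor of two adjacent letters is readable.\<close>

lemma block_sequence_unbounded:
  assumes block: "\<And>n. (\<exists>x\<in>I. B n = {x}) \<or> (\<exists>x y. x \<noteq> y \<and> m x y = 2 \<and> {x, y} \<in> J \<and> B n = {x, y})"
    and next': "\<And>n x y. x \<in> B n \<Longrightarrow> y \<in> B (Suc n) \<Longrightarrow>
      3 \<le> m x y \<or> (B n = {x} \<and> B (Suc n) = {x} \<and> B (Suc (Suc n)) \<noteq> {x} \<and> 3 \<le> d x)"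
    and bounce: "\<And>n a b. a \<in> B n \<Longrightarrow> B (Suc n) = {b} \<Longrightarrow> a \<in> B (Suc (Suc n)) \<Longrightarrow> a \<noteq> b \<Longrightarrow>
       4 \<le> m a b \<and> (b \<in> B (Suc (Suc (Suc n))) \<longrightarrow> m a b = \<infinity>)"
  shows "\<not> bounded_words"
proof -
  have BI: "B n \<subseteq> I" "B n \<noteq> {}" "finite (B n)" for n using block[of n] J_D by auto
  have pairD: "m a b = 2 \<and> {a, b} \<in> J" if "a \<in> B n" "b \<in> B n" "a \<noteq> b" for a b n
    using block[of n] that m_sym[of a b] BI(1)[of n] by (auto simp: insert_commute)
  have mxx: "m x x = 1" if "x \<in> B n" for x n using m_refl BI(1) that by blast
  let ?act = "block_act B"
  \<comment> \<open>the next fact lists how two letters can follow each other: they form one block, or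
    the first completes a block and the second belongs to the next one\<close>
  have card2: "B n = {a, b}" if "a \<in> B n" "b \<in> B n" "a \<noteq> b" for a b n
    using block[of n] that by auto
  have two: "(B n = {a, b} \<and> a \<noteq> b \<and> P = {} \<and> t = (Suc n, {})) \<or>
      (insert a P = B n \<and> b \<in> B (Suc n) \<and> (t = (if B (Suc n) = {b} then (Suc (Suc n), {}) else (Suc n, {b}))))"
    if r: "run ?act [a, b] (n, P) = Some t" for a b n P t
  proof -
    have a: "P \<subset> B n" "a \<in> B n" "a \<notin> P" using r by (auto simp: block_act_def split: if_splits)
    show ?thesis
    proof (cases "insert a P = B n")
      case True
      then show ?thesis using r a by (auto simp: block_act_def split: if_splits)
    next
      case False
      then have r2: "?act b (n, insert a P) = Some t" using r a by (auto simp: block_act_def split: if_splits option.splits)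
      then have b: "b \<in> B n" "b \<noteq> a" "b \<notin> P" by (auto simp: block_act_def split: if_splits)
      have Bn: "B n = {a, b}" using card2 a b by blast
      then have "P = {}" using a b by auto
      then show ?thesis using Bn b r2 by (auto simp: block_act_def split: if_splits)
    qed
  qed
  show ?thesis
  proof (rule partial_action_unbounded[where f = id and L = I and act = ?act])
    show "inj_on id I" "id ` I \<subseteq> I" by auto
    fix i and s :: "nat \<times> 'i set" assume i: "i \<in> I"
    obtain n P where s: "s = (n, P)" by (cases s)
    show "run ?act (replicate (d (id i)) i) s = None"
    proof (rule ccontr)
      assume "run ?act (replicate (d (id i)) i) s \<noteq> None"
      moreover obtain e where e: "d i = Suc (Suc e)" using d2[OF i] by (metis add_2_eq_Suc le_Suc_ex)
      ultimately obtain t where t: "run ?act [i, i] (n, P) = Some t" "run ?act (replicate e i) t \<noteq> None"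
        using s run_append[of ?act "[i, i]" "replicate e i"] by (auto simp del: run.simps split: option.splits)
      then have ii: "insert i P = B n" "i \<in> B (Suc n)" "t = (if B (Suc n) = {i} then (Suc (Suc n), {}) else (Suc n, {i}))"
        using two[OF t(1)] by auto
      have "i \<in> B n" using ii(1) by blast
      then have r: "B n = {i}" "B (Suc n) = {i}" "B (Suc (Suc n)) \<noteq> {i}" "3 \<le> d i"
        using next'[OF \<open>i \<in> B n\<close> ii(2)] m_refl[OF i] by (auto simp: numeral_eq_enat one_enat_def)
      then obtain k where "e = Suc k" using e by (cases e) auto
      then have "?act i (Suc (Suc n), {}) \<noteq> None" using t(2) ii(3) r(2) by (auto split: option.splits)
      then have "i \<in> B (Suc (Suc n))" by (auto simp: block_act_def split: if_splits)
      then have "3 \<le> m i i \<or> B (Suc (Suc n)) = {i}" using next'[of i "Suc n" i] r(2) by auto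
      then show False using r(3) m_refl[OF i] by (auto simp: numeral_eq_enat one_enat_def)
    qed
  next
    fix i j assume ij: "i \<in> I" "j \<in> I" "i \<noteq> j"
    have three: "4 \<le> m a b" if nn: "run ?act [a, b, a] s \<noteq> None" and "a \<in> I" "b \<in> I" "a \<noteq> b" "3 \<le> m a b" for a b s
    proof -
      obtain n P where s: "s = (n, P)" by (cases s)
      have "[a, b, a] = [a, b] @ [a]" by simp
      then obtain t where t: "run ?act [a, b] (n, P) = Some t" "run ?act [a] t \<noteq> None"
        using nn s run_append[of ?act "[a,b]" "[a]"] by (auto simp del: run.simps split: option.splits)
      have m3: "m a b \<noteq> 2" using that(5) by (auto simp: numeral_eq_enat)
      then have "B n \<noteq> {a, b}" using pairD[of a n b] that(4) by auto
      then have ii: "insert a P = B n" "b \<in> B (Suc n)" "t = (if B (Suc n) = {b} then (Suc (Suc n), {}) else (Suc n, {b}))"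
        using two[OF t(1)] by auto
      show ?thesis
      proof (cases "B (Suc n) = {b}")
        case True
        then have "a \<in> B (Suc (Suc n))" using t(2) ii(3) by (auto simp: block_act_def split: if_splits option.splits)
        then show ?thesis using bounce[of a n b] ii(1) True that(4) by blast
      next
        case False
        then have "a \<in> B (Suc n)" using t(2) ii(3) by (auto simp: block_act_def split: if_splits option.splits)
        then show ?thesis using pairD[OF _ ii(2)] m3 that(4) by blast
      qed
    qed
    have four: "run ?act [a, b, a, b] s = None" if "a \<in> I" "b \<in> I" "a \<noteq> b" "3 \<le> m a b" "m a b \<noteq> \<infinity>" for a b s
    proof (rule ccontr)
      assume nn: "run ?act [a, b, a, b] s \<noteq> None"
      obtain n P where s: "s = (n, P)" by (cases s)
      have "[a, b, a, b] = [a, b] @ [a, b]" by simp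
      then obtain t where t: "run ?act [a, b] (n, P) = Some t" "run ?act [a, b] t \<noteq> None"
        using nn s run_append[of ?act "[a,b]" "[a,b]"] by (auto simp del: run.simps split: option.splits)
      have m3: "m a b \<noteq> 2" using that(4) by (auto simp: numeral_eq_enat)
      have nab: "B k \<noteq> {a, b}" for k using pairD[of a k b] that(3) m3 by auto
      then have ii: "insert a P = B n" "b \<in> B (Suc n)" "t = (if B (Suc n) = {b} then (Suc (Suc n), {}) else (Suc n, {b}))"
        using two[OF t(1)] by auto
      show False
      proof (cases "B (Suc n) = {b}")
        case True
        obtain t' where t': "run ?act [a, b] (Suc (Suc n), {}) = Some t'" using t(2) ii(3) True by auto
        have "insert a {} = B (Suc (Suc n))" "b \<in> B (Suc (Suc (Suc n)))" using two[OF t'] nab by auto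
        then show ?thesis using bounce[of a n b] ii(1) True that(3,5) by blast
      next
        case False
        then have "a \<in> B (Suc n)" using t(2) ii(3) by (auto simp: block_act_def split: if_splits option.splits)
        then show ?thesis using pairD[OF _ ii(2)] m3 that(3) by blast
      qed
    qed
    have ms: "m j i = m i j" using m_sym ij by blast
    consider "m i j = 2" | "m i j = 3" | "4 \<le> m i j" "m i j \<noteq> \<infinity>" | "m i j = \<infinity>"
      using m_ge2[OF ij] by (cases "m i j" rule: enat_cases_2_3_4) auto
    then show "{id i, id j} \<in> J \<and> (\<forall>s. run ?act (alt_word i j (the_enat (m (id i) (id j)))) s
        = run ?act (alt_word j i (the_enat (m (id i) (id j)))) s)
      \<or> (\<exists>r. enat r \<le> m (id i) (id j) \<and>
          (\<forall>s. run ?act (alt_word i j r) s = None \<and> run ?act (alt_word j i r) s = None))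
      \<or> m (id i) (id j) = \<infinity>"
    proof cases
      case 1
      have dich: "(B n = {a, b} \<and> P = {} \<and> {a, b} \<in> J \<and> run ?act [b, a] (n, P) = run ?act [a, b] (n, P))"
        if nn: "run ?act [a, b] (n, P) \<noteq> None" and "{a, b} = {i, j}" for a b n P
      proof -
        obtain t where t: "run ?act [a, b] (n, P) = Some t" using nn by blast
        have ab: "a \<noteq> b" "m a b = 2" using that(2) 1 ij(3) ms by (auto simp: doubleton_eq_iff)
        have "\<not> (insert a P = B n \<and> b \<in> B (Suc n))"
        proof
          assume h: "insert a P = B n \<and> b \<in> B (Suc n)"
          then have "a \<in> B n" by blast
          then show False using next'[of a n b] ab h by (auto simp: numeral_eq_enat)
        qed
        then have h: "B n = {a, b}" "P = {}" "t = (Suc n, {})" using two[OF t] by auto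
        moreover have "run ?act [b, a] (n, P) = Some (Suc n, {})"
          using h ab(1) by (auto simp: block_act_def insert_commute)
        ultimately show ?thesis using t pairD[of a n b] ab(1) by auto
      qed
      show ?thesis
      proof (cases "{i, j} \<in> J")
        case True
        have "run ?act [i, j] s = run ?act [j, i] s" for s
        proof -
          obtain n P where s: "s = (n, P)" by (cases s)
          show ?thesis unfolding s using dich[of i j n P] dich[of j i n P] by (metis insert_commute)
        qed
        then show ?thesis using True 1 by (simp add: numeral_2_eq_2 numeral_eq_enat)
      next
        case False
        have "run ?act [i, j] s = None \<and> run ?act [j, i] s = None" for s
        proof -
          obtain n P where s: "s = (n, P)" by (cases s)
          show ?thesis unfolding s using dich[of i j n P] dich[of j i n P] False by (metis insert_commute)
        qed
        then have "\<forall>s. run ?act (alt_word i j 2) s = None \<and> run ?act (alt_word j i 2) s = None"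
          by (simp add: numeral_2_eq_2 del: run.simps)
        moreover have "enat 2 \<le> m (id i) (id j)" using 1 by (simp add: numeral_eq_enat)
        ultimately show ?thesis by blast
      qed
    next
      case 2
      have "3 \<le> m i j" "\<not> 4 \<le> m i j" "3 \<le> m j i" "\<not> 4 \<le> m j i" using 2 ms by (simp_all add: numeral_eq_enat)
      then have "run ?act [i, j, i] s = None \<and> run ?act [j, i, j] s = None" for s
        using three[of i j s] three[of j i s] ij by blast
      then have "\<forall>s. run ?act (alt_word i j 3) s = None \<and> run ?act (alt_word j i 3) s = None"
        by (simp add: numeral_3_eq_3 del: run.simps)
      moreover have "enat 3 \<le> m (id i) (id j)" using 2 by (simp add: numeral_eq_enat)
      ultimately show ?thesis by blast
    next
      case 3
      have "3 \<le> m i j" using 3(1) by (cases "m i j") (auto simp: numeral_eq_enat)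
      then have "3 \<le> m j i" "m j i \<noteq> \<infinity>" using 3 ms by simp_all
      then have "run ?act [i, j, i, j] s = None \<and> run ?act [j, i, j, i] s = None" for s
        using four[of i j s] four[of j i s] ij 3 \<open>3 \<le> m i j\<close> by blast
      then have "\<forall>s. run ?act (alt_word i j 4) s = None \<and> run ?act (alt_word j i 4) s = None"
        by (simp add: eval_nat_numeral del: run.simps)
      moreover have "enat 4 \<le> m (id i) (id j)" using 3 by (simp add: numeral_eq_enat)
      ultimately show ?thesis by blast
    qed simp
  next
    fix N
    have one_block: "\<exists>u\<in>lists I. u \<noteq> [] \<and> run ?act u (n, {}) = Some (Suc n, {})" for n
      using block[of n]
    proof
      assume "\<exists>x\<in>I. B n = {x}"
      then obtain x where "x \<in> I" "B n = {x}" by blast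
      then show ?thesis by (intro bexI[of _ "[x]"]) (auto simp: block_act_def)
    next
      assume "\<exists>x y. x \<noteq> y \<and> m x y = 2 \<and> {x, y} \<in> J \<and> B n = {x, y}"
      then obtain x y where "x \<noteq> y" "B n = {x, y}" by blast
      then show ?thesis using BI(1)[of n] by (intro bexI[of _ "[x, y]"]) (auto simp: block_act_def insert_commute)
    qed
    have "\<exists>u\<in>lists I. n \<le> length u \<and> run ?act u (0, {}) = Some (n, {})" for n
    proof (induction n)
      case 0
      show ?case by (intro bexI[of _ "[]"]) auto
    next
      case (Suc n)
      then obtain u v where "u \<in> lists I" "n \<le> length u" "run ?act u (0, {}) = Some (n, {})"
        "v \<in> lists I" "v \<noteq> []" "run ?act v (n, {}) = Some (Suc n, {})" using one_block by blast
      then show ?case by (intro bexI[of _ "u @ v"]) (auto simp: run_append Suc_le_eq length_greater_0_conv[symmetric] simp del: length_greater_0_conv)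
    qed
    from this[of "Suc N"] obtain u where
      "u \<in> lists I" "Suc N \<le> length u" "run ?act u (0, {}) = Some (Suc N, {})" by blast
    then show "\<exists>w\<in>lists I. N < length w \<and> (\<exists>s. run ?act w s \<noteq> None)"
      by (intro bexI[of _ u] conjI exI[of _ "(0, {})"]) auto
  qed
qed

end

section \<open>Periodic words along walks\<close>

context braid_words begin

lemma adj3: "adj a b \<Longrightarrow> 3 \<le> m a b"
  by (simp add: coxeter_adj_def)

lemma infinite_edge_unbounded:
  assumes "a \<in> I" "b \<in> I" "a \<noteq> b" "m a b = \<infinity>" shows "\<not> bounded_words"
proof -
  have "m b a = \<infinity>" using m_sym assms by metis
  then show ?thesis
    by (intro block_sequence_unbounded[where B = "\<lambda>n. if even n then {a} else {b}"])
      (use assms in \<open>auto split: if_splits\<close>)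
qed

text \<open>The word that runs around the cycle again and again; it has length at least three, so the
  word never returns to a node after two steps.\<close>

lemma cycle_unbounded:
  assumes c: "coxeter_cycle I m c" shows "\<not> bounded_words"
proof -
  define l where "l = length c"
  have l3: "3 \<le> l" and dc: "distinct c" and ad: "\<And>k. k < l \<Longrightarrow> adj (c ! k) (c ! (Suc k mod l))"
    using c unfolding coxeter_cycle_def l_def by auto
  have in_l: "n mod l < l" for n using l3 by simp
  show ?thesis
  proof (rule block_sequence_unbounded[where B = "\<lambda>n. {c ! (n mod l)}"])
    fix n
    show "(\<exists>x\<in>I. {c ! (n mod l)} = {x}) \<or> (\<exists>x y. x \<noteq> y \<and> m x y = 2 \<and> {x, y} \<in> J \<and> {c ! (n mod l)} = {x, y})"
      using ad[OF in_l[of n]] by (auto simp: coxeter_adj_def)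
  next
    fix n x y assume "x \<in> {c ! (n mod l)}" "y \<in> {c ! (Suc n mod l)}"
    then show "3 \<le> m x y \<or> {c ! (n mod l)} = {x} \<and> {c ! (Suc n mod l)} = {x} \<and> {c ! (Suc (Suc n) mod l)} \<noteq> {x} \<and> 3 \<le> d x"
      using ad[OF in_l[of n]] by (simp add: adj3 mod_Suc_eq)
  next
    fix n a b assume "a \<in> {c ! (n mod l)}" "a \<in> {c ! (Suc (Suc n) mod l)}"
    then have "n mod l = Suc (Suc n) mod l"
      using dc in_l[of n] in_l[of "Suc (Suc n)"] by (simp add: nth_eq_iff_index_eq l_def)
    then have "l dvd Suc (Suc n) - n" using mod_eq_dvd_iff_nat[of n "Suc (Suc n)" l] by simp
    then have "l dvd 2" by (simp add: numeral_2_eq_2)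
    then have False using l3 by (auto dest: dvd_imp_le)
    then show "4 \<le> m a b \<and> (b \<in> {c ! (Suc (Suc (Suc n)) mod l)} \<longrightarrow> m a b = \<infinity>)" ..
  qed
qed

text \<open>The position of a point that runs back and forth on \<open>{0..R}\<close>, resting for one
  step at the ends marked by \<open>sl\<close> and \<open>sr\<close>. The Boolean component is the
  direction.\<close>

definition shuttle :: "nat \<Rightarrow> bool \<Rightarrow> bool \<Rightarrow> bool \<times> nat \<Rightarrow> bool \<times> nat" where
  "shuttle R sl sr s = (case s of (up, j) \<Rightarrow>
     if up then if j < R then (True, Suc j) else (False, if sr then R else R - 1)
     else if 0 < j then (False, j - 1) else (True, if sl then 0 else 1))"

lemma shuttle_props:
  fixes s :: "bool \<times> nat"
  assumes R: "0 < R" "R = 1 \<longrightarrow> sl \<or> sr" and j: "snd s \<le> R"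
  defines "f \<equiv> shuttle R sl sr"
  shows "snd (f s) \<le> R"
    "snd (f s) = snd s \<Longrightarrow> (snd s = 0 \<and> sl \<or> snd s = R \<and> sr) \<and> snd (f (f s)) \<noteq> snd s"
    "snd (f s) \<noteq> snd s \<Longrightarrow> snd (f s) = Suc (snd s) \<or> snd s = Suc (snd (f s))"
    "snd (f (f s)) = snd s \<Longrightarrow> snd (f s) \<noteq> snd s \<Longrightarrow>
       (snd (f s) = 0 \<and> \<not> sl \<and> snd s = 1 \<or> snd (f s) = R \<and> \<not> sr \<and> Suc (snd s) = R) \<and> snd (f (f (f s))) \<noteq> snd (f s)"
  using assms(1-3) unfolding f_def shuttle_def by (cases s; auto split: if_splits)+

text \<open>The walk \<open>Q 0, \<dots>, Q R\<close> is read to and fro for ever. At an end the walk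
  has to turn, and there are three ways to do so: to stay for one step at a node of exponent at least
  three, to turn on a multiple edge, or to turn at a block of two commuting letters.\<close>

lemma back_and_forth_unbounded:
  fixes Q :: "nat \<Rightarrow> 'i set" and R :: nat
  assumes R: "0 < R" "R = 1 \<Longrightarrow> sl \<or> sr"
    and block: "\<And>j. j \<le> R \<Longrightarrow> (\<exists>x\<in>I. Q j = {x}) \<or> (\<exists>x y. x \<noteq> y \<and> m x y = 2 \<and> {x, y} \<in> J \<and> Q j = {x, y})"
    and ad: "\<And>j x y. j < R \<Longrightarrow> x \<in> Q j \<Longrightarrow> y \<in> Q (Suc j) \<Longrightarrow> adj x y"
    and ne: "\<And>j x. Suc j < R \<Longrightarrow> x \<in> Q j \<Longrightarrow> x \<notin> Q (Suc (Suc j))"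
    and rest0: "\<And>x. sl \<Longrightarrow> x \<in> Q 0 \<Longrightarrow> Q 0 = {x} \<and> 3 \<le> d x"
    and rest1: "\<And>x. sr \<Longrightarrow> x \<in> Q R \<Longrightarrow> Q R = {x} \<and> 3 \<le> d x"
    and turn0: "\<And>a b. \<not> sl \<Longrightarrow> Q 0 = {b} \<Longrightarrow> a \<in> Q 1 \<Longrightarrow> 4 \<le> m a b"
    and turn1: "\<And>a b. \<not> sr \<Longrightarrow> Q R = {b} \<Longrightarrow> a \<in> Q (R - 1) \<Longrightarrow> 4 \<le> m a b"
  shows "\<not> bounded_words"
proof -
  define f where "f = shuttle R sl sr"
  define s where "s n = (f ^^ n) (True, 0)" for n
  have sS: "s (Suc n) = f (s n)" for n by (simp add: s_def)
  have R': "R = 1 \<longrightarrow> sl \<or> sr" using R(2) by blast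
  have sR: "snd (s n) \<le> R" for n
    by (induction n) (use shuttle_props(1)[OF R(1) R'] in \<open>auto simp: sS f_def s_def[of 0]\<close>)
  note props = shuttle_props[OF R(1) R' sR, folded f_def, folded sS]
  have irr: False if "x \<in> Q i" "x \<in> Q j" "i \<le> R" "j \<le> R" "i = Suc j \<or> j = Suc i" for i j x
    using ad[of j x x] ad[of i x x] that by (auto simp: coxeter_adj_def)
  have ne': False if "x \<in> Q i" "x \<in> Q j" "i \<le> R" "j \<le> R" "i = Suc (Suc j) \<or> j = Suc (Suc i)" for i j x
    using ne[of j x] ne[of i x] that by auto
  show ?thesis
  proof (rule block_sequence_unbounded[where B = "\<lambda>n. Q (snd (s n))"])
    fix n
    show "(\<exists>x\<in>I. Q (snd (s n)) = {x}) \<or> (\<exists>x y. x \<noteq> y \<and> m x y = 2 \<and> {x, y} \<in> J \<and> Q (snd (s n)) = {x, y})"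
      using block sR by blast
  next
    fix n x y assume xy: "x \<in> Q (snd (s n))" "y \<in> Q (snd (s (Suc n)))"
    show "3 \<le> m x y \<or> Q (snd (s n)) = {x} \<and> Q (snd (s (Suc n))) = {x} \<and> Q (snd (s (Suc (Suc n)))) \<noteq> {x} \<and> 3 \<le> d x"
    proof (cases "snd (s (Suc n)) = snd (s n)")
      case True
      then have st: "(snd (s n) = 0 \<and> sl \<or> snd (s n) = R \<and> sr)" "snd (s (Suc (Suc n))) \<noteq> snd (s n)"
        using props(2)[of n] by auto
      have x: "Q (snd (s n)) = {x}" "3 \<le> d x" using st(1) rest0[of x] rest1[of x] xy(1) by auto
      have "snd (s (Suc (Suc n))) = Suc (snd (s n)) \<or> snd (s n) = Suc (snd (s (Suc (Suc n))))"
        using props(3)[of "Suc n"] st(2) True by simp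
      then have "x \<notin> Q (snd (s (Suc (Suc n))))"
        using irr[OF xy(1) _ sR[of n] sR[of "Suc (Suc n)"]] by blast
      then show ?thesis using x True by auto
    next
      case False
      then have "adj x y \<or> adj y x"
        using props(3)[OF False] ad[of "snd (s n)" x y] ad[of "snd (s (Suc n))" y x] xy sR[of n] sR[of "Suc n"]
        by auto
      then show ?thesis using adj_sym adj3 by blast
    qed
  next
    fix n a b
    assume h: "a \<in> Q (snd (s n))" "Q (snd (s (Suc n))) = {b}" "a \<in> Q (snd (s (Suc (Suc n))))" "a \<noteq> b"
    have ne1: "snd (s (Suc n)) \<noteq> snd (s n)" using h(1,2,4) by (metis singletonD)
    have ne2: "snd (s (Suc (Suc n))) \<noteq> snd (s (Suc n))" using h(2,3,4) by (metis singletonD)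
    have eq: "snd (s (Suc (Suc n))) = snd (s n)"
    proof (rule ccontr)
      assume "snd (s (Suc (Suc n))) \<noteq> snd (s n)"
      then have "snd (s (Suc (Suc n))) = Suc (Suc (snd (s n))) \<or> snd (s n) = Suc (Suc (snd (s (Suc (Suc n)))))"
        using props(3)[OF ne1] props(3)[OF ne2] by arith
      then show False using ne'[OF h(1,3) sR sR] by blast
    qed
    have p: "snd (s (Suc n)) = 0 \<and> \<not> sl \<and> snd (s n) = 1 \<or> snd (s (Suc n)) = R \<and> \<not> sr \<and> Suc (snd (s n)) = R"
      "snd (s (Suc (Suc (Suc n)))) \<noteq> snd (s (Suc n))"
      using props(4)[OF eq ne1] by blast+
    have "4 \<le> m a b" using p(1)
    proof (elim disjE conjE)
      assume e: "snd (s (Suc n)) = 0" "\<not> sl" "snd (s n) = 1"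
      show ?thesis using turn0[OF e(2), of b a] h(1,2) e(1,3) by simp
    next
      assume e: "snd (s (Suc n)) = R" "\<not> sr" "Suc (snd (s n)) = R"
      then have "snd (s n) = R - 1" by simp
      then show ?thesis using turn1[OF e(2), of b a] h(1,2) e(1) by simp
    qed
    moreover have "b \<notin> Q (snd (s (Suc (Suc (Suc n)))))"
    proof
      assume b: "b \<in> Q (snd (s (Suc (Suc (Suc n)))))"
      let ?x = "snd (s (Suc n))" and ?y = "snd (s (Suc (Suc (Suc n))))"
      have "?x = Suc ?y \<or> ?y = Suc ?x \<or> ?x = Suc (Suc ?y) \<or> ?y = Suc (Suc ?x)"
        using props(3)[OF ne2] props(3)[of "Suc (Suc n)"] p(2) by arith
      moreover have b': "b \<in> Q ?x" using h(2) by simp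
      ultimately show False using irr[OF b' b sR sR] ne'[OF b' b sR sR] by blast
    qed
    ultimately show "4 \<le> m a b \<and> (b \<in> Q (snd (s (Suc (Suc (Suc n))))) \<longrightarrow> m a b = \<infinity>)" by blast
  qed
qed

definition nbwalk :: "'i list \<Rightarrow> bool" where
  "nbwalk w \<longleftrightarrow> (\<forall>t. Suc t < length w \<longrightarrow> adj (w ! t) (w ! Suc t)) \<and>
     (\<forall>t. Suc (Suc t) < length w \<longrightarrow> w ! t \<noteq> w ! Suc (Suc t))"

lemma nbwalk_rev: "nbwalk w \<Longrightarrow> nbwalk (rev w)"
proof -
  assume w: "nbwalk w"
  have "adj (rev w ! t) (rev w ! Suc t)" if "Suc t < length w" for t
  proof -
    have "Suc (length w - Suc (Suc t)) = length w - Suc t" using that by simp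
    then have "adj (w ! (length w - Suc (Suc t))) (w ! (length w - Suc t))"
      using w that unfolding nbwalk_def by (metis diff_less zero_less_Suc length_greater_0_conv less_nat_zero_code list.size(3))
    then show ?thesis using that adj_sym by (simp add: rev_nth)
  qed
  moreover have "rev w ! t \<noteq> rev w ! Suc (Suc t)" if "Suc (Suc t) < length w" for t
  proof -
    have e: "Suc (Suc (length w - Suc (Suc (Suc t)))) = length w - Suc t" using that by simp
    then have "w ! (length w - Suc (Suc (Suc t))) \<noteq> w ! (length w - Suc t)"
      using w that unfolding nbwalk_def by (metis diff_less zero_less_Suc length_greater_0_conv less_nat_zero_code list.size(3))
    then show ?thesis using that by (simp add: rev_nth)
  qed
  ultimately show "nbwalk (rev w)" unfolding nbwalk_def by simp
qed

lemma nbwalk_snoc: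
  "p \<noteq> [] \<Longrightarrow> nbwalk (p @ [x]) \<longleftrightarrow> nbwalk p \<and> adj (last p) x \<and> (2 \<le> length p \<longrightarrow> p ! (length p - 2) \<noteq> x)"
proof -
  assume p: "p \<noteq> []"
  then obtain k where k: "length p = Suc k" by (cases p) auto
  have l: "last p = p ! k" using p k by (simp add: last_conv_nth)
  have A: "(\<forall>t. Suc t < length (p @ [x]) \<longrightarrow> adj ((p @ [x]) ! t) ((p @ [x]) ! Suc t)) \<longleftrightarrow>
    (\<forall>t. Suc t < length p \<longrightarrow> adj (p ! t) (p ! Suc t)) \<and> adj (last p) x"
  proof -
    have "(\<forall>t. Suc t < length (p @ [x]) \<longrightarrow> adj ((p @ [x]) ! t) ((p @ [x]) ! Suc t)) \<longleftrightarrow>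
      (\<forall>t<Suc k. adj ((p @ [x]) ! t) ((p @ [x]) ! Suc t))" using k by simp
    also have "\<dots> \<longleftrightarrow> (\<forall>t<k. adj ((p @ [x]) ! t) ((p @ [x]) ! Suc t)) \<and> adj ((p @ [x]) ! k) ((p @ [x]) ! Suc k)"
      by (auto simp: less_Suc_eq)
    also have "\<dots> \<longleftrightarrow> (\<forall>t<k. adj (p ! t) (p ! Suc t)) \<and> adj (p ! k) x"
      using k by (simp add: nth_append)
    finally show ?thesis using k l by simp
  qed
  have B: "(\<forall>t. Suc (Suc t) < length (p @ [x]) \<longrightarrow> (p @ [x]) ! t \<noteq> (p @ [x]) ! Suc (Suc t)) \<longleftrightarrow>
    (\<forall>t. Suc (Suc t) < length p \<longrightarrow> p ! t \<noteq> p ! Suc (Suc t)) \<and> (2 \<le> length p \<longrightarrow> p ! (length p - 2) \<noteq> x)"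
  proof (cases k)
    case (Suc r)
    have "(\<forall>t. Suc (Suc t) < length (p @ [x]) \<longrightarrow> (p @ [x]) ! t \<noteq> (p @ [x]) ! Suc (Suc t)) \<longleftrightarrow>
      (\<forall>t<Suc r. (p @ [x]) ! t \<noteq> (p @ [x]) ! Suc (Suc t))" using k Suc by simp
    also have "\<dots> \<longleftrightarrow> (\<forall>t<r. (p @ [x]) ! t \<noteq> (p @ [x]) ! Suc (Suc t)) \<and> (p @ [x]) ! r \<noteq> (p @ [x]) ! Suc (Suc r)"
      by (auto simp: less_Suc_eq)
    also have "\<dots> \<longleftrightarrow> (\<forall>t<r. p ! t \<noteq> p ! Suc (Suc t)) \<and> p ! r \<noteq> x"
      using k Suc by (simp add: nth_append)
    finally show ?thesis using k Suc by simp
  qed (use k in simp)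
  show ?thesis unfolding nbwalk_def A B by blast
qed

lemma nbwalk_Cons:
  "p \<noteq> [] \<Longrightarrow> nbwalk (x # p) \<longleftrightarrow> nbwalk p \<and> adj x (hd p) \<and> (2 \<le> length p \<longrightarrow> x \<noteq> p ! 1)"
  unfolding nbwalk_def
  by (auto simp: nth_Cons hd_conv_nth less_Suc_eq_0_disj split: nat.split)

lemma nbwalk_nil [simp]: "nbwalk []" and nbwalk_single [simp]: "nbwalk [x]"
  by (auto simp: nbwalk_def)

lemma nbwalk_I: "nbwalk p \<Longrightarrow> 2 \<le> length p \<Longrightarrow> set p \<subseteq> I"
proof
  fix x assume p: "nbwalk p" "2 \<le> length p" "x \<in> set p"
  then obtain t where t: "t < length p" "x = p ! t" by (auto simp: in_set_conv_nth)
  show "x \<in> I"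
  proof (cases t)
    case 0
    then show ?thesis using p t unfolding nbwalk_def coxeter_adj_def by auto
  next
    case (Suc k)
    then show ?thesis using p t unfolding nbwalk_def coxeter_adj_def by auto
  qed
qed

text \<open>Both ends of the walk are nodes of exponent at least three or multiple edges. A walk on a
  single edge cannot turn on this edge at both ends, since the alternating word is killed or braided
  after \<open>m a b\<close> letters.\<close>

lemma walk_unbounded:
  assumes p: "nbwalk p" "2 \<le> length p"
    and left: "3 \<le> d (p ! 0) \<or> 4 \<le> m (p ! 0) (p ! 1)"
    and right: "3 \<le> d (last p) \<or> 4 \<le> m (p ! (length p - 2)) (last p)"
    and deg: "length p = 2 \<Longrightarrow> 3 \<le> d (p ! 0) \<or> 3 \<le> d (last p)"
  shows "\<not> bounded_words"
proof (rule back_and_forth_unbounded[where Q = "\<lambda>j. {p ! j}" and R = "length p - 1"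
    and sl = "3 \<le> d (p ! 0)" and sr = "3 \<le> d (last p)"])
  have pI: "p ! j \<in> I" if "j < length p" for j using nbwalk_I[OF p] that by auto
  have l: "last p = p ! (length p - 1)" using p(2) by (intro last_conv_nth) auto
  have ms: "m (p ! 1) (p ! 0) = m (p ! 0) (p ! 1)" by (rule m_sym; rule pI) (use p(2) in auto)
  show "0 < length p - 1" using p by simp
  show "length p - 1 = 1 \<Longrightarrow> 3 \<le> d (p ! 0) \<or> 3 \<le> d (last p)" using deg by simp
  show "(\<exists>x\<in>I. {p ! j} = {x}) \<or> (\<exists>x y. x \<noteq> y \<and> m x y = 2 \<and> {x, y} \<in> J \<and> {p ! j} = {x, y})"
    if "j \<le> length p - 1" for j using pI[of j] that p(2) by auto
  show "adj x y" if "j < length p - 1" "x \<in> {p ! j}" "y \<in> {p ! Suc j}" for j x y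
    using that p(1) by (auto simp: nbwalk_def)
  show "x \<notin> {p ! Suc (Suc j)}" if "Suc j < length p - 1" "x \<in> {p ! j}" for j x
    using that p(1) by (auto simp: nbwalk_def)
  show "{p ! 0} = {x} \<and> 3 \<le> d x" if "3 \<le> d (p ! 0)" "x \<in> {p ! 0}" for x using that by auto
  show "{p ! (length p - 1)} = {x} \<and> 3 \<le> d x" if "3 \<le> d (last p)" "x \<in> {p ! (length p - 1)}" for x
    using that l by auto
  show "4 \<le> m a b" if "\<not> 3 \<le> d (p ! 0)" "{p ! 0} = {b}" "a \<in> {p ! 1}" for a b
    using that left ms by auto
  show "4 \<le> m a b" if "\<not> 3 \<le> d (last p)" "{p ! (length p - 1)} = {b}" "a \<in> {p ! (length p - 1 - 1)}" for a b
    using that right l by (auto simp: numeral_2_eq_2)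
qed

text \<open>One end is as before; at the other end the walk branches into two commuting nodes, which are
  read together.\<close>

lemma walk_fork_unbounded:
  assumes p: "p \<noteq> []" "nbwalk (p @ [x])" "nbwalk (p @ [y])"
    and xy: "x \<noteq> y" "m x y = 2" "{x, y} \<in> J"
    and left: "3 \<le> d (p ! 0) \<or> 2 \<le> length p \<and> 4 \<le> m (p ! 0) (p ! 1)"
  shows "\<not> bounded_words"
proof -
  define Q where "Q j = (if j < length p then {p ! j} else {x, y})" for j
  have pI: "p ! j \<in> I" if "j < length p" for j
    using nbwalk_I[OF p(2)] p(1) that nth_mem[OF that] by (cases p) auto
  have nx: "adj ((p @ [z]) ! j) ((p @ [z]) ! Suc j)" if "j < length p" "z \<in> {x, y}" for j z
    using that p(2,3) unfolding nbwalk_def by auto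
  have nn: "(p @ [z]) ! j \<noteq> (p @ [z]) ! Suc (Suc j)" if "Suc j < length p" "z \<in> {x, y}" for j z
    using that p(2,3) unfolding nbwalk_def by auto
  show ?thesis
  proof (rule back_and_forth_unbounded[where Q = Q and R = "length p" and sl = "3 \<le> d (p ! 0)" and sr = False])
    show "0 < length p" using p by simp
    show "length p = 1 \<Longrightarrow> 3 \<le> d (p ! 0) \<or> False" using left by simp
    show "(\<exists>x\<in>I. Q j = {x}) \<or> (\<exists>x y. x \<noteq> y \<and> m x y = 2 \<and> {x, y} \<in> J \<and> Q j = {x, y})"
      if "j \<le> length p" for j
      using pI[of j] xy by (cases "j < length p") (auto simp: Q_def)
    show "adj u v" if "j < length p" "u \<in> Q j" "v \<in> Q (Suc j)" for j u v
    proof (cases "Suc j < length p")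
      case True
      then show ?thesis using nx[of j x] that by (simp add: Q_def nth_append)
    next
      case False
      then show ?thesis using nx[of j v] that by (simp add: Q_def nth_append)
    qed
    show "u \<notin> Q (Suc (Suc j))" if "Suc j < length p" "u \<in> Q j" for j u
    proof (cases "Suc (Suc j) < length p")
      case True
      then show ?thesis using nn[of j x] that by (simp add: Q_def nth_append)
    next
      case False
      then show ?thesis using nn[of j x] nn[of j y] that by (auto simp: Q_def nth_append split: if_splits)
    qed
    show "Q 0 = {x} \<and> 3 \<le> d x" if "3 \<le> d (p ! 0)" "x \<in> Q 0" for x using that p(1) by (auto simp: Q_def)
    show "4 \<le> m a b" if "\<not> 3 \<le> d (p ! 0)" "Q 0 = {b}" "a \<in> Q 1" for a b
    proof -
      have "2 \<le> length p" "4 \<le> m (p ! 0) (p ! 1)" using left that(1) by auto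
      moreover then have "m (p ! 1) (p ! 0) = m (p ! 0) (p ! 1)" by (intro m_sym pI) auto
      ultimately show ?thesis using that by (auto simp: Q_def split: if_splits)
    qed
    show "4 \<le> m a b" if "Q (length p) = {b}" for a b using that xy(1) by (auto simp: Q_def)
  qed auto
qed

lemma two_forks_unbounded:
  assumes p: "\<And>x z. x \<in> {x1, x2} \<Longrightarrow> z \<in> {z1, z2} \<Longrightarrow> nbwalk (x # p @ [z])" "p \<noteq> []"
    and x: "x1 \<noteq> x2" "m x1 x2 = 2" "{x1, x2} \<in> J"
    and z: "z1 \<noteq> z2" "m z1 z2 = 2" "{z1, z2} \<in> J"
  shows "\<not> bounded_words"
proof -
  define Q where "Q j = (if j = 0 then {x1, x2} else if j \<le> length p then {p ! (j - 1)} else {z1, z2})" for j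
  have pI: "p ! j \<in> I" if "j < length p" for j
    using nbwalk_I[OF p(1)[of x1 z1]] that nth_mem[OF that] by auto
  have nx: "adj ((u # p @ [z]) ! j) ((u # p @ [z]) ! Suc j)" if "j < Suc (length p)" "u \<in> {x1, x2}" "z \<in> {z1, z2}" for j z u
    using that p(1)[OF that(2,3)] unfolding nbwalk_def by auto
  have nn: "(u # p @ [z]) ! j \<noteq> (u # p @ [z]) ! Suc (Suc j)" if "Suc j < Suc (length p)" "u \<in> {x1, x2}" "z \<in> {z1, z2}" for j z u
    using that p(1)[OF that(2,3)] unfolding nbwalk_def by auto
  have rep: "\<exists>a\<in>{x1, x2}. \<exists>b\<in>{z1, z2}. u = (a # p @ [b]) ! j \<and> v = (a # p @ [b]) ! k"
    if "u \<in> Q j" "v \<in> Q k" "j < k" "k \<le> Suc (length p)" for j k u v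
    using that p(2) by (auto simp: Q_def nth_append nth_Cons' split: if_splits)
  show ?thesis
  proof (rule back_and_forth_unbounded[where Q = Q and R = "Suc (length p)" and sl = False and sr = False])
    show "Suc (length p) = 1 \<Longrightarrow> False \<or> False" using p(2) by simp
    show "(\<exists>x\<in>I. Q j = {x}) \<or> (\<exists>x y. x \<noteq> y \<and> m x y = 2 \<and> {x, y} \<in> J \<and> Q j = {x, y})"
      if "j \<le> Suc (length p)" for j
      using pI[of "j - 1"] x z that by (cases "j = 0"; cases "j \<le> length p") (auto simp: Q_def)
    show "adj u v" if "j < Suc (length p)" "u \<in> Q j" "v \<in> Q (Suc j)" for j u v
      using rep[OF that(2,3)] that(1) nx by fastforce
    show "u \<notin> Q (Suc (Suc j))" if "Suc j < Suc (length p)" "u \<in> Q j" for j u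
      using rep[OF that(2), of u "Suc (Suc j)"] that(1) nn by fastforce
    show "4 \<le> m a b" if "Q 0 = {b}" for a b using that x by (auto simp: Q_def)
    show "4 \<le> m a b" if "Q (Suc (length p)) = {b}" for a b using that z by (auto simp: Q_def)
  qed auto
qed

end

section \<open>Periodic words from games and automata\<close>

context braid_words begin

text \<open>It suffices to return to a state after reading a nonempty word. As the letters are numbers,
  each pair needs to be considered in one order only.\<close>

lemma periodic_action_unbounded:
  fixes f :: "nat \<Rightarrow> 'i"
  assumes M: "\<And>i j. i < n \<Longrightarrow> j < n \<Longrightarrow> i \<noteq> j \<Longrightarrow> f i \<noteq> f j" "\<And>i. i < n \<Longrightarrow> f i \<in> I"
    and sq: "\<And>i s. i < n \<Longrightarrow> run act [i, i] s = None"
    and rel: "\<And>i j. i < n \<Longrightarrow> j < i \<Longrightarrow>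
       (\<exists>r. m (f i) (f j) = enat r \<and> {f i, f j} \<in> J \<and> (\<forall>s. run act (alt_word i j r) s = run act (alt_word j i r) s))
       \<or> (\<exists>r. enat r \<le> m (f i) (f j) \<and>
            (\<forall>s. run act (alt_word i j r) s = None \<and> run act (alt_word j i r) s = None))"
    and u: "u \<in> lists {..<n}" "u \<noteq> []" "run act u s = Some s"
  shows "\<not> bounded_words"
proof (rule partial_action_unbounded[where f = f and L = "{..<n}" and act = act])
  show "inj_on f {..<n}" using M(1) by (auto simp: inj_on_def)
  show "f ` {..<n} \<subseteq> I" using M(2) by auto
  fix i s assume i: "i \<in> {..<n}"
  then obtain e where "d (f i) = Suc (Suc e)" using d2[OF M(2)] by (metis add_2_eq_Suc le_Suc_ex lessThan_iff)
  then show "run act (replicate (d (f i)) i) s = None"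
    using sq[of i s] run_append[of act "[i, i]" "replicate e i" s] i by (simp del: run.simps)
next
  fix i j assume ij: "i \<in> {..<n}" "j \<in> {..<n}" "i \<noteq> j"
  have ms: "m (f j) (f i) = m (f i) (f j)" using M(2) m_sym ij by simp
  have js: "{f j, f i} = {f i, f j}" by blast
  have "(\<exists>r. m (f i) (f j) = enat r \<and> {f i, f j} \<in> J \<and> (\<forall>s. run act (alt_word i j r) s = run act (alt_word j i r) s))
       \<or> (\<exists>r. enat r \<le> m (f i) (f j) \<and>
            (\<forall>s. run act (alt_word i j r) s = None \<and> run act (alt_word j i r) s = None))"
  proof (cases "j < i")
    case False
    then have "i < j" using ij by simp
    then have "(\<exists>r. m (f i) (f j) = enat r \<and> {f i, f j} \<in> J \<and> (\<forall>s. run act (alt_word j i r) s = run act (alt_word i j r) s))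
       \<or> (\<exists>r. enat r \<le> m (f i) (f j) \<and>
            (\<forall>s. run act (alt_word j i r) s = None \<and> run act (alt_word i j r) s = None))"
      using rel[of j i] ij unfolding ms js by simp
    then show ?thesis by metis
  qed (use rel ij in blast)
  then show "{f i, f j} \<in> J \<and> (\<forall>s. run act (alt_word i j (the_enat (m (f i) (f j)))) s
          = run act (alt_word j i (the_enat (m (f i) (f j)))) s)
       \<or> (\<exists>r. enat r \<le> m (f i) (f j) \<and>
            (\<forall>s. run act (alt_word i j r) s = None \<and> run act (alt_word j i r) s = None))
       \<or> m (f i) (f j) = \<infinity>"
    by (elim disjE exE) auto
next
  fix N
  have "concat (replicate (Suc N) u) \<in> lists {..<n}" using u(1) by (induction N) auto
  moreover have "N < length (concat (replicate (Suc N) u))"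
    using u(2) by (induction N) (auto simp: length_greater_0_conv[symmetric] simp del: length_greater_0_conv)
  ultimately show "\<exists>w\<in>lists {..<n}. N < length w \<and> (\<exists>s. run act w s \<noteq> None)"
    using run_cycle[OF u(3)] by (metis option.distinct(1))
qed

end

subsection \<open>Numbers games\<close>

text \<open>A label \<open>4\<close> gets the coefficients \<open>1\<close> and \<open>2\<close>, which
  depend on the direction.\<close>

definition game_coeff :: "(nat \<Rightarrow> nat \<Rightarrow> enat) \<Rightarrow> nat \<Rightarrow> nat \<Rightarrow> int" where
  "game_coeff M i j = (if M i j = 3 then 1 else if M i j = 4 then if i < j then 1 else 2 else 0)"

text \<open>Mozes's numbers game: firing \<open>i\<close> is the action of the simple reflection
  \<open>i\<close> on a weight with the coordinates \<open>L\<close>.\<close>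

definition fire :: "(nat \<Rightarrow> nat \<Rightarrow> enat) \<Rightarrow> nat \<Rightarrow> int list \<Rightarrow> int list" where
  "fire M i L = map (\<lambda>j. if j = i then - L ! i else L ! j + game_coeff M i j * L ! i) [0..<length L]"

text \<open>Only positive labels may be fired, so a node is never fired twice in a row. The threshold
  \<open>t\<close> excludes longer alternating words: \<open>i j i\<close> needs a label of at least
  \<open>2\<close>, and \<open>i j i j\<close> over a label \<open>4\<close> one of at least
  \<open>3\<close> at some stage.\<close>

definition game :: "(nat \<Rightarrow> nat \<Rightarrow> enat) \<Rightarrow> int \<Rightarrow> nat \<Rightarrow> int list \<Rightarrow> int list option" where
  "game M t i L = (if i < length L \<and> 0 < L ! i \<and> L ! i \<le> t then Some (fire M i L) else None)"

lemma length_fire [simp]: "length (fire M i L) = length L"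
  by (simp add: fire_def)

lemma nth_fire: "j < length L \<Longrightarrow>
    fire M i L ! j = (if j = i then - L ! i else L ! j + game_coeff M i j * L ! i)"
  by (simp add: fire_def)

lemma run_game_commute:
  assumes "i \<noteq> j" "game_coeff M i j = 0" "game_coeff M j i = 0"
  shows "run (game M t) [i, j] L = run (game M t) [j, i] L"
proof -
  have "fire M j (fire M i L) = fire M i (fire M j L)" if "i < length L" "j < length L"
    by (rule nth_equalityI) (use assms that in \<open>auto simp: nth_fire\<close>)
  then show ?thesis using assms by (auto simp: game_def nth_fire)
qed

lemma run_game_braid:
  assumes "i \<noteq> j" "game_coeff M i j = 1" "game_coeff M j i = 1"
  shows "run (game M t) [i, j, i] L = run (game M t) [j, i, j] L"
proof (cases "i < length L \<and> j < length L")
  case True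
  have "fire M i (fire M j (fire M i L)) = fire M j (fire M i (fire M j L))"
    by (rule nth_equalityI) (use assms True in \<open>auto simp: nth_fire algebra_simps\<close>)
  then show ?thesis using assms True by (auto simp: game_def nth_fire)
qed (auto simp: game_def)

lemma run_game_1_dies:
  assumes "i \<noteq> j" "game_coeff M i j = 1" "game_coeff M j i = 1"
  shows "run (game M 1) [i, j, i] L = None"
  using assms by (auto simp: game_def nth_fire)

lemma run_game_2_dies:
  assumes "i \<noteq> j" "game_coeff M i j = 1" "game_coeff M j i = 2" "t \<le> 2"
  shows "run (game M t) [i, j, i, j] L = None" "run (game M t) [j, i, j, i] L = None"
  using assms by (auto simp: game_def nth_fire)

context braid_words begin

text \<open>With threshold \<open>1\<close> both sides of a braid relation of length three are
  undefined, so it need not be kept; for larger thresholds the game respects these relations.\<close>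

lemma game_unbounded:
  fixes f :: "nat \<Rightarrow> 'i" and t :: int
  assumes M: "\<And>i j. i < n \<Longrightarrow> j < n \<Longrightarrow> m (f i) (f j) = M i j" "\<And>i. i < n \<Longrightarrow> f i \<in> I"
    and small: "\<And>i j. i < n \<Longrightarrow> j < n \<Longrightarrow> i \<noteq> j \<Longrightarrow> M i j = 2 \<or> M i j = 3 \<or> M i j = 4 \<and> t \<le> 2"
    and J2: "PROP keeps 2"
    and J3: "t = 1 \<or> (\<forall>a\<in>I. \<forall>b\<in>I. m a b = 3 \<longrightarrow> {a, b} \<in> J)"
    and u: "u \<in> lists {..<n}" "u \<noteq> []" "run (game M t) u L = Some L"
  shows "\<not> bounded_words"
proof (rule periodic_action_unbounded[OF _ M(2) _ _ u])
  fix i j assume ij: "i < n" "j < n" "i \<noteq> j"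
  then have "m (f i) (f j) \<noteq> 1" using small[OF ij] M(1) by (auto simp: numeral_eq_enat one_enat_def)
  then show "f i \<noteq> f j" using m_refl M(2) ij by metis
next
  fix i s assume "i < n"
  then show "run (game M t) [i, i] s = None" by (auto simp: game_def nth_fire)
next
  fix i j assume ij: "i < n" "j < i"
  then have I: "f i \<in> I" "f j \<in> I" "j < n" "i \<noteq> j" using M(2) by auto
  have mm: "m (f i) (f j) = M i j" "M j i = M i j"
    using M(1)[OF ij(1) I(3)] M(1)[OF I(3) ij(1)] m_sym[OF I(1,2)] by simp_all
  consider "M i j = 2" | "M i j = 3" | "M i j = 4" "t \<le> 2" using small[OF ij(1) I(3,4)] by blast
  then show "(\<exists>r. m (f i) (f j) = enat r \<and> {f i, f j} \<in> J \<and>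
        (\<forall>s. run (game M t) (alt_word i j r) s = run (game M t) (alt_word j i r) s))
      \<or> (\<exists>r. enat r \<le> m (f i) (f j) \<and>
        (\<forall>s. run (game M t) (alt_word i j r) s = None \<and> run (game M t) (alt_word j i r) s = None))"
  proof cases
    case 1
    then have "\<forall>s. run (game M t) (alt_word i j 2) s = run (game M t) (alt_word j i 2) s"
      using run_game_commute[of i j M t] mm I(4) by (simp add: game_coeff_def numeral_2_eq_2 numeral_eq_enat del: run.simps)
    moreover have "m (f i) (f j) = enat 2" "{f i, f j} \<in> J" using J2 I 1 mm by (simp_all add: numeral_eq_enat)
    ultimately show ?thesis by blast
  next
    case 2
    have c: "game_coeff M i j = 1" "game_coeff M j i = 1" using 2 mm by (simp_all add: game_coeff_def)
    have e: "m (f i) (f j) = enat 3" using 2 mm by (simp add: numeral_eq_enat)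
    show ?thesis
    proof (cases "t = 1")
      case True
      have "\<forall>s. run (game M t) (alt_word i j 3) s = None \<and> run (game M t) (alt_word j i 3) s = None"
        using run_game_1_dies[of i j M] run_game_1_dies[of j i M] c I(4) True by (simp add: numeral_3_eq_3 del: run.simps)
      then show ?thesis using e by (metis order_refl)
    next
      case False
      then have "{f i, f j} \<in> J" using J3 I 2 mm by auto
      moreover have "\<forall>s. run (game M t) (alt_word i j 3) s = run (game M t) (alt_word j i 3) s"
        using run_game_braid[of i j M t] c I(4) by (simp add: numeral_3_eq_3 del: run.simps)
      ultimately show ?thesis using e by blast
    qed
  next
    case 3
    have c: "game_coeff M j i = 1" "game_coeff M i j = 2" using 3 mm ij by (simp_all add: game_coeff_def numeral_eq_enat)
    have "\<forall>s. run (game M t) (alt_word i j 4) s = None \<and> run (game M t) (alt_word j i 4) s = None"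
      using run_game_2_dies[of j i M t] c I(4) 3(2) by (simp add: eval_nat_numeral del: run.simps)
    moreover have "enat 4 \<le> m (f i) (f j)" using 3 mm by (simp add: numeral_eq_enat)
    ultimately show ?thesis by blast
  qed
qed

end

lemma run_game_Cons:
  "run (game M t) (i # w) L = (if i < length L \<and> 0 < L ! i \<and> L ! i \<le> t then run (game M t) w (fire M i L) else None)"
  by (simp add: game_def)

text \<open>The node \<open>(r, s)\<close> lies on arm \<open>r\<close> at distance \<open>s\<close>
  from the centre, and all \<open>(r, 0)\<close> stand for the centre.\<close>

definition star_matrix :: "(nat \<times> nat) list \<Rightarrow> nat \<Rightarrow> nat \<Rightarrow> enat" where
  "star_matrix ps i j = (case (ps ! i, ps ! j) of ((r, s), (r', s')) \<Rightarrow>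
     if r = r' \<or> s = 0 \<or> s' = 0 then A_matrix s s' else 2)"

text \<open>On an affine diagram, the weights of level zero are permuted through the finite Weyl group,
  so their orbits are finite and a game on them can be periodic. The starting positions here and below
  have level zero: the labels, weighted by the coefficients of the null root, add up to zero.\<close>

lemma tilde_E6_cycle:
  "run (game (star_matrix [(0, 2), (0, 1), (0, 0), (1, 1), (1, 2), (2, 1), (2, 2)]) 1)
    [6, 5, 2, 1, 3, 2, 4, 3, 5, 2, 1, 0] [-1, 0, 0, 0, 0, 0, 1] = Some [-1, 0, 0, 0, 0, 0, 1]"
  by (simp add: run_game_Cons fire_def upt_rec game_coeff_def star_matrix_def A_matrix_def numeral_eq_enat one_enat_def del: run.simps(2))

lemma tilde_E7_cycle:
  "run (game (star_matrix [(0, 3), (0, 2), (0, 1), (0, 0), (1, 1), (1, 2), (1, 3), (2, 1)]) 1)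
    [6, 5, 4, 3, 2, 1, 7, 3, 2, 4, 3, 5, 4, 7, 3, 2, 1, 0] [-1, 0, 0, 0, 0, 0, 1, 0]
   = Some [-1, 0, 0, 0, 0, 0, 1, 0]"
  by (simp add: run_game_Cons fire_def upt_rec game_coeff_def star_matrix_def A_matrix_def numeral_eq_enat one_enat_def del: run.simps(2))

lemma F5_cycle:
  "run (game (\<lambda>i j. F_matrix (Suc i) (Suc j)) 2) [2, 1, 3, 2, 1, 0, 4, 3, 2, 1, 0] [-1, -1, 1, 0, 0]
   = Some [-1, -1, 1, 0, 0]"
  by (simp add: run_game_Cons fire_def upt_rec game_coeff_def F_matrix_eq numeral_eq_enat one_enat_def del: run.simps(2))

lemma E9_cycle:
  "run (game (\<lambda>i j. E_matrix (Suc i) (Suc j)) 2)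
    [8, 7, 6, 5, 4, 3, 1, 0, 2, 3, 1, 4, 3, 2, 5, 4, 3, 1, 0, 6, 5, 4, 3, 1, 2, 3, 4, 5, 6, 7, 6, 5, 4, 3, 1, 0, 2,
     3, 1, 4, 3, 2, 5, 4, 3, 1, 0, 6, 5, 4, 3, 1, 2, 3, 4, 5, 6, 7] [0, 0, 0, 0, 0, 0, 0, -1, 2]
   = Some [0, 0, 0, 0, 0, 0, 0, -1, 2]"
  by (simp add: run_game_Cons fire_def upt_rec game_coeff_def E_matrix_eq numeral_eq_enat one_enat_def del: run.simps(2))

subsection \<open>Automata given by tables\<close>

text \<open>The list \<open>T ! i\<close> is the graph of the partial map of the letter
  \<open>i\<close>. The tables below come from periodic words: a state tells how far the word has been
  read, up to the braid moves that are kept and modulo the period.\<close>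

definition table_act :: "(int \<times> int) list list \<Rightarrow> nat \<Rightarrow> int \<Rightarrow> int option" where
  "table_act T i s = map_of (T ! i) s"

text \<open>Only states at which the first letter is defined have to be inspected.\<close>

definition dies :: "(int \<times> int) list list \<Rightarrow> nat list \<Rightarrow> bool" where
  "dies T w \<longleftrightarrow> list_all (\<lambda>s. run (table_act T) w s = None) (map fst (T ! hd w))"

definition agree :: "(int \<times> int) list list \<Rightarrow> nat list \<Rightarrow> nat list \<Rightarrow> bool" where
  "agree T u v \<longleftrightarrow> list_all (\<lambda>s. run (table_act T) u s = run (table_act T) v s) (map fst (T ! hd u) @ map fst (T ! hd v))"

text \<open>A path in which the edge between \<open>p\<close> and \<open>p + 1\<close> has label
  \<open>r\<close> and all others have label \<open>3\<close>.\<close>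

definition path_label :: "nat \<Rightarrow> nat \<Rightarrow> nat \<Rightarrow> nat \<Rightarrow> nat" where
  "path_label p r i j = (if i = Suc j then if j = p then r else 3 else if j = Suc i then if i = p then r else 3 else 2)"

text \<open>The flag \<open>br\<close> tells whether the braid relations of length three have to hold or
  may be replaced by zero.\<close>

definition table_check :: "nat \<Rightarrow> nat \<Rightarrow> nat \<Rightarrow> bool \<Rightarrow> (int \<times> int) list list \<Rightarrow> bool" where
  "table_check n p r br T \<longleftrightarrow> list_all (\<lambda>i. dies T [i, i] \<and> list_all (\<lambda>j.
     let l = path_label p r i j; u = alt_word i j l; v = alt_word j i l in
     if l = 2 \<or> br \<and> l = 3 then agree T u v else dies T u \<and> dies T v) [0..<i]) [0..<n]"

lemma table_act_outside: "w \<noteq> [] \<Longrightarrow> s \<notin> set (map fst (T ! hd w)) \<Longrightarrow> run (table_act T) w s = None"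
  by (cases w) (auto simp: table_act_def map_of_eq_None_iff[THEN iffD2] split: option.split)

lemma diesD: "dies T w \<Longrightarrow> w \<noteq> [] \<Longrightarrow> run (table_act T) w s = None"
  by (cases "s \<in> set (map fst (T ! hd w))") (auto simp: dies_def list_all_iff table_act_outside)

lemma agreeD: "agree T u v \<Longrightarrow> u \<noteq> [] \<Longrightarrow> v \<noteq> [] \<Longrightarrow> run (table_act T) u s = run (table_act T) v s"
  by (cases "s \<in> set (map fst (T ! hd u) @ map fst (T ! hd v))")
    (auto simp: agree_def list_all_iff table_act_outside)

context braid_words begin

text \<open>The labels of the actual graph may exceed those for which the table was checked: an
  alternating word that is undefined stays undefined when it gets longer.\<close>

lemma table_unbounded:
  fixes f :: "nat \<Rightarrow> 'i"
  assumes f: "\<And>i. i < n \<Longrightarrow> f i \<in> I" "\<And>i j. i < n \<Longrightarrow> j < n \<Longrightarrow> i \<noteq> j \<Longrightarrow> f i \<noteq> f j"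
    and le: "\<And>i j. i < n \<Longrightarrow> j < n \<Longrightarrow> i \<noteq> j \<Longrightarrow> path_label p r i j \<le> m (f i) (f j)"
    and two: "\<And>i j. i < n \<Longrightarrow> j < n \<Longrightarrow> i \<noteq> j \<Longrightarrow> path_label p r i j = 2 \<Longrightarrow> m (f i) (f j) = 2"
    and three: "\<And>i j. i < n \<Longrightarrow> j < n \<Longrightarrow> i \<noteq> j \<Longrightarrow> br \<Longrightarrow> path_label p r i j = 3 \<Longrightarrow> m (f i) (f j) = 3"
    and J2: "PROP keeps 2"
    and J3: "br \<Longrightarrow> PROP keeps 3"
    and r: "2 < r"
    and tab: "table_check n p r br T"
    and u: "u \<in> lists {..<n}" "u \<noteq> []" "run (table_act T) u 0 = Some 0"
  shows "\<not> bounded_words"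
proof (rule periodic_action_unbounded[OF f(2,1) _ _ u])
  fix i s assume i: "i < n"
  then show "run (table_act T) [i, i] s = None"
    using tab diesD[of T "[i, i]" s] by (auto simp: table_check_def list_all_iff simp del: run.simps)
next
  fix i j assume ij: "i < n" "j < i"
  then have I: "f i \<in> I" "f j \<in> I" "i \<noteq> j" "j < n" using f by auto
  define l where "l = path_label p r i j"
  have l2: "2 \<le> l" using r by (auto simp: l_def path_label_def)
  have ne: "alt_word a b l \<noteq> []" for a b :: nat using l2 length_alt_word[of a b l] by (metis list.size(3) not_numeral_le_zero)
  have chk: "if l = 2 \<or> br \<and> l = 3 then agree T (alt_word i j l) (alt_word j i l)
      else dies T (alt_word i j l) \<and> dies T (alt_word j i l)"
    using tab ij unfolding table_check_def l_def list_all_iff Let_def by simp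
  show "(\<exists>r. m (f i) (f j) = enat r \<and> {f i, f j} \<in> J \<and>
        (\<forall>s. run (table_act T) (alt_word i j r) s = run (table_act T) (alt_word j i r) s))
      \<or> (\<exists>r. enat r \<le> m (f i) (f j) \<and>
        (\<forall>s. run (table_act T) (alt_word i j r) s = None \<and> run (table_act T) (alt_word j i r) s = None))"
  proof (cases "l = 2 \<or> br \<and> l = 3")
    case True
    then have "m (f i) (f j) = enat l" "{f i, f j} \<in> J"
      using two[OF ij(1) I(4,3)] three[OF ij(1) I(4,3)] J2[OF I(1,2)] J3[OF _ I(1,2)]
      by (auto simp: l_def numeral_eq_enat)
    then show ?thesis using chk True agreeD[OF _ ne ne] by auto
  next
    case False
    then show ?thesis using chk diesD[OF _ ne] le[OF ij(1) I(4,3)] unfolding l_def[symmetric] of_nat_eq_enat by auto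
  qed
qed

end

text \<open>Three nodes, first label \<open>6\<close>: the word \<open>2 1 0 1 0\<close>
  repeated.\<close>

definition six_table :: "(int \<times> int) list list" where
  "six_table = [
      [(2, 3), (4, 0), (5, 1)],
   [(1, 2), (3, 4)],
   [(0, 1), (4, 5)]]"

text \<open>Four nodes, middle label \<open>5\<close>.\<close>

definition five_table :: "(int \<times> int) list list" where
  "five_table = [
   [(0, 1), (4, 6), (7, 8)],
   [(1, 2), (3, 4), (5, 7)],
   [(2, 3), (7, 0), (8, 1)],
   [(3, 5), (4, 7), (6, 8)]]"

text \<open>Six nodes, middle label \<open>4\<close>.\<close>

definition four_table :: "(int \<times> int) list list" where
  "four_table = [
   [(3, 5), (6, 8), (9, 10), (11, 12), (13, 15), (16, 18), (19, 22), (28, 29)],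
   [(1, 3), (4, 6), (7, 9), (12, 14), (15, 17), (18, 21), (22, 24), (27, 28)],
   [(0, 1), (2, 4), (9, 11), (10, 12), (17, 20), (21, 23), (24, 26), (25, 27)],
   [(4, 7), (6, 9), (8, 10), (11, 13), (12, 15), (14, 17), (23, 25), (26, 0)],
   [(0, 2), (1, 4), (3, 6), (5, 8), (13, 16), (15, 18), (17, 21), (20, 23)],
   [(16, 19), (18, 22), (21, 24), (23, 26), (25, 0), (27, 1), (28, 3), (29, 5)]]"

text \<open>Type \<open>H\<^sub>5\<close>. In contrast to the preceding tables, the braid relations of
  length three are respected.\<close>

definition H5_table :: "(int \<times> int) list list" where
  "H5_table = [
   [(0, 1), (2, 4), (5, 8), (7, 11), (9, 13), (12, 16), (14, 19), (17, 22), (20, 24), (21, 25), (26, 31), (27, 32), (30, 35), (33, 37), (41, 44), (45, 48), (49, 52), (53, 55)],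
   [(1, 3), (4, 7), (6, 9), (8, 12), (10, 14), (13, 18), (15, 21), (19, 23), (22, 27), (24, 30), (25, 29), (28, 33), (31, 0), (32, 36), (34, 2), (35, 39), (37, 41), (38, 5), (42, 45), (46, 49), (48, 51), (50, 53), (52, 54), (55, 57)],
   [(0, 2), (1, 4), (3, 6), (7, 9), (11, 13), (12, 17), (14, 20), (16, 22), (19, 24), (21, 26), (23, 28), (25, 31), (29, 34), (30, 33), (35, 37), (36, 40), (39, 42), (41, 45), (43, 46), (44, 48), (47, 50), (54, 56), (57, 58), (59, 38)],
   [(2, 5), (4, 8), (6, 10), (7, 12), (9, 14), (11, 16), (13, 19), (17, 20), (18, 23), (22, 24), (27, 30), (32, 35), (34, 38), (36, 39), (40, 43), (42, 46), (45, 49), (48, 52), (50, 15), (51, 54), (53, 21), (55, 25), (57, 29), (58, 59)],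
   [(10, 15), (14, 21), (19, 25), (20, 26), (23, 29), (24, 31), (28, 34), (30, 0), (33, 2), (35, 1), (37, 4), (39, 3), (41, 7), (42, 6), (43, 47), (44, 11), (45, 9), (46, 50), (48, 13), (49, 53), (51, 18), (52, 55), (54, 57), (56, 58)]]"

lemma six_table_check: "table_check 3 0 6 False six_table" by code_simp
lemma six_table_cycle: "run (table_act six_table) [2, 1, 0, 1, 0] 0 = Some 0" by code_simp
lemma five_table_check: "table_check 4 1 5 False five_table" by code_simp
lemma five_table_cycle: "run (table_act five_table) [0, 1, 2, 3, 1, 2] 0 = Some 0" by code_simp
lemma four_table_check: "table_check 6 2 4 False four_table" by code_simp
lemma four_table_cycle: "run (table_act four_table) [2, 4, 3, 1, 0, 2, 3, 1, 2, 4, 5, 3] 0 = Some 0" by code_simp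
lemma H5_table_check: "table_check 5 0 5 True H5_table" by code_simp
lemma H5_table_cycle: "run (table_act H5_table) [0, 1, 2, 1, 0, 3, 2, 4, 1] 0 = Some 0" by code_simp

section \<open>Obstructions in a tree\<close>

context braid_words begin

subsection \<open>Walks without backtracking in a tree\<close>

lemma adjI: "a \<in> I \<Longrightarrow> b \<in> I \<Longrightarrow> a \<noteq> b \<Longrightarrow> m a b \<noteq> 2 \<Longrightarrow> adj a b"
  using m_ge2[of a b] by (cases "m a b" rule: enat_cases_2_3_4) (auto simp: coxeter_adj_def intro: order_trans[of 3 4])

lemma multiple_edge_adj: "a \<in> I \<Longrightarrow> b \<in> I \<Longrightarrow> a \<noteq> b \<Longrightarrow> 4 \<le> m a b \<Longrightarrow> adj a b"
  by (rule adjI) (auto simp: numeral_eq_enat)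

lemma nbwalk_factor: "nbwalk (p @ x @ q) \<Longrightarrow> nbwalk x"
proof -
  assume w: "nbwalk (p @ x @ q)"
  have nth: "(p @ x @ q) ! (length p + t) = x ! t" if "t < length x" for t
    using that by (simp add: nth_append)
  show ?thesis unfolding nbwalk_def
  proof (intro conjI allI impI)
    fix t assume "Suc t < length x"
    then show "adj (x ! t) (x ! Suc t)"
      using w[unfolded nbwalk_def, THEN conjunct1, rule_format, of "length p + t"] nth[of t] nth[of "Suc t"] by simp
  next
    fix t assume "Suc (Suc t) < length x"
    then show "x ! t \<noteq> x ! Suc (Suc t)"
      using w[unfolded nbwalk_def, THEN conjunct2, rule_format, of "length p + t"] nth[of t] nth[of "Suc (Suc t)"] by simp
  qed
qed

lemma walk_exists:
  assumes "coxeter_connected I m" "u \<in> I" "v \<in> I"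
  shows "\<exists>p. nbwalk p \<and> p \<noteq> [] \<and> hd p = u \<and> last p = v"
proof -
  have "adj\<^sup>*\<^sup>* u v" using assms by (simp add: coxeter_connected_def)
  then show ?thesis
  proof (induction rule: rtranclp_induct)
    case base
    show ?case by (intro exI[of _ "[u]"]) simp
  next
    case (step y z)
    then obtain p where p: "nbwalk p" "p \<noteq> []" "hd p = u" "last p = y" by blast
    show ?case
    proof (cases "2 \<le> length p \<and> p ! (length p - 2) = z")
      case True
      have "nbwalk (butlast p)" using nbwalk_factor[of "[]" "butlast p" "[last p]"] append_butlast_last_id[OF p(2)] p(1)
        by (simp del: append_butlast_last_id)
      moreover have "butlast p \<noteq> []" using True by (cases p rule: rev_cases) auto
      moreover have "hd (butlast p) = u" using p True by (cases p) (auto split: if_splits)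
      moreover have "last (butlast p) = z"
      proof -
        have "last (butlast p) = butlast p ! (length p - 2)"
          using \<open>butlast p \<noteq> []\<close> by (simp add: last_conv_nth numeral_2_eq_2)
        also have "\<dots> = p ! (length p - 2)" by (rule nth_butlast) (use True in \<open>simp, arith\<close>)
        finally show ?thesis using True by simp
      qed
      ultimately show ?thesis by blast
    next
      case False
      then have "nbwalk (p @ [z])" using nbwalk_snoc[OF p(2)] p step(2) by simp
      then show ?thesis using p(2,3) by (intro exI[of _ "p @ [z]"]) simp
    qed
  qed
qed

end

locale coxeter_tree_words = braid_words +
  assumes con: "coxeter_connected I m"
    and acyc: "\<nexists>c. coxeter_cycle I m c"
begin

lemma nbwalk_distinct: "nbwalk w \<Longrightarrow> distinct w"
  using nonbacktracking_distinct[OF acyc] by (simp add: nbwalk_def)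

lemma nbwalk_length: assumes "nbwalk w" shows "length w \<le> Suc (card I)"
proof (cases "2 \<le> length w")
  case True
  then show ?thesis
    using card_mono[OF finite_I nbwalk_I[OF assms True]] distinct_card[OF nbwalk_distinct[OF assms]] by simp
qed simp

lemma nbwalk_adj: "nbwalk p \<Longrightarrow> Suc i < length p \<Longrightarrow> adj (p ! i) (p ! Suc i)"
  by (simp add: nbwalk_def)

lemma nbwalk_nonadj:
  assumes p: "nbwalk p" and ij: "Suc i < j" "j < length p"
  shows "m (p ! i) (p ! j) = 2"
proof (rule ccontr)
  assume ne: "m (p ! i) (p ! j) \<noteq> 2"
  have I: "p ! i \<in> I" "p ! j \<in> I" using nbwalk_I[OF p] ij by auto
  have pp: "p ! i \<noteq> p ! j" using nbwalk_distinct[OF p] ij by (simp add: nth_eq_iff_index_eq)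
  have ad: "adj (p ! j) (p ! i)" by (rule adj_sym[OF adjI[OF I pp ne]])
  define q where "q = take (Suc j - i) (drop i p)"
  have "p = take i p @ q @ drop (Suc j - i) (drop i p)" unfolding q_def by (metis append_take_drop_id)
  then have q: "nbwalk q" using nbwalk_factor p by metis
  have lq: "length q = Suc j - i" and nq: "\<And>t. t < Suc j - i \<Longrightarrow> q ! t = p ! (i + t)"
    using ij unfolding q_def by auto
  have q0: "q \<noteq> []" using lq ij by auto
  have "last q = p ! j" using nq[of "j - i"] ij lq q0 by (simp add: last_conv_nth Suc_diff_le)
  moreover have "q ! (length q - 2) \<noteq> p ! i"
  proof -
    have "q ! (length q - 2) = p ! (j - 1)" using nq[of "j - i - 1"] lq ij by (simp add: numeral_2_eq_2 Suc_diff_le)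
    then show ?thesis using nbwalk_distinct[OF p] ij by (simp add: nth_eq_iff_index_eq)
  qed
  ultimately have "nbwalk (q @ [p ! i])" using nbwalk_snoc[OF q0] q ad by simp
  then have "distinct (q @ [p ! i])" by (rule nbwalk_distinct)
  moreover have "p ! i \<in> set q" using nq[of 0] lq ij nth_mem[of 0 q] by simp
  ultimately show False by simp
qed

lemma neighbours_commute:
  assumes "adj v x" "adj v y" "x \<noteq> y" shows "m x y = 2"
proof -
  have "nbwalk [x, v, y]" using assms adj_sym[of v x] nbwalk_Cons[of "[v, y]" x] nbwalk_Cons[of "[y]" v] by simp
  then show ?thesis using nbwalk_nonadj[of "[x, v, y]" 0 2] by simp
qed

lemma adj_closed_subset:
  assumes "x \<in> S" "x \<in> I" "\<And>y z. y \<in> S \<Longrightarrow> adj y z \<Longrightarrow> z \<in> S" shows "I \<subseteq> S"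
proof
  fix y assume "y \<in> I"
  then have "adj\<^sup>*\<^sup>* x y" using con assms(2) by (simp add: coxeter_connected_def)
  then show "y \<in> S" by (induction rule: rtranclp_induct) (use assms in auto)
qed

definition branch_node :: "'a \<Rightarrow> bool" where
  "branch_node v \<longleftrightarrow> (\<exists>x y z. adj v x \<and> adj v y \<and> adj v z \<and> x \<noteq> y \<and> y \<noteq> z \<and> x \<noteq> z)"

lemma branch_node_two_others:
  assumes "branch_node v" obtains x y where "adj v x" "adj v y" "x \<noteq> y" "x \<noteq> w" "y \<noteq> w"
  using assms unfolding branch_node_def by metis

text \<open>A longest walk covers the whole graph, since without branch nodes no node of it can have a
  neighbour outside.\<close>

lemma path_graph:
  assumes nb: "\<And>v. \<not> branch_node v" and ne: "I \<noteq> {}"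
  obtains p where "nbwalk p" "p \<noteq> []" "set p = I"
proof -
  obtain a where a: "a \<in> I" using ne by blast
  have ex: "nbwalk [a] \<and> [a] \<noteq> [] \<and> set [a] \<subseteq> I" using a by simp
  have "\<exists>p. (nbwalk p \<and> p \<noteq> [] \<and> set p \<subseteq> I) \<and> (\<forall>q. nbwalk q \<and> q \<noteq> [] \<and> set q \<subseteq> I \<longrightarrow> length q \<le> length p)"
    by (rule ex_has_greatest_nat[of "\<lambda>p. nbwalk p \<and> p \<noteq> [] \<and> set p \<subseteq> I", OF ex, of length "Suc (Suc (card I))"]) (use nbwalk_length in \<open>auto simp: less_Suc_eq_le\<close>)
  then obtain p where p: "nbwalk p" "p \<noteq> []" "set p \<subseteq> I"
    and max: "\<And>q. nbwalk q \<Longrightarrow> q \<noteq> [] \<Longrightarrow> set q \<subseteq> I \<Longrightarrow> length q \<le> length p" by blast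
  have "z \<in> set p" if y: "y \<in> set p" "adj y z" for y z
  proof (rule ccontr)
    assume z: "z \<notin> set p"
    have zI: "z \<in> I" using y(2) by (simp add: coxeter_adj_def)
    obtain i where i: "i < length p" "y = p ! i" using y(1) by (auto simp: in_set_conv_nth)
    consider "i = 0" | "Suc i = length p" | "0 < i" "Suc i < length p" using i(1) by linarith
    then show False
    proof cases
      case 1
      then have "hd p = y" using i p(2) by (simp add: hd_conv_nth)
      moreover have "2 \<le> length p \<Longrightarrow> p ! 1 \<in> set p" by (rule nth_mem) simp
      ultimately have "nbwalk (z # p)" using nbwalk_Cons[OF p(2), of z] p y(2) z adj_sym by metis
      then show False using max[of "z # p"] p zI by simp
    next
      case 2
      then have "last p = y" using i p(2) by (simp add: last_conv_nth flip: 2)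
      moreover have "2 \<le> length p \<Longrightarrow> p ! (length p - 2) \<in> set p" by (rule nth_mem) simp
      ultimately have "nbwalk (p @ [z])" using nbwalk_snoc[OF p(2), of z] p y(2) z by metis
      then show False using max[of "p @ [z]"] p zI by simp
    next
      case 3
      have "adj y (p ! (i - 1))" using nbwalk_adj[OF p(1), of "i - 1"] 3 i adj_sym by simp
      moreover have "adj y (p ! Suc i)" using nbwalk_adj[OF p(1), of i] 3 i by simp
      moreover have "p ! (i - 1) \<noteq> p ! Suc i" using nbwalk_distinct[OF p(1)] 3 by (simp add: nth_eq_iff_index_eq)
      moreover have "p ! (i - 1) \<in> set p" "p ! Suc i \<in> set p" using 3 by auto
      ultimately have "branch_node y" unfolding branch_node_def using y(2) z by metis
      then show False using nb by blast
    qed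
  qed
  then have "I \<subseteq> set p" using adj_closed_subset[of "hd p" "set p"] p by (metis hd_in_set subsetD)
  then show ?thesis using that p by blast
qed

subsection \<open>Obstructions\<close>

lemma multiple_edge_walk:
  assumes e: "a \<in> I" "b \<in> I" "a \<noteq> b" "4 \<le> m a b" and v: "v \<in> I"
  obtains p where "nbwalk p" "2 \<le> length p" "last p = v" "{p ! 0, p ! 1} = {a, b}"
proof -
  have ad: "adj b a" using multiple_edge_adj[OF e] adj_sym by blast
  obtain q where q: "nbwalk q" "q \<noteq> []" "hd q = a" "last q = v" using walk_exists[OF con e(1) v] by blast
  show ?thesis
  proof (cases "2 \<le> length q \<and> q ! 1 = b")
    case True
    then show ?thesis using that[of q] q by (simp add: hd_conv_nth)
  next
    case False
    then have "nbwalk (b # q)" using nbwalk_Cons[OF q(2), of b] q ad by auto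
    then show ?thesis using that[of "b # q"] q by (simp add: hd_conv_nth insert_commute length_greater_0_conv[symmetric] Suc_le_eq del: length_greater_0_conv)
  qed
qed

lemma multi_ends: "{x, y} = {a, b} \<Longrightarrow> a \<in> I \<Longrightarrow> b \<in> I \<Longrightarrow> m x y = m a b"
  using m_sym by (auto simp: doubleton_eq_iff)

lemma two_high_degrees_unbounded:
  assumes "u \<in> I" "v \<in> I" "u \<noteq> v" "3 \<le> d u" "3 \<le> d v" shows "\<not> bounded_words"
proof -
  obtain p where p: "nbwalk p" "p \<noteq> []" "hd p = u" "last p = v" using walk_exists[OF con assms(1,2)] by blast
  have "2 \<le> length p" using p assms(3) by (cases p; cases "tl p") auto
  then show ?thesis using walk_unbounded[OF p(1)] p assms by (simp add: hd_conv_nth)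
qed

lemma high_degree_multiple_edge_unbounded:
  assumes e: "a \<in> I" "b \<in> I" "a \<noteq> b" "4 \<le> m a b" and v: "v \<in> I" "3 \<le> d v" shows "\<not> bounded_words"
proof -
  obtain p where p: "nbwalk p" "2 \<le> length p" "last p = v" "{p ! 0, p ! 1} = {a, b}"
    using multiple_edge_walk[OF e v(1)] by blast
  then show ?thesis using walk_unbounded[OF p(1,2)] v(2) e multi_ends[OF p(4) e(1,2)] by simp
qed

lemma two_multiple_edges_unbounded:
  assumes e: "a \<in> I" "b \<in> I" "a \<noteq> b" "4 \<le> m a b" and e': "a' \<in> I" "b' \<in> I" "a' \<noteq> b'" "4 \<le> m a' b'"
    and ne: "{a, b} \<noteq> {a', b'}"
  shows "\<not> bounded_words"
proof -
  have ad: "adj a' b'" using multiple_edge_adj[OF e'] .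
  obtain p where p: "nbwalk p" "2 \<le> length p" "last p = a'" "{p ! 0, p ! 1} = {a, b}"
    using multiple_edge_walk[OF e e'(1)] by blast
  have p0: "p \<noteq> []" using p(2) by auto
  define q where "q = (if p ! (length p - 2) = b' then p else p @ [b'])"
  have q: "nbwalk q" unfolding q_def using nbwalk_snoc[OF p0, of b'] p ad by simp
  have q01: "{q ! 0, q ! 1} = {a, b}" unfolding q_def using p p0 by (auto simp: nth_append)
  have qe: "{q ! (length q - 2), last q} = {a', b'}"
    unfolding q_def using p p0 by (auto simp: nth_append last_conv_nth numeral_2_eq_2)
  have lq: "2 \<le> length q" unfolding q_def using p by simp
  have "length q \<noteq> 2"
  proof
    assume "length q = 2"
    moreover then have "q \<noteq> []" by auto
    ultimately have "{q ! 0, q ! 1} = {q ! (length q - 2), last q}" by (simp add: last_conv_nth)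
    then show False using q01 qe ne by simp
  qed
  then show ?thesis using walk_unbounded[OF q lq] multi_ends[OF q01 e(1,2)] multi_ends[OF qe e'(1,2)] e e' by simp
qed

context
  assumes J2: "PROP keeps 2"
begin

lemma neighbours_J:
  assumes "adj v x" "adj v y" "x \<noteq> y" shows "{x, y} \<in> J"
  using neighbours_commute[OF assms] J2 assms unfolding coxeter_adj_def by blast

lemma nbwalk_fork:
  assumes p: "nbwalk p" "p \<noteq> []" and x: "adj (last p) x" "2 \<le> length p \<Longrightarrow> p ! (length p - 2) \<noteq> x"
  shows "nbwalk (p @ [x])"
  using nbwalk_snoc[OF p(2)] p(1) x by simp

lemma high_degree_branch_unbounded:
  assumes u: "u \<in> I" "3 \<le> d u" and v: "branch_node v" shows "\<not> bounded_words"
proof -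
  have vI: "v \<in> I" using v unfolding branch_node_def coxeter_adj_def by blast
  obtain p where p: "nbwalk p" "p \<noteq> []" "hd p = u" "last p = v" using walk_exists[OF con u(1) vI] by blast
  obtain x y where xy: "adj v x" "adj v y" "x \<noteq> y" "x \<noteq> p ! (length p - 2)" "y \<noteq> p ! (length p - 2)"
    by (rule branch_node_two_others[OF v])
  have "nbwalk (p @ [x])" "nbwalk (p @ [y])" using nbwalk_fork[OF p(1,2)] xy p(4) by auto
  moreover have "3 \<le> d (p ! 0)" using u p(2,3) by (simp add: hd_conv_nth)
  ultimately show ?thesis
    using walk_fork_unbounded[OF p(2) _ _ xy(3) neighbours_commute[OF xy(1-3)] neighbours_J[OF xy(1-3)]] by blast
qed

lemma high_degree_inner_unbounded:
  assumes u: "u \<in> I" "3 \<le> d u" and xy: "adj u x" "adj u y" "x \<noteq> y" shows "\<not> bounded_words"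
proof -
  have "nbwalk ([u] @ [x])" "nbwalk ([u] @ [y])" using xy nbwalk_snoc[of "[u]"] by simp_all
  then show ?thesis
    using walk_fork_unbounded[OF _ _ _ xy(3) neighbours_commute[OF xy] neighbours_J[OF xy], of "[u]"] u by simp
qed

lemma multiple_edge_branch_unbounded:
  assumes e: "a \<in> I" "b \<in> I" "a \<noteq> b" "4 \<le> m a b" and v: "branch_node v" shows "\<not> bounded_words"
proof -
  have vI: "v \<in> I" using v unfolding branch_node_def coxeter_adj_def by blast
  obtain p where p: "nbwalk p" "2 \<le> length p" "last p = v" "{p ! 0, p ! 1} = {a, b}"
    using multiple_edge_walk[OF e vI] by blast
  have p0: "p \<noteq> []" using p(2) by auto
  obtain x y where xy: "adj v x" "adj v y" "x \<noteq> y" "x \<noteq> p ! (length p - 2)" "y \<noteq> p ! (length p - 2)"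
    by (rule branch_node_two_others[OF v])
  have "nbwalk (p @ [x])" "nbwalk (p @ [y])" using nbwalk_fork[OF p(1) p0] xy p(3) by auto
  moreover have "2 \<le> length p \<and> 4 \<le> m (p ! 0) (p ! 1)" using p(2) multi_ends[OF p(4) e(1,2)] e(4) by simp
  ultimately show ?thesis
    using walk_fork_unbounded[OF p0 _ _ xy(3) neighbours_commute[OF xy(1-3)] neighbours_J[OF xy(1-3)]] by blast
qed

lemma two_branches_unbounded:
  assumes u: "branch_node u" and v: "branch_node v" and ne: "u \<noteq> v" shows "\<not> bounded_words"
proof -
  have I: "u \<in> I" "v \<in> I" using u v unfolding branch_node_def coxeter_adj_def by blast+
  obtain p where p: "nbwalk p" "p \<noteq> []" "hd p = u" "last p = v" using walk_exists[OF con I] by blast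
  have l2: "2 \<le> length p" using p ne by (cases p; cases "tl p") auto
  obtain x y where xy: "adj v x" "adj v y" "x \<noteq> y" "x \<noteq> p ! (length p - 2)" "y \<noteq> p ! (length p - 2)"
    by (rule branch_node_two_others[OF v])
  obtain z w where zw: "adj u z" "adj u w" "z \<noteq> w" "z \<noteq> p ! 1" "w \<noteq> p ! 1"
    by (rule branch_node_two_others[OF u])
  have "nbwalk (a # p @ [b])" if "a \<in> {z, w}" "b \<in> {x, y}" for a b
  proof -
    have "nbwalk (p @ [b])" using that xy p by (intro nbwalk_fork) auto
    moreover have "adj a u" "a \<noteq> p ! 1" using that zw adj_sym by auto
    ultimately show ?thesis using nbwalk_Cons[of "p @ [b]" a] p l2 by (simp add: nth_append)
  qed
  then show ?thesis
    using two_forks_unbounded[OF _ p(2) zw(3) neighbours_commute[OF zw(1-3)] neighbours_J[OF zw(1-3)]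
        xy(3) neighbours_commute[OF xy(1-3)] neighbours_J[OF xy(1-3)]] by blast
qed

lemma four_neighbours_unbounded:
  assumes a: "adj v x" "adj v y" "adj v z" "adj v w" and di: "distinct [x, y, z, w]" shows "\<not> bounded_words"
proof -
  have "nbwalk (a # [v] @ [b])" if "a \<in> {x, y}" "b \<in> {z, w}" for a b
  proof -
    have "adj a v" "adj v b" "a \<noteq> b" using that a di adj_sym by auto
    then show ?thesis using nbwalk_Cons[of "[v, b]" a] nbwalk_Cons[of "[b]" v] by simp
  qed
  then show ?thesis
    using two_forks_unbounded[of x y z w "[v]"] neighbours_commute neighbours_J a di by simp
qed

end

end

section \<open>Trees without braid relations\<close>

context braid_words begin

lemma factor_at:
  assumes "alive w" "s + n \<le> length w" "\<And>i. i < n \<Longrightarrow> w ! (s + i) = x ! i" "length x = n"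
  shows "x \<notin> null_words"
proof -
  have "take n (drop s w) = x"
    using assms by (intro nth_equalityI) auto
  then have "w = take s w @ x @ drop n (drop s w)" by (metis append_take_drop_id)
  then show ?thesis using assms(1) alive_null by metis
qed

lemma free_null_alt:
  assumes "J = {}" "a \<in> I" "b \<in> I" "a \<noteq> b" "m a b = enat n" shows "alt_word a b n \<in> null_words"
proof -
  have "{a, b} \<in> braid_pairs I m - J" using assms braid_pairs_iff by simp
  then show ?thesis unfolding null_words_def using assms(5) by force
qed

lemma free_step:
  assumes "J = {}" "alive w" "Suc t < length w" "w ! t \<noteq> w ! Suc t"
  shows "adj (w ! t) (w ! Suc t)"
proof -
  have I: "w ! t \<in> I" "w ! Suc t \<in> I" using alive_lists[OF assms(2)] assms(3) by (auto simp: lists_eq_set)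
  have "m (w ! t) (w ! Suc t) \<noteq> enat 2"
  proof
    assume "m (w ! t) (w ! Suc t) = enat 2"
    then have "alt_word (w ! t) (w ! Suc t) 2 \<in> null_words" using free_null_alt assms I by blast
    moreover have "alt_word (w ! t) (w ! Suc t) 2 \<notin> null_words"
      by (rule factor_at[OF assms(2), of t 2]) (use assms(3) in \<open>auto simp: nth_alt_word less_2_cases_iff\<close>)
    ultimately show False by contradiction
  qed
  moreover have "2 \<le> m (w ! t) (w ! Suc t)" using m_ge2 I assms(4) by blast
  ultimately have "3 \<le> m (w ! t) (w ! Suc t)"
    by (cases "m (w ! t) (w ! Suc t)") (auto simp: numeral_eq_enat)
  then show ?thesis unfolding coxeter_adj_def using I assms(4) by blast
qed

lemma free_no_backtrack:
  assumes "J = {}" "alive w" "Suc (Suc t) < length w" "w ! t \<noteq> w ! Suc t" "m (w ! t) (w ! Suc t) \<le> 3"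
  shows "w ! t \<noteq> w ! Suc (Suc t)"
proof
  assume eq: "w ! t = w ! Suc (Suc t)"
  have ad: "adj (w ! t) (w ! Suc t)" by (rule free_step[OF assms(1,2) _ assms(4)]) (use assms(3) in simp)
  then have "m (w ! t) (w ! Suc t) = enat 3" "w ! t \<in> I" "w ! Suc t \<in> I"
    using assms(5) unfolding coxeter_adj_def by (auto simp: numeral_eq_enat antisym)
  then have "alt_word (w ! t) (w ! Suc t) 3 \<in> null_words" using free_null_alt assms by blast
  moreover have "alt_word (w ! t) (w ! Suc t) 3 \<notin> null_words"
  proof (rule factor_at[OF assms(2), of t 3])
    fix i :: nat assume "i < 3"
    then consider "i = 0" | "i = 1" | "i = 2" by linarith
    then show "w ! (t + i) = alt_word (w ! t) (w ! Suc t) 3 ! i"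
      by cases (use eq in \<open>auto simp: nth_alt_word\<close>)
  qed (use assms(3) in auto)
  ultimately show False by contradiction
qed

lemma free_no_repeat:
  assumes "alive w" "Suc t < length w" "d (w ! t) = 2" shows "w ! t \<noteq> w ! Suc t"
proof
  assume eq: "w ! t = w ! Suc t"
  have "w ! t \<in> I" using alive_lists[OF assms(1)] assms(2) by (auto simp: lists_eq_set)
  then have "replicate 2 (w ! t) \<in> null_words" unfolding null_words_def using assms(3) by force
  moreover have "replicate 2 (w ! t) \<notin> null_words"
    by (rule factor_at[OF assms(1), of t 2]) (use assms eq in \<open>auto simp: less_2_cases_iff\<close>)
  ultimately show False by contradiction
qed

end

context coxeter_tree_words begin

text \<open>The nodes of \<open>S\<close> are pairwise adjacent, and outside \<open>S\<close> an alive
  word is a walk without backtracking. Such a walk cannot leave \<open>S\<close> and come back: its ends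
  would be two adjacent or equal nodes joined by another walk, in a graph without cycles. So a word is a
  walk into \<open>S\<close>, a word on \<open>S\<close>, and a walk out of \<open>S\<close>.\<close>

lemma core_walk_bounded:
  assumes S: "\<And>x y. x \<in> S \<Longrightarrow> y \<in> S \<Longrightarrow> x \<noteq> y \<Longrightarrow> adj x y"
    and step: "\<And>w t. alive w \<Longrightarrow> Suc t < length w \<Longrightarrow> \<not> (w ! t \<in> S \<and> w ! Suc t \<in> S) \<Longrightarrow>
      adj (w ! t) (w ! Suc t) \<and> (Suc (Suc t) < length w \<longrightarrow> w ! t \<noteq> w ! Suc (Suc t))"
    and run: "\<And>w. alive w \<Longrightarrow> set w \<subseteq> S \<Longrightarrow> length w \<le> K"
  shows bounded_words
proof -
  have nb: "nbwalk w" if "alive w" "\<And>t. Suc t < length w \<Longrightarrow> \<not> (w ! t \<in> S \<and> w ! Suc t \<in> S)" for w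
    unfolding nbwalk_def using step[OF that(1) _ that(2)] by auto
  have outside: "length w \<le> Suc (card I)" if "alive w" "set w \<inter> S = {}" for w
    using that by (intro nbwalk_length nb) (auto simp: disjoint_iff)
  have "length w \<le> 2 * Suc (card I) + K" if w: "alive w" for w
  proof (cases "set w \<inter> S = {}")
    case True
    then show ?thesis using outside[OF w] by simp
  next
    case False
    then obtain p a r where p: "w = p @ a # r" "a \<in> S" "\<forall>x\<in>set p. x \<notin> S"
      using split_list_first_prop[of w "\<lambda>x. x \<in> S"] by blast
    have "\<exists>x\<in>set (a # r). x \<in> S" using p(2) by simp
    then obtain c b q where q: "a # r = c @ b # q" "b \<in> S" "\<forall>x\<in>set q. x \<notin> S"
      using split_list_last_prop[of "a # r" "\<lambda>x. x \<in> S"] by blast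
    have w_eq: "w = p @ (c @ [b]) @ q" using p(1) q(1) by simp
    have al: "alive p" "alive (c @ [b])" "alive q"
      using w alive_factor[of "[]" p "(c @ [b]) @ q"] alive_factor[of p "c @ [b]" q] alive_factor[of "p @ c @ [b]" q "[]"]
      unfolding w_eq by simp_all
    have "set (c @ [b]) \<subseteq> S"
    proof (rule ccontr)
      assume "\<not> set (c @ [b]) \<subseteq> S"
      then have "\<exists>x\<in>set c. x \<notin> S" using q(2) by auto
      then obtain c1 x c2 where c: "c = c1 @ x # c2" "x \<notin> S" "\<forall>y\<in>set c1. y \<in> S"
        using split_list_first_prop[of c "\<lambda>x. x \<notin> S"] by blast
      have c1: "c1 \<noteq> []" using c q(1) p(2) by (cases c1) auto
      have "\<exists>y\<in>set (c2 @ [b]). y \<in> S" using q(2) by simp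
      then obtain u t y where u: "c2 @ [b] = u @ t # y" "t \<in> S" "\<forall>z\<in>set u. z \<notin> S"
        using split_list_first_prop[of "c2 @ [b]" "\<lambda>x. x \<in> S"] by blast
      \<comment> \<open>the piece of \<open>w\<close> from its last letter in \<open>S\<close> before
        leaving \<open>S\<close> to its first letter after returning\<close>
      define v where "v = last c1 # (x # u) @ [t]"
      have "c @ [b] = butlast c1 @ v @ y" using c(1) u(1) c1 by (simp add: v_def)
      then have av: "alive v" using al(2) alive_factor by metis
      have "\<not> (v ! k \<in> S \<and> v ! Suc k \<in> S)" if k: "Suc k < length v" for k
        using k c(2) u(3) by (cases k) (auto simp: v_def nth_append nth_Cons' split: if_splits)
      then have nv: "nbwalk v" by (rule nb[OF av])
      have lv: "length v = length u + 3" "v ! 0 = last c1" "v ! (length u + 2) = t"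
        by (simp_all add: v_def nth_append)
      have "m (last c1) t = 2" using nbwalk_nonadj[OF nv, of 0 "length u + 2"] lv by simp
      moreover have "last c1 \<noteq> t"
        using nbwalk_distinct[OF nv] lv nth_eq_iff_index_eq[of v 0 "length u + 2"] by auto
      then have "3 \<le> m (last c1) t" using S c(3) c1 u(2) adj3 by simp
      ultimately show False by (simp add: numeral_eq_enat)
    qed
    then have "length (c @ [b]) \<le> K" by (rule run[OF al(2)])
    moreover have "length p \<le> Suc (card I)" "length q \<le> Suc (card I)"
      using outside[OF al(1)] outside[OF al(3)] p(3) q(3) by auto
    ultimately show ?thesis unfolding w_eq by simp
  qed
  then show ?thesis unfolding bounded_words_def by blast
qed

lemma simply_laced_tree_bounded:
  assumes J: "J = {}" and sl: "simply_laced I m" and one: "card {i \<in> I. 3 \<le> d i} \<le> 1"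
  shows bounded_words
proof (rule core_walk_bounded[where S = "{i \<in> I. 3 \<le> d i}"])
  have uniq: "i = j" if "i \<in> {i \<in> I. 3 \<le> d i}" "j \<in> {i \<in> I. 3 \<le> d i}" for i j
    using one that finite_I card_le_Suc0_iff_eq[of "{i \<in> I. 3 \<le> d i}"] by auto
  then show "adj i j" if "i \<in> {i \<in> I. 3 \<le> d i}" "j \<in> {i \<in> I. 3 \<le> d i}" "i \<noteq> j" for i j
    using that by blast
  fix w assume w: "alive w"
  then have wI: "w ! t \<in> I" if "t < length w" for t using alive_lists[OF w] that by (auto simp: lists_eq_set)
  show "adj (w ! t) (w ! Suc t) \<and> (Suc (Suc t) < length w \<longrightarrow> w ! t \<noteq> w ! Suc (Suc t))"
    if t: "Suc t < length w" "\<not> (w ! t \<in> {i \<in> I. 3 \<le> d i} \<and> w ! Suc t \<in> {i \<in> I. 3 \<le> d i})" for t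
  proof -
    have I: "w ! t \<in> I" "w ! Suc t \<in> I" using wI t(1) by auto
    have ne: "w ! t \<noteq> w ! Suc t" using free_no_repeat[OF w t(1)] d2[OF I(1)] I t(2) by force
    have "m (w ! t) (w ! Suc t) \<le> 3" using sl I unfolding simply_laced_def by blast
    then show ?thesis using free_step[OF J w t(1) ne] free_no_backtrack[OF J w _ ne] by blast
  qed
  assume sub: "set w \<subseteq> {i \<in> I. 3 \<le> d i}"
  show "length w \<le> (\<Sum>i\<in>I. d i)"
  proof (rule ccontr)
    assume long: "\<not> length w \<le> (\<Sum>i\<in>I. d i)"
    then have "0 < length w" by linarith
    then have i: "w ! 0 \<in> I" by (rule wI)
    then have dle: "d (w ! 0) \<le> (\<Sum>i\<in>I. d i)" using finite_I by (intro member_le_sum) auto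
    have "w ! t = w ! 0" if "t < length w" for t using uniq[of "w ! t" "w ! 0"] sub that nth_mem by (metis gr_zeroI not_less_zero subsetD)
    then have "replicate (d (w ! 0)) (w ! 0) \<notin> null_words"
      by (intro factor_at[OF w, of 0 "d (w ! 0)"]) (use long dle in auto)
    then show False using i unfolding null_words_def by blast
  qed
qed

lemma one_multiple_edge_tree_bounded:
  assumes J: "J = {}" and d: "\<And>i. i \<in> I \<Longrightarrow> d i = 2"
    and ij: "i0 \<in> I" "j0 \<in> I" "i0 \<noteq> j0" "multiple_edges I m = {{i0, j0}}" "m i0 j0 = enat M"
  shows bounded_words
proof (rule core_walk_bounded[where S = "{i0, j0}"])
  have ms: "m j0 i0 = enat M" using ij m_sym by simp
  have "4 \<le> m i0 j0"
  proof -
    have "{i0, j0} \<in> multiple_edges I m" using ij(4) by simp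
    then obtain a b where "{i0, j0} = {a, b}" "a \<in> I" "b \<in> I" "4 \<le> m a b" unfolding multiple_edges_def by blast
    then show ?thesis using multi_ends[of i0 j0 a b] by simp
  qed
  then have ad: "adj i0 j0" by (rule multiple_edge_adj[OF ij(1-3)])
  then show "adj x y" if "x \<in> {i0, j0}" "y \<in> {i0, j0}" "x \<noteq> y" for x y using that adj_sym by auto
  fix w assume w: "alive w"
  then have wI: "w ! t \<in> I" if "t < length w" for t using alive_lists[OF w] that by (auto simp: lists_eq_set)
  have ne: "w ! t \<noteq> w ! Suc t" if "Suc t < length w" for t using free_no_repeat[OF w that] d wI that by simp
  show "adj (w ! t) (w ! Suc t) \<and> (Suc (Suc t) < length w \<longrightarrow> w ! t \<noteq> w ! Suc (Suc t))"
    if t: "Suc t < length w" "\<not> (w ! t \<in> {i0, j0} \<and> w ! Suc t \<in> {i0, j0})" for t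
  proof -
    have I: "w ! t \<in> I" "w ! Suc t \<in> I" using wI t(1) by auto
    have "m (w ! t) (w ! Suc t) \<le> 3"
    proof (rule ccontr)
      assume "\<not> m (w ! t) (w ! Suc t) \<le> 3"
      then have "4 \<le> m (w ! t) (w ! Suc t)" by (cases "m (w ! t) (w ! Suc t)") (auto simp: numeral_eq_enat)
      then have "{w ! t, w ! Suc t} \<in> multiple_edges I m" unfolding multiple_edges_def using I ne[OF t(1)] by blast
      then show False using ij(4) t(2) by auto
    qed
    then show ?thesis using free_step[OF J w t(1) ne[OF t(1)]] free_no_backtrack[OF J w _ ne[OF t(1)]] by blast
  qed
  assume sub: "set w \<subseteq> {i0, j0}"
  show "length w \<le> M"
  proof (rule ccontr)
    assume long: "\<not> length w \<le> M"
    define a b where "a = hd w" and "b = (if hd w = i0 then j0 else i0)"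
    have ab: "a \<in> I" "b \<in> I" "a \<noteq> b" "set w \<subseteq> {b, a}" "m a b = enat M"
    proof -
      have "hd w = i0 \<or> hd w = j0" using sub long hd_in_set[of w] by (cases w) auto
      then show "a \<in> I" "b \<in> I" "a \<noteq> b" "set w \<subseteq> {b, a}" "m a b = enat M"
        using sub ij ms unfolding a_def b_def by (elim disjE; simp add: insert_commute)+
    qed
    have "w = alt_word a b (length w)"
    proof (rule no_square_alt_word[OF ab(4)])
      show "w \<noteq> p @ [i, i] @ q" for p i q using ne[of "length p"] by (auto simp: nth_append)
    qed (use long ab in \<open>auto simp: a_def\<close>)
    then have "w = [] @ alt_word a b M @ drop M w"
      using alt_word_add[of a b M "length w - M"] long by (metis append_Nil append_eq_conv_conj le_add_diff_inverse length_alt_word nat_le_linear)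
    then show False using alive_null[of "[]" "alt_word a b M" "drop M w"] w free_null_alt[OF J ab(1-3,5)] by simp
  qed
qed

end

section \<open>Paths and stars\<close>

context coxeter_tree_words begin

lemma nbwalk_matrix:
  assumes p: "nbwalk p" "set p \<subseteq> I" and ij: "i < length p" "j < length p"
    and e: "\<And>i. Suc i < length p \<Longrightarrow> m (p ! i) (p ! Suc i) = e i"
  shows "m (p ! i) (p ! j) = (if i = j then 1 else if j = Suc i then e i else if i = Suc j then e j else 2)"
proof -
  have I: "p ! i \<in> I" "p ! j \<in> I" using p ij by auto
  consider "i = j" | "j = Suc i" | "i = Suc j" | "Suc i < j" | "Suc j < i" by linarith
  then show ?thesis
  proof cases
    case 5
    then show ?thesis using nbwalk_nonadj[OF p(1) 5 ij(1)] m_sym[OF I] by simp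
  next
    case 3
    then show ?thesis using e[of j] ij m_sym[OF I] by simp
  qed (use m_refl I e[of i] ij nbwalk_nonadj[OF p(1), of i j] in auto)
qed

text \<open>A table for a path with one special edge applies to every longer path that contains it
  around its multiple edge; \<open>l\<close> is the position at which it is placed.\<close>

lemma path_table_unbounded:
  assumes J2: "PROP keeps 2"
    and J3: "br \<Longrightarrow> PROP keeps 3"
    and p: "nbwalk p" "set p \<subseteq> I" "l + n \<le> length p"
    and e: "\<And>i. Suc i < length p \<Longrightarrow> i \<noteq> l + q \<Longrightarrow> m (p ! i) (p ! Suc i) = 3"
    and r: "enat r \<le> m (p ! (l + q)) (p ! Suc (l + q))" "3 < r" "Suc q < n"
    and tab: "table_check n q r br T"
    and u: "u \<in> lists {..<n}" "u \<noteq> []" "run (table_act T) u 0 = Some 0"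
  shows "\<not> bounded_words"
proof -
  define w where "w = m (p ! (l + q)) (p ! Suc (l + q))"
  have M: "m (p ! (l + i)) (p ! (l + j)) = (if i = j then 1 else if j = Suc i then if i = q then w else 3
    else if i = Suc j then if j = q then w else 3 else 2)" if "i < n" "j < n" for i j
    using nbwalk_matrix[OF p(1,2), of "l + i" "l + j" "\<lambda>i. if i = l + q then w else 3"] that p(3) e
    by (auto simp: w_def)
  show ?thesis
  proof (rule table_unbounded[where f = "\<lambda>i. p ! (l + i)", OF _ _ _ _ _ J2 J3 _ tab u])
    show "p ! (l + i) \<in> I" if "i < n" for i using that p(2,3) by auto
    show "p ! (l + i) \<noteq> p ! (l + j)" if "i < n" "j < n" "i \<noteq> j" for i j
      using that p(3) nbwalk_distinct[OF p(1)] by (simp add: nth_eq_iff_index_eq)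
    show "2 < r" using r by simp
    show "path_label q r i j \<le> m (p ! (l + i)) (p ! (l + j))" if "i < n" "j < n" "i \<noteq> j" for i j
      using that r by (auto simp: M path_label_def w_def of_nat_eq_enat numeral_eq_enat)
    show "m (p ! (l + i)) (p ! (l + j)) = 2" if "i < n" "j < n" "i \<noteq> j" "path_label q r i j = 2" for i j
      using that r by (auto simp: M path_label_def split: if_splits)
    show "m (p ! (l + i)) (p ! (l + j)) = 3" if "i < n" "j < n" "i \<noteq> j" "path_label q r i j = 3" for i j
      using that r by (auto simp: M path_label_def split: if_splits)
  qed
qed

definition longest_arm :: "'a \<Rightarrow> 'a \<Rightarrow> 'a list \<Rightarrow> bool" where
  "longest_arm v x w \<longleftrightarrow> nbwalk w \<and> 2 \<le> length w \<and> w ! 0 = v \<and> w ! 1 = x \<and>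
     (\<forall>q. nbwalk q \<and> 2 \<le> length q \<and> q ! 0 = v \<and> q ! 1 = x \<longrightarrow> length q \<le> length w)"

lemma longest_arm_exists:
  assumes "adj v x" shows "\<exists>w. longest_arm v x w"
proof -
  have ex: "nbwalk [v, x] \<and> 2 \<le> length [v, x] \<and> [v, x] ! 0 = v \<and> [v, x] ! 1 = x"
    using assms nbwalk_Cons[of "[x]" v] by simp
  show ?thesis unfolding longest_arm_def
    using ex_has_greatest_nat[of "\<lambda>w. nbwalk w \<and> 2 \<le> length w \<and> w ! 0 = v \<and> w ! 1 = x", OF ex, of length "Suc (Suc (card I))"]
      nbwalk_length by (auto simp: less_Suc_eq_le)
qed

text \<open>Two walks that meet in \<open>v\<close> and leave it in different directions form one
  walk.\<close>

lemma nbwalk_join: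
  assumes "nbwalk (p @ [v])" "nbwalk (v # q)" "p \<noteq> []" "q \<noteq> [] \<Longrightarrow> last p \<noteq> hd q"
  shows "nbwalk (p @ v # q)"
  using assms(2,4)
proof (induction q rule: rev_induct)
  case Nil
  then show ?case using assms(1) by simp
next
  case (snoc z q)
  have vq: "nbwalk (v # q)" "adj (last (v # q)) z" "2 \<le> length (v # q) \<longrightarrow> (v # q) ! (length (v # q) - 2) \<noteq> z"
    using snoc.prems(1) nbwalk_snoc[of "v # q" z] by simp_all
  have w: "nbwalk (p @ v # q)" using snoc.IH[OF vq(1)] snoc.prems(2) by (cases q) auto
  have "(p @ v # q) ! (length (p @ v # q) - 2) \<noteq> z"
  proof (cases "q = []")
    case True
    then show ?thesis using snoc.prems(2) assms(3) by (simp add: nth_append last_conv_nth numeral_2_eq_2)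
  next
    case False
    then have "length (p @ v # q) - 2 = length p + (length (v # q) - 2)" by (cases q) auto
    then have "(p @ v # q) ! (length (p @ v # q) - 2) = (v # q) ! (length (v # q) - 2)" by (simp only: nth_append_length_plus)
    then show ?thesis using vq(3) False by (cases q) auto
  qed
  then have "nbwalk ((p @ v # q) @ [z])" using nbwalk_snoc[of "p @ v # q" z] w vq(2) by simp
  then show ?case by simp
qed

definition star :: "(nat \<Rightarrow> nat) \<Rightarrow> (nat \<Rightarrow> nat \<Rightarrow> 'a) \<Rightarrow> bool" where
  "star l X \<longleftrightarrow> I = {X r s | r s. r < 3 \<and> s \<le> l r} \<and>
     (\<forall>r r' s s'. r < 3 \<longrightarrow> r' < 3 \<longrightarrow> s \<le> l r \<longrightarrow> s' \<le> l r' \<longrightarrow>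
        m (X r s) (X r' s') = (if r = r' \<or> s = 0 \<or> s' = 0 then A_matrix s s' else 2))"

lemma starD:
  assumes "star l X"
  shows "I = {X r s | r s. r < 3 \<and> s \<le> l r}"
    "r < 3 \<Longrightarrow> r' < 3 \<Longrightarrow> s \<le> l r \<Longrightarrow> s' \<le> l r' \<Longrightarrow>
       m (X r s) (X r' s') = (if r = r' \<or> s = 0 \<or> s' = 0 then A_matrix s s' else 2)"
  using assms unfolding star_def by blast+

text \<open>The arms are the longest walks that start from \<open>v\<close> towards one of its three
  neighbours; without further branch nodes they cover the graph. They are sorted by length.\<close>

lemma star_graph:
  assumes v: "branch_node v" and uniq: "\<And>u. branch_node u \<Longrightarrow> u = v"
    and three: "\<And>x y z w. adj v x \<Longrightarrow> adj v y \<Longrightarrow> adj v z \<Longrightarrow> adj v w \<Longrightarrow> \<not> distinct [x, y, z, w]"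
    and sl: "\<And>a b. adj a b \<Longrightarrow> m a b = 3"
  obtains l :: "nat \<Rightarrow> nat" and X :: "nat \<Rightarrow> nat \<Rightarrow> 'a"
  where "star l X" "1 \<le> l 2" "l 2 \<le> l 1" "l 1 \<le> l 0"
proof -
  have "\<exists>W. \<forall>x. adj v x \<longrightarrow> longest_arm v x (W x)" using longest_arm_exists by metis
  then obtain W where W: "\<And>x. adj v x \<Longrightarrow> longest_arm v x (W x)" by blast
  obtain x0 y0 z0 where "adj v x0" "adj v y0" "adj v z0" "x0 \<noteq> y0" "y0 \<noteq> z0" "x0 \<noteq> z0"
    using v unfolding branch_node_def by blast
  then have "\<exists>x y z. adj v x \<and> adj v y \<and> adj v z \<and> x \<noteq> y \<and> y \<noteq> z \<and> x \<noteq> z \<and>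
      length (W z) \<le> length (W y) \<and> length (W y) \<le> length (W x)"
    using linear[of "length (W x0)" "length (W y0)"] linear[of "length (W x0)" "length (W z0)"]
      linear[of "length (W y0)" "length (W z0)"] by metis
  then obtain x y z where xyz: "adj v x" "adj v y" "adj v z" "x \<noteq> y" "y \<noteq> z" "x \<noteq> z"
    "length (W z) \<le> length (W y)" "length (W y) \<le> length (W x)" by blast
  define nb where "nb r = (if r = 0 then x else if r = 1 then y else z)" for r :: nat
  define A where "A r = W (nb r)" for r
  define l where "l r = length (A r) - 1" for r
  define X where "X r s = A r ! s" for r s
  have nb: "adj v (nb r)" for r using xyz by (simp add: nb_def)
  have nb_ne: "nb r \<noteq> nb r'" if "r < 3" "r' < 3" "r \<noteq> r'" for r r'
    using that xyz by (auto simp: nb_def)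
  have A: "nbwalk (A r)" "2 \<le> length (A r)" "A r ! 0 = v" "A r ! 1 = nb r"
    "\<And>q. nbwalk q \<Longrightarrow> 2 \<le> length q \<Longrightarrow> q ! 0 = v \<Longrightarrow> q ! 1 = nb r \<Longrightarrow> length q \<le> length (A r)" for r
    using W[OF nb[of r]] unfolding A_def longest_arm_def by auto
  have lA: "length (A r) = Suc (l r)" "1 \<le> l r" for r using A(2)[of r] by (auto simp: l_def)
  have same: "m (X r s) (X r s') = A_matrix s s'" if "s \<le> l r" "s' \<le> l r" for r s s'
    using nbwalk_matrix[OF A(1) nbwalk_I[OF A(1,2)], of s r s' "\<lambda>_. 3"] that sl nbwalk_adj[OF A(1), of _ r] lA(1)[of r]
    by (auto simp: X_def A_matrix_def)
  have cross: "m (X r s) (X r' s') = 2" if h: "r < 3" "r' < 3" "r \<noteq> r'" "s \<le> l r" "s' \<le> l r'" "0 < s" "0 < s'" for r r' s s'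
  proof -
    have split: "A r = v # tl (A r)" for r using A(2,3)[of r] by (cases "A r") auto
    have ne: "tl (A r) \<noteq> []" and hd: "hd (tl (A r)) = nb r" for r
      using A(2,4)[of r] by (cases "A r"; cases "tl (A r)"; auto)+
    define p where "p = rev (tl (A r)) @ v # tl (A r')"
    have "rev (A r) = rev (tl (A r)) @ [v]" by (subst split) simp
    then have "nbwalk (rev (tl (A r)) @ [v])" using nbwalk_rev[OF A(1)[of r]] by simp
    moreover have "nbwalk (v # tl (A r'))" using A(1)[of r'] split[of r'] by simp
    moreover have "last (rev (tl (A r))) \<noteq> hd (tl (A r'))" using hd nb_ne[OF h(1-3)] by (simp add: last_rev)
    ultimately have p: "nbwalk p" unfolding p_def using ne[of r] nbwalk_join by simp
    have lr: "length (tl (A r)) = l r" for r using lA(1)[of r] by simp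
    have tl: "tl (A r) ! (t - 1) = A r ! t" if "0 < t" "t \<le> l r" for r t
      using that lA(1)[of r] by (cases t) (auto simp: nth_tl)
    have i: "p ! (l r - s) = X r s"
    proof -
      have "p ! (l r - s) = rev (tl (A r)) ! (l r - s)" using h lr[of r] by (simp add: p_def nth_append)
      also have "\<dots> = tl (A r) ! (s - 1)" using h lr[of r] by (simp add: rev_nth)
      finally show ?thesis using tl[OF h(6,4)] by (simp add: X_def)
    qed
    have j: "p ! (l r + s') = X r' s'"
    proof -
      have "p ! (l r + s') = (v # tl (A r')) ! s'" using lr[of r] by (simp add: p_def nth_append)
      then show ?thesis using split[of r'] by (simp add: X_def)
    qed
    have "length p = Suc (l r + l r')" using lr[of r] lr[of r'] by (simp add: p_def)
    then show ?thesis using nbwalk_nonadj[OF p, of "l r - s" "l r + s'"] i j h by simp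
  qed
  have X0: "X r 0 = v" for r using A(3) by (simp add: X_def)
  let ?S = "{X r s | r s. r < 3 \<and> s \<le> l r}"
  have closed: "b \<in> ?S" if ab: "a \<in> ?S" "adj a b" for a b
  proof -
    obtain r s where rs: "r < 3" "s \<le> l r" "a = X r s" using ab(1) by blast
    show ?thesis
    proof (cases "s = 0")
      case True
      then have "adj v b" using rs ab(2) X0 by simp
      then have "\<not> distinct [x, y, z, b]" using three xyz by blast
      then have "b = nb 0 \<or> b = nb 1 \<or> b = nb 2" using xyz by (auto simp: nb_def)
      moreover have "(0 :: nat) < 3" "(1 :: nat) < 3" "(2 :: nat) < 3" by simp_all
      ultimately obtain r' where "r' < 3" "b = nb r'" by blast
      then have "b = X r' 1" "r' < 3" "1 \<le> l r'" using A(4) lA(2) by (auto simp: X_def)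
      then show ?thesis by blast
    next
      case False
      have av: "a \<noteq> v"
        using nbwalk_distinct[OF A(1)[of r]] rs False A(3)[of r] lA(1)[of r]
        by (metis X_def le_imp_less_Suc nth_eq_iff_index_eq zero_less_Suc)
      then have nbr: "\<not> branch_node a" using uniq by blast
      have prev: "adj a (X r (s - 1))"
        using nbwalk_adj[OF A(1), of "s - 1" r] False rs lA(1)[of r] adj_sym by (simp add: X_def)
      show ?thesis
      proof (cases "s < l r")
        case True
        have next': "adj a (X r (Suc s))" using nbwalk_adj[OF A(1), of s r] True rs lA(1)[of r] by (simp add: X_def)
        have "X r (s - 1) \<noteq> X r (Suc s)"
          using nbwalk_distinct[OF A(1)[of r]] True False lA(1)[of r] by (simp add: X_def nth_eq_iff_index_eq)
        then have "b = X r (s - 1) \<or> b = X r (Suc s)" using nbr prev next' ab(2) unfolding branch_node_def by metis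
        moreover have "s - 1 \<le> l r" "Suc s \<le> l r" using True by auto
        ultimately show ?thesis using rs(1) by blast
      next
        case False
        then have sl: "s = l r" using rs by simp
        have ne: "A r \<noteq> []" using A(2)[of r] by auto
        have "last (A r) = a" using ne rs sl lA(1)[of r] by (simp add: last_conv_nth X_def)
        moreover have "A r ! (length (A r) - 2) = X r (s - 1)" using lA(1)[of r] sl by (simp add: X_def numeral_2_eq_2)
        moreover have "\<not> nbwalk (A r @ [b])"
        proof
          assume "nbwalk (A r @ [b])"
          then have "length (A r @ [b]) \<le> length (A r)" using A(2-4)[of r] by (intro A(5)) (auto simp: nth_append)
          then show False by simp
        qed
        ultimately have "b = X r (s - 1)" using nbwalk_snoc[OF ne, of b] A(1)[of r] ab(2) by auto
        moreover have "s - 1 \<le> l r" using rs by simp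
        ultimately show ?thesis using rs(1) by blast
      qed
    qed
  qed
  have vI: "v \<in> I" using xyz(1) by (simp add: coxeter_adj_def)
  have "v \<in> ?S" using X0[of 0] by force
  then have sub: "I \<subseteq> ?S" using adj_closed_subset[OF _ vI, of ?S] closed by blast
  have sup: "?S \<subseteq> I"
  proof
    fix a assume "a \<in> ?S"
    then obtain r s where "s \<le> l r" "a = A r ! s" by (auto simp: X_def)
    then show "a \<in> I" using nbwalk_I[OF A(1,2), of r] lA(1)[of r] by (auto simp: le_imp_less_Suc)
  qed
  show ?thesis
  proof (rule that[of l X])
    show "star l X" unfolding star_def
    proof (intro conjI allI impI)
      show "I = ?S" using sub sup by blast
      fix r r' s s' assume h: "r < 3" "r' < 3" "s \<le> l r" "s' \<le> l r'"
      show "m (X r s) (X r' s') = (if r = r' \<or> s = 0 \<or> s' = 0 then A_matrix s s' else 2)"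
      proof (cases "r = r'")
        case False
        show ?thesis
        proof (cases "s = 0 \<or> s' = 0")
          case True
          then show ?thesis using same[of s r 0] same[of 0 r' s'] h X0 by auto
        qed (use cross[OF h(1,2) False h(3,4)] False in simp)
      qed (use same h in simp)
    qed
    show "1 \<le> l 2" using lA(2) .
    show "l 2 \<le> l 1" "l 1 \<le> l 0" using xyz(7,8) by (auto simp: l_def A_def nb_def)
  qed
qed

text \<open>The list \<open>ps\<close> selects the nodes of a substar on which the game is played. The
  centre may only be selected as \<open>(0, 0)\<close>, because its other names denote the same
  node.\<close>

lemma star_game_unbounded:
  assumes J2: "PROP keeps 2"
    and X: "star l X"
    and ps: "distinct ps" "list_all (\<lambda>(r, s). r < 3 \<and> s \<le> l r \<and> (s = 0 \<longrightarrow> r = 0)) ps"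
    and u: "u \<in> lists {..<length ps}" "u \<noteq> []" "run (game (star_matrix ps) 1) u L = Some L"
  shows "\<not> bounded_words"
proof (rule game_unbounded[where f = "\<lambda>i. case ps ! i of (r, s) \<Rightarrow> X r s", OF _ _ _ J2 _ u])
  have p: "fst (ps ! i) < 3 \<and> snd (ps ! i) \<le> l (fst (ps ! i)) \<and> (snd (ps ! i) = 0 \<longrightarrow> fst (ps ! i) = 0)"
    if "i < length ps" for i using ps(2) that unfolding list_all_length by (auto simp: case_prod_beta)
  fix i assume i: "i < length ps"
  show "(case ps ! i of (r, s) \<Rightarrow> X r s) \<in> I"
    unfolding starD(1)[OF X] case_prod_beta using p[OF i] by blast
  fix j assume j: "j < length ps"
  show "m (case ps ! i of (r, s) \<Rightarrow> X r s) (case ps ! j of (r, s) \<Rightarrow> X r s) = star_matrix ps i j"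
    unfolding star_matrix_def case_prod_beta using starD(2)[OF X] p[OF i] p[OF j] by simp
  assume "i \<noteq> j"
  then have "ps ! i \<noteq> ps ! j" using ps(1) i j by (simp add: nth_eq_iff_index_eq)
  then show "star_matrix ps i j = 2 \<or> star_matrix ps i j = 3 \<or> star_matrix ps i j = 4 \<and> (1 :: int) \<le> 2"
    using p[OF i] p[OF j] by (auto simp: star_matrix_def A_matrix_def case_prod_beta prod_eq_iff)
qed simp_all

end

context braid_words begin

lemma labelling_in_I: "coxeter_labelling M n I m f \<Longrightarrow> i \<in> {1..n} \<Longrightarrow> f i \<in> I"
  unfolding coxeter_labelling_def by (meson bij_betwE)

lemma E9_unbounded:
  assumes J2: "PROP keeps 2"
    and J3: "PROP keeps 3"
    and f: "coxeter_labelling E_matrix n I m f" "9 \<le> n"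
  shows "\<not> bounded_words"
proof (rule game_unbounded[where f = "\<lambda>i. f (Suc i)" and n = 9 and t = 2, OF _ _ _ J2 _ _ _ E9_cycle])
  show "m (f (Suc i)) (f (Suc j)) = E_matrix (Suc i) (Suc j)" if "i < 9" "j < 9" for i j
    using f that unfolding coxeter_labelling_def by auto
  show "f (Suc i) \<in> I" if "i < 9" for i using labelling_in_I[OF f(1)] f(2) that by auto
  show "E_matrix (Suc i) (Suc j) = 2 \<or> E_matrix (Suc i) (Suc j) = 3 \<or> E_matrix (Suc i) (Suc j) = 4 \<and> 2 \<le> (2 :: int)"
    if "i \<noteq> j" for i j using that by (simp add: E_matrix_eq)
  show "2 = (1 :: int) \<or> (\<forall>a\<in>I. \<forall>b\<in>I. m a b = 3 \<longrightarrow> {a, b} \<in> J)" using J3 by blast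
qed auto

lemma F5_unbounded:
  assumes J2: "PROP keeps 2"
    and J3: "PROP keeps 3"
    and f: "coxeter_labelling F_matrix n I m f" "5 \<le> n"
  shows "\<not> bounded_words"
proof (rule game_unbounded[where f = "\<lambda>i. f (Suc i)" and n = 5 and t = 2, OF _ _ _ J2 _ _ _ F5_cycle])
  show "m (f (Suc i)) (f (Suc j)) = F_matrix (Suc i) (Suc j)" if "i < 5" "j < 5" for i j
    using f that unfolding coxeter_labelling_def by auto
  show "f (Suc i) \<in> I" if "i < 5" for i using labelling_in_I[OF f(1)] f(2) that by auto
  show "F_matrix (Suc i) (Suc j) = 2 \<or> F_matrix (Suc i) (Suc j) = 3 \<or> F_matrix (Suc i) (Suc j) = 4 \<and> 2 \<le> (2 :: int)"
    if "i \<noteq> j" for i j using that by (simp add: F_matrix_eq)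
  show "2 = (1 :: int) \<or> (\<forall>a\<in>I. \<forall>b\<in>I. m a b = 3 \<longrightarrow> {a, b} \<in> J)" using J3 by blast
qed auto

end

section \<open>Labelled Coxeter graphs\<close>

lemma coxeter_labellingI:
  assumes "\<And>i. i \<in> I \<Longrightarrow> m i i = 1" "f ` {1..n} = I"
    and M: "\<And>i j. i \<in> {1..n} \<Longrightarrow> j \<in> {1..n} \<Longrightarrow> m (f i) (f j) = M i j"
    and "\<And>i j. M i j = 1 \<Longrightarrow> i = j"
  shows "coxeter_labelling M n I m f"
proof -
  have "inj_on f {1..n}"
  proof (rule inj_onI)
    fix i j assume ij: "i \<in> {1..n}" "j \<in> {1..n}" "f i = f j"
    then have "m (f i) (f j) = 1" using assms(1,2) by auto
    then show "i = j" using M[OF ij(1,2)] assms(4) by simp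
  qed
  then show ?thesis unfolding coxeter_labelling_def bij_betw_def using assms(2) M by blast
qed

lemma coxeter_matrix_labelled:
  assumes "coxeter_matrix I m" "coxeter_labelling M n I m f"
  shows "coxeter_matrix {1..n} M"
proof -
  have f: "bij_betw f {1..n} I" "\<And>i j. i \<in> {1..n} \<Longrightarrow> j \<in> {1..n} \<Longrightarrow> M i j = m (f i) (f j)"
    using assms(2) unfolding coxeter_labelling_def by auto
  have I: "f i \<in> I" if "i \<in> {1..n}" for i using f(1) that by (meson bij_betwE)
  have ne: "f i \<noteq> f j" if "i \<in> {1..n}" "j \<in> {1..n}" "i \<noteq> j" for i j
    using f(1) that by (meson bij_betw_imp_inj_on inj_on_eq_iff)
  show ?thesis using assms(1) f(2) I ne unfolding coxeter_matrix_def by simp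
qed

text \<open>Pulling words back along a labelling turns alive words into alive words of the same
  length.\<close>

lemma labelled_bounded_transport:
  assumes B: "braid_words I m d J" and B': "braid_words {1..n} M d' J'"
    and f: "coxeter_labelling M n I m f" "\<And>i. i \<in> {1..n} \<Longrightarrow> d (f i) = d' i"
    and J: "\<And>a b. {a, b} \<in> J' \<Longrightarrow> {f a, f b} \<in> J"
      "\<And>a b. {a, b} \<in> braid_pairs {1..n} M - J' \<Longrightarrow> {f a, f b} \<in> braid_pairs I m - J"
    and bd: "braid_words.bounded_words {1..n} M d' J'"
  shows "braid_words.bounded_words I m d J"
proof -
  interpret B: braid_words I m d J by (rule B)
  interpret B': braid_words "{1..n}" M d' J' by (rule B')
  have bij: "bij_betw f {1..n} I" and M: "\<And>i j. i \<in> {1..n} \<Longrightarrow> j \<in> {1..n} \<Longrightarrow> m (f i) (f j) = M i j"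
    using f(1) unfolding coxeter_labelling_def by auto
  obtain N where N: "\<And>w. B'.alive w \<Longrightarrow> length w \<le> N" using bd unfolding B'.bounded_words_def by blast
  define g where "g = the_inv_into {1..n} f"
  have "length w \<le> N" if w: "B.alive w" for w
  proof -
    have wI: "set w \<subseteq> I" using B.alive_lists[OF w] by auto
    then have fg: "map f (map g w) = w"
      unfolding g_def using f_the_inv_into_f_bij_betw[OF bij] by (simp add: map_idI subsetD)
    have g: "g ` I = {1..n}" using bij_betw_the_inv_into[OF bij] unfolding g_def bij_betw_def by blast
    have gw: "map g w \<in> lists {1..n}" using wI g by (auto simp: lists_eq_set)
    have fI: "f a \<in> I" if "a \<in> {1..n}" for a using bij that by (meson bij_betwE)
    have "B'.alive (map g w)"
      by (rule alive_map[OF B B' fI M f(2) J(1) J(2) gw]) (use fg w in simp_all)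
    then show ?thesis using N by fastforce
  qed
  then show ?thesis unfolding B.bounded_words_def by blast
qed

lemma mem_braid_pairs_iff:
  "{a, b} \<in> braid_pairs I m \<longleftrightarrow> a \<in> I \<and> b \<in> I \<and> a \<noteq> b \<and> (m a b < \<infinity> \<or> m b a < \<infinity>)"
proof
  assume "{a, b} \<in> braid_pairs I m"
  then obtain x y where "{a, b} = {x, y}" "x \<in> I" "y \<in> I" "x \<noteq> y" "m x y < \<infinity>"
    unfolding braid_pairs_def by blast
  then show "a \<in> I \<and> b \<in> I \<and> a \<noteq> b \<and> (m a b < \<infinity> \<or> m b a < \<infinity>)" unfolding doubleton_eq_iff by blast
next
  assume h: "a \<in> I \<and> b \<in> I \<and> a \<noteq> b \<and> (m a b < \<infinity> \<or> m b a < \<infinity>)"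
  have "{a, b} = {b, a}" by blast
  then show "{a, b} \<in> braid_pairs I m" unfolding braid_pairs_def using h by blast
qed

lemma braid_pairs_labelled:
  assumes f: "coxeter_labelling M n I m f" and ab: "a \<in> {1..n}" "b \<in> {1..n}"
  shows "{f a, f b} \<in> braid_pairs I m \<longleftrightarrow> {a, b} \<in> braid_pairs {1..n} M"
proof -
  have bij: "bij_betw f {1..n} I" and M: "\<And>i j. i \<in> {1..n} \<Longrightarrow> j \<in> {1..n} \<Longrightarrow> m (f i) (f j) = M i j"
    using f(1) unfolding coxeter_labelling_def by auto
  have inv: "\<exists>i\<in>{1..n}. x = f i" if "x \<in> I" for x using bij that unfolding bij_betw_def by auto
  have I: "f i \<in> I" if "i \<in> {1..n}" for i using bij that by (meson bij_betwE)
  have inj: "f i = f j \<longleftrightarrow> i = j" if "i \<in> {1..n}" "j \<in> {1..n}" for i j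
    using bij that by (meson bij_betw_imp_inj_on inj_on_eq_iff)
  show ?thesis unfolding mem_braid_pairs_iff using M ab I inj by simp
qed

lemma braid_pairs_labels: "{a, b} \<in> braid_pairs {1..n} M \<Longrightarrow> a \<in> {1..n} \<and> b \<in> {1..n}"
  unfolding braid_pairs_def by (auto simp: doubleton_eq_iff)

context coxeter begin

text \<open>Type A with all exponents two is covered by the words with one arbitrary exponent.\<close>

lemma A_type_bounded:
  assumes lab: "coxeter_labelling A_matrix n I m f" shows bounded_words
proof -
  have cA: "coxeter_matrix {1..n} A_matrix" by (rule coxeter_matrix_labelled[OF cox lab])
  interpret A: type_A_end n "\<lambda>_. 2" by unfold_locales (use cA in auto)
  show ?thesis
  proof (rule labelled_bounded_transport[OF braid_words_axioms A.braid_words_axioms lab HOL.refl _ _ A.type_A_bounded])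
    fix a b assume "{a, b} \<in> braid_pairs {1..n} A_matrix"
    then show "{f a, f b} \<in> braid_pairs I m"
      using braid_pairs_labelled[OF lab] braid_pairs_labels by blast
  qed simp
qed

end

context coxeter_tree_words begin

text \<open>The shift by one in \<open>p ! (i - 1)\<close> is between the nodes \<open>1, \<dots>,
  n\<close> of a type and the positions of a list.\<close>

lemma path_labelling:
  assumes p: "nbwalk p" "set p = I"
    and M: "\<And>i j. i \<in> {1..length p} \<Longrightarrow> j \<in> {1..length p} \<Longrightarrow>
      M i j = (if i = j then 1 else if j = Suc i then m (p ! (i - 1)) (p ! i) else if i = Suc j then m (p ! (j - 1)) (p ! j) else 2)"
    and M1: "\<And>i j. M i j = 1 \<Longrightarrow> i = j"
  shows "coxeter_labelling M (length p) I m (\<lambda>i. p ! (i - 1))"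
proof (rule coxeter_labellingI)
  show "(\<lambda>i. p ! (i - 1)) ` {1..length p} = I"
  proof -
    have "(\<lambda>i. i - 1) ` {1..length p} = {..<length p}"
      by (auto simp: image_iff intro!: bexI[of _ "Suc _"])
    then have "(\<lambda>i. p ! (i - 1)) ` {1..length p} = (!) p ` {..<length p}" by (metis image_image)
    also have "\<dots> = set p" by (auto simp: set_conv_nth)
    finally show ?thesis using p(2) by simp
  qed
  fix i j assume ij: "i \<in> {1..length p}" "j \<in> {1..length p}"
  have "m (p ! (i - 1)) (p ! (j - 1)) = (if i - 1 = j - 1 then 1 else if j - 1 = Suc (i - 1) then m (p ! (i - 1)) (p ! Suc (i - 1))
      else if i - 1 = Suc (j - 1) then m (p ! (j - 1)) (p ! Suc (j - 1)) else 2)"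
    by (rule nbwalk_matrix[OF p(1) _ _ _ HOL.refl]) (use p(2) ij in auto)
  moreover have "i - 1 = j - 1 \<longleftrightarrow> i = j" "j - 1 = Suc (i - 1) \<longleftrightarrow> j = Suc i" "i - 1 = Suc (j - 1) \<longleftrightarrow> i = Suc j"
    "Suc (i - 1) = i" "Suc (j - 1) = j" using ij by auto
  ultimately show "m (p ! (i - 1)) (p ! (j - 1)) = M i j" unfolding M[OF ij] by simp
qed (use m_refl M1 in auto)

lemma star_centre: assumes X: "star l X" and "r < 3" shows "X r 0 = X 0 0"
proof (rule ccontr)
  have "X r 0 \<in> I" "X 0 0 \<in> I" unfolding starD(1)[OF X] using assms(2) by force+
  moreover assume "X r 0 \<noteq> X 0 0"
  ultimately have "2 \<le> m (X r 0) (X 0 0)" by (rule m_ge2)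
  then show False using starD(2)[OF X, of r 0 0 0] assms(2) by (simp add: A_matrix_def one_enat_def numeral_eq_enat)
qed

lemma star_labelling:
  fixes l :: "nat \<Rightarrow> nat" and X :: "nat \<Rightarrow> nat \<Rightarrow> 'a" and rs :: "nat \<Rightarrow> nat \<times> nat"
  assumes X: "star l X"
    and rs: "\<And>i. i \<in> {1..n} \<Longrightarrow> fst (rs i) < 3 \<and> snd (rs i) \<le> l (fst (rs i))"
    and cover: "\<And>r s. r < 3 \<Longrightarrow> s \<le> l r \<Longrightarrow> \<exists>i\<in>{1..n}. X r s = X (fst (rs i)) (snd (rs i))"
    and M: "\<And>i j. i \<in> {1..n} \<Longrightarrow> j \<in> {1..n} \<Longrightarrow>
       M i j = (if fst (rs i) = fst (rs j) \<or> snd (rs i) = 0 \<or> snd (rs j) = 0 then A_matrix (snd (rs i)) (snd (rs j)) else 2)"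
    and M1: "\<And>i j. M i j = 1 \<Longrightarrow> i = j"
  shows "coxeter_labelling M n I m (\<lambda>i. X (fst (rs i)) (snd (rs i)))"
proof (rule coxeter_labellingI)
  show "(\<lambda>i. X (fst (rs i)) (snd (rs i))) ` {1..n} = I"
  proof
    show "(\<lambda>i. X (fst (rs i)) (snd (rs i))) ` {1..n} \<subseteq> I" unfolding starD(1)[OF X] using rs by blast
    show "I \<subseteq> (\<lambda>i. X (fst (rs i)) (snd (rs i))) ` {1..n}"
    proof
      fix x assume "x \<in> I"
      then obtain r s where "r < 3" "s \<le> l r" "x = X r s" using starD(1)[OF X] by blast
      then show "x \<in> (\<lambda>i. X (fst (rs i)) (snd (rs i))) ` {1..n}" using cover[of r s] by (auto simp: image_iff)
    qed
  qed
  fix i j assume ij: "i \<in> {1..n}" "j \<in> {1..n}"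
  show "m (X (fst (rs i)) (snd (rs i))) (X (fst (rs j)) (snd (rs j))) = M i j"
    unfolding M[OF ij] using starD(2)[OF X] rs[OF ij(1)] rs[OF ij(2)] by blast
qed (use m_refl M1 in auto)

lemma D_labelling:
  assumes X: "star l X"
    and l: "l 1 = 1" "l (2 :: nat) = (1 :: nat)"
  shows "\<exists>n f. coxeter_labelling D_matrix n I m f"
proof -
  define rs :: "nat \<Rightarrow> nat \<times> nat" where
    "rs i = (if i = 1 then (1, 1) else if i = 2 then (2, 1) else (0, i - 3))" for i
  have "coxeter_labelling D_matrix (l 0 + 3) I m (\<lambda>i. X (fst (rs i)) (snd (rs i)))"
  proof (rule star_labelling[OF X])
    show "fst (rs i) < 3 \<and> snd (rs i) \<le> l (fst (rs i))" if "i \<in> {1..l 0 + 3}" for i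
      using that l by (auto simp: rs_def)
    show "\<exists>i\<in>{1..l 0 + 3}. X r s = X (fst (rs i)) (snd (rs i))" if h: "r < 3" "s \<le> l r" for r s
    proof -
      consider "s = 0" | "r = 0" | "s = 1" "r = 1" | "s = 1" "r = 2"
        using h l by (metis One_nat_def less_2_cases less_Suc_eq numeral_2_eq_2 numeral_3_eq_3 le_SucE le_zero_eq)
      then show ?thesis
      proof cases
        case 1
        then show ?thesis using star_centre[OF X h(1)] by (intro bexI[of _ 3]) (auto simp: rs_def)
      next
        case 2
        then show ?thesis using h by (intro bexI[of _ "s + 3"]) (auto simp: rs_def)
      next
        case 3
        then show ?thesis by (intro bexI[of _ 1]) (auto simp: rs_def)
      next
        case 4
        then show ?thesis by (intro bexI[of _ 2]) (auto simp: rs_def)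
      qed
    qed
    show "D_matrix i j = (if fst (rs i) = fst (rs j) \<or> snd (rs i) = 0 \<or> snd (rs j) = 0 then A_matrix (snd (rs i)) (snd (rs j)) else 2)"
      if ij: "i \<in> {1..l 0 + 3}" "j \<in> {1..l 0 + 3}" for i j
    proof -
      have c: "i = 1 \<or> i = 2 \<or> (\<exists>a. i = a + 3)" if "i \<in> {1..l 0 + 3}" for i
      proof (cases "3 \<le> i")
        case True
        then show ?thesis by (metis add.commute le_Suc_ex)
      qed (use that in auto)
      show ?thesis using c[OF ij(1)] c[OF ij(2)]
        by (elim disjE exE) (simp_all add: D_matrix_eq A_matrix_def rs_def)
    qed
    show "D_matrix i j = 1 \<Longrightarrow> i = j" for i j
      by (auto simp: D_matrix_eq one_enat_def numeral_eq_enat split: if_splits)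
  qed
  then show ?thesis by blast
qed

lemma E_labelling:
  assumes X: "star l X"
    and l: "l 1 = 2" "l (2 :: nat) = (1 :: nat)"
  shows "\<exists>n f. coxeter_labelling E_matrix n I m f"
proof -
  define rs :: "nat \<Rightarrow> nat \<times> nat" where
    "rs i = (if i = 1 then (1, 2) else if i = 2 then (1, 1) else if i = 3 then (2, 1) else (0, i - 4))" for i
  have "coxeter_labelling E_matrix (l 0 + 4) I m (\<lambda>i. X (fst (rs i)) (snd (rs i)))"
  proof (rule star_labelling[OF X])
    show "fst (rs i) < 3 \<and> snd (rs i) \<le> l (fst (rs i))" if "i \<in> {1..l 0 + 4}" for i
      using that l by (auto simp: rs_def)
    show "\<exists>i\<in>{1..l 0 + 4}. X r s = X (fst (rs i)) (snd (rs i))" if h: "r < 3" "s \<le> l r" for r s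
    proof -
      have "r = 0 \<or> r = 1 \<or> r = 2" using h(1) by linarith
      then consider "s = 0" | "r = 0" | "s = 1" "r = 1" | "s = 2" "r = 1" | "s = 1" "r = 2"
        using h(2) l by fastforce
      then show ?thesis
      proof cases
        case 1
        then show ?thesis using star_centre[OF X h(1)] by (intro bexI[of _ 4]) (auto simp: rs_def)
      next
        case 2
        then show ?thesis using h by (intro bexI[of _ "s + 4"]) (auto simp: rs_def)
      next
        case 3
        then show ?thesis by (intro bexI[of _ 2]) (auto simp: rs_def)
      next
        case 4
        then show ?thesis by (intro bexI[of _ 1]) (auto simp: rs_def)
      next
        case 5
        then show ?thesis by (intro bexI[of _ 3]) (auto simp: rs_def)
      qed
    qed
    show "E_matrix i j = (if fst (rs i) = fst (rs j) \<or> snd (rs i) = 0 \<or> snd (rs j) = 0 then A_matrix (snd (rs i)) (snd (rs j)) else 2)"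
      if ij: "i \<in> {1..l 0 + 4}" "j \<in> {1..l 0 + 4}" for i j
    proof -
      have c: "i = 1 \<or> i = 2 \<or> i = 3 \<or> (\<exists>a. i = a + 4)" if "i \<in> {1..l 0 + 4}" for i
      proof (cases "4 \<le> i")
        case True
        then show ?thesis by (metis add.commute le_Suc_ex)
      qed (use that in auto)
      show ?thesis using c[OF ij(1)] c[OF ij(2)]
        by (elim disjE exE) (simp_all add: E_matrix_eq A_matrix_def rs_def)
    qed
    show "E_matrix i j = 1 \<Longrightarrow> i = j" for i j
      by (auto simp: E_matrix_eq one_enat_def numeral_eq_enat split: if_splits)
  qed
  then show ?thesis by blast
qed

end

section \<open>The classification\<close>

lemma enat_cases_level:
  fixes k :: enat assumes "1 \<le> k" obtains "k \<in> {1, 2}" | "k = 3" | "4 \<le> k"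
proof (cases "k = 1")
  case False
  then have "2 \<le> k" using assms by (cases k) (auto simp: numeral_eq_enat one_enat_def)
  then show ?thesis using that by (cases k rule: enat_cases_2_3_4) auto
qed (use that in simp)

context braid_words begin

lemma finite_typeI:
  assumes "\<And>i. i \<in> I \<Longrightarrow> d i = 2" "3 \<le> k" "finite (carrier (coxeter_group I m))"
  shows "nil_hecke_finite_list I m d k"
  unfolding nil_hecke_finite_list_def using assms by blast

end

context coxeter_tree_words begin

lemma A_labelling:
  assumes p: "nbwalk p" "set p = I" and sl: "\<And>a b. adj a b \<Longrightarrow> m a b = 3"
  shows "coxeter_labelling A_matrix (length p) I m (\<lambda>i. p ! (i - 1))"
proof (rule path_labelling[OF p])
    fix i j assume ij: "i \<in> {1..length p}" "j \<in> {1..length p}"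
    have "m (p ! (i - 1)) (p ! i) = 3" if "i \<in> {1..<length p}" for i
      using sl nbwalk_adj[OF p(1), of "i - 1"] that by simp
    then show "A_matrix i j = (if i = j then 1 else if j = Suc i then m (p ! (i - 1)) (p ! i)
        else if i = Suc j then m (p ! (j - 1)) (p ! j) else 2)"
      using ij by (auto simp: A_matrix_def)
  qed (auto simp: A_matrix_def one_enat_def numeral_eq_enat split: if_splits)

text \<open>With a node of exponent at least three the graph is a path with this node at an end.
  Otherwise, the graph is a path or a star with three arms, and the affine diagrams of types E6 and E7
  restrict the arms to those of types D and E; from nine nodes on, the affine diagram of type E8
  excludes that braid relations of length three are kept.\<close>

lemma simply_laced_classification:
  assumes J: "J = braid_pairs_less I m k" and k: "3 \<le> k"
    and J2: "PROP keeps 2"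
    and J3: "4 \<le> k \<Longrightarrow> PROP keeps 3"
    and sl: "\<And>a b. adj a b \<Longrightarrow> m a b = 3" and bd: bounded_words
  shows "nil_hecke_finite_list I m d k"
proof (cases "\<exists>u\<in>I. 3 \<le> d u")
  case True
  then obtain u where u: "u \<in> I" "3 \<le> d u" by blast
  have "\<not> branch_node v" for v using high_degree_branch_unbounded[OF J2 u] bd by blast
  then obtain p where p: "nbwalk p" "p \<noteq> []" "set p = I" using path_graph u(1) by blast
  have two: "d i = 2" if "i \<in> I" "i \<noteq> u" for i
    using two_high_degrees_unbounded[OF that(1) u(1) that(2) _ u(2)] bd d2[OF that(1)] by fastforce
  define f where "f i = p ! (i - 1)" for i
  define n where "n = length p"
  have n: "1 \<le> n" using p(2) by (simp add: n_def Suc_le_eq)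
  have lab: "coxeter_labelling A_matrix n I m f" unfolding f_def n_def by (rule A_labelling[OF p(1,3) sl])
  have dist: "distinct p" by (rule nbwalk_distinct[OF p(1)])
  have fI: "f i \<in> I" if "i \<in> {1..n}" for i using that p(3) by (auto simp: f_def n_def)
  have inj: "f i \<noteq> f j" if "i \<in> {1..n}" "j \<in> {1..n}" "i \<noteq> j" for i j
    using that dist unfolding f_def n_def by (auto simp: nth_eq_iff_index_eq)
  obtain t where t: "t < n" "u = p ! t" using u(1) p(3) by (auto simp: in_set_conv_nth n_def)
  have "t = 0 \<or> Suc t = n"
  proof (rule ccontr)
    assume "\<not> (t = 0 \<or> Suc t = n)"
    then have tt: "0 < t" "Suc t < length p" using t n_def by auto
    have "adj u (p ! (t - 1))" using nbwalk_adj[OF p(1), of "t - 1"] tt t adj_sym by simp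
    moreover have "adj u (p ! Suc t)" using nbwalk_adj[OF p(1), of t] tt t by simp
    moreover have "p ! (t - 1) \<noteq> p ! Suc t" using dist tt by (simp add: nth_eq_iff_index_eq)
    ultimately show False using high_degree_inner_unbounded[OF J2 u] bd by blast
  qed
  then have "f 1 = u \<or> f n = u" using t by (auto simp: f_def)
  then have "(2 < d (f 1) \<and> (\<forall>i\<in>{2..n}. d (f i) = 2)) \<or> (2 < d (f n) \<and> (\<forall>i\<in>{1..<n}. d (f i) = 2))"
  proof
    assume h: "f 1 = u"
    have "d (f i) = 2" if "i \<in> {2..n}" for i using two[of "f i"] fI[of i] inj[of i 1] h n that by auto
    then show ?thesis using h u by auto
  next
    assume h: "f n = u"
    have "d (f i) = 2" if "i \<in> {1..<n}" for i using two[of "f i"] fI[of i] inj[of i n] h n that by auto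
    then show ?thesis using h u by auto
  qed
  then show ?thesis unfolding nil_hecke_finite_list_def using k n lab by blast
next
  case False
  then have dd: "d i = 2" if "i \<in> I" for i using d2[OF that] that by fastforce
  interpret W: coxeter I m by unfold_locales (rule cox)
  show ?thesis
  proof (cases "\<exists>v. branch_node v")
    case nb: False
    have "\<exists>n f. coxeter_labelling A_matrix n I m f"
    proof (cases "I = {}")
      case True
      then have "coxeter_labelling A_matrix 0 I m f" for f by (simp add: coxeter_labelling_def bij_betw_def)
      then show ?thesis by blast
    next
      case False
      then obtain p where p: "nbwalk p" "p \<noteq> []" "set p = I" using path_graph nb by blast
      have "coxeter_labelling A_matrix (length p) I m (\<lambda>i. p ! (i - 1))" by (rule A_labelling[OF p(1,3) sl])
      then show ?thesis by blast
    qed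
    then show ?thesis using finite_typeI[OF dd k] W.bounded_imp_finite_coxeter_group W.A_type_bounded by blast
  next
    case True
    then obtain v where v: "branch_node v" by blast
    have uniq: "u = v" if "branch_node u" for u using two_branches_unbounded[OF J2 that v] bd by blast
    have three: "\<not> distinct [x, y, z, w]" if "adj v x" "adj v y" "adj v z" "adj v w" for x y z w
      using four_neighbours_unbounded[OF J2 that] bd by blast
    show ?thesis
    proof (rule star_graph[OF v uniq three sl])
    fix l :: "nat \<Rightarrow> nat" and X :: "nat \<Rightarrow> nat \<Rightarrow> 'a"
    assume X: "star l X" and l: "1 \<le> l 2" "l 2 \<le> l 1" "l 1 \<le> l 0"
    have "l 2 < 2"
    proof (rule ccontr)
      assume "\<not> l 2 < 2"
      then have "2 \<le> l 0" "2 \<le> l 1" "2 \<le> l 2"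
        using l by linarith+
      then have "\<not> bounded_words"
        by (intro star_game_unbounded[OF J2 X _ _ _ _ tilde_E6_cycle]) (simp_all add: l)
      then show False using bd by contradiction
    qed
    then have l2: "l 2 = 1" using l by simp
    have "l 1 < 3"
    proof (rule ccontr)
      assume "\<not> l 1 < 3"
      then have "3 \<le> l 0" "3 \<le> l 1" "Suc 0 \<le> l 2"
        using l by linarith+
      then have "\<not> bounded_words"
        by (intro star_game_unbounded[OF J2 X _ _ _ _ tilde_E7_cycle]) (simp_all add: l)
      then show False using bd by contradiction
    qed
    then consider "l 1 = 1" | "l 1 = 2" using l l2 by linarith
    then show ?thesis
    proof cases
      case 1
      then show ?thesis using D_labelling[OF X 1 l2] finite_typeI[OF dd k]
        W.bounded_imp_finite_coxeter_group W.D_type_bounded by blast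
    next
      case 2
      then obtain n f where f: "coxeter_labelling E_matrix n I m f" using E_labelling[OF X 2 l2] by blast
      show ?thesis
      proof (cases "n \<le> 8")
        case True
        then show ?thesis using f finite_typeI[OF dd k]
          W.bounded_imp_finite_coxeter_group W.E_type_bounded by blast
      next
        case False
        then have n: "9 \<le> n" by simp
        have "\<not> 4 \<le> k" using E9_unbounded[OF J2 J3 f n] bd by blast
        then have "k = 3" using k by (cases k) (auto simp: numeral_eq_enat)
        then show ?thesis unfolding nil_hecke_finite_list_def coxeter_type_def using n f dd by blast
      qed
    qed
    qed
  qed
qed

text \<open>The graph is a path, and by reversing it one may assume that the multiple edge is in its
  first half. The automata then leave the graphs on two nodes, label \<open>5\<close> at the end, and
  label \<open>4\<close> at the end or next to it.\<close>

lemma multiple_edge_classification: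
  assumes J: "J = braid_pairs_less I m k" and k: "3 \<le> k"
    and J2: "PROP keeps 2"
    and J3: "4 \<le> k \<Longrightarrow> PROP keeps 3"
    and e: "a \<in> I" "b \<in> I" "a \<noteq> b" "4 \<le> m a b" "m a b \<noteq> \<infinity>" and bd: bounded_words
    and others: "\<And>x y. adj x y \<Longrightarrow> {x, y} \<noteq> {a, b} \<Longrightarrow> m x y = 3"
    and dd: "\<And>i. i \<in> I \<Longrightarrow> d i = 2"
  shows "nil_hecke_finite_list I m d k"
proof -
  interpret W: coxeter I m by unfold_locales (rule cox)
  have "\<not> branch_node v" for v using multiple_edge_branch_unbounded[OF J2 e(1-4)] bd by blast
  then obtain p' where p': "nbwalk p'" "p' \<noteq> []" "set p' = I" using path_graph e(1) by blast
  have "\<exists>p q. nbwalk p \<and> set p = I \<and> Suc q < length p \<and> {p ! q, p ! Suc q} = {a, b} \<and> q \<le> length p - 2 - q"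
  proof -
    obtain i j where ij: "i < length p'" "a = p' ! i" "j < length p'" "b = p' ! j"
      using e(1,2) p'(3) by (auto simp: in_set_conv_nth)
    have nt: "m a b \<noteq> 2" "m b a \<noteq> 2" using e m_sym[OF e(1,2)] by (auto simp: numeral_eq_enat)
    have "\<exists>q. Suc q < length p' \<and> {p' ! q, p' ! Suc q} = {a, b}"
    proof -
      consider "i = j" | "j = Suc i" | "i = Suc j" | "Suc i < j" | "Suc j < i" by linarith
      then show ?thesis
      proof cases
        case 2
        then show ?thesis using ij by blast
      next
        case 3
        then show ?thesis using ij by blast
      qed (use ij e nt nbwalk_nonadj[OF p'(1)] in auto)
    qed
    then obtain q where q: "Suc q < length p'" "{p' ! q, p' ! Suc q} = {a, b}" by blast
    show ?thesis
    proof (cases "q \<le> length p' - 2 - q")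
      case True
      then show ?thesis using p' q by blast
    next
      case False
      \<comment> \<open>the position of the multiple edge in the reversed path\<close>
      define q' where "q' = length p' - 2 - q"
      have "rev p' ! q' = p' ! Suc q" "rev p' ! Suc q' = p' ! q"
        using q(1) by (simp_all add: q'_def rev_nth Suc_diff_Suc numeral_2_eq_2)
      then have "{rev p' ! q', rev p' ! Suc q'} = {a, b}" using q(2) by (simp add: insert_commute)
      moreover have "Suc q' < length (rev p')" "q' \<le> length (rev p') - 2 - q'" using q(1) False by (auto simp: q'_def)
      moreover have "nbwalk (rev p')" "set (rev p') = I" using nbwalk_rev[OF p'(1)] p'(3) by simp_all
      ultimately show ?thesis by blast
    qed
  qed
  then obtain p q where p: "nbwalk p" "set p = I" and q: "Suc q < length p" "{p ! q, p ! Suc q} = {a, b}" "q \<le> length p - 2 - q"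
    by blast
  define w where "w = m a b"
  have dist: "distinct p" by (rule nbwalk_distinct[OF p(1)])
  have wq: "m (p ! q) (p ! Suc q) = w" unfolding w_def by (rule multi_ends[OF q(2) e(1,2)])
  have three: "m (p ! i) (p ! Suc i) = 3" if "Suc i < length p" "i \<noteq> q" for i
  proof -
    have "{p ! i, p ! Suc i} \<noteq> {p ! q, p ! Suc q}"
      using that q(1) dist by (auto simp: doubleton_eq_iff nth_eq_iff_index_eq)
    then show ?thesis using others nbwalk_adj[OF p(1) that(1)] q(2) by simp
  qed
  define n where "n = length p"
  have edge: "m (p ! (i - 1)) (p ! i) = (if i = Suc q then w else 3)" if "i \<in> {1..<n}" for i
    using that three[of "i - 1"] wq by (auto simp: n_def)
  have path: "coxeter_labelling M n I m (\<lambda>i. p ! (i - 1))"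
    if M: "\<And>i j. M i j = (if i = j then 1 else if j = Suc i then if i = Suc q then w else 3
      else if i = Suc j then if j = Suc q then w else 3 else 2)" for M
    unfolding n_def
  proof (rule path_labelling[OF p])
    fix i j assume ij: "i \<in> {1..length p}" "j \<in> {1..length p}"
    then show "M i j = (if i = j then 1 else if j = Suc i then m (p ! (i - 1)) (p ! i)
        else if i = Suc j then m (p ! (j - 1)) (p ! j) else 2)"
      using edge[of i] edge[of j] by (auto simp: M n_def)
  next
    show "i = j" if "M i j = 1" for i j
      using that e(4) by (auto simp: M w_def one_enat_def numeral_eq_enat split: if_splits)
  qed
  have table: False if tl: "l + n' \<le> length p" and tq: "l + q' = q" and tr: "enat r \<le> w" "3 < r" "Suc q' < n'"
    and tab: "table_check n' q' r br T" "u \<in> lists {..<n'}" "u \<noteq> []" "run (table_act T) u 0 = Some 0"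
    and tb: "br \<Longrightarrow> 4 \<le> k" for l n' q' r br T u
  proof -
    have "\<not> bounded_words"
    proof (rule path_table_unbounded[OF J2 _ p(1) _ tl _ _ tr(2,3) tab])
      show "{x, y} \<in> J" if br "x \<in> I" "y \<in> I" "m x y = 3" for x y using J3[OF tb] that by blast
      show "set p \<subseteq> I" using p(2) by simp
      show "m (p ! i) (p ! Suc i) = 3" if "Suc i < length p" "i \<noteq> l + q'" for i using three that tq by simp
      show "enat r \<le> m (p ! (l + q')) (p ! Suc (l + q'))" unfolding tq wq by (rule tr(1))
    qed
    then show False using bd by contradiction
  qed
  have not6: "w \<in> {4, 5} \<or> n = 2"
  proof (rule ccontr)
    assume h: "\<not> (w \<in> {4, 5} \<or> n = 2)"
    obtain r where r: "w = enat r" using e(5) w_def by auto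
    then have "6 \<le> r" using h e(4) w_def by (auto simp: numeral_eq_enat)
    then have w6: "enat 6 \<le> w" using r by simp
    have "q + 3 \<le> length p" using q h n_def by linarith
    then show False
      by (rule table[OF _ _ w6 _ _ six_table_check _ _ six_table_cycle]) auto
  qed
  have not5: "q = 0" if w5: "w = 5"
  proof (rule ccontr)
    assume "q \<noteq> 0"
    then have l: "(q - 1) + 4 \<le> length p" "q - 1 + 1 = q" using q by linarith+
    have "enat 5 \<le> w" using w5 by (simp add: numeral_eq_enat)
    then show False
      by (rule table[OF l _ _ _ five_table_check _ _ five_table_cycle]) auto
  qed
  have not4: "q \<le> 1" if w4: "w = 4"
  proof (rule ccontr)
    assume "\<not> q \<le> 1"
    then have l: "(q - 2) + 6 \<le> length p" "q - 2 + 2 = q" using q by linarith+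
    have "enat 4 \<le> w" using w4 by (simp add: numeral_eq_enat)
    then show False
      by (rule table[OF l _ _ _ four_table_check _ _ four_table_cycle]) auto
  qed
  show ?thesis
  proof (cases "n = 2")
    case True
    then have "p = [p ! 0, p ! 1]" by (intro nth_equalityI) (auto simp: n_def less_2_cases_iff)
    moreover have "q = 0" using q(1) True n_def by simp
    ultimately have "I = {a, b}" using p(2) q(2) by (metis One_nat_def list.simps(15) empty_set)
    then show ?thesis using finite_typeI[OF dd k] W.bounded_imp_finite_coxeter_group W.rank_two_bounded[OF _ e(3)] e(5) by simp
  next
    case False
    consider "w = 5" "q = 0" | "w = 4" "q = 0" | "w = 4" "q = 1" using False not6 not5 not4 by force
    then show ?thesis
    proof cases
      case 1
      have lab: "coxeter_labelling H_matrix n I m (\<lambda>i. p ! (i - 1))"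
        by (rule path) (use 1 in \<open>auto simp: H_matrix_eq one_enat_def numeral_eq_enat split: if_splits\<close>)
      show ?thesis
      proof (cases "n \<le> 4")
        case True
        then show ?thesis using lab finite_typeI[OF dd k]
          W.bounded_imp_finite_coxeter_group W.H_type_bounded by blast
      next
        case False
        then have n: "5 \<le> n" by simp
        have "\<not> 4 \<le> k"
        proof
          assume k4: "4 \<le> k"
          have "0 + 5 \<le> length p" "0 + 0 = q" "enat 5 \<le> w" using 1 n by (auto simp: n_def numeral_eq_enat)
          then show False
            by (rule table[OF _ _ _ _ _ H5_table_check _ _ H5_table_cycle]) (use k4 in auto)
        qed
        then have "k = 3" using k by (cases k) (auto simp: numeral_eq_enat)
        then show ?thesis unfolding nil_hecke_finite_list_def coxeter_type_def using n lab dd by blast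
      qed
    next
      case 2
      have lab: "coxeter_labelling B_matrix n I m (\<lambda>i. p ! (i - 1))"
        by (rule path) (use 2 in \<open>auto simp: B_matrix_def A_matrix_def doubleton_eq_iff one_enat_def numeral_eq_enat split: if_splits\<close>)
      then show ?thesis using finite_typeI[OF dd k] W.bounded_imp_finite_coxeter_group W.B_type_bounded by blast
    next
      case 3
      have lab: "coxeter_labelling F_matrix n I m (\<lambda>i. p ! (i - 1))"
        by (rule path) (use 3 in \<open>auto simp: F_matrix_eq one_enat_def numeral_eq_enat split: if_splits\<close>)
      show ?thesis
      proof (cases "n \<le> 4")
        case True
        then show ?thesis using lab finite_typeI[OF dd k]
          W.bounded_imp_finite_coxeter_group W.F_type_bounded by blast
      next
        case False
        then have n: "5 \<le> n" by simp
        have "\<not> 4 \<le> k" using F5_unbounded[OF J2 J3 lab n] bd by blast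
        then have "k = 3" using k by (cases k) (auto simp: numeral_eq_enat)
        then show ?thesis unfolding nil_hecke_finite_list_def coxeter_type_def using n lab dd by blast
      qed
    qed
  qed
qed

end

context braid_words begin

lemma bounded_imp_list:
  assumes J: "J = braid_pairs_less I m k" and k: "1 \<le> k"
    and con: "coxeter_connected I m" and bd: bounded_words
  shows "nil_hecke_finite_list I m d k"
proof -
  interpret coxeter_tree_words I m d J
    by unfold_locales (use con cycle_unbounded bd in blast)+
  have tree: "coxeter_tree I m" using con acyc by (simp add: coxeter_tree_def)
  have noinf: "m a b \<noteq> \<infinity>" if "a \<in> I" "b \<in> I" "a \<noteq> b" for a b
    using infinite_edge_unbounded[OF that] bd by blast
  have memJ: "{a, b} \<in> J" if "a \<in> I" "b \<in> I" "m a b < k" "m a b \<noteq> 1" for a b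
  proof -
    have "a \<noteq> b" using that m_refl by auto
    then have "{a, b} \<in> braid_pairs I m" using braid_pairs_iff noinf that by simp
    then show ?thesis unfolding J braid_pairs_less_def using that(3) by blast
  qed
  have J2: "{a, b} \<in> J" if "3 \<le> k" "a \<in> I" "b \<in> I" "m a b = 2" for a b
  proof -
    have "(2 :: enat) < 3" "(2 :: enat) \<noteq> 1" by (simp_all add: numeral_eq_enat one_enat_def)
    then show ?thesis using memJ[OF that(2,3)] that(1,4) by (metis less_le_trans)
  qed
  have J3: "{a, b} \<in> J" if "4 \<le> k" "a \<in> I" "b \<in> I" "m a b = 3" for a b
  proof -
    have "(3 :: enat) < 4" "(3 :: enat) \<noteq> 1" by (simp_all add: numeral_eq_enat one_enat_def)
    then show ?thesis using memJ[OF that(2,3)] that(1,4) by (metis less_le_trans)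
  qed
  have k3: "k \<in> {1, 2} \<or> 3 \<le> k" using k by (cases k rule: enat_cases_level) (auto intro: order_trans[of 3 4])
  show ?thesis
  proof (cases "\<exists>a\<in>I. \<exists>b\<in>I. a \<noteq> b \<and> 4 \<le> m a b")
    case True
    then obtain a b where e: "a \<in> I" "b \<in> I" "a \<noteq> b" "4 \<le> m a b" by blast
    have uniq: "{x, y} = {a, b}" if "x \<in> I" "y \<in> I" "x \<noteq> y" "4 \<le> m x y" for x y
      using two_multiple_edges_unbounded[OF e that] bd by blast
    have dd: "d i = 2" if "i \<in> I" for i
      using high_degree_multiple_edge_unbounded[OF e that] bd d2[OF that] by fastforce
    have me: "multiple_edges I m = {{a, b}}"
      unfolding multiple_edges_def using uniq e by blast
    show ?thesis
    proof (cases "3 \<le> k")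
      case False
      have ex: "\<exists>i0\<in>I. \<exists>j0\<in>I. i0 \<noteq> j0 \<and> multiple_edges I m = {{i0, j0}} \<and> 4 \<le> m i0 j0 \<and> m i0 j0 < \<infinity>"
        using e me noinf[OF e(1-3)] by (intro bexI[of _ a] bexI[of _ b]) auto
      have kk: "k \<in> {1, 2}" using k3 False by blast
      show ?thesis unfolding nil_hecke_finite_list_def
        by (rule disjI1, intro conjI ballI) (fact kk tree ex dd)+
    next
      case k: True
      show ?thesis
      proof (rule multiple_edge_classification[OF J k J2[OF k] J3 e noinf[OF e(1-3)] bd _ dd])
        fix x y assume xy: "adj x y" "{x, y} \<noteq> {a, b}"
        then have "\<not> 4 \<le> m x y" "3 \<le> m x y" using uniq unfolding coxeter_adj_def by blast+
        then show "m x y = 3" by (cases "m x y") (auto simp: numeral_eq_enat)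
      qed
    qed
  next
    case False
    then have no4: "\<not> 4 \<le> m a b" if "a \<in> I" "b \<in> I" "a \<noteq> b" for a b using that by blast
    have le3: "m a b \<le> 3" if "a \<in> I" "b \<in> I" for a b
    proof (cases "a = b")
      case True
      then show ?thesis using m_refl that by (simp add: one_enat_def numeral_eq_enat)
    next
      case False
      then show ?thesis using no4[OF that] by (cases "m a b") (auto simp: numeral_eq_enat)
    qed
    have one: "card {i \<in> I. 3 \<le> d i} \<le> 1"
      using two_high_degrees_unbounded bd finite_I card_le_Suc0_iff_eq[of "{i \<in> I. 3 \<le> d i}"] by auto
    show ?thesis
    proof (cases "3 \<le> k")
      case False
      then have kk: "k \<in> {1, 2}" using k3 by blast
      show ?thesis unfolding nil_hecke_finite_list_def simply_laced_def
        by (rule disjI2, rule disjI1, intro conjI ballI) (fact kk tree one le3)+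
    next
      case k: True
      show ?thesis
      proof (rule simply_laced_classification[OF J k J2[OF k] J3 _ bd])
        fix x y assume "adj x y"
        then show "m x y = 3" using le3[of x y] unfolding coxeter_adj_def by (meson antisym)
      qed
    qed
  qed
qed

end

section \<open>The listed algebras and the equivalence\<close>

lemma mem_braid_pairs_less_iff:
  "{a, b} \<in> braid_pairs_less I m k \<longleftrightarrow> {a, b} \<in> braid_pairs I m \<and> (m a b < k \<or> m b a < k)"
proof
  assume "{a, b} \<in> braid_pairs_less I m k"
  then obtain x y where xy: "{a, b} = {x, y}" "{x, y} \<in> braid_pairs I m" "m x y < k"
    unfolding braid_pairs_less_def by blast
  have "m a b < k \<or> m b a < k" using xy(1,3) unfolding doubleton_eq_iff by blast
  then show "{a, b} \<in> braid_pairs I m \<and> (m a b < k \<or> m b a < k)" using xy(1,2) by simp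
next
  assume h: "{a, b} \<in> braid_pairs I m \<and> (m a b < k \<or> m b a < k)"
  have "{a, b} = {b, a}" by blast
  then have "\<exists>x y. {a, b} = {x, y} \<and> {x, y} \<in> braid_pairs I m \<and> m x y < k" using h by metis
  then show "{a, b} \<in> braid_pairs_less I m k" unfolding braid_pairs_less_def by blast
qed

lemma braid_pairs_less_subset: "braid_pairs_less I m k \<subseteq> braid_pairs I m"
  unfolding braid_pairs_less_def by blast

context braid_words begin

lemma fully_commutative_transport:
  assumes J: "J = braid_pairs_less I m 3" and dd: "\<And>i. i \<in> I \<Longrightarrow> d i = 2"
    and lab: "coxeter_labelling M n I m f"
    and bd: "braid_words.bounded_words {1..n} M (\<lambda>_. 2) (braid_pairs_less {1..n} M 3)"
  shows bounded_words
proof (rule labelled_bounded_transport[OF braid_words_axioms _ lab _ _ _ bd])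
  have cM: "coxeter_matrix {1..n} M" by (rule coxeter_matrix_labelled[OF cox lab])
  show "braid_words {1..n} M (\<lambda>_. 2) (braid_pairs_less {1..n} M 3)"
    by unfold_locales (use cM braid_pairs_less_subset in auto)
  show "d (f i) = 2" if "i \<in> {1..n}" for i using dd labelling_in_I[OF lab that] .
  have M: "M i j = m (f i) (f j)" if "i \<in> {1..n}" "j \<in> {1..n}" for i j
    using lab that unfolding coxeter_labelling_def by auto
  have iff: "{f a, f b} \<in> braid_pairs I m \<longleftrightarrow> {a, b} \<in> braid_pairs {1..n} M"
    "{f a, f b} \<in> J \<longleftrightarrow> {a, b} \<in> braid_pairs_less {1..n} M 3"
    if "a \<in> {1..n}" "b \<in> {1..n}" for a b
    using braid_pairs_labelled[OF lab that] M that unfolding J mem_braid_pairs_less_iff by auto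
  show "{f a, f b} \<in> J" if "{a, b} \<in> braid_pairs_less {1..n} M 3" for a b
    using iff that braid_pairs_labels[of a b n M] braid_pairs_less_subset by blast
  show "{f a, f b} \<in> braid_pairs I m - J" if "{a, b} \<in> braid_pairs {1..n} M - braid_pairs_less {1..n} M 3" for a b
    using iff that braid_pairs_labels[of a b n M] by blast
qed

lemma bounded_mono:
  assumes "braid_words.bounded_words I m d (braid_pairs I m)" shows bounded_words
proof -
  have B: "braid_words I m d (braid_pairs I m)" by unfold_locales (use cox d2 in auto)
  show ?thesis
    using assms alive_mono[OF braid_words_axioms B J_sub]
    unfolding bounded_words_def braid_words.bounded_words_def[OF B] by blast
qed

lemma finite_type_bounded:
  assumes dd: "\<And>i. i \<in> I \<Longrightarrow> d i = 2" and W: "finite (carrier (coxeter_group I m))"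
  shows bounded_words
proof (rule bounded_mono)
  have B: "braid_words I m d (braid_pairs I m)" by unfold_locales (use cox d2 in auto)
  have B': "braid_words I m (\<lambda>_. 2) (braid_pairs I m)" by unfold_locales (use cox in auto)
  have "coxeter I m" by unfold_locales (rule cox)
  then have "braid_words.bounded_words I m (\<lambda>_. 2) (braid_pairs I m)"
    using coxeter.finite_coxeter_group_imp_bounded W by blast
  moreover have "braid_words.alive I m (\<lambda>_. 2) (braid_pairs I m) w" if "braid_words.alive I m d (braid_pairs I m) w" for w
    by (rule alive_map[OF B B', where f = "\<lambda>i. i"]) (use dd that braid_words.alive_lists[OF B that] in auto)
  ultimately show "braid_words.bounded_words I m d (braid_pairs I m)"
    unfolding braid_words.bounded_words_def[OF B] braid_words.bounded_words_def[OF B'] by blast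
qed

lemma type_A_end_bounded:
  assumes lab: "coxeter_labelling A_matrix n I m f" and dd: "\<And>i. i \<in> {2..n} \<Longrightarrow> d (f i) = 2"
  shows bounded_words
proof (rule bounded_mono)
  have B: "braid_words I m d (braid_pairs I m)" by unfold_locales (use cox d2 in auto)
  have cA: "coxeter_matrix {1..n} A_matrix" by (rule coxeter_matrix_labelled[OF cox lab])
  have "type_A_end n (\<lambda>i. d (f i))"
    by unfold_locales (use cA dd d2 labelling_in_I[OF lab] in auto)
  then have bd: "braid_words.bounded_words {1..n} A_matrix (\<lambda>i. d (f i)) (braid_pairs {1..n} A_matrix)"
    by (rule type_A_end.type_A_bounded)
  have B': "braid_words {1..n} A_matrix (\<lambda>i. d (f i)) (braid_pairs {1..n} A_matrix)"
    by unfold_locales (use cA d2 labelling_in_I[OF lab] in auto)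
  show "braid_words.bounded_words I m d (braid_pairs I m)"
  proof (rule labelled_bounded_transport[OF B B' lab HOL.refl _ _ bd])
    show "{f a, f b} \<in> braid_pairs I m" if "{a, b} \<in> braid_pairs {1..n} A_matrix" for a b
      using braid_pairs_labelled[OF lab] braid_pairs_labels[OF that] that by blast
  qed simp
qed

lemma reverse_A_labelling:
  assumes "coxeter_labelling A_matrix n I m f"
  shows "coxeter_labelling A_matrix n I m (\<lambda>i. f (Suc n - i))"
proof -
  have f: "bij_betw f {1..n} I" "\<And>i j. i \<in> {1..n} \<Longrightarrow> j \<in> {1..n} \<Longrightarrow> m (f i) (f j) = A_matrix i j"
    using assms unfolding coxeter_labelling_def by auto
  have "bij_betw (\<lambda>i. Suc n - i) {1..n} {1..n}"
    by (rule bij_betw_byWitness[where f' = "\<lambda>i. Suc n - i"]) auto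
  then have "bij_betw (\<lambda>i. f (Suc n - i)) {1..n} I" using bij_betw_trans f(1) unfolding comp_def by blast
  moreover have "m (f (Suc n - i)) (f (Suc n - j)) = A_matrix i j" if "i \<in> {1..n}" "j \<in> {1..n}" for i j
  proof -
    have "Suc n - i = Suc n - j \<longleftrightarrow> i = j" "Suc n - j = Suc (Suc n - i) \<longleftrightarrow> i = Suc j"
      "Suc n - i = Suc (Suc n - j) \<longleftrightarrow> j = Suc i" using that unfolding atLeastAtMost_iff by arith+
    then have "A_matrix (Suc n - i) (Suc n - j) = A_matrix i j" unfolding A_matrix_def by auto
    moreover have "Suc n - i \<in> {1..n}" "Suc n - j \<in> {1..n}" using that unfolding atLeastAtMost_iff by arith+
    ultimately show ?thesis using f(2) by simp
  qed
  ultimately show ?thesis unfolding coxeter_labelling_def by blast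
qed

text \<open>For \<open>k \<le> 2\<close> no braid relation is kept; for the other levels each case was
  treated for a standard labelling or for the largest set of kept relations.\<close>

lemma list_imp_bounded:
  assumes J: "J = braid_pairs_less I m k" and l: "nil_hecke_finite_list I m d k"
  shows bounded_words
proof -
  have J0: "J = {}" if "k \<in> {1, 2}"
  proof -
    have "k \<le> 2" using that by (auto simp: one_enat_def numeral_eq_enat)
    then have "\<not> m a b < k" if "a \<in> I" "b \<in> I" "a \<noteq> b" for a b using m_ge2[OF that] by (meson leD order_trans)
    then show ?thesis unfolding J braid_pairs_less_def using braid_pairs_iff by blast
  qed
  have tree_words: "coxeter_tree_words I m d J" if "coxeter_tree I m"
    using that unfolding coxeter_tree_def by unfold_locales blast+
  show ?thesis using l unfolding nil_hecke_finite_list_def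
  proof (elim disjE conjE exE bexE)
    fix i0 j0 assume "k \<in> {1, 2}" "coxeter_tree I m" "\<forall>i\<in>I. d i = 2" "i0 \<in> I" "j0 \<in> I" "i0 \<noteq> j0"
      "multiple_edges I m = {{i0, j0}}" "m i0 j0 < \<infinity>"
    then show ?thesis using coxeter_tree_words.one_multiple_edge_tree_bounded[OF tree_words J0] by (metis enat.exhaust less_irrefl)
  next
    assume "k \<in> {1, 2}" "coxeter_tree I m" "simply_laced I m" "card {i \<in> I. 3 \<le> d i} \<le> 1"
    then show ?thesis using coxeter_tree_words.simply_laced_tree_bounded[OF tree_words J0] by blast
  next
    assume "finite (carrier (coxeter_group I m))" "\<forall>i\<in>I. d i = 2"
    then show ?thesis using finite_type_bounded by blast
  next
    fix n assume h: "k = 3" "\<forall>i\<in>I. d i = 2" "coxeter_type E_matrix n I m"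
    then obtain f where "coxeter_labelling E_matrix n I m f" unfolding coxeter_type_def by blast
    then show ?thesis using fully_commutative_transport[OF _ _ _ E_fully_commutative_bounded] coxeter_matrix_labelled[OF cox] J h by blast
  next
    fix n assume h: "k = 3" "\<forall>i\<in>I. d i = 2" "coxeter_type F_matrix n I m"
    then obtain f where "coxeter_labelling F_matrix n I m f" unfolding coxeter_type_def by blast
    then show ?thesis using fully_commutative_transport[OF _ _ _ F_fully_commutative_bounded] coxeter_matrix_labelled[OF cox] J h by blast
  next
    fix n assume h: "k = 3" "\<forall>i\<in>I. d i = 2" "coxeter_type H_matrix n I m"
    then obtain f where "coxeter_labelling H_matrix n I m f" unfolding coxeter_type_def by blast
    then show ?thesis using fully_commutative_transport[OF _ _ _ H_fully_commutative_bounded] coxeter_matrix_labelled[OF cox] J h by blast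
  next
    fix n f assume "coxeter_labelling A_matrix n I m f" "\<forall>i\<in>{2..n}. d (f i) = 2"
    then show ?thesis using type_A_end_bounded by blast
  next
    fix n f assume h: "coxeter_labelling A_matrix n I m f" "\<forall>i\<in>{1..<n}. d (f i) = 2"
    show ?thesis
    proof (rule type_A_end_bounded[OF reverse_A_labelling[OF h(1)]])
      fix i assume "i \<in> {2..n}"
      then have "Suc n - i \<in> {1..<n}" by auto
      then show "d (f (Suc n - i)) = 2" using h(2) by blast
    qed
  qed
qed

end

theorem theorem4:
  fixes R :: "('a, 'c) ring_scheme"
    and I :: "'i set"
    and m :: "'i \<Rightarrow> 'i \<Rightarrow> enat"
    and d :: "'i \<Rightarrow> nat"
    and k :: enat
  assumes "cring R" and "\<one>\<^bsub>R\<^esub> \<noteq> \<zero>\<^bsub>R\<^esub>"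
    and "coxeter_matrix I m"
    and "\<forall>i\<in>I. 2 \<le> d i"
    and "1 \<le> k"
  shows
    "let NH = nil_hecke R I m d (braid_pairs_less I m k);
         aug = augmentation_ideal R I m d (braid_pairs_less I m k)
     in
       (coxeter_connected I m \<longrightarrow> fin_gen_module R NH \<longrightarrow> nil_hecke_finite_list I m d k) \<and>
       (nil_hecke_finite_list I m d k \<longrightarrow> fin_gen_module R NH) \<and>
       (fin_gen_module R NH \<longleftrightarrow> nilpotent_ideal NH aug) \<and>
       (field R \<and> fin_gen_module R NH \<longrightarrow>
          local_ring NH \<and>
          (\<forall>K. maximal_left_ideal K NH \<longleftrightarrow> K = aug) \<and>
          (\<forall>K. maximalideal K NH \<longleftrightarrow> K = aug))"
proof -
  interpret B: braid_words I m d "braid_pairs_less I m k"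
    by (unfold_locales; use assms(3,4) braid_pairs_less_subset in blast)
  interpret cring R by (rule assms(1))
  interpret N: nil_hecke_ring R I m d "braid_pairs_less I m k"
    by unfold_locales (rule assms(2))
  show ?thesis unfolding Let_def N.fin_gen_iff_bounded N.nilpotent_iff_bounded
    using B.bounded_imp_list[OF HOL.refl assms(5)] B.list_imp_bounded[OF HOL.refl] N.Aug_local by blast
qed

end
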